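(* Let $\eta,d>0$ and let $S(x,y)=\sum_{k\eta+l=d}a_{k,l}x^ky^l$ be a real-valued polynomial on $\mathbb{R}^2$ (the sum is over nonnegative integers $k,l$ with $k\eta+l=d$). For $\lambda\in\mathbb{R}\setminus\{0\}$, $z\in\mathbb{C}$ and $\varphi\in C_0^\infty(\mathbb{R}^2)$, let $$W_zf(x)=\int_{\mathbb{R}}e^{i\lambda S(x,y)}\,|S''_{xy}(x,y)|^z\,\varphi(x,y)f(y)\,dy .$$ Then there exists a constant $C=C(\deg(S))$, depending only on the degree of $S$, such that $$\|W_zf\|_{L^2}\le C(1+|z|)^2M|\lambda|^{-1/2}\|f\|_{L^2}$$ for all $z\in\mathbb{C}$ with $\mathrm{Re}(z)=\frac12$ and all $\varphi\in C_0^\infty(\mathbb{R}^2)$ satisfying $$\sup_{\Omega}\sum_{k=0}^{2}\Big(\big(\delta_{\Omega,h}(x)\big)^k|\partial_y^k\varphi(x,y)|+\big(\delta_{\Omega,v}(y)\big)^k|\partial_x^k\varphi(x,y)|\Big)\le M,$$ where $M$ is a positive number and $\Omega$ is a horizontally and vertically convex domain such that $\varphi$ is supported in $\Omega$.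
   Context: $S''_{xy}=\partial_x\partial_yS$. A set $\Omega\subseteq\mathbb{R}^2$ is horizontally convex if $(x,z),(y,z)\in\Omega$ imply $(u,z)\in\Omega$ for all $x\le u\le y$; it is vertically convex if $(x,y),(x,z)\in\Omega$ imply $(x,v)\in\Omega$ for all $y\le v\le z$. All horizontally and vertically convex domains considered have horizontal and vertical cross sections that are closed intervals, so that $\Omega=\{(x,y): a\le x\le b,\ g(x)\le y\le h(x)\}=\{(x,y): c\le y\le d',\ u(y)\le x\le v(y)\}$ for some numbers $a,b,c,d'$ and functions $g,h,u,v$. $\delta_{\Omega,h}(x)$ is the length of the cross section $\{y:(x,y)\in\Omega\}$ and $\delta_{\Omega,v}(y)$ is the length of $\{x:(x,y)\in\Omega\}$. The supremum is over $(x,y)\in\Omega$. *)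

theory Defs
  imports "HOL-Analysis.Analysis"
begin

definition partial_x :: "(real \<times> real \<Rightarrow> 'a::real_normed_vector) \<Rightarrow> real \<times> real \<Rightarrow> 'a" where
  "partial_x F = (\<lambda>(x, y). vector_derivative (\<lambda>t. F (t, y)) (at x))"

definition partial_y :: "(real \<times> real \<Rightarrow> 'a::real_normed_vector) \<Rightarrow> real \<times> real \<Rightarrow> 'a" where
  "partial_y F = (\<lambda>(x, y). vector_derivative (\<lambda>t. F (x, t)) (at y))"

primrec C_k_plane :: "nat \<Rightarrow> (real \<times> real \<Rightarrow> 'a::real_normed_vector) \<Rightarrow> bool" where
  "C_k_plane 0 F \<longleftrightarrow> continuous_on UNIV F"
| "C_k_plane (Suc k) F \<longleftrightarrow>
     F differentiable_on UNIV \<and> C_k_plane k (partial_x F) \<and> C_k_plane k (partial_y F)"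

definition smooth_plane :: "(real \<times> real \<Rightarrow> 'a::real_normed_vector) \<Rightarrow> bool" where
  "smooth_plane F \<longleftrightarrow> (\<forall>k. C_k_plane k F)"

definition supp :: "(real \<times> real \<Rightarrow> 'a::real_normed_vector) \<Rightarrow> (real \<times> real) set" where
  "supp F = closure {p. F p \<noteq> 0}"

definition test_function :: "(real \<times> real \<Rightarrow> complex) \<Rightarrow> bool" where
  "test_function \<phi> \<longleftrightarrow> smooth_plane \<phi> \<and> compact (supp \<phi>)"

definition horizontally_convex :: "(real \<times> real) set \<Rightarrow> bool" where
  "horizontally_convex \<Omega> \<longleftrightarrow>
     (\<forall>x y z u. (x, z) \<in> \<Omega> \<and> (y, z) \<in> \<Omega> \<and> x \<le> u \<and> u \<le> y \<longrightarrow> (u, z) \<in> \<Omega>)"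

definition vertically_convex :: "(real \<times> real) set \<Rightarrow> bool" where
  "vertically_convex \<Omega> \<longleftrightarrow>
     (\<forall>x y z v. (x, y) \<in> \<Omega> \<and> (x, z) \<in> \<Omega> \<and> y \<le> v \<and> v \<le> z \<longrightarrow> (x, v) \<in> \<Omega>)"

text \<open>
  The two representations say that \<open>\<Omega>\<close> is bounded and that all its horizontal and vertical cross
  sections are closed intervals. The set \<open>\<Omega>\<close> itself need not be closed, and a cross section over a
  point of \<open>{a..b}\<close> may be empty.
\<close>

definition hv_convex_domain :: "(real \<times> real) set \<Rightarrow> bool" where
  "hv_convex_domain \<Omega> \<longleftrightarrow>
     horizontally_convex \<Omega> \<and> vertically_convex \<Omega> \<and>
     (\<exists>a b g h. \<Omega> = {(x, y). a \<le> x \<and> x \<le> b \<and> g x \<le> y \<and> y \<le> h x}) \<and>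
     (\<exists>c d u v. \<Omega> = {(x, y). c \<le> y \<and> y \<le> d \<and> u y \<le> x \<and> x \<le> v y})"

definition delta_h :: "(real \<times> real) set \<Rightarrow> real \<Rightarrow> real" where
  "delta_h \<Omega> x = measure lborel {y. (x, y) \<in> \<Omega>}"

definition delta_v :: "(real \<times> real) set \<Rightarrow> real \<Rightarrow> real" where
  "delta_v \<Omega> y = measure lborel {x. (x, y) \<in> \<Omega>}"

definition cutoff_size :: "(real \<times> real) set \<Rightarrow> (real \<times> real \<Rightarrow> complex) \<Rightarrow> ereal" where
  "cutoff_size \<Omega> \<phi> =
     (SUP (x, y) \<in> \<Omega>. ereal (\<Sum>k=0..2. delta_h \<Omega> x ^ k * cmod ((partial_y ^^ k) \<phi> (x, y))
                                      + delta_v \<Omega> y ^ k * cmod ((partial_x ^^ k) \<phi> (x, y))))"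

definition qh_index :: "real \<Rightarrow> real \<Rightarrow> (nat \<times> nat) set" where
  "qh_index \<eta> d = {(k, l). real k * \<eta> + real l = d}"

definition qh_poly :: "real \<Rightarrow> real \<Rightarrow> (nat \<Rightarrow> nat \<Rightarrow> real) \<Rightarrow> real \<times> real \<Rightarrow> real" where
  "qh_poly \<eta> d a = (\<lambda>(x, y). \<Sum>(k, l)\<in>qh_index \<eta> d. a k l * x ^ k * y ^ l)"

text \<open>Total degree; the zero polynomial is given degree \<open>0\<close>.\<close>

definition qh_degree :: "real \<Rightarrow> real \<Rightarrow> (nat \<Rightarrow> nat \<Rightarrow> real) \<Rightarrow> nat" where
  "qh_degree \<eta> d a = Max (insert 0 {k + l |k l. (k, l) \<in> qh_index \<eta> d \<and> a k l \<noteq> 0})"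

lemma finite_qh_index:
  assumes "\<eta> > 0"
  shows "finite (qh_index \<eta> d)"
proof (rule finite_subset)
  show "qh_index \<eta> d \<subseteq> {..nat \<lceil>d / \<eta>\<rceil>} \<times> {..nat \<lceil>d\<rceil>}"
  proof clarify
    fix k l assume "(k, l) \<in> qh_index \<eta> d"
    then have eq: "real k * \<eta> + real l = d"
      by (simp add: qh_index_def)
    have "real k * \<eta> \<ge> 0"
      using assms by simp
    then have "real l \<le> d" "real k \<le> d / \<eta>"
      using eq assms by (linarith, simp add: pos_le_divide_eq)
    then show "k \<in> {..nat \<lceil>d / \<eta>\<rceil>} \<and> l \<in> {..nat \<lceil>d\<rceil>}"
      by (simp add: le_nat_iff) linarith
  qed
qed simp

lemma finite_qh_degree_set:
  assumes "\<eta> > 0"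
  shows "finite {k + l |k l. (k, l) \<in> qh_index \<eta> d \<and> a k l \<noteq> 0}"
  by (rule finite_subset[OF _ finite_imageI[OF finite_qh_index[OF assms, of d],
        of "\<lambda>(k, l). k + l"]]) force

definition in_L2 :: "(real \<Rightarrow> complex) \<Rightarrow> bool" where
  "in_L2 f \<longleftrightarrow> f \<in> borel_measurable lebesgue \<and> integrable lebesgue (\<lambda>x. (cmod (f x))\<^sup>2)"

definition L2_norm :: "(real \<Rightarrow> complex) \<Rightarrow> real" where
  "L2_norm f = sqrt (LINT x|lebesgue. (cmod (f x))\<^sup>2)"

text \<open>
  In the damping factor \<open>\<bar>S''\<^sub>x\<^sub>y\<bar>\<^sup>z\<close> the convention \<open>0 powr z = 0\<close> agrees with the usual one, as it
  is only used for \<open>Re z > 0\<close>.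
\<close>

definition W_op ::
  "real \<Rightarrow> (real \<times> real \<Rightarrow> real) \<Rightarrow> complex \<Rightarrow> (real \<times> real \<Rightarrow> complex) \<Rightarrow>
   (real \<Rightarrow> complex) \<Rightarrow> real \<Rightarrow> complex" where
  "W_op lam S z \<phi> f x =
     (LINT y|lebesgue. exp (\<i> * complex_of_real (lam * S (x, y)))
        * complex_of_real \<bar>partial_x (partial_y S) (x, y)\<bar> powr z * \<phi> (x, y) * f y)"

end

theory Submission
  imports Defs "HOL-Computational_Algebra.Fundamental_Theorem_Algebra"
begin

text \<open>
  By reflections it suffices to bound \<open>W\<^sub>z\<close> on the open first quadrant. There the zero set of \<open>S''\<^sub>x\<^sub>y\<close>
  is a union of curves \<open>x = w y\<^sup>\<eta>\<close>, which cut the quadrant into at most \<open>deg S + 1\<close> sectors. In a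
  sector, decompose every dyadic rectangle \<open>[2\<^sup>j, 2\<^sup>j\<^sup>+\<^sup>1) \<times> [2\<^sup>k, 2\<^sup>k\<^sup>+\<^sup>1)\<close> into Whitney boxes for the complex
  zero set, and let \<open>T\<close> be the part of the operator on the boxes of one size \<open>(2\<^sup>j\<^sup>-\<^sup>m, 2\<^sup>k\<^sup>-\<^sup>m)\<close>. On a single box
  \<open>S''\<^sub>x\<^sub>y\<close> is essentially constant, and two integrations by parts in the kernel of \<open>T T\<^sup>*\<close> give the bound
  \<open>\<bar>\<lambda>\<bar>\<^sup>-\<^sup>1\<^sup>/\<^sup>2\<close>; a horizontal or vertical line meets boundedly many boxes of one size, so the boxes add up.
  Boxes of different sizes interact weakly: one integration by parts gains
  \<open>\<integral> \<bar>S''\<^sub>x\<^sub>y(t, y)\<bar> dt\<close> over the segment joining two boxes, no cancellation being possible in a sector, and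
  the result decays geometrically in the difference of the parameters. The theorem of Cotlar and Stein
  sums the pieces. All constants come from counting roots of polynomials of degree at most \<open>deg S\<close>.
\<close>

section \<open>Integral operators on the line\<close>

text \<open>Since \<open>Re z = 1/2\<close>, the amplitude in the kernel of
  \<open>T T\<^sup>*\<close> is the geometric mean of \<open>S''\<^sub>x\<^sub>y\<close> (in
  absolute value) at \<open>(x, y)\<close> and \<open>(x', y)\<close>, while the derivative of the
  phase is the integral of \<open>S''\<^sub>x\<^sub>y\<close> from \<open>x'\<close> to
  \<open>x\<close>. An integration by parts divides the first by the second, so the size of
  \<open>S\<close> cancels. The obstacle is the cutoff: its derivatives are controlled only by
  inverse widths of sections of \<Omega>, which vary with no regularity. Between different boxes
  only the integral of one derivative enters, and this is at most \<open>M\<close> whatever the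
  width. On a single box two derivatives are used, and the kernel of \<open>T T\<^sup>*\<close>
  acquires a width depending on \<open>x\<close>; \<open>opb_pois\<close> is made for this. Boxes
  stay away from complex zeros, not only real ones, because then the derivatives of
  \<open>S''\<^sub>x\<^sub>y\<close> relative to its size are bounded by the degree over the side.
  No constant sees \<eta>: a zero off the axes forces \<eta> to be at most the degree, and
  exchanging the coordinates replaces \<eta> by its inverse. The same exchange reduces
  \<open>T\<^sup>* T\<close> to \<open>T T\<^sup>*\<close>.\<close>

lemma measurable_cnj [measurable (raw)]:
  "f \<in> borel_measurable M \<Longrightarrow> (\<lambda>x. cnj (f x)) \<in> borel_measurable M"
  by (rule borel_measurable_continuous_on[OF continuous_on_cnj[OF continuous_on_id]])

section \<open>Square integrable Borel functions, their norm and inner product\<close>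

definition sqint :: "(real \<Rightarrow> complex) \<Rightarrow> bool" where
  "sqint f \<longleftrightarrow> f \<in> borel_measurable borel \<and> integrable lborel (\<lambda>x. (cmod (f x))\<^sup>2)"

definition nrm :: "(real \<Rightarrow> complex) \<Rightarrow> real" where
  "nrm f = sqrt (LINT x|lborel. (cmod (f x))\<^sup>2)"

definition ip :: "(real \<Rightarrow> complex) \<Rightarrow> (real \<Rightarrow> complex) \<Rightarrow> complex" where
  "ip f g = (LINT x|lborel. f x * cnj (g x))"

lemma sqint_measurable [measurable_dest]: "sqint f \<Longrightarrow> f \<in> borel_measurable borel"
  by (simp add: sqint_def)

lemma sqint_integrable: "sqint f \<Longrightarrow> integrable lborel (\<lambda>x. (cmod (f x))\<^sup>2)"
  by (simp add: sqint_def)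

lemma nrm_nonneg [simp]: "0 \<le> nrm f"
  by (simp add: nrm_def)

lemma nrm_sq: "(nrm f)\<^sup>2 = (LINT x|lborel. (cmod (f x))\<^sup>2)"
  by (simp add: nrm_def)

lemma sqint_zero [simp]: "sqint (\<lambda>x. 0)"
  by (simp add: sqint_def)

lemma nrm_zero [simp]: "nrm (\<lambda>x. 0) = 0"
  by (simp add: nrm_def)

lemma sqint_bound:
  assumes f [measurable]: "f \<in> borel_measurable borel" and g: "sqint g"
    and le: "\<And>x. cmod (f x) \<le> c * cmod (g x)"
  shows "sqint f" "0 \<le> c \<Longrightarrow> nrm f \<le> c * nrm g"
proof -
  have sq: "(cmod (f x))\<^sup>2 \<le> c\<^sup>2 * (cmod (g x))\<^sup>2" for x
    using power_mono[OF le[of x], of 2] by (simp add: power_mult_distrib)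
  have i: "integrable lborel (\<lambda>x. (cmod (f x))\<^sup>2)"
    by (rule Bochner_Integration.integrable_bound
          [OF integrable_mult_right[OF sqint_integrable[OF g], of "c\<^sup>2"]])
       (use sq in auto)
  then show "sqint f" by (simp add: sqint_def)
  show "nrm f \<le> c * nrm g" if "0 \<le> c"
  proof (rule power2_le_imp_le)
    show "(nrm f)\<^sup>2 \<le> (c * nrm g)\<^sup>2"
      unfolding power_mult_distrib nrm_sq
      by (subst integral_mult_right_zero[symmetric], rule integral_mono)
         (use i sqint_integrable[OF g] sq in auto)
  qed (use that in auto)
qed

lemma sqint_add:
  assumes f: "sqint f" and g: "sqint g"
  shows "sqint (\<lambda>x. f x + g x)"
proof -
  have [measurable]: "f \<in> borel_measurable borel" "g \<in> borel_measurable borel"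
    using f g by (auto simp: sqint_def)
  have "(cmod (f x + g x))\<^sup>2 \<le> 2 * (cmod (f x))\<^sup>2 + 2 * (cmod (g x))\<^sup>2" for x
  proof -
    have "(cmod (f x + g x))\<^sup>2 \<le> (cmod (f x) + cmod (g x))\<^sup>2"
      by (intro power_mono norm_triangle_ineq) auto
    also have "\<dots> \<le> 2 * (cmod (f x))\<^sup>2 + 2 * (cmod (g x))\<^sup>2"
      using sum_squares_bound[of "cmod (f x)" "cmod (g x)"] by (simp add: power2_sum)
    finally show ?thesis .
  qed
  then have le: "AE x in lborel. norm ((cmod (f x + g x))\<^sup>2)
      \<le> norm (2 * (cmod (f x))\<^sup>2 + 2 * (cmod (g x))\<^sup>2)"
    by simp
  have "integrable lborel (\<lambda>x. 2 * (cmod (f x))\<^sup>2 + 2 * (cmod (g x))\<^sup>2)"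
    using sqint_integrable[OF f] sqint_integrable[OF g] by simp
  then have "integrable lborel (\<lambda>x. (cmod (f x + g x))\<^sup>2)"
    by (rule Bochner_Integration.integrable_bound[OF _ _ le]) simp
  then show ?thesis by (simp add: sqint_def)
qed

lemma sqint_sum:
  "(\<And>i. i \<in> I \<Longrightarrow> sqint (f i)) \<Longrightarrow> sqint (\<lambda>x. \<Sum>i\<in>I. f i x)"
  by (induction I rule: infinite_finite_induct) (auto intro: sqint_add)

lemma sqint_indicator_mult:
  assumes "sqint f" "A \<in> sets borel"
  shows "sqint (\<lambda>x. indicator A x * f x)"
  by (rule sqint_bound(1)[OF _ assms(1), of _ 1])
     (use assms in \<open>auto simp: sqint_def indicator_def\<close>)

text \<open>The weight \<open>t = b / a\<close> is optimal; enlarging \<open>a\<close> and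
  \<open>b\<close> by \<open>e\<close> first and letting \<open>e\<close> tend to 0 covers the cases
  where one of them vanishes. The Cauchy--Schwarz inequality, the Schur test and the bound for sums
  of blocks are all obtained this way.\<close>

lemma le_mult_if_le_weighted:
  fixes X a b :: real
  assumes "0 \<le> a" "0 \<le> b" and le: "\<And>t. 0 < t \<Longrightarrow> 2 * X \<le> t * a\<^sup>2 + b\<^sup>2 / t"
  shows "X \<le> a * b"
proof -
  have X: "X \<le> (a + e) * (b + e)" if "0 < e" for e
  proof -
    have *: "q / p * p\<^sup>2 + q\<^sup>2 / (q / p) = 2 * (p * q)" if "0 < p" "0 < q" for p q :: real
      using that by (simp add: field_simps power2_eq_square)
    have p: "0 < a + e" "0 < b + e" using that assms by auto
    have t: "0 < (b + e) / (a + e)" using p by simp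
    have "2 * X \<le> (b + e) / (a + e) * a\<^sup>2 + b\<^sup>2 / ((b + e) / (a + e))"
      using le[OF t] .
    also have "\<dots> \<le> (b + e) / (a + e) * (a + e)\<^sup>2 + (b + e)\<^sup>2 / ((b + e) / (a + e))"
      using p assms that by (intro add_mono mult_left_mono divide_right_mono power_mono) auto
    also have "\<dots> = 2 * ((a + e) * (b + e))"
      using * [OF p] .
    finally show ?thesis by simp
  qed
  have "((\<lambda>e. (a + e) * (b + e)) \<longlongrightarrow> (a + 0) * (b + 0)) (at_right 0)"
    by (intro tendsto_intros)
  moreover have "eventually (\<lambda>e. X \<le> (a + e) * (b + e)) (at_right 0)"
    using X by (intro eventually_at_right_less[THEN eventually_mono]) auto
  ultimately show ?thesis
    using tendsto_lowerbound[of _ _ "at_right (0::real)"] by fastforce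
qed

lemma ip_integrable:
  assumes f: "sqint f" and g: "sqint g"
  shows "integrable lborel (\<lambda>x. f x * cnj (g x))" "integrable lborel (\<lambda>x. cmod (f x) * cmod (g x))"
proof -
  have [measurable]: "f \<in> borel_measurable borel" "g \<in> borel_measurable borel"
    using f g by (auto simp: sqint_def)
  show a: "integrable lborel (\<lambda>x. cmod (f x) * cmod (g x))"
  proof (rule Bochner_Integration.integrable_bound[where f =
        "\<lambda>x. (cmod (f x))\<^sup>2 + (cmod (g x))\<^sup>2"])
    show "AE x in lborel. norm (cmod (f x) * cmod (g x)) \<le> norm ((cmod (f x))\<^sup>2 + (cmod (g x))\<^sup>2)"
    proof (rule AE_I2)
      fix x
      have "0 \<le> cmod (f x) * cmod (g x)" by simp
      then show "norm (cmod (f x) * cmod (g x)) \<le> norm ((cmod (f x))\<^sup>2 + (cmod (g x))\<^sup>2)"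
        using sum_squares_bound[of "cmod (f x)" "cmod (g x)"] unfolding real_norm_def by linarith
    qed
  qed (use sqint_integrable[OF f] sqint_integrable[OF g] in auto)
  show "integrable lborel (\<lambda>x. f x * cnj (g x))"
    by (rule Bochner_Integration.integrable_bound[OF a]) (auto simp: norm_mult)
qed

lemma cauchy_schwarz_abs:
  assumes f: "sqint f" and g: "sqint g"
  shows "(LINT x|lborel. cmod (f x) * cmod (g x)) \<le> nrm f * nrm g"
proof (rule le_mult_if_le_weighted)
  fix t :: real assume t: "0 < t"
  have "2 * (LINT x|lborel. cmod (f x) * cmod (g x))
      = (LINT x|lborel. 2 * (cmod (f x) * cmod (g x)))" by simp
  also have "\<dots> \<le> (LINT x|lborel. t * (cmod (f x))\<^sup>2 + (cmod (g x))\<^sup>2 / t)"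
  proof (rule integral_mono)
    fix x
    have "2 * (cmod (f x) * cmod (g x)) * t \<le> (t * cmod (f x))\<^sup>2 + (cmod (g x))\<^sup>2"
      using sum_squares_bound[of "t * cmod (f x)" "cmod (g x)"] by (simp add: algebra_simps)
    then show "2 * (cmod (f x) * cmod (g x)) \<le> t * (cmod (f x))\<^sup>2 + (cmod (g x))\<^sup>2 / t"
      using t by (simp add: field_simps power2_eq_square)
  qed (use ip_integrable[OF f g] sqint_integrable[OF f] sqint_integrable[OF g] in auto)
  also have "\<dots> = t * (nrm f)\<^sup>2 + (nrm g)\<^sup>2 / t"
    unfolding nrm_sq using sqint_integrable[OF f] sqint_integrable[OF g] by simp
  finally show "2 * (LINT x|lborel. cmod (f x) * cmod (g x)) \<le> t * (nrm f)\<^sup>2 + (nrm g)\<^sup>2 / t" .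
qed auto

lemma cauchy_schwarz:
  assumes "sqint f" "sqint g"
  shows "cmod (ip f g) \<le> nrm f * nrm g"
proof -
  have "cmod (ip f g) \<le> (LINT x|lborel. cmod (f x * cnj (g x)))"
    unfolding ip_def by (rule integral_norm_bound)
  also have "\<dots> \<le> nrm f * nrm g"
    using cauchy_schwarz_abs[OF assms] by (simp add: norm_mult)
  finally show ?thesis .
qed

lemma ip_self: "ip f f = complex_of_real ((nrm f)\<^sup>2)"
  unfolding ip_def nrm_sq complex_norm_square[symmetric] of_real_power[symmetric]
    integral_complex_of_real ..

lemma cmod_ip_self: "cmod (ip f f) = (nrm f)\<^sup>2"
  unfolding ip_self norm_of_real by simp

lemma ip_add_left:
  "sqint f \<Longrightarrow> sqint g \<Longrightarrow> sqint h \<Longrightarrow> ip (\<lambda>x. f x + g x) h = ip f h + ip g h"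
  unfolding ip_def by (simp add: ring_distribs ip_integrable)

lemma ip_sum_left:
  "(\<And>i. i \<in> I \<Longrightarrow> sqint (f i)) \<Longrightarrow> sqint h \<Longrightarrow> ip (\<lambda>x. \<Sum>i\<in>I. f i x) h = (\<Sum>i\<in>I. ip (f i) h)"
  unfolding ip_def by (simp add: sum_distrib_right ip_integrable)

lemma nrm_add:
  assumes f: "sqint f" and g: "sqint g"
  shows "nrm (\<lambda>x. f x + g x) \<le> nrm f + nrm g"
proof -
  let ?h = "\<lambda>x. f x + g x"
  have h: "sqint ?h" by (rule sqint_add[OF f g])
  have "complex_of_real ((nrm ?h)\<^sup>2) = ip f ?h + ip g ?h"
    unfolding ip_self[symmetric] by (rule ip_add_left[OF f g h])
  then have "(nrm ?h)\<^sup>2 = cmod (ip f ?h + ip g ?h)"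
    by (metis abs_power2 norm_of_real)
  also have "\<dots> \<le> cmod (ip f ?h) + cmod (ip g ?h)"
    by (rule norm_triangle_ineq)
  also have "\<dots> \<le> nrm f * nrm ?h + nrm g * nrm ?h"
    by (intro add_mono cauchy_schwarz f g h)
  finally have "nrm ?h * nrm ?h \<le> (nrm f + nrm g) * nrm ?h"
    by (simp add: power2_eq_square ring_distribs)
  then show ?thesis
    using nrm_nonneg[of ?h] nrm_nonneg[of f] nrm_nonneg[of g]
    by (cases "nrm ?h = 0") (auto simp: mult_le_cancel_right)
qed

lemma nrm_sum:
  "(\<And>i. i \<in> I \<Longrightarrow> sqint (f i)) \<Longrightarrow> nrm (\<lambda>x. \<Sum>i\<in>I. f i x) \<le> (\<Sum>i\<in>I. nrm (f i))"
proof (induction I rule: infinite_finite_induct)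
  case (insert i I)
  then show ?case
    using nrm_add[of "f i" "\<lambda>x. \<Sum>i\<in>I. f i x"] sqint_sum[of I f] by fastforce
qed auto

lemma ip_cnj: "cnj (ip f g) = ip g f"
proof -
  have "ip g f = (LINT x|lborel. cnj (f x * cnj (g x)))"
    unfolding ip_def by (simp add: mult.commute)
  also have "\<dots> = cnj (ip f g)"
    unfolding ip_def by (rule Bochner_Integration.integral_cnj)
  finally show ?thesis by (rule sym)
qed

text \<open>Boundedness and compact support make every double integral below absolutely convergent,
  and the class is closed under adjoints, finite sums and composition. Nothing quantitative is read
  off from \<open>B\<close> and \<open>R\<close>.\<close>

definition bker :: "(real \<Rightarrow> real \<Rightarrow> complex) \<Rightarrow> bool" where
  "bker k \<longleftrightarrow> (\<lambda>p. k (fst p) (snd p)) \<in> borel_measurable borel \<and>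
     (\<exists>B R. \<forall>x y. cmod (k x y) \<le> B \<and> (k x y \<noteq> 0 \<longrightarrow> \<bar>x\<bar> \<le> R \<and> \<bar>y\<bar> \<le> R))"

definition kop :: "(real \<Rightarrow> real \<Rightarrow> complex) \<Rightarrow> (real \<Rightarrow> complex) \<Rightarrow> real \<Rightarrow> complex" where
  "kop k f x = (LINT y|lborel. k x y * f y)"

definition kadj :: "(real \<Rightarrow> real \<Rightarrow> complex) \<Rightarrow> real \<Rightarrow> real \<Rightarrow> complex" where
  "kadj k = (\<lambda>y x. cnj (k x y))"

definition kcomp ::
  "(real \<Rightarrow> real \<Rightarrow> complex) \<Rightarrow> (real \<Rightarrow> real \<Rightarrow> complex) \<Rightarrow> real \<Rightarrow> real \<Rightarrow> complex" where
  "kcomp k l = (\<lambda>x z. LINT y|lborel. k x y * l y z)"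

text \<open>A bound for the operator norm instead of the norm itself: functions need not be
  identified almost everywhere, and bounds can simply be enlarged.\<close>

definition opb :: "(real \<Rightarrow> real \<Rightarrow> complex) \<Rightarrow> real \<Rightarrow> bool" where
  "opb k C \<longleftrightarrow> (\<forall>f. sqint f \<longrightarrow> nrm (kop k f) \<le> C * nrm f)"

lemma bkerI:
  assumes "(\<lambda>p. k (fst p) (snd p)) \<in> borel_measurable borel"
    "\<And>x y. cmod (k x y) \<le> B" "\<And>x y. k x y \<noteq> 0 \<Longrightarrow> \<bar>x\<bar> \<le> R \<and> \<bar>y\<bar> \<le> R"
  shows "bker k"
  unfolding bker_def using assms by blast

lemma bkerE:
  assumes "bker k"
  obtains B R where "0 \<le> B" "0 \<le> R"
    "\<And>x y. cmod (k x y) \<le> B * indicator {-R..R} x * indicator {-R..R} y"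
    "\<And>x y. k x y \<noteq> 0 \<Longrightarrow> \<bar>x\<bar> \<le> R \<and> \<bar>y\<bar> \<le> R"
proof -
  obtain B R where B: "\<And>x y. cmod (k x y) \<le> B"
    and R: "\<And>x y. k x y \<noteq> 0 \<Longrightarrow> \<bar>x\<bar> \<le> R \<and> \<bar>y\<bar> \<le> R"
    using assms unfolding bker_def by blast
  have B0: "0 \<le> B" using B[of 0 0] norm_ge_zero[of "k 0 0"] by linarith
  show ?thesis
  proof (rule that[of B "max R 0"])
    show "k x y \<noteq> 0 \<Longrightarrow> \<bar>x\<bar> \<le> max R 0 \<and> \<bar>y\<bar> \<le> max R 0" for x y
      using R[of x y] by auto
    show "cmod (k x y) \<le> B * indicator {-max R 0..max R 0} x * indicator {-max R 0..max R 0} y" for x y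
    proof (cases "k x y = 0")
      case False
      then show ?thesis using R[OF False] B[of x y] by (auto simp: indicator_def)
    qed (use B0 in auto)
  qed (use B0 in auto)
qed

lemma bker_measurable2:
  assumes "bker k"
  shows "(\<lambda>p. k (fst p) (snd p)) \<in> borel_measurable (borel \<Otimes>\<^sub>M borel)"
  using assms by (simp add: bker_def borel_prod)

lemma bker_measurable [measurable (raw)]:
  assumes k: "bker k" and f: "f \<in> borel_measurable M" and g: "g \<in> borel_measurable M"
  shows "(\<lambda>x. k (f x) (g x)) \<in> borel_measurable M"
  using measurable_compose[OF measurable_Pair[OF f g] bker_measurable2[OF k]] by simp

lemma kadj_kadj [simp]: "kadj (kadj k) = k"
  by (simp add: kadj_def)

lemma bker_adj: assumes "bker k" shows "bker (kadj k)"
proof -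
  obtain B R where BR: "\<And>x y. cmod (k x y) \<le> B"
    "\<And>x y. k x y \<noteq> 0 \<Longrightarrow> \<bar>x\<bar> \<le> R \<and> \<bar>y\<bar> \<le> R"
    using assms unfolding bker_def by blast
  have m: "(\<lambda>p. cnj (k (snd p) (fst p))) \<in> borel_measurable (borel \<Otimes>\<^sub>M borel)"
    using assms by measurable
  show ?thesis
    by (rule bkerI[of _ B R]) (use BR m in \<open>auto simp: kadj_def borel_prod\<close>)
qed

lemma bker_zero: "bker (\<lambda>x y. 0)"
  by (rule bkerI[of _ 0 0]) auto

lemma bker_add:
  assumes "bker k" "bker l" shows "bker (\<lambda>x y. k x y + l x y)"
proof -
  obtain B R where B: "\<And>x y. cmod (k x y) \<le> B"
    "\<And>x y. k x y \<noteq> 0 \<Longrightarrow> \<bar>x\<bar> \<le> R \<and> \<bar>y\<bar> \<le> R"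
    using assms(1) unfolding bker_def by blast
  obtain B' R' where B': "\<And>x y. cmod (l x y) \<le> B'"
    "\<And>x y. l x y \<noteq> 0 \<Longrightarrow> \<bar>x\<bar> \<le> R' \<and> \<bar>y\<bar> \<le> R'"
    using assms(2) unfolding bker_def by blast
  show ?thesis
  proof (rule bkerI[of _ "B + B'" "max R R'"])
    show "(\<lambda>p. k (fst p) (snd p) + l (fst p) (snd p)) \<in> borel_measurable borel"
      using assms unfolding bker_def by auto
    show "cmod (k x y + l x y) \<le> B + B'" for x y
      using norm_triangle_ineq[of "k x y" "l x y"] B(1)[of x y] B'(1)[of x y] by linarith
    show "\<bar>x\<bar> \<le> max R R' \<and> \<bar>y\<bar> \<le> max R R'" if "k x y + l x y \<noteq> 0" for x y
    proof -
      from that have "k x y \<noteq> 0 \<or> l x y \<noteq> 0" by auto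
      then show ?thesis using B(2)[of x y] B'(2)[of x y] by auto
    qed
  qed
qed

lemma bker_sum: "(\<And>i. i \<in> I \<Longrightarrow> bker (k i)) \<Longrightarrow> bker (\<lambda>x y. \<Sum>i\<in>I. k i x y)"
  by (induction I rule: infinite_finite_induct) (auto intro: bker_add bker_zero)

lemma bker_mult_bounded:
  assumes k: "bker k" and g: "(\<lambda>p. g (fst p) (snd p)) \<in> borel_measurable (borel \<Otimes>\<^sub>M borel)"
    and b: "\<And>x y. cmod (g x y) \<le> c"
  shows "bker (\<lambda>x y. g x y * k x y)"
proof -
  obtain B R where B: "\<And>x y. cmod (k x y) \<le> B"
    "\<And>x y. k x y \<noteq> 0 \<Longrightarrow> \<bar>x\<bar> \<le> R \<and> \<bar>y\<bar> \<le> R"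
    using k unfolding bker_def by blast
  have c: "0 \<le> c" using b[of 0 0] norm_ge_zero[of "g 0 0"] by linarith
  show ?thesis
  proof (rule bkerI[of _ "c * B" R])
    show "(\<lambda>p. g (fst p) (snd p) * k (fst p) (snd p)) \<in> borel_measurable borel"
      using g bker_measurable2[OF k] unfolding borel_prod by simp
  qed (use B b c in \<open>auto simp: norm_mult intro!: mult_mono\<close>)
qed

lemma cmod_indicator: "cmod (indicator A x) = indicator A x"
  by (simp add: indicator_def)

lemma sqint_indicator: "sqint (\<lambda>x. indicator {-R..R} x)"
proof -
  have "(\<lambda>x. (cmod (indicator {-R..R} x))\<^sup>2) = (indicator {-R..R} :: real \<Rightarrow> real)"
    by (auto simp: indicator_def fun_eq_iff)
  moreover have "integrable lborel (indicator {-R..R} :: real \<Rightarrow> real)"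
    by (intro integrable_real_indicator) (auto simp: emeasure_lborel_Icc_eq)
  ultimately show ?thesis unfolding sqint_def by simp
qed

lemma sqint_local_integrable:
  assumes "sqint f" shows "integrable lborel (\<lambda>x. indicator {-R..R} x * cmod (f x))"
  using ip_integrable(2)[OF sqint_indicator assms, of R] by (simp add: cmod_indicator)

text \<open>Local integrability of \<open>u\<close> and \<open>v\<close> is enough because the
  kernel has compact support; in the Schur test one of them is the constant 1.\<close>

lemma bker_integrable_abs:
  fixes u v :: "real \<Rightarrow> real"
  assumes k: "bker k" and u: "\<And>R. integrable lborel (\<lambda>x. indicator {-R..R} x * u x)"
    and v: "\<And>R. integrable lborel (\<lambda>x. indicator {-R..R} x * v x)"
    and [measurable]: "u \<in> borel_measurable borel" "v \<in> borel_measurable borel"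
    and nn: "\<And>x. 0 \<le> u x" "\<And>x. 0 \<le> v x"
  shows "integrable (lborel \<Otimes>\<^sub>M lborel) (\<lambda>(x, y). cmod (k x y) * u y * v x)"
proof -
  obtain B R where BR: "0 \<le> B" "0 \<le> R"
    "\<And>x y. cmod (k x y) \<le> B * indicator {-R..R} x * indicator {-R..R} y"
    using bkerE[OF k] by metis
  let ?F = "\<lambda>y. indicator {-R..R} y * u y"
  let ?G = "\<lambda>x. indicator {-R..R} x * v x"
  have fg: "integrable (lborel \<Otimes>\<^sub>M lborel) (\<lambda>(x, y). B * ?G x * ?F y)"
    by (rule lborel_pair.Fubini_integrable) (use u[of R] v[of R] BR nn in \<open>auto simp: abs_mult\<close>)
  have b: "cmod (k x y) * u y * v x \<le> B * ?G x * ?F y" for x y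
    using mult_right_mono[OF BR(3)[of x y], of "u y * v x"] nn by (simp add: algebra_simps)
  have m: "(\<lambda>(x, y). cmod (k x y) * u y * v x) \<in> borel_measurable (lborel \<Otimes>\<^sub>M lborel)"
    using k by measurable
  show ?thesis
    by (rule Bochner_Integration.integrable_bound[OF fg m])
       (use b BR nn in \<open>auto simp: abs_mult\<close>)
qed

lemma bker_integrable2:
  assumes k: "bker k" and f: "sqint f" and g: "sqint g"
  shows "integrable (lborel \<Otimes>\<^sub>M lborel) (\<lambda>(x, y). k x y * f y * cnj (g x))"
    "integrable (lborel \<Otimes>\<^sub>M lborel) (\<lambda>(x, y). cmod (k x y) * cmod (f y) * cmod (g x))"
proof -
  have [measurable]: "f \<in> borel_measurable borel" "g \<in> borel_measurable borel"
    using f g by (auto simp: sqint_def)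
  show *: "integrable (lborel \<Otimes>\<^sub>M lborel) (\<lambda>(x, y). cmod (k x y) * cmod (f y) * cmod (g x))"
    by (rule bker_integrable_abs) (use k f g sqint_local_integrable in auto)
  have m: "(\<lambda>(x, y). k x y * f y * cnj (g x)) \<in> borel_measurable (lborel \<Otimes>\<^sub>M lborel)"
    using k by measurable
  show "integrable (lborel \<Otimes>\<^sub>M lborel) (\<lambda>(x, y). k x y * f y * cnj (g x))"
    by (rule Bochner_Integration.integrable_bound[OF * m]) (auto simp: norm_mult)
qed

lemma bker_row: assumes k: "bker k" shows "sqint (\<lambda>y. k x y)"
proof -
  obtain B R where BR: "0 \<le> B" "0 \<le> R"
    "\<And>x y. cmod (k x y) \<le> B * indicator {-R..R} x * indicator {-R..R} y"
    using bkerE[OF k] by metis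
  have m: "(\<lambda>y. k x y) \<in> borel_measurable borel"
    using k by measurable
  show ?thesis
    by (rule sqint_bound(1)[OF m sqint_indicator[of R], of B])
       (rule order_trans[OF BR(3)], use BR(1) in \<open>auto simp: indicator_def\<close>)
qed

lemma bker_col: "bker k \<Longrightarrow> sqint (\<lambda>x. k x y)"
  using bker_row[OF bker_adj, of k y] sqint_bound(1)[of "\<lambda>x. k x y" "\<lambda>x. kadj k y x" 1]
  by (simp add: kadj_def bker_measurable)

lemma sqint_cnj: "sqint f \<Longrightarrow> sqint (\<lambda>y. cnj (f y))"
  by (auto simp: sqint_def)

lemma kop_integrable:
  assumes "bker k" "sqint f" shows "integrable lborel (\<lambda>y. k x y * f y)"
  using ip_integrable(1)[OF bker_row[OF assms(1), of x] sqint_cnj[OF assms(2)]]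
  by (simp only: complex_cnj_cnj)

lemma kop_sqint:
  assumes k: "bker k" and f: "sqint f" shows "sqint (kop k f)"
proof -
  obtain B R where BR: "0 \<le> B" "0 \<le> R"
    "\<And>x y. cmod (k x y) \<le> B * indicator {-R..R} x * indicator {-R..R} y"
    using bkerE[OF k] by metis
  have [measurable]: "f \<in> borel_measurable borel" using f by (rule sqint_measurable)
  have m0: "(\<lambda>(x, y). k x y * f y) \<in> borel_measurable (borel \<Otimes>\<^sub>M lborel)"
    using k by measurable
  have m: "kop k f \<in> borel_measurable borel"
    unfolding kop_def using lborel.borel_measurable_lebesgue_integral[OF m0] by simp
  define J where "J = (LINT y|lborel. indicator {-R..R} y * cmod (f y))"
  have le: "cmod (kop k f x) \<le> B * J * cmod (indicator {-R..R} x)" for x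
  proof -
    have "cmod (kop k f x) \<le> (LINT y|lborel. cmod (k x y * f y))"
      unfolding kop_def by (rule integral_norm_bound)
    also have "\<dots> \<le> (LINT y|lborel. (B * indicator {-R..R} x) * (indicator {-R..R} y * cmod (f y)))"
    proof (rule integral_mono)
      show "cmod (k x y * f y) \<le> (B * indicator {-R..R} x) * (indicator {-R..R} y * cmod (f y))" for y
        using mult_right_mono[OF BR(3)[of x y], of "cmod (f y)"] by (simp add: norm_mult algebra_simps)
    qed (use kop_integrable[OF k f] sqint_local_integrable[OF f] in auto)
    also have "\<dots> = B * J * cmod (indicator {-R..R} x)"
      unfolding J_def by (auto simp: indicator_def)
    finally show ?thesis .
  qed
  show ?thesis by (rule sqint_bound(1)[OF m sqint_indicator le])
qed

lemma ip_kop_integral: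
  assumes k: "bker k" and f: "sqint f" and g: "sqint g"
  shows "ip (kop k f) g = (LINT p|(lborel \<Otimes>\<^sub>M lborel). k (fst p) (snd p) * f (snd p) * cnj (g (fst p)))"
proof -
  have "ip (kop k f) g = (LINT x|lborel. LINT y|lborel. k x y * f y * cnj (g x))"
    unfolding ip_def kop_def by simp
  also have "\<dots> = (LINT p|(lborel \<Otimes>\<^sub>M lborel). (case p of (x, y) \<Rightarrow> k x y * f y * cnj (g x)))"
    using lborel_pair.integral_fst'[OF bker_integrable2(1)[OF k f g]] by simp
  finally show ?thesis by (simp add: case_prod_unfold)
qed

lemma ip_kop_adj:
  assumes k: "bker k" and f: "sqint f" and g: "sqint g"
  shows "ip (kop k f) g = ip f (kop (kadj k) g)"
proof -
  have "ip (kop k f) g = (LINT x|lborel. LINT y|lborel. k x y * f y * cnj (g x))"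
    unfolding ip_def kop_def by simp
  also have "\<dots> = (LINT y|lborel. LINT x|lborel. k x y * f y * cnj (g x))"
    using lborel_pair.Fubini_integral[OF bker_integrable2(1)[OF k f g]] by simp
  also have "\<dots> = (LINT y|lborel. f y * (LINT x|lborel. k x y * cnj (g x)))"
  proof (intro Bochner_Integration.integral_cong refl)
    fix y
    have eq: "(\<lambda>x. k x y * f y * cnj (g x)) = (\<lambda>x. f y * (k x y * cnj (g x)))"
      by (simp add: fun_eq_iff mult_ac)
    show "(LINT x|lborel. k x y * f y * cnj (g x)) = f y * (LINT x|lborel. k x y * cnj (g x))"
      unfolding eq by simp
  qed
  also have "(\<lambda>y. LINT x|lborel. k x y * cnj (g x)) = (\<lambda>y. cnj (kop (kadj k) g y))"
    unfolding kop_def kadj_def Bochner_Integration.integral_cnj[symmetric] by simp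
  finally show ?thesis unfolding ip_def .
qed

lemma cmod_ip_kop_le:
  assumes k: "bker k" and f: "sqint f" and g: "sqint g"
  shows "cmod (ip (kop k f) g) \<le>
    (LINT p|(lborel \<Otimes>\<^sub>M lborel). cmod (k (fst p) (snd p)) * cmod (f (snd p)) * cmod (g (fst p)))"
  unfolding ip_kop_integral[OF k f g]
  using integral_norm_bound[of "lborel \<Otimes>\<^sub>M lborel" "\<lambda>p. k (fst p) (snd p) * f (snd p) * cnj (g (fst p))"]
  by (simp add: norm_mult)

lemma kop_sum_fun:
  "bker k \<Longrightarrow> (\<And>i. i \<in> I \<Longrightarrow> sqint (f i)) \<Longrightarrow>
   kop k (\<lambda>x. \<Sum>i\<in>I. f i x) = (\<lambda>x. \<Sum>i\<in>I. kop k (f i) x)"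
  by (rule ext) (simp add: kop_def sum_distrib_left kop_integrable)

lemma kop_sum_ker:
  "(\<And>i. i \<in> I \<Longrightarrow> bker (k i)) \<Longrightarrow> sqint f \<Longrightarrow>
   kop (\<lambda>x y. \<Sum>i\<in>I. k i x y) f = (\<lambda>x. \<Sum>i\<in>I. kop (k i) f x)"
  by (rule ext) (simp add: kop_def sum_distrib_right kop_integrable)

text \<open>The value of \<open>kop k\<close> at \<open>x\<close> is an inner product with the
  conjugated row of \<open>k\<close>, so moving \<open>l\<close> to the other side by
  \<open>ip_kop_adj\<close> performs the interchange of integrals.\<close>

lemma kop_kop:
  assumes k: "bker k" and l: "bker l" and f: "sqint f"
  shows "kop k (kop l f) = kop (kcomp k l) f"
proof
  fix x
  have row: "sqint (\<lambda>y. cnj (k x y))"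
    using bker_col[OF bker_adj[OF k], of x] by (simp add: kadj_def)
  have "kop k (kop l f) x = ip (kop l f) (\<lambda>y. cnj (k x y))"
    unfolding ip_def kop_def[of k] by (simp add: mult.commute)
  also have "\<dots> = ip f (kop (kadj l) (\<lambda>y. cnj (k x y)))"
    by (rule ip_kop_adj[OF l f row])
  also have "\<dots> = (LINT z|lborel. f z * (LINT y|lborel. k x y * l y z))"
    unfolding ip_def kop_def kadj_def Bochner_Integration.integral_cnj[symmetric] by (simp add: mult.commute)
  finally show "kop k (kop l f) x = kop (kcomp k l) f x"
    unfolding kop_def[of "kcomp k l"] unfolding kcomp_def by (simp add: mult.commute)
qed

lemma bker_comp:
  assumes k: "bker k" and l: "bker l" shows "bker (kcomp k l)"
proof -
  obtain B R where BR: "0 \<le> B" "0 \<le> R"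
    "\<And>x y. cmod (k x y) \<le> B * indicator {-R..R} x * indicator {-R..R} y"
    "\<And>x y. k x y \<noteq> 0 \<Longrightarrow> \<bar>x\<bar> \<le> R \<and> \<bar>y\<bar> \<le> R"
    using bkerE[OF k] by metis
  obtain B' R' where BR': "0 \<le> B'" "0 \<le> R'"
    "\<And>x y. cmod (l x y) \<le> B' * indicator {-R'..R'} x * indicator {-R'..R'} y"
    "\<And>x y. l x y \<noteq> 0 \<Longrightarrow> \<bar>x\<bar> \<le> R' \<and> \<bar>y\<bar> \<le> R'"
    using bkerE[OF l] by metis
  have lb: "cmod (l x y) \<le> B'" for x y
    by (rule order_trans[OF BR'(3)]) (use BR'(1) in \<open>auto simp: indicator_def\<close>)
  have kb: "cmod (k x y) \<le> B * cmod (indicator {-R..R} y)" for x y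
    by (rule order_trans[OF BR(3)]) (use BR(1) in \<open>auto simp: indicator_def\<close>)
  define J where "J = (LINT y|lborel. cmod (indicator {-R..R} y))"
  have J: "integrable lborel (\<lambda>y. cmod (indicator {-R..R} y))"
    using sqint_local_integrable[OF sqint_indicator[of R], of R]
    by (rule Bochner_Integration.integrable_cong[THEN iffD1, rotated 2]) (auto simp: indicator_def)
  have m0: "(\<lambda>(p, y). k (fst p) y * l y (snd p)) \<in> borel_measurable (borel \<Otimes>\<^sub>M lborel)"
    using k l unfolding borel_prod[symmetric] by measurable
  have m: "(\<lambda>p. kcomp k l (fst p) (snd p)) \<in> borel_measurable borel"
    unfolding kcomp_def using lborel.borel_measurable_lebesgue_integral[OF m0] by simp
  show ?thesis
  proof (rule bkerI[OF m, of "B * B' * J" "max R R'"])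
    fix x z
    have "cmod (kcomp k l x z) \<le> (LINT y|lborel. cmod (k x y * l y z))"
      unfolding kcomp_def by (rule integral_norm_bound)
    also have "\<dots> \<le> (LINT y|lborel. (B * B') * cmod (indicator {-R..R} y))"
    proof (rule integral_mono)
      show "integrable lborel (\<lambda>y. cmod (k x y * l y z))"
        using kop_integrable[OF k bker_col[OF l, of z], of x] by (rule integrable_norm)
      show "cmod (k x y * l y z) \<le> (B * B') * cmod (indicator {-R..R} y)" for y
        using mult_mono[OF kb[of x y] lb[of y z]] BR(1) by (simp add: norm_mult mult_ac)
    qed (use J in auto)
    also have "\<dots> = B * B' * J" by (simp add: J_def)
    finally show "cmod (kcomp k l x z) \<le> B * B' * J" .
    show "\<bar>x\<bar> \<le> max R R' \<and> \<bar>z\<bar> \<le> max R R'" if "kcomp k l x z \<noteq> 0"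
    proof -
      have "\<exists>y. k x y * l y z \<noteq> 0"
      proof (rule ccontr)
        assume "\<not> ?thesis"
        then have "(\<lambda>y. k x y * l y z) = (\<lambda>y. 0)" by (simp add: fun_eq_iff)
        then have "kcomp k l x z = 0" unfolding kcomp_def by simp
        with that show False by simp
      qed
      then obtain y where "k x y \<noteq> 0" "l y z \<noteq> 0" by auto
      then show ?thesis using BR(4) BR'(4) by fastforce
    qed
  qed
qed

section \<open>Bounds for integral operators\<close>

lemma opbD: "opb k C \<Longrightarrow> sqint f \<Longrightarrow> nrm (kop k f) \<le> C * nrm f"
  by (simp add: opb_def)

lemma opb_mono: "opb k C \<Longrightarrow> C \<le> D \<Longrightarrow> opb k D"
  unfolding opb_def by (meson mult_right_mono nrm_nonneg order_trans)

lemma opb_formI: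
  assumes k: "bker k" and C: "0 \<le> C"
    and le: "\<And>f g. sqint f \<Longrightarrow> sqint g \<Longrightarrow> cmod (ip (kop k f) g) \<le> C * nrm f * nrm g"
  shows "opb k C"
  unfolding opb_def
proof (intro allI impI)
  fix f assume f: "sqint f"
  have "(nrm (kop k f))\<^sup>2 = cmod (ip (kop k f) (kop k f))"
    by (simp only: cmod_ip_self)
  also have "\<dots> \<le> C * nrm f * nrm (kop k f)"
    by (rule le[OF f kop_sqint[OF k f]])
  finally show "nrm (kop k f) \<le> C * nrm f"
    using nrm_nonneg[of "kop k f"] nrm_nonneg[of f] C
    by (cases "nrm (kop k f) = 0") (auto simp: power2_eq_square mult_le_cancel_right)
qed

lemma opb_form:
  assumes "bker k" "opb k C" "sqint f" "sqint g"
  shows "cmod (ip (kop k f) g) \<le> C * nrm f * nrm g"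
  using cauchy_schwarz[OF kop_sqint[OF assms(1,3)] assms(4)]
    mult_right_mono[OF opbD[OF assms(2,3)] nrm_nonneg[of g]] by linarith

lemma opb_adj:
  assumes k: "bker k" and C: "0 \<le> C" and o: "opb k C"
  shows "opb (kadj k) C"
proof (rule opb_formI[OF bker_adj[OF k] C])
  fix f g assume f: "sqint f" and g: "sqint g"
  have "cmod (ip (kop (kadj k) f) g) = cmod (ip (kop k g) f)"
    using ip_kop_adj[OF k g f] ip_cnj[of g "kop (kadj k) f"] by (metis complex_mod_cnj)
  also have "\<dots> \<le> C * nrm f * nrm g"
    using opb_form[OF k o g f] by (simp add: mult_ac)
  finally show "cmod (ip (kop (kadj k) f) g) \<le> C * nrm f * nrm g" .
qed

text \<open>The squared norm of the adjoint applied to \<open>g\<close> is the form of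
  \<open>T T\<^sup>*\<close> at \<open>g\<close>, so the adjoint is bounded by \<open>C\<close>, and
  then so is the operator.\<close>

lemma opb_of_kcomp_adj:
  assumes k: "bker k" and C: "0 \<le> C" and o: "opb (kcomp k (kadj k)) (C\<^sup>2)"
  shows "opb k C"
proof -
  have "opb (kadj k) C"
    unfolding opb_def
  proof (intro allI impI)
    fix g assume g: "sqint g"
    have s: "sqint (kop (kadj k) g)" by (rule kop_sqint[OF bker_adj[OF k] g])
    have "(nrm (kop (kadj k) g))\<^sup>2 = cmod (ip (kop (kadj k) g) (kop (kadj k) g))"
      by (simp only: cmod_ip_self)
    also have "\<dots> = cmod (ip (kop k (kop (kadj k) g)) g)"
      using ip_kop_adj[OF k s g] by simp
    also have "\<dots> = cmod (ip (kop (kcomp k (kadj k)) g) g)"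
      by (simp add: kop_kop[OF k bker_adj[OF k] g])
    also have "\<dots> \<le> C\<^sup>2 * nrm g * nrm g"
      by (rule opb_form[OF bker_comp[OF k bker_adj[OF k]] o g g])
    finally have "(nrm (kop (kadj k) g))\<^sup>2 \<le> (C * nrm g)\<^sup>2"
      by (simp add: power2_eq_square mult_ac)
    then show "nrm (kop (kadj k) g) \<le> C * nrm g"
      by (rule power2_le_imp_le) (use C in simp)
  qed
  from opb_adj[OF bker_adj[OF k] C this] show ?thesis by simp
qed

lemma opb_comp:
  assumes k: "bker k" and l: "bker l" and o: "opb k C" "opb l D" and C: "0 \<le> C"
  shows "opb (kcomp k l) (C * D)"
  unfolding opb_def
proof (intro allI impI)
  fix f assume f: "sqint f"
  have "nrm (kop (kcomp k l) f) = nrm (kop k (kop l f))"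
    by (simp add: kop_kop[OF k l f])
  also have "\<dots> \<le> C * nrm (kop l f)" by (rule opbD[OF o(1) kop_sqint[OF l f]])
  also have "\<dots> \<le> C * (D * nrm f)" by (rule mult_left_mono[OF opbD[OF o(2) f] C])
  finally show "nrm (kop (kcomp k l) f) \<le> C * D * nrm f" by simp
qed

lemma opb_sum:
  assumes "\<And>i. i \<in> I \<Longrightarrow> bker (k i)" "\<And>i. i \<in> I \<Longrightarrow> opb (k i) (C i)"
  shows "opb (\<lambda>x y. \<Sum>i\<in>I. k i x y) (\<Sum>i\<in>I. C i)"
  unfolding opb_def
proof (intro allI impI)
  fix f assume f: "sqint f"
  have "nrm (kop (\<lambda>x y. \<Sum>i\<in>I. k i x y) f) = nrm (\<lambda>x. \<Sum>i\<in>I. kop (k i) f x)"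
    using kop_sum_ker[of I k f] assms f by simp
  also have "\<dots> \<le> (\<Sum>i\<in>I. nrm (kop (k i) f))"
    by (rule nrm_sum) (use assms f kop_sqint in auto)
  also have "\<dots> \<le> (\<Sum>i\<in>I. C i * nrm f)"
    by (rule sum_mono) (use assms f opbD in auto)
  finally show "nrm (kop (\<lambda>x y. \<Sum>i\<in>I. k i x y) f) \<le> (\<Sum>i\<in>I. C i) * nrm f"
    by (simp add: sum_distrib_right)
qed

lemma opb_zero: "0 \<le> C \<Longrightarrow> opb (\<lambda>x y. 0) C"
  by (simp add: opb_def kop_def[abs_def])

lemma bker_integrable_row:
  assumes k: "bker k" shows "integrable lborel (\<lambda>y. cmod (k x y))"
proof -
  obtain R where R: "\<And>x y. k x y \<noteq> 0 \<Longrightarrow> \<bar>x\<bar> \<le> R \<and> \<bar>y\<bar> \<le> R"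
    using bkerE[OF k] by metis
  have "k x y * indicator {-R..R} y = k x y" for y
    using R[of x y] by (cases "k x y = 0") (auto simp: indicator_def)
  with integrable_norm[OF kop_integrable[OF k sqint_indicator[of R], of x]] show ?thesis
    by simp
qed

text \<open>Under the kernel, twice the product of the absolute values of \<open>f\<close> and
  \<open>g\<close> is split with a weight \<open>t\<close> into squares; integrating first in the
  other variable, column sums control the square of \<open>f\<close> and row sums that of
  \<open>g\<close>.\<close>

lemma schur:
  assumes k: "bker k" and C: "0 \<le> C1" "0 \<le> C2"
    and 1: "\<And>x. (LINT y|lborel. cmod (k x y)) \<le> C1"
    and 2: "\<And>y. (LINT x|lborel. cmod (k x y)) \<le> C2"
  shows "opb k (sqrt (C1 * C2))"
proof (rule opb_formI[OF k])
  fix f g assume f: "sqint f" and g: "sqint g"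
  have mf [measurable]: "f \<in> borel_measurable borel" "g \<in> borel_measurable borel"
    using f g by (auto simp: sqint_def)
  have loc1: "integrable lborel (\<lambda>x. indicator {-R..R} x * (1::real))" for R :: real
    by (simp add: integrable_real_indicator emeasure_lborel_Icc_eq)
  have loc2: "integrable lborel (\<lambda>x. indicator {-R..R} x * (cmod (h x))\<^sup>2)" if "sqint h" for R h
    by (rule integrable_real_mult_indicator[of "{-R..R}" lborel "\<lambda>x. (cmod (h x))\<^sup>2",
          unfolded mult.commute[of _ "indicator _ _"]])
       (use sqint_integrable[OF that] in auto)
  let ?k = "\<lambda>p. cmod (k (fst p) (snd p))"
  have i1: "integrable (lborel \<Otimes>\<^sub>M lborel) (\<lambda>(x, y). cmod (k x y) * (cmod (f y))\<^sup>2 * 1)"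
    by (rule bker_integrable_abs[OF k]) (use loc1 loc2[OF f] in auto)
  have i2: "integrable (lborel \<Otimes>\<^sub>M lborel) (\<lambda>(x, y). cmod (k x y) * 1 * (cmod (g x))\<^sup>2)"
    by (rule bker_integrable_abs[OF k]) (use loc1 loc2[OF g] in auto)
  have i1': "integrable (lborel \<Otimes>\<^sub>M lborel) (\<lambda>p. ?k p * (cmod (f (snd p)))\<^sup>2)"
    and i2': "integrable (lborel \<Otimes>\<^sub>M lborel) (\<lambda>p. ?k p * (cmod (g (fst p)))\<^sup>2)"
    using i1 i2 by (simp_all add: case_prod_unfold)
  have e1: "(LINT p|(lborel \<Otimes>\<^sub>M lborel). ?k p * (cmod (f (snd p)))\<^sup>2) \<le> C2 * (nrm f)\<^sup>2"
  proof -
    have "(LINT p|(lborel \<Otimes>\<^sub>M lborel). ?k p * (cmod (f (snd p)))\<^sup>2)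
        = (LINT y|lborel. LINT x|lborel. cmod (k x y) * (cmod (f y))\<^sup>2)"
      using lborel_pair.integral_snd[OF i1] by (simp add: case_prod_unfold)
    also have "\<dots> \<le> (LINT y|lborel. C2 * (cmod (f y))\<^sup>2)"
    proof (rule integral_mono')
      show "(LINT x|lborel. cmod (k x y) * (cmod (f y))\<^sup>2) \<le> C2 * (cmod (f y))\<^sup>2" for y
        using mult_right_mono[OF 2[of y], of "(cmod (f y))\<^sup>2"] by simp
    qed (use sqint_integrable[OF f] C in auto)
    finally show ?thesis by (simp add: nrm_sq)
  qed
  have e2: "(LINT p|(lborel \<Otimes>\<^sub>M lborel). ?k p * (cmod (g (fst p)))\<^sup>2) \<le> C1 * (nrm g)\<^sup>2"
  proof -
    have "(LINT p|(lborel \<Otimes>\<^sub>M lborel). ?k p * (cmod (g (fst p)))\<^sup>2)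
        = (LINT x|lborel. LINT y|lborel. cmod (k x y) * (cmod (g x))\<^sup>2)"
      using lborel_pair.integral_fst'[OF i2] by (simp add: case_prod_unfold)
    also have "\<dots> \<le> (LINT x|lborel. C1 * (cmod (g x))\<^sup>2)"
    proof (rule integral_mono')
      show "(LINT y|lborel. cmod (k x y) * (cmod (g x))\<^sup>2) \<le> C1 * (cmod (g x))\<^sup>2" for x
        using mult_right_mono[OF 1[of x], of "(cmod (g x))\<^sup>2"] by simp
    qed (use sqint_integrable[OF g] C in auto)
    finally show ?thesis by (simp add: nrm_sq)
  qed
  let ?X = "LINT p|(lborel \<Otimes>\<^sub>M lborel). ?k p * cmod (f (snd p)) * cmod (g (fst p))"
  have i3: "integrable (lborel \<Otimes>\<^sub>M lborel) (\<lambda>p. ?k p * cmod (f (snd p)) * cmod (g (fst p)))"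
    using bker_integrable2(2)[OF k f g] by (simp add: case_prod_unfold)
  have "?X \<le> (sqrt C2 * nrm f) * (sqrt C1 * nrm g)"
  proof (rule le_mult_if_le_weighted)
    fix t :: real assume t: "0 < t"
    have "2 * ?X = (LINT p|(lborel \<Otimes>\<^sub>M lborel). 2 * (?k p * cmod (f (snd p)) * cmod (g (fst p))))"
      by simp
    also have "\<dots> \<le> (LINT p|(lborel \<Otimes>\<^sub>M lborel). t * (?k p * (cmod (f (snd p)))\<^sup>2)
                   + (?k p * (cmod (g (fst p)))\<^sup>2) / t)"
    proof (rule integral_mono)
      fix p
      let ?a = "cmod (f (snd p))" and ?b = "cmod (g (fst p))"
      have "2 * (?a * ?b) * t \<le> (t * ?a)\<^sup>2 + ?b\<^sup>2"
        using sum_squares_bound[of "t * ?a" ?b] by (simp add: algebra_simps)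
      then have "2 * (?a * ?b) \<le> t * ?a\<^sup>2 + ?b\<^sup>2 / t"
        using t by (simp add: field_simps power2_eq_square)
      from mult_left_mono[OF this, of "?k p"]
      show "2 * (?k p * ?a * ?b) \<le> t * (?k p * ?a\<^sup>2) + (?k p * ?b\<^sup>2) / t"
        by (simp add: algebra_simps)
    qed (use i1' i2' i3 in auto)
    also have "\<dots> \<le> t * (C2 * (nrm f)\<^sup>2) + (C1 * (nrm g)\<^sup>2) / t"
      using i1' i2' e1 e2 t by (simp add: divide_right_mono add_mono)
    finally show "2 * ?X \<le> t * (sqrt C2 * nrm f)\<^sup>2 + (sqrt C1 * nrm g)\<^sup>2 / t"
      using C by (simp add: power_mult_distrib)
  qed (use C in auto)
  then show "cmod (ip (kop k f) g) \<le> sqrt (C1 * C2) * nrm f * nrm g"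
    using cmod_ip_kop_le[OF k f g] by (simp add: real_sqrt_mult mult_ac)
qed (use C in simp)

section \<open>Kernels of variable width\<close>

text \<open>A Poisson kernel of height \<open>D\<close> and width \<open>1 / D\<close>. It is
  comparable to the minimum of \<open>D\<close> and \<open>1 / (D * t\<^sup>2)\<close>, which are
  the trivial bound and the bound after two integrations by parts, and its primitive is an
  arctangent, so its integral is at most \<open>pi\<close> for every \<open>D\<close>.\<close>

definition pois :: "real \<Rightarrow> real \<Rightarrow> real" where
  "pois D t = D / (1 + D\<^sup>2 * t\<^sup>2)"

lemma pois_den_pos: "0 < 1 + D\<^sup>2 * (t::real)\<^sup>2"
  by (simp add: add_pos_nonneg)

lemma pois_nonneg: "0 \<le> D \<Longrightarrow> 0 \<le> pois D t"
  using pois_den_pos[of D t] by (simp add: pois_def)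

lemma pois_le: "0 \<le> D \<Longrightarrow> pois D t \<le> D"
  using pois_den_pos[of D t] by (simp add: pois_def divide_le_eq mult_left_mono distrib_left)

lemma pois_le_inverse:
  assumes "0 < D" "0 < s" "s \<le> \<bar>t\<bar>" shows "pois D t \<le> 1 / (D * s\<^sup>2)"
proof -
  have "s\<^sup>2 \<le> t\<^sup>2" using assms by (simp add: abs_le_square_iff[symmetric])
  then have "D * (D * s\<^sup>2) \<le> 1 + D\<^sup>2 * t\<^sup>2"
    using assms by (simp add: power2_eq_square mult.assoc add_increasing mult_left_mono)
  then show ?thesis
    using assms pois_den_pos[of D t] by (simp add: pois_def divide_simps)
qed

lemma pois_ge_half: "0 \<le> m \<Longrightarrow> m * \<bar>t\<bar> \<le> 1 \<Longrightarrow> m / 2 \<le> pois m t"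
proof -
  assume m: "0 \<le> m" "m * \<bar>t\<bar> \<le> 1"
  have "(m * \<bar>t\<bar>)\<^sup>2 \<le> 1" using m by (simp add: power_le_one)
  then have "1 + m\<^sup>2 * t\<^sup>2 \<le> 2" by (simp add: power_mult_distrib)
  then show ?thesis unfolding pois_def using m pois_den_pos[of m t]
    by (intro divide_left_mono) auto
qed

lemma pois_ge_inverse:
  assumes "1 < m * \<bar>t\<bar>" "0 < m" shows "1 / (2 * m * t\<^sup>2) \<le> pois m t"
proof -
  have "1 \<le> (m * \<bar>t\<bar>)\<^sup>2" using assms by (simp add: one_le_power)
  then have a: "1 + m\<^sup>2 * t\<^sup>2 \<le> 2 * m\<^sup>2 * t\<^sup>2" by (simp add: power_mult_distrib)
  have t: "t \<noteq> 0" using assms by auto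
  have "1 / (2 * m * t\<^sup>2) = m / (2 * m\<^sup>2 * t\<^sup>2)"
    using assms t by (simp add: power2_eq_square)
  also have "\<dots> \<le> pois m t"
    unfolding pois_def using a assms pois_den_pos[of m t] t by (intro divide_left_mono) auto
  finally show ?thesis .
qed

text \<open>One of the two factors is always dominated by the kernel of the smaller scale
  \<open>m\<close> at \<open>x - x'\<close>. If \<open>m\<close> times the distance is at most 1,
  this is the factor whose scale is \<open>m\<close>, which never exceeds \<open>m\<close>.
  Otherwise one of \<open>x\<close>, \<open>x'\<close> is at least half the distance away from
  \<open>y\<close>, and the tail of its factor is small enough.\<close>

lemma pois_mult_le:
  assumes D: "0 < D" "0 < E"
  shows "pois D (x - y) * pois E (x' - y)
    \<le> 8 * pois (min D E) (x - x') * (pois D (x - y) + pois E (x' - y))"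
proof -
  define m where "m = min D E"
  define L where "L = \<bar>x - x'\<bar>"
  have m: "0 < m" "m \<le> D" "m \<le> E" using D by (auto simp: m_def)
  have nn: "0 \<le> pois D (x - y)" "0 \<le> pois E (x' - y)" "0 \<le> pois m (x - x')"
    using D m by (auto intro: pois_nonneg)
  have key: "pois D (x - y) \<le> 8 * pois m (x - x') \<or> pois E (x' - y) \<le> 8 * pois m (x - x')"
  proof (cases "m * L \<le> 1")
    case True
    then have h: "m / 2 \<le> pois m (x - x')" using pois_ge_half[of m "x - x'"] m by (simp add: L_def)
    show ?thesis
    proof (cases "m = D")
      case True
      then show ?thesis using pois_le[of D "x - y"] D h nn(3) by linarith
    next
      case False
      then have "m = E" by (auto simp: m_def min_def)
      then show ?thesis using pois_le[of E "x' - y"] D h nn(3) by linarith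
    qed
  next
    case False
    then have h: "1 / (2 * m * L\<^sup>2) \<le> pois m (x - x')"
      using pois_ge_inverse[of m "x - x'"] m by (simp add: L_def)
    have L: "0 < L" using False m by (cases "L = 0") (auto simp: L_def)
    have c: "1 / (d * (L / 2)\<^sup>2) \<le> 8 * (1 / (2 * m * L\<^sup>2))" if "m \<le> d" for d
      using that m L by (simp add: power_divide divide_simps mult_right_mono)
    have "L / 2 \<le> \<bar>x - y\<bar> \<or> L / 2 \<le> \<bar>x' - y\<bar>"
      using abs_triangle_ineq4[of "x - y" "x' - y"] unfolding L_def by auto
    then show ?thesis
    proof
      assume "L / 2 \<le> \<bar>x - y\<bar>"
      then have "pois D (x - y) \<le> 1 / (D * (L / 2)\<^sup>2)"
        by (intro pois_le_inverse) (use D L in auto)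
      then show ?thesis using c[OF m(2)] h by linarith
    next
      assume "L / 2 \<le> \<bar>x' - y\<bar>"
      then have "pois E (x' - y) \<le> 1 / (E * (L / 2)\<^sup>2)"
        by (intro pois_le_inverse) (use D L in auto)
      then show ?thesis using c[OF m(3)] h by linarith
    qed
  qed
  then show ?thesis
  proof
    assume "pois D (x - y) \<le> 8 * pois m (x - x')"
    then have "pois D (x - y) * pois E (x' - y) \<le> 8 * pois m (x - x') * pois E (x' - y)"
      using nn by (intro mult_right_mono)
    also have "\<dots> \<le> 8 * pois m (x - x') * (pois D (x - y) + pois E (x' - y))"
      using nn by (intro mult_left_mono) auto
    finally show ?thesis by (simp add: m_def)
  next
    assume "pois E (x' - y) \<le> 8 * pois m (x - x')"
    then have "pois D (x - y) * pois E (x' - y) \<le> pois D (x - y) * (8 * pois m (x - x'))"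
      using nn by (intro mult_left_mono)
    also have "\<dots> \<le> (pois D (x - y) + pois E (x' - y)) * (8 * pois m (x - x'))"
      using nn by (intro mult_right_mono) auto
    finally show ?thesis by (simp add: m_def mult_ac)
  qed
qed

lemma pois_integral:
  assumes D: "0 < D" and R: "0 \<le> R"
  shows "integrable lborel (\<lambda>y. pois D (x - y) * indicator {-R..R} y)"
    "(LINT y|lborel. pois D (x - y) * indicator {-R..R} y) \<le> pi"
proof -
  have d: "((\<lambda>y. arctan (D * (y - x))) has_real_derivative pois D (x - y)) (at y)" for y
    by (auto intro!: derivative_eq_intros simp: pois_def power_mult_distrib inverse_eq_divide power2_commute)
  have c: "isCont (\<lambda>y. pois D (x - y)) y" for y
    unfolding pois_def using pois_den_pos[of D "x - y"]
    by (intro continuous_intros) (auto simp: add_nonneg_eq_0_iff)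
  show "integrable lborel (\<lambda>y. pois D (x - y) * indicator {-R..R} y)"
    by (rule integrable.intros, rule has_bochner_integral_FTC_Icc_real) (use R d c in auto)
  have "(LINT y|lborel. pois D (x - y) * indicator {-R..R} y)
      = arctan (D * (R - x)) - arctan (D * (-R - x))"
    by (rule integral_FTC_Icc_real) (use R d c in auto)
  also have "\<dots> \<le> pi"
    using arctan_bounded[of "D * (R - x)"] arctan_bounded[of "D * (-R - x)"] by linarith
  finally show "(LINT y|lborel. pois D (x - y) * indicator {-R..R} y) \<le> pi" .
qed

text \<open>
  The scale \<open>D x\<close> may vary arbitrarily with \<open>x\<close>, so neither row nor column sums of the kernel are
  controlled. The operator \<open>A\<close> with kernel \<open>pois (D x) (x - y)\<close> satisfies \<open>A A\<^sup>* \<le> c (A + A\<^sup>*)\<close>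
  pointwise, whence \<open>\<parallel>A\<^sup>* v\<parallel>\<^sup>2 \<le> 2 c \<parallel>v\<parallel> \<parallel>A\<^sup>* v\<parallel>\<close>: this replaces the maximal function.
\<close>

lemma opb_pois:
  assumes K: "bker K" and D [measurable]: "D \<in> borel_measurable borel"
    and Dpos: "\<And>x. 0 \<le> D x" and Dle: "\<And>x. D x \<le> Dm" and c: "0 \<le> c"
    and le: "\<And>x x'. cmod (K x x') \<le> c * pois (min (D x) (D x')) (x - x')"
  shows "opb K (64 * pi * c)"
proof -
  obtain R where R: "0 \<le> R" "\<And>x y. K x y \<noteq> 0 \<Longrightarrow> \<bar>x\<bar> \<le> R \<and> \<bar>y\<bar> \<le> R"
    using bkerE[OF K] by metis
  define I where "I x = (indicator {-R..R} x :: real)" for x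
  have I: "0 \<le> I x" "I x \<le> 1" "I x * I x = I x" for x by (auto simp: I_def indicator_def)
  define a where "a x y = I x * I y * pois (D x) (x - y)" for x y
  define A where "A x y = complex_of_real (a x y)" for x y
  have a0: "0 \<le> a x y" for x y
    using I pois_nonneg[OF Dpos] by (simp add: a_def)
  have A: "bker A"
  proof (rule bkerI[of _ Dm R])
    have "(\<lambda>p. A (fst p) (snd p)) \<in> borel_measurable (borel \<Otimes>\<^sub>M borel)"
      unfolding A_def a_def I_def pois_def by measurable
    then show "(\<lambda>p. A (fst p) (snd p)) \<in> borel_measurable borel" by (simp add: borel_prod)
    fix x y
    have "a x y \<le> 1 * 1 * pois (D x) (x - y)"
      unfolding a_def using I Dpos by (intro mult_right_mono mult_mono pois_nonneg) auto
    also have "\<dots> \<le> Dm" using pois_le[OF Dpos, of x "x - y"] Dle[of x] by simp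
    finally show "cmod (A x y) \<le> Dm" using a0[of x y] by (simp add: A_def)
    show "A x y \<noteq> 0 \<Longrightarrow> \<bar>x\<bar> \<le> R \<and> \<bar>y\<bar> \<le> R"
      by (auto simp: A_def a_def I_def indicator_def split: if_splits)
  qed
  note A' = bker_adj[OF A]
  note AA = bker_comp[OF A A']
  \<comment> \<open>The minimum is one of the two scales, so the symmetric kernel is dominated by
    \<open>a\<close> plus its transpose.\<close>
  have min_le: "I x * I x' * pois (min (D x) (D x')) (x - x') \<le> a x x' + a x' x" for x x'
  proof -
    have s: "pois d (x - x') = pois d (x' - x)" for d by (simp add: pois_def power2_commute)
    show ?thesis
    proof (cases "D x \<le> D x'")
      case True
      then have "I x * I x' * pois (min (D x) (D x')) (x - x') = a x x'" by (simp add: a_def)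
      then show ?thesis using a0[of x' x] by linarith
    next
      case False
      then have "I x * I x' * pois (min (D x) (D x')) (x - x') = a x' x" by (simp add: a_def s)
      then show ?thesis using a0[of x x'] by linarith
    qed
  qed
  have comp_le: "cmod (kcomp A (kadj A) x x') \<le> 16 * pi * (a x x' + a x' x)" for x x'
  proof (cases "D x = 0 \<or> D x' = 0")
    case True
    then have "(\<lambda>y. A x y * kadj A y x') = (\<lambda>y. 0)"
      by (auto simp: A_def a_def kadj_def pois_def fun_eq_iff)
    then have "kcomp A (kadj A) x x' = 0" unfolding kcomp_def by simp
    then show ?thesis using a0[of x x'] a0[of x' x] by simp
  next
    case False
    then have p: "0 < D x" "0 < D x'" using Dpos[of x] Dpos[of x'] by auto
    let ?m = "pois (min (D x) (D x')) (x - x')"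
    let ?f = "\<lambda>y. pois (D x) (x - y) * I y" and ?g = "\<lambda>y. pois (D x') (x' - y) * I y"
    have fi: "integrable lborel ?f" "integrable lborel ?g" "(LINT y|lborel. ?f y) \<le> pi"
      "(LINT y|lborel. ?g y) \<le> pi"
      using pois_integral[OF p(1) R(1), of x] pois_integral[OF p(2) R(1), of x'] by (simp_all add: I_def)
    have m0: "0 \<le> ?m" using p by (intro pois_nonneg) auto
    have "cmod (kcomp A (kadj A) x x') \<le> (LINT y|lborel. cmod (A x y * kadj A y x'))"
      unfolding kcomp_def by (rule integral_norm_bound)
    also have "\<dots> \<le> (LINT y|lborel. I x * I x' * (8 * ?m) * (?f y + ?g y))"
    proof (rule integral_mono)
      show "integrable lborel (\<lambda>y. cmod (A x y * kadj A y x'))"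
        by (intro integrable_norm kop_integrable[OF A] bker_col[OF A'])
      show "integrable lborel (\<lambda>y. I x * I x' * (8 * ?m) * (?f y + ?g y))"
        using fi by simp
      fix y
      have "cmod (A x y * kadj A y x') = (I x * I x' * I y) * (pois (D x) (x - y) * pois (D x') (x' - y))"
      proof -
        have "cmod (A x y * kadj A y x') = a x y * a x' y"
          using a0[of x y] a0[of x' y] by (simp add: A_def kadj_def norm_mult)
        also have "\<dots> = (I x * I x' * (I y * I y)) * (pois (D x) (x - y) * pois (D x') (x' - y))"
          by (simp add: a_def mult_ac)
        finally show ?thesis unfolding I(3) .
      qed
      also have "\<dots> \<le> (I x * I x' * I y) * (8 * ?m * (pois (D x) (x - y) + pois (D x') (x' - y)))"
        using pois_mult_le[OF p, of x y x'] I by (intro mult_left_mono) auto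
      finally show "cmod (A x y * kadj A y x') \<le> I x * I x' * (8 * ?m) * (?f y + ?g y)"
        by (simp add: algebra_simps)
    qed
    also have "\<dots> = I x * I x' * (8 * ?m) * ((LINT y|lborel. ?f y) + (LINT y|lborel. ?g y))"
      using fi by simp
    also have "\<dots> \<le> I x * I x' * (8 * ?m) * (pi + pi)"
      using fi m0 I by (intro mult_left_mono add_mono) auto
    also have "\<dots> = 16 * pi * (I x * I x' * ?m)" by simp
    also have "\<dots> \<le> 16 * pi * (a x x' + a x' x)"
      by (intro mult_left_mono min_le) auto
    finally show ?thesis .
  qed
  \<comment> \<open>Taking absolute values of the functions turns the absolute forms
    \<open>J\<close> of the nonnegative kernels \<open>A\<close> and \<open>kadj A\<close> into
    inner products, to which the adjoint identity and the Cauchy--Schwarz inequality apply.\<close>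
  define v where "v f x = complex_of_real (cmod (f x))" for f :: "real \<Rightarrow> complex" and x
  have v: "sqint (v f)" "nrm (v f) = nrm f" if "sqint f" for f
    using that by (auto simp: sqint_def v_def[abs_def] nrm_def)
  define J where "J k f g = (LINT p|(lborel \<Otimes>\<^sub>M lborel).
      cmod (k (fst p) (snd p)) * cmod (f (snd p)) * cmod (g (fst p)))"
    for k :: "real \<Rightarrow> real \<Rightarrow> complex" and f g :: "real \<Rightarrow> complex"
  have Ji: "integrable (lborel \<Otimes>\<^sub>M lborel)
      (\<lambda>p. cmod (k (fst p) (snd p)) * cmod (f (snd p)) * cmod (g (fst p)))"
    if "bker k" "sqint f" "sqint g" for k f g
    using bker_integrable2(2)[OF that] by (simp add: case_prod_unfold)
  have JA: "J A f g = cmod (ip (kop A (v f)) (v g))" "J (kadj A) f g = cmod (ip (kop (kadj A) (v f)) (v g))"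
    if f: "sqint f" and g: "sqint g" for f g
  proof -
    have *: "J k f g = cmod (ip (kop k (v f)) (v g))"
      if k: "bker k" and pos: "\<And>x y. k x y = complex_of_real (cmod (k x y))" for k
    proof -
      have "ip (kop k (v f)) (v g) = (LINT p|(lborel \<Otimes>\<^sub>M lborel).
          complex_of_real (cmod (k (fst p) (snd p)) * cmod (f (snd p)) * cmod (g (fst p))))"
        unfolding ip_kop_integral[OF k v(1)[OF f] v(1)[OF g]]
        by (intro Bochner_Integration.integral_cong refl) (simp add: v_def pos[symmetric])
      also have "\<dots> = complex_of_real (J k f g)" unfolding J_def by (rule integral_complex_of_real)
      finally show ?thesis by (simp add: J_def)
    qed
    show "J A f g = cmod (ip (kop A (v f)) (v g))" "J (kadj A) f g = cmod (ip (kop (kadj A) (v f)) (v g))"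
      by (rule *; use A A' a0 in \<open>simp add: A_def kadj_def\<close>)+
  qed
  have Av: "nrm (kop (kadj A) (v f)) \<le> 32 * pi * nrm f" if f: "sqint f" for f
  proof -
    let ?h = "kop (kadj A) (v f)"
    have h: "sqint ?h" by (rule kop_sqint[OF A' v(1)[OF f]])
    have "(nrm ?h)\<^sup>2 = cmod (ip ?h ?h)" by (simp only: cmod_ip_self)
    also have "\<dots> = cmod (ip (kop (kcomp A (kadj A)) (v f)) (v f))"
      using ip_kop_adj[OF A h v(1)[OF f]] kop_kop[OF A A' v(1)[OF f]] by simp
    also have "\<dots> \<le> J (kcomp A (kadj A)) (v f) (v f)"
      unfolding J_def by (rule cmod_ip_kop_le[OF AA v(1)[OF f] v(1)[OF f]])
    also have "\<dots> \<le> (LINT p|(lborel \<Otimes>\<^sub>M lborel).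
        16 * pi * (cmod (A (fst p) (snd p)) * cmod (f (snd p)) * cmod (f (fst p))
          + cmod (kadj A (fst p) (snd p)) * cmod (f (snd p)) * cmod (f (fst p))))"
      unfolding J_def
    proof (rule integral_mono)
      show "integrable (lborel \<Otimes>\<^sub>M lborel) (\<lambda>p. cmod (kcomp A (kadj A) (fst p) (snd p)) * cmod (v f (snd p)) * cmod (v f (fst p)))"
        by (rule Ji[OF AA v(1)[OF f] v(1)[OF f]])
      show "integrable (lborel \<Otimes>\<^sub>M lborel) (\<lambda>p. 16 * pi * (cmod (A (fst p) (snd p)) * cmod (f (snd p)) * cmod (f (fst p))
          + cmod (kadj A (fst p) (snd p)) * cmod (f (snd p)) * cmod (f (fst p))))"
        using Ji[OF A f f] Ji[OF A' f f] by simp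
      fix p
      have e: "cmod (A (fst p) (snd p)) = a (fst p) (snd p)" "cmod (kadj A (fst p) (snd p)) = a (snd p) (fst p)"
        using a0 by (simp_all add: A_def kadj_def)
      show "cmod (kcomp A (kadj A) (fst p) (snd p)) * cmod (v f (snd p)) * cmod (v f (fst p))
        \<le> 16 * pi * (cmod (A (fst p) (snd p)) * cmod (f (snd p)) * cmod (f (fst p))
          + cmod (kadj A (fst p) (snd p)) * cmod (f (snd p)) * cmod (f (fst p)))"
        using mult_right_mono[OF comp_le[of "fst p" "snd p"], of "cmod (f (snd p)) * cmod (f (fst p))"]
        unfolding e by (simp add: v_def algebra_simps)
    qed
    also have "\<dots> = 16 * pi * (J A f f + J (kadj A) f f)"
      unfolding J_def using Ji[OF A f f] Ji[OF A' f f] by simp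
    also have "\<dots> = 32 * pi * cmod (ip (v f) ?h)"
    proof -
      have "ip (kop A (v f)) (v f) = ip (v f) ?h" by (rule ip_kop_adj[OF A v(1)[OF f] v(1)[OF f]])
      moreover have "cmod (ip ?h (v f)) = cmod (ip (v f) ?h)"
        by (metis complex_mod_cnj ip_cnj)
      ultimately show ?thesis unfolding JA[OF f f] by simp
    qed
    also have "\<dots> \<le> 32 * pi * (nrm f * nrm ?h)"
      using cauchy_schwarz[OF v(1)[OF f] h] v(2)[OF f] by (intro mult_left_mono) auto
    finally show ?thesis
      using nrm_nonneg[of ?h] nrm_nonneg[of f]
      by (cases "nrm ?h = 0") (auto simp: power2_eq_square mult_le_cancel_right mult.assoc[symmetric])
  qed
  show ?thesis
  proof (rule opb_formI[OF K])
    fix f g assume f: "sqint f" and g: "sqint g"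
    have "cmod (ip (kop K f) g) \<le> J K f g"
      unfolding J_def by (rule cmod_ip_kop_le[OF K f g])
    also have "\<dots> \<le> (LINT p|(lborel \<Otimes>\<^sub>M lborel).
        c * (cmod (A (fst p) (snd p)) * cmod (f (snd p)) * cmod (g (fst p))
          + cmod (kadj A (fst p) (snd p)) * cmod (f (snd p)) * cmod (g (fst p))))"
      unfolding J_def
    proof (rule integral_mono)
      show "integrable (lborel \<Otimes>\<^sub>M lborel) (\<lambda>p. c * (cmod (A (fst p) (snd p)) * cmod (f (snd p)) * cmod (g (fst p))
          + cmod (kadj A (fst p) (snd p)) * cmod (f (snd p)) * cmod (g (fst p))))"
        using Ji[OF A f g] Ji[OF A' f g] by simp
      fix p
      obtain x x' where p: "p = (x :: real, x' :: real)" by (cases p)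
      have e: "cmod (A x x') = a x x'" "cmod (kadj A x x') = a x' x"
        using a0 by (simp_all add: A_def kadj_def)
      have "cmod (K x x') \<le> c * (a x x' + a x' x)"
      proof (cases "K x x' = 0")
        case False
        then have "I x = 1" "I x' = 1" using R(2)[of x x'] by (auto simp: I_def indicator_def)
        then have "pois (min (D x) (D x')) (x - x') \<le> a x x' + a x' x" using min_le[of x x'] by simp
        from mult_left_mono[OF this c] le[of x x'] show ?thesis by linarith
      qed (use c a0 in simp)
      from mult_right_mono[OF this, of "cmod (f x') * cmod (g x)"]
      show "cmod (K (fst p) (snd p)) * cmod (f (snd p)) * cmod (g (fst p))
        \<le> c * (cmod (A (fst p) (snd p)) * cmod (f (snd p)) * cmod (g (fst p))
          + cmod (kadj A (fst p) (snd p)) * cmod (f (snd p)) * cmod (g (fst p)))"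
        unfolding p by (simp add: e algebra_simps)
    qed (rule Ji[OF K f g])
    also have "\<dots> = c * (J A f g + J (kadj A) f g)"
      unfolding J_def using Ji[OF A f g] Ji[OF A' f g] by simp
    also have "\<dots> \<le> c * (32 * pi * nrm f * nrm g + 32 * pi * nrm f * nrm g)"
    proof (intro mult_left_mono add_mono c)
      have "J A f g = cmod (ip (v f) (kop (kadj A) (v g)))"
        using JA[OF f g] ip_kop_adj[OF A v(1)[OF f] v(1)[OF g]] by simp
      also have "\<dots> \<le> nrm (v f) * nrm (kop (kadj A) (v g))"
        by (rule cauchy_schwarz[OF v(1)[OF f] kop_sqint[OF A' v(1)[OF g]]])
      also have "\<dots> \<le> nrm f * (32 * pi * nrm g)"
        using Av[OF g] v(2)[OF f] by (simp add: mult_left_mono)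
      finally show "J A f g \<le> 32 * pi * nrm f * nrm g" by (simp add: mult_ac)
      have "J (kadj A) f g \<le> nrm (kop (kadj A) (v f)) * nrm (v g)"
        unfolding JA[OF f g] by (rule cauchy_schwarz[OF kop_sqint[OF A' v(1)[OF f]] v(1)[OF g]])
      also have "\<dots> \<le> (32 * pi * nrm f) * nrm g"
        using Av[OF f] v(2)[OF g] by (simp add: mult_right_mono)
      finally show "J (kadj A) f g \<le> 32 * pi * nrm f * nrm g" .
    qed
    finally show "cmod (ip (kop K f) g) \<le> 64 * pi * c * nrm f * nrm g" by (simp add: algebra_simps)
  qed (use c in simp)
qed

text \<open>Words expand the powers of the adjoint of \<open>K\<close> times \<open>K\<close>, where
  \<open>K\<close> is the sum of the \<open>T i\<close>: a letter \<open>(i, j)\<close> stands for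
  the adjoint of \<open>T i\<close> followed on its right by \<open>T j\<close>.\<close>

fun word_op :: "('i \<Rightarrow> real \<Rightarrow> real \<Rightarrow> complex) \<Rightarrow> ('i \<times> 'i) list \<Rightarrow> (real \<Rightarrow> complex) \<Rightarrow> real \<Rightarrow> complex" where
  "word_op T [] f = f"
| "word_op T (p # w) f = kop (kadj (T (fst p))) (kop (T (snd p)) (word_op T w f))"

text \<open>Here \<open>j\<close> is the second index of the preceding letter. The factor
  \<open>a\<close> belongs to the two indices inside a letter and \<open>b\<close> to the two
  indices that meet between letters; the product is the geometric mean of the two ways to bracket
  the word into pairs.\<close>

fun link_weight :: "('i \<Rightarrow> 'i \<Rightarrow> real) \<Rightarrow> ('i \<Rightarrow> 'i \<Rightarrow> real) \<Rightarrow> 'i \<Rightarrow> ('i \<times> 'i) list \<Rightarrow> real" where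
  "link_weight a b j [] = 1"
| "link_weight a b j (p # w) = b j (fst p) * a (fst p) (snd p) * link_weight a b (snd p) w"

section \<open>The Cotlar--Stein theorem\<close>

fun words :: "'i set \<Rightarrow> nat \<Rightarrow> ('i \<times> 'i) list set" where
  "words F 0 = {[]}"
| "words F (Suc n) = (\<lambda>(p, w). p # w) ` ((F \<times> F) \<times> words F n)"

lemma words_subset: "w \<in> words F n \<Longrightarrow> set w \<subseteq> F \<times> F"
  by (induction n arbitrary: w) (simp, force)

lemma sum_words_Suc:
  assumes "finite F"
  shows "(\<Sum>w\<in>words F (Suc n). g w) = (\<Sum>i\<in>F. \<Sum>j\<in>F. \<Sum>w\<in>words F n. g ((i, j) # w))"
proof -
  have "(\<Sum>w\<in>words F (Suc n). g w) = (\<Sum>q\<in>(F \<times> F) \<times> words F n. g (fst q # snd q))"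
    by (simp add: sum.reindex inj_on_def case_prod_unfold prod_eq_iff)
  also have "\<dots> = (\<Sum>p\<in>F \<times> F. \<Sum>w\<in>words F n. g (p # w))"
    by (subst sum.cartesian_product) (simp add: case_prod_unfold)
  also have "\<dots> = (\<Sum>i\<in>F. \<Sum>j\<in>F. \<Sum>w\<in>words F n. g ((i, j) # w))"
    by (subst sum.cartesian_product) (simp add: case_prod_unfold)
  finally show ?thesis .
qed

text \<open>This disposes of the constant in front of the power bounds. Only exponents that are
  powers of two are available, because they come from repeated squaring.\<close>

lemma power_two_power_bounded_imp_le_one:
  fixes x c :: real
  assumes "0 \<le> x" "\<And>s::nat. x ^ (2 ^ s) \<le> c"
  shows "x \<le> 1"
proof (rule ccontr)
  assume "\<not> x \<le> 1"
  then obtain n where n: "c < x ^ n" using real_arch_pow[of x c] by auto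
  have "x ^ n \<le> x ^ (2 ^ n)" using \<open>\<not> x \<le> 1\<close> by (intro power_increasing) auto
  with n assms(2)[of n] show False by simp
qed

text \<open>The product of two neighbouring factors in a word has norm at most the square of
  \<open>a\<close> or of \<open>b\<close>, depending on how the word is bracketed; the geometric
  mean of both bracketings has the first powers, and summing over one index at a time gives one
  factor \<open>A\<close> each. The crude bound \<open>B\<close> and the number of summands enter
  only a constant that disappears when roots of high powers are taken.\<close>

lemma cotlar_stein:
  fixes T :: "'i \<Rightarrow> real \<Rightarrow> real \<Rightarrow> complex"
  assumes F: "finite F" and T: "\<And>i. i \<in> F \<Longrightarrow> bker (T i)"
    and B: "\<And>i. i \<in> F \<Longrightarrow> opb (T i) B"
    and a: "\<And>i j. i \<in> F \<Longrightarrow> j \<in> F \<Longrightarrow> opb (kcomp (kadj (T i)) (T j)) ((a i j)\<^sup>2)"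
    and b: "\<And>i j. i \<in> F \<Longrightarrow> j \<in> F \<Longrightarrow> opb (kcomp (T i) (kadj (T j))) ((b i j)\<^sup>2)"
    and a0: "\<And>i j. 0 \<le> a i j" and b0: "\<And>i j. 0 \<le> b i j"
    and as: "\<And>i. i \<in> F \<Longrightarrow> (\<Sum>j\<in>F. a i j) \<le> A" and bs: "\<And>i. i \<in> F \<Longrightarrow> (\<Sum>j\<in>F. b i j) \<le> A"
    and A: "0 < A"
  shows "opb (\<lambda>x y. \<Sum>i\<in>F. T i x y) A"
proof -
  define B' where "B' = max B 0"
  have B': "0 \<le> B'" "\<And>i. i \<in> F \<Longrightarrow> opb (T i) B'"
    using opb_mono[OF B] by (auto simp: B'_def)
  define K where "K = (\<lambda>x y. \<Sum>i\<in>F. T i x y)"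
  have K: "bker K" unfolding K_def by (rule bker_sum) (rule T)
  define G where "G f = kop (kadj K) (kop K f)" for f
  have Gs: "sqint (G f)" if "sqint f" for f
    unfolding G_def using that K by (intro kop_sqint bker_adj)
  have Gns: "sqint ((G ^^ n) f)" if "sqint f" for f n
    by (induction n) (use that Gs in auto)
  have ws: "sqint (word_op T w f)" if "sqint f" "set w \<subseteq> F \<times> F" for f w
    using that(2) by (induction w) (use that(1) T in \<open>auto intro!: kop_sqint bker_adj\<close>)
  have G_words: "(G ^^ n) f = (\<lambda>x. \<Sum>w\<in>words F n. word_op T w f x)" if f: "sqint f" for f n
  proof (induction n)
    case (Suc n)
    have w: "sqint (word_op T w f)" if "w \<in> words F n" for w
      using ws[OF f words_subset[OF that]] .
    have adjK: "kadj K = (\<lambda>x y. \<Sum>i\<in>F. kadj (T i) x y)"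
      by (simp add: K_def kadj_def)
    have 1: "kop K ((G ^^ n) f) = (\<lambda>x. \<Sum>j\<in>F. \<Sum>w\<in>words F n. kop (T j) (word_op T w f) x)"
    proof -
      have "kop K ((G ^^ n) f) = (\<lambda>x. \<Sum>j\<in>F. kop (T j) ((G ^^ n) f) x)"
        unfolding K_def by (rule kop_sum_ker[OF T Gns[OF f]])
      also have "\<dots> = (\<lambda>x. \<Sum>j\<in>F. \<Sum>w\<in>words F n. kop (T j) (word_op T w f) x)"
        unfolding Suc by (intro ext sum.cong refl, subst kop_sum_fun) (use T w in auto)
      finally show ?thesis .
    qed
    have s1: "sqint (\<lambda>x. \<Sum>w\<in>words F n. kop (T j) (word_op T w f) x)" if "j \<in> F" for j
      by (rule sqint_sum) (use that w T in \<open>auto intro: kop_sqint\<close>)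
    have "(G ^^ Suc n) f = kop (kadj K) (kop K ((G ^^ n) f))"
      by (simp add: G_def)
    also have "\<dots> = (\<lambda>x. \<Sum>i\<in>F. kop (kadj (T i)) (kop K ((G ^^ n) f)) x)"
      unfolding adjK by (rule kop_sum_ker) (use T Gns[OF f] K in \<open>auto intro: bker_adj kop_sqint\<close>)
    also have "\<dots> = (\<lambda>x. \<Sum>i\<in>F. \<Sum>j\<in>F. \<Sum>w\<in>words F n. kop (kadj (T i)) (kop (T j) (word_op T w f)) x)"
    proof (intro ext sum.cong refl)
      fix x i assume i: "i \<in> F"
      have "kop (kadj (T i)) (kop K ((G ^^ n) f)) x
          = (\<Sum>j\<in>F. kop (kadj (T i)) (\<lambda>x. \<Sum>w\<in>words F n. kop (T j) (word_op T w f) x) x)"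
        unfolding 1 by (subst kop_sum_fun) (use i T s1 in \<open>auto intro: bker_adj\<close>)
      also have "\<dots> = (\<Sum>j\<in>F. \<Sum>w\<in>words F n. kop (kadj (T i)) (kop (T j) (word_op T w f)) x)"
        by (intro sum.cong refl, subst kop_sum_fun)
           (use i T w in \<open>auto intro: bker_adj kop_sqint\<close>)
      finally show "kop (kadj (T i)) (kop K ((G ^^ n) f)) x
          = (\<Sum>j\<in>F. \<Sum>w\<in>words F n. kop (kadj (T i)) (kop (T j) (word_op T w f)) x)" .
    qed
    also have "\<dots> = (\<lambda>x. \<Sum>w\<in>words F (Suc n). word_op T w f x)"
      by (rule ext, subst sum_words_Suc[OF F]) simp
    finally show ?case .
  qed simp
  have step: "nrm (kop (kadj (T i)) (kop (T j) f)) \<le> (a i j)\<^sup>2 * nrm f"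
    if "i \<in> F" "j \<in> F" "sqint f" for i j f
    using opbD[OF a[OF that(1,2)] that(3)] kop_kop[OF bker_adj[OF T[OF that(1)]] T[OF that(2)] that(3)]
    by simp
  have step': "nrm (kop (T i) (kop (kadj (T j)) f)) \<le> (b i j)\<^sup>2 * nrm f"
    if "i \<in> F" "j \<in> F" "sqint f" for i j f
    using opbD[OF b[OF that(1,2)] that(3)] kop_kop[OF T[OF that(1)] bker_adj[OF T[OF that(2)]] that(3)]
    by simp
  have adj_bound: "nrm (kop (kadj (T i)) f) \<le> B' * nrm f" if "i \<in> F" "sqint f" for i f
    using opbD[OF opb_adj[OF T[OF that(1)] B'(1) B'(2)[OF that(1)]] that(2)] .
  define pa where "pa w = (\<Prod>p\<leftarrow>w. a (fst p) (snd p))" for w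
  have pa0: "0 \<le> pa w" for w by (induction w) (auto simp: pa_def a0)
  have bound1: "nrm (word_op T w f) \<le> (pa w)\<^sup>2 * nrm f" if f: "sqint f" and w: "set w \<subseteq> F \<times> F" for w f
    using w
  proof (induction w)
    case (Cons p w)
    have "nrm (word_op T (p # w) f) \<le> (a (fst p) (snd p))\<^sup>2 * nrm (word_op T w f)"
      using step[of "fst p" "snd p", OF _ _ ws[OF f]] Cons.prems by auto
    also have "\<dots> \<le> (a (fst p) (snd p))\<^sup>2 * ((pa w)\<^sup>2 * nrm f)"
      using Cons by (intro mult_left_mono) auto
    finally show ?case by (simp add: pa_def power_mult_distrib mult_ac)
  qed (simp add: pa_def)
  \<comment> \<open>The \<open>b\<close>-factors of \<open>link_weight\<close> alone; the remaining
    factors are \<open>pa\<close>.\<close>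
  define pb where "pb = (\<lambda>w. rec_list (\<lambda>j. 1) (\<lambda>p w r j. b j (fst p) * r (snd p)) w :: 'i \<Rightarrow> real)"
  have pb: "pb [] j = 1" "pb (p # w) j = b j (fst p) * pb w (snd p)" for p w j
    by (simp_all add: pb_def)
  have pb0: "0 \<le> pb w j" for w j by (induction w arbitrary: j) (auto simp: pb b0)
  have link: "link_weight a b j w = pa w * pb w j" for j w
    by (induction w arbitrary: j) (auto simp: pb pa_def)
  \<comment> \<open>The second bracketing pairs each \<open>T j\<close> with the adjoint that
    follows it. The last factor of the word remains alone and costs \<open>B'\<close>; the adjoint
    at the very front costs another \<open>B'\<close> in \<open>word_bound\<close>.\<close>
  have bound2: "nrm (kop (T j) (word_op T w f)) \<le> B' * (pb w j)\<^sup>2 * nrm f"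
    if f: "sqint f" and w: "set w \<subseteq> F \<times> F" and j: "j \<in> F" for w j f
    using w j
  proof (induction w arbitrary: j)
    case Nil
    then show ?case using opbD[OF B'(2) f] by (simp add: pb)
  next
    case (Cons p w)
    have p: "fst p \<in> F" "snd p \<in> F" using Cons.prems by auto
    have s: "sqint (kop (T (snd p)) (word_op T w f))"
      using p T ws[OF f] Cons.prems by (auto intro: kop_sqint)
    have "nrm (kop (T j) (word_op T (p # w) f))
        \<le> (b j (fst p))\<^sup>2 * nrm (kop (T (snd p)) (word_op T w f))"
      using step'[OF Cons.prems(2) p(1) s] by simp
    also have "\<dots> \<le> (b j (fst p))\<^sup>2 * (B' * (pb w (snd p))\<^sup>2 * nrm f)"
      using Cons p by (intro mult_left_mono) auto
    finally show ?case by (simp add: pb power_mult_distrib mult_ac)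
  qed
  have word_bound: "nrm (word_op T ((i, j) # w) f) \<le> B' * (a i j * link_weight a b j w) * nrm f"
    if f: "sqint f" and w: "set w \<subseteq> F \<times> F" and ij: "i \<in> F" "j \<in> F" for w i j f
  proof (rule power2_le_imp_le)
    let ?n = "nrm (word_op T ((i, j) # w) f)"
    have s: "sqint (kop (T j) (word_op T w f))"
      using ij T ws[OF f w] by (auto intro: kop_sqint)
    have 1: "?n \<le> (a i j * pa w)\<^sup>2 * nrm f"
      using bound1[OF f, of "(i, j) # w"] w ij by (simp add: pa_def)
    have "?n \<le> B' * nrm (kop (T j) (word_op T w f))"
      using adj_bound[OF ij(1) s] by simp
    also have "\<dots> \<le> B' * (B' * (pb w j)\<^sup>2 * nrm f)"
      by (rule mult_left_mono[OF bound2[OF f w ij(2)] B'(1)])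
    finally have 2: "?n \<le> B'\<^sup>2 * (pb w j)\<^sup>2 * nrm f" by (simp add: power2_eq_square mult_ac)
    have "?n\<^sup>2 \<le> ((a i j * pa w)\<^sup>2 * nrm f) * (B'\<^sup>2 * (pb w j)\<^sup>2 * nrm f)"
      unfolding power2_eq_square[of ?n] by (rule mult_mono[OF 1 2]) auto
    then show "?n\<^sup>2 \<le> (B' * (a i j * link_weight a b j w) * nrm f)\<^sup>2"
      by (simp add: link power_mult_distrib power2_eq_square mult_ac)
    show "0 \<le> B' * (a i j * link_weight a b j w) * nrm f"
      by (simp add: link a0 pa0 pb0 B')
  qed
  have lw0: "0 \<le> link_weight a b j w" for j w by (simp add: link pa0 pb0)
  have lw_sum: "(\<Sum>w\<in>words F n. link_weight a b j w) \<le> A ^ (2 * n)" if "j \<in> F" for n j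
    using that
  proof (induction n arbitrary: j)
    case (Suc n)
    have "(\<Sum>w\<in>words F (Suc n). link_weight a b j w)
        = (\<Sum>i\<in>F. b j i * (\<Sum>l\<in>F. a i l * (\<Sum>w\<in>words F n. link_weight a b l w)))"
      by (subst sum_words_Suc[OF F]) (simp add: sum_distrib_left mult.assoc)
    also have "\<dots> \<le> (\<Sum>i\<in>F. b j i * (\<Sum>l\<in>F. a i l * A ^ (2 * n)))"
      using Suc by (intro sum_mono mult_left_mono a0 b0) auto
    also have "\<dots> = (\<Sum>i\<in>F. b j i * (\<Sum>l\<in>F. a i l)) * A ^ (2 * n)"
      by (simp add: sum_distrib_right sum_distrib_left mult.assoc)
    also have "\<dots> \<le> (\<Sum>i\<in>F. b j i * A) * A ^ (2 * n)"
      using as A by (intro mult_right_mono sum_mono mult_left_mono b0) auto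
    also have "\<dots> = (\<Sum>i\<in>F. b j i) * A * A ^ (2 * n)" by (simp add: sum_distrib_right)
    also have "\<dots> \<le> A * A * A ^ (2 * n)"
      using bs[OF Suc.prems] A by (intro mult_right_mono) auto
    finally show ?case by simp
  qed simp
  have Gn_bound: "nrm ((G ^^ Suc n) f) \<le> B' * real (card F) * A ^ (2 * n + 1) * nrm f"
    if f: "sqint f" for f n
  proof -
    have "nrm ((G ^^ Suc n) f) \<le> (\<Sum>w\<in>words F (Suc n). nrm (word_op T w f))"
      unfolding G_words[OF f] by (rule nrm_sum) (rule ws[OF f words_subset])
    also have "\<dots> = (\<Sum>i\<in>F. \<Sum>j\<in>F. \<Sum>w\<in>words F n. nrm (word_op T ((i, j) # w) f))"
      by (rule sum_words_Suc[OF F])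
    also have "\<dots> \<le> (\<Sum>i\<in>F. \<Sum>j\<in>F. \<Sum>w\<in>words F n. B' * (a i j * link_weight a b j w) * nrm f)"
      by (intro sum_mono word_bound[OF f]) (use words_subset in auto)
    also have "\<dots> = (\<Sum>i\<in>F. \<Sum>j\<in>F. a i j * (\<Sum>w\<in>words F n. link_weight a b j w)) * (B' * nrm f)"
      by (simp add: sum_distrib_left sum_distrib_right mult_ac)
    also have "\<dots> \<le> (\<Sum>i\<in>F. \<Sum>j\<in>F. a i j * A ^ (2 * n)) * (B' * nrm f)"
      using B' by (intro mult_right_mono sum_mono mult_left_mono lw_sum a0) auto
    also have "\<dots> = (\<Sum>i\<in>F. \<Sum>j\<in>F. a i j) * A ^ (2 * n) * (B' * nrm f)"
      by (simp add: sum_distrib_right)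
    also have "\<dots> \<le> (\<Sum>i\<in>F. A) * A ^ (2 * n) * (B' * nrm f)"
      using B' A as by (intro mult_right_mono sum_mono) auto
    finally show ?thesis by (simp add: mult_ac)
  qed
  have G_adj: "ip (G f) g = ip f (G g)" if "sqint f" "sqint g" for f g
    unfolding G_def
    using ip_kop_adj[OF bker_adj[OF K] kop_sqint[OF K that(1)] that(2)]
      ip_kop_adj[OF K that(1) kop_sqint[OF K that(2)]] by simp
  have Gn_adj: "ip ((G ^^ n) f) g = ip f ((G ^^ n) g)" if f: "sqint f" and "sqint g" for f g n
    using that(2)
  proof (induction n arbitrary: g)
    case (Suc n)
    have "ip ((G ^^ Suc n) f) g = ip ((G ^^ n) f) (G g)"
      using G_adj[OF Gns[OF f] Suc.prems] by simp
    also have "\<dots> = ip f ((G ^^ n) (G g))" by (rule Suc.IH[OF Gs[OF Suc.prems]])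
    also have "(G ^^ n) (G g) = (G ^^ Suc n) g" by (simp add: funpow_swap1)
    finally show ?case .
  qed simp
  \<comment> \<open>As \<open>G\<close> is symmetric, the squared norm of the \<open>n\<close>-th
    power at \<open>f\<close> is at most the norm of \<open>f\<close> times that of the
    \<open>2 n\<close>-th power; this is iterated \<open>s\<close> times.\<close>
  have Gpow: "nrm (G f) ^ (2 ^ s) \<le> nrm ((G ^^ (2 ^ s)) f) * nrm f ^ (2 ^ s - 1)"
    if f: "sqint f" for f s
  proof (induction s)
    case (Suc s)
    let ?n = "2 ^ s :: nat"
    have "(nrm ((G ^^ ?n) f))\<^sup>2 = cmod (ip ((G ^^ ?n) f) ((G ^^ ?n) f))"
      by (simp only: cmod_ip_self)
    also have "\<dots> = cmod (ip f ((G ^^ (?n + ?n)) f))"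
      by (subst Gn_adj[OF f Gns[OF f]]) (simp add: funpow_add)
    also have "\<dots> \<le> nrm f * nrm ((G ^^ (?n + ?n)) f)" by (rule cauchy_schwarz[OF f Gns[OF f]])
    finally have sq: "(nrm ((G ^^ ?n) f))\<^sup>2 \<le> nrm f * nrm ((G ^^ (2 ^ Suc s)) f)"
      by (simp add: mult_2)
    have e: "2 ^ Suc s - 1 = Suc ((?n - 1) * 2)" 
      by (cases "2 ^ s :: nat") auto
    have e': "nrm f ^ (2 ^ Suc s - 1) = nrm f * nrm f ^ ((?n - 1) * 2)"
      by (subst e) (rule power_Suc)
    have "nrm (G f) ^ (2 ^ Suc s) = (nrm (G f) ^ ?n)\<^sup>2"
      by (simp add: power_mult[symmetric] mult.commute)
    also have "\<dots> \<le> (nrm ((G ^^ ?n) f) * nrm f ^ (?n - 1))\<^sup>2"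
      using Suc by (intro power_mono) auto
    also have "\<dots> = (nrm ((G ^^ ?n) f))\<^sup>2 * nrm f ^ ((?n - 1) * 2)"
      by (simp add: power_mult_distrib power_mult[symmetric])
    also have "\<dots> \<le> (nrm f * nrm ((G ^^ (2 ^ Suc s)) f)) * nrm f ^ ((?n - 1) * 2)"
      by (intro mult_right_mono sq) auto
    also have "\<dots> = nrm ((G ^^ (2 ^ Suc s)) f) * nrm f ^ (2 ^ Suc s - 1)"
      unfolding e' by (simp only: mult_ac)
    finally show ?case .
  qed simp
  have "nrm (kop K f) \<le> A * nrm f" if f: "sqint f" for f
  proof (cases "nrm f = 0")
    case True
    have "(nrm (kop K f))\<^sup>2 = cmod (ip (kop K f) (kop K f))" by (simp only: cmod_ip_self)
    also have "\<dots> = cmod (ip f (G f))"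
      using ip_kop_adj[OF K f kop_sqint[OF K f]] by (simp add: G_def)
    also have "\<dots> \<le> nrm f * nrm (G f)" by (rule cauchy_schwarz[OF f Gs[OF f]])
    finally show ?thesis using True by simp
  next
    case False
    then have nf: "0 < nrm f" using nrm_nonneg[of f] by linarith
    have le1: "nrm (G f) / (A\<^sup>2 * nrm f) \<le> 1"
    proof (rule power_two_power_bounded_imp_le_one)
      fix s :: nat
      obtain m where m: "2 ^ s = Suc m" using not0_implies_Suc[of "2 ^ s"] by auto
      have "nrm (G f) ^ Suc m \<le> nrm ((G ^^ Suc m) f) * nrm f ^ m"
        using Gpow[OF f, of s] unfolding m diff_Suc_1 .
      also have "\<dots> \<le> (B' * real (card F) * A ^ (2 * m + 1) * nrm f) * nrm f ^ m"
        by (rule mult_right_mono[OF Gn_bound[OF f]]) simp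
      finally have 1: "nrm (G f) ^ Suc m * A \<le> (B' * real (card F) * A ^ (2 * m + 1) * nrm f) * nrm f ^ m * A"
        by (rule mult_right_mono) (use A in simp)
      have 2: "(B' * real (card F) * A ^ (2 * m + 1) * nrm f) * nrm f ^ m * A
          = (B' * real (card F)) * (A\<^sup>2 * nrm f) ^ Suc m"
        by (simp add: power_mult_distrib power_mult power2_eq_square mult_ac)
      have 3: "0 < (A\<^sup>2 * nrm f) ^ Suc m" using A nf by simp
      show "(nrm (G f) / (A\<^sup>2 * nrm f)) ^ 2 ^ s \<le> B' * real (card F) / A"
        unfolding m power_divide using 1 A pos_divide_le_eq[OF 3] unfolding 2
        by (simp add: pos_le_divide_eq mult_ac)
    qed (use A nf in auto)
    have Gf: "nrm (G f) \<le> A\<^sup>2 * nrm f"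
      using le1 A nf by (simp add: divide_le_eq)
    have "(nrm (kop K f))\<^sup>2 = cmod (ip (kop K f) (kop K f))" by (simp only: cmod_ip_self)
    also have "\<dots> = cmod (ip f (G f))"
      using ip_kop_adj[OF K f kop_sqint[OF K f]] by (simp add: G_def)
    also have "\<dots> \<le> nrm f * nrm (G f)" by (rule cauchy_schwarz[OF f Gs[OF f]])
    also have "\<dots> \<le> nrm f * (A\<^sup>2 * nrm f)" by (rule mult_left_mono[OF Gf]) simp
    finally have "(nrm (kop K f))\<^sup>2 \<le> (A * nrm f)\<^sup>2" by (simp add: power2_eq_square mult_ac)
    then show ?thesis by (rule power2_le_imp_le) (use A in auto)
  qed
  then show ?thesis unfolding opb_def K_def by blast
qed

section \<open>Polynomials away from their roots\<close>

text \<open>Splitting off one linear factor at a time: all estimates in this section are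
  multiplicative over the roots, and each factor is estimated by its distance to the root.\<close>

lemma complex_poly_root_induct [consumes 1, case_names const root]:
  fixes p :: "complex poly"
  assumes "p \<noteq> 0" and const: "\<And>c. c \<noteq> 0 \<Longrightarrow> Q [:c:]"
    and root: "\<And>r q. q \<noteq> 0 \<Longrightarrow> Q q \<Longrightarrow> Q ([:-r, 1:] * q)"
  shows "Q p"
  using assms(1)
proof (induction "degree p" arbitrary: p)
  case 0
  then obtain c where "p = [:c:]" by (metis degree_eq_zeroE)
  with 0 show ?case using const by auto
next
  case (Suc n)
  then have "\<not> constant (poly p)" by (simp add: constant_degree)
  then obtain r where "poly p r = 0" using fundamental_theorem_of_algebra by blast
  then obtain q where q: "p = [:-r, 1:] * q" by (auto simp: poly_eq_0_iff_dvd elim: dvdE)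
  with Suc.prems have "q \<noteq> 0" by auto
  moreover have "degree p = Suc (degree q)"
    unfolding q using \<open>q \<noteq> 0\<close> by (subst degree_mult_eq) auto
  ultimately show ?case using Suc.hyps root[of q r] q by auto
qed

lemma degree_linear_mult:
  "(q :: complex poly) \<noteq> 0 \<Longrightarrow> degree ([:-r, 1:] * q) = Suc (degree q)"
  by (subst degree_mult_eq) auto

lemma poly_linear_mult: "poly ([:-r, 1:] * q) (t :: complex) = (t - r) * poly q t"
  by (simp add: algebra_simps)

lemma pderiv_linear_mult: "pderiv ([:-r, 1:] * q) = [:-r, 1:] * pderiv q + (q :: complex poly)"
  by (subst pderiv_mult) (simp add: pderiv_pCons)

text \<open>If every root is at distance at least \<rho> from \<open>s\<close>, moving from
  \<open>s\<close> by \<open>K * \<rho>\<close> multiplies the distance to each root by at most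
  \<open>1 + K\<close>.\<close>

lemma poly_le_shift:
  fixes p :: "complex poly"
  assumes "p \<noteq> 0" and far: "\<And>r. poly p r = 0 \<Longrightarrow> \<rho> \<le> cmod (s - r)"
    and "0 \<le> K" "0 < \<rho>" and near: "cmod (t - s) \<le> K * \<rho>"
  shows "cmod (poly p t) \<le> (1 + K) ^ degree p * cmod (poly p s)"
  using assms(1,2)
proof (induction p rule: complex_poly_root_induct)
  case (root r q)
  have "cmod (t - r) \<le> cmod (t - s) + cmod (s - r)"
    using norm_triangle_ineq[of "t - s" "s - r"] by simp
  also have "\<dots> \<le> K * cmod (s - r) + cmod (s - r)"
    using near root.prems[of r] \<open>0 \<le> K\<close> by (intro add_right_mono order_trans[OF near] mult_left_mono) auto
  finally have 1: "cmod (t - r) \<le> (1 + K) * cmod (s - r)" by (simp add: ring_distribs)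
  have 2: "cmod (poly q t) \<le> (1 + K) ^ degree q * cmod (poly q s)"
    using root.IH root.prems by simp
  have "cmod (t - r) * cmod (poly q t) \<le> ((1 + K) * cmod (s - r)) * ((1 + K) ^ degree q * cmod (poly q s))"
    using \<open>0 \<le> K\<close> by (intro mult_mono 1 2) auto
  then show ?case
    unfolding poly_linear_mult degree_linear_mult[OF root.hyps] by (simp add: norm_mult mult_ac)
qed simp

text \<open>Relative to the polynomial, its derivative is the sum of the inverse distances to the
  roots and its second derivative is a sum over ordered pairs of distinct factors; each inverse
  distance is at most \<open>1 / \<rho>\<close>.\<close>

lemma poly_deriv_le:
  fixes p :: "complex poly"
  assumes "p \<noteq> 0" and far: "\<And>r. poly p r = 0 \<Longrightarrow> \<rho> \<le> cmod (s - r)" and "0 < \<rho>"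
  shows "cmod (poly (pderiv p) s) \<le> real (degree p) / \<rho> * cmod (poly p s)"
    "cmod (poly (pderiv (pderiv p)) s) \<le> (real (degree p) / \<rho>)\<^sup>2 * cmod (poly p s)"
proof -
  have "cmod (poly (pderiv p) s) \<le> real (degree p) / \<rho> * cmod (poly p s) \<and>
    cmod (poly (pderiv (pderiv p)) s) \<le> (real (degree p) / \<rho>)\<^sup>2 * cmod (poly p s)"
    using assms(1,2)
  proof (induction p rule: complex_poly_root_induct)
    case (root r q)
    let ?n = "real (degree q)"
    have sr: "\<rho> \<le> cmod (s - r)" using root.prems[of r] by simp
    have IH: "cmod (poly (pderiv q) s) \<le> ?n / \<rho> * cmod (poly q s)"
      "cmod (poly (pderiv (pderiv q)) s) \<le> (?n / \<rho>)\<^sup>2 * cmod (poly q s)"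
      using root.IH root.prems by auto
    have qp: "cmod (poly q s) \<le> cmod (s - r) * cmod (poly q s) / \<rho>"
      using mult_right_mono[OF sr, of "cmod (poly q s)"] \<open>0 < \<rho>\<close> by (simp add: field_simps)
    have d1: "poly (pderiv ([:-r, 1:] * q)) s = poly q s + (s - r) * poly (pderiv q) s"
      unfolding pderiv_linear_mult poly_add poly_linear_mult by simp
    have d2: "poly (pderiv (pderiv ([:-r, 1:] * q))) s = 2 * poly (pderiv q) s + (s - r) * poly (pderiv (pderiv q)) s"
      unfolding pderiv_linear_mult pderiv_add poly_add poly_linear_mult by simp
    have "cmod (poly q s + (s - r) * poly (pderiv q) s) \<le> cmod (poly q s) + cmod (s - r) * cmod (poly (pderiv q) s)"
      using norm_triangle_ineq[of "poly q s" "(s - r) * poly (pderiv q) s"] by (simp add: norm_mult)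
    also have "\<dots> \<le> cmod (s - r) * cmod (poly q s) / \<rho> + cmod (s - r) * (?n / \<rho> * cmod (poly q s))"
      by (intro add_mono qp mult_left_mono IH) auto
    also have "\<dots> = (1 + ?n) / \<rho> * (cmod (s - r) * cmod (poly q s))"
      by (simp add: algebra_simps add_divide_distrib)
    finally have 1: "cmod (poly q s + (s - r) * poly (pderiv q) s) \<le> (1 + ?n) / \<rho> * (cmod (s - r) * cmod (poly q s))" .
    have "cmod (2 * poly (pderiv q) s + (s - r) * poly (pderiv (pderiv q)) s)
        \<le> 2 * cmod (poly (pderiv q) s) + cmod (s - r) * cmod (poly (pderiv (pderiv q)) s)"
      using norm_triangle_ineq[of "2 * poly (pderiv q) s" "(s - r) * poly (pderiv (pderiv q)) s"]
      by (simp add: norm_mult)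
    also have "\<dots> \<le> 2 * (?n / \<rho> * (cmod (s - r) * cmod (poly q s) / \<rho>))
        + cmod (s - r) * ((?n / \<rho>)\<^sup>2 * cmod (poly q s))"
      using \<open>0 < \<rho>\<close> by (intro add_mono mult_left_mono IH order_trans[OF IH(1)] qp) auto
    also have "\<dots> = (2 * ?n + ?n\<^sup>2) / \<rho>\<^sup>2 * (cmod (s - r) * cmod (poly q s))"
      by (simp add: algebra_simps add_divide_distrib power2_eq_square)
    also have "\<dots> \<le> ((1 + ?n) / \<rho>)\<^sup>2 * (cmod (s - r) * cmod (poly q s))"
      unfolding power_divide by (intro mult_right_mono divide_right_mono) (auto simp: power2_sum)
    finally show ?case
      unfolding d1 d2 degree_linear_mult[OF root.hyps] poly_linear_mult using 1
      by (simp add: norm_mult)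
  qed (simp add: pderiv_pCons)
  then show "cmod (poly (pderiv p) s) \<le> real (degree p) / \<rho> * cmod (poly p s)"
    "cmod (poly (pderiv (pderiv p)) s) \<le> (real (degree p) / \<rho>)\<^sup>2 * cmod (poly p s)" by auto
qed

text \<open>\<open>poly_le_shift\<close> read from the point \<open>t\<close> that is far from the
  roots: a lower bound at \<open>t\<close> by the value at \<open>s\<close>, where \<open>s\<close>
  itself may be arbitrarily close to a root.\<close>

lemma poly_le_far_from_roots:
  fixes p :: "complex poly"
  assumes "p \<noteq> 0" and far: "\<And>r. poly p r = 0 \<Longrightarrow> h \<le> cmod (t - r)"
    and "0 \<le> K" "0 < h" and near: "cmod (t - s) \<le> K * h"
  shows "cmod (poly p s) \<le> (1 + K) ^ degree p * cmod (poly p t)"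
  by (rule poly_le_shift[OF assms(1) far assms(3,4)]) (use near in \<open>auto simp: norm_minus_commute\<close>)

lemma pigeonhole_subinterval:
  fixes R :: "real set"
  assumes R: "finite R" "card R \<le> n" and h: "0 < h"
  obtains i where "i \<le> n" "\<And>r. r \<in> R \<Longrightarrow> r \<le> u + real i * h \<or> u + real (Suc i) * h \<le> r"
proof -
  define g where "g r = nat \<lfloor>(r - u) / h\<rfloor>" for r
  have "card (g ` R) \<le> n" using card_image_le[OF R(1), of g] R(2) by simp
  then have "\<not> {..n} \<subseteq> g ` R"
    using card_mono[of "g ` R" "{..n}"] R(1) by auto
  then obtain i where i: "i \<le> n" "i \<notin> g ` R" by auto
  show ?thesis
  proof (rule that[OF i(1)])
    fix r assume r: "r \<in> R"
    show "r \<le> u + real i * h \<or> u + real (Suc i) * h \<le> r"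
    proof (rule ccontr)
      assume "\<not> ?thesis"
      then have "real i \<le> (r - u) / h" "(r - u) / h < real (Suc i)"
        using h by (auto simp: field_simps)
      then have "\<lfloor>(r - u) / h\<rfloor> = int i" by (intro floor_unique) auto
      then have "g r = i" by (simp add: g_def)
      with i(2) r show False by auto
    qed
  qed
qed

text \<open>With \<open>N = n + 1\<close> the base is \<open>1 + 3 * N\<close>: two points of an
  interval cut into \<open>N\<close> parts of length \<open>h\<close> are at distance at most
  \<open>3 * N\<close> thirds of \<open>h\<close>. There is one factor for each of at most
  \<open>n\<close> roots; the two extra powers absorb the \<open>N\<close> and
  \<open>N\<^sup>2\<close> that come from writing \<open>v - u\<close> as
  \<open>N * h\<close>.\<close>

definition poly_const :: "nat \<Rightarrow> real" where
  "poly_const n = 1 / (3 * real n + 4) ^ (n + 2)"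

lemma poly_const_pos: "0 < poly_const n"
  by (simp add: poly_const_def)

text \<open>One of \<open>n + 1\<close> equal parts of \<open>[u, v]\<close> contains no real part of a root in its interior; on its
  middle third \<open>\<bar>p\<bar>\<close> is bounded below by its value at any point of the interval.\<close>

lemma poly_integral_ge:
  fixes p :: "complex poly"
  assumes p: "p \<noteq> 0" "degree p \<le> n" and uv: "u < v" and s: "s \<in> {u..v}"
  shows "poly_const n * (v - u) * cmod (poly p (of_real s))
      \<le> integral {u..v} (\<lambda>t. cmod (poly p (of_real t)))"
    and "\<And>r \<rho>. poly p r = 0 \<Longrightarrow> cmod (of_real s - r) \<le> \<rho> \<Longrightarrow> 0 < \<rho> \<Longrightarrow>
      poly_const n * (v - u)\<^sup>2 / \<rho> * cmod (poly p (of_real s))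
      \<le> integral {u..v} (\<lambda>t. cmod (poly p (of_real t)))"
proof -
  define N where "N = real n + 1"
  define h where "h = (v - u) / N"
  have N: "1 \<le> N" "0 < N" by (auto simp: N_def)
  have h: "0 < h" using uv N by (simp add: h_def)
  have vh: "v - u = N * h" using N by (simp add: h_def)
  have fin: "finite {r. poly p r = 0}" using p(1) by (rule poly_roots_finite)
  have "card (Re ` {r. poly p r = 0}) \<le> n"
    using card_image_le[OF fin, of Re] card_poly_roots_bound[OF p(1)] p(2) by simp
  then obtain i where i: "i \<le> n"
    "\<And>r. r \<in> Re ` {r. poly p r = 0} \<Longrightarrow> r \<le> u + real i * h \<or> u + real (Suc i) * h \<le> r"
    using pigeonhole_subinterval[of "Re ` {r. poly p r = 0}" n h u] fin h by auto
  define a where "a = u + (real i + 1/3) * h"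
  define b where "b = u + (real i + 2/3) * h"
  have ba: "b - a = h / 3" by (simp add: a_def b_def field_simps)
  have sub: "u \<le> a" "a \<le> b" "b \<le> v"
  proof -
    show "u \<le> a" "a \<le> b" using h by (auto simp: a_def b_def)
    have "(real i + 2/3) * h \<le> N * h" using i(1) h by (intro mult_right_mono) (auto simp: N_def)
    then show "b \<le> v" using vh by (simp add: b_def)
  qed
  have far: "h / 3 \<le> cmod (of_real t - r)" if t: "t \<in> {a..b}" and r: "poly p r = 0" for t r
  proof -
    have "h / 3 \<le> \<bar>t - Re r\<bar>"
      using i(2)[of "Re r"] r t by (auto simp: a_def b_def field_simps)
    also have "\<dots> \<le> cmod (of_real t - r)"
      using abs_Re_le_cmod[of "of_real t - r"] by simp
    finally show ?thesis .
  qed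
  have ts: "cmod (of_real t - of_real s) \<le> 3 * N * (h / 3)" if "t \<in> {a..b}" for t
  proof -
    have "\<bar>t - s\<bar> \<le> v - u" using that s sub by auto
    then show ?thesis using vh by (simp flip: of_real_diff)
  qed
  have cont: "continuous_on S (\<lambda>t. cmod (poly p (of_real t)))" for S
    by (intro continuous_intros)
  have int_ge: "h / 3 * c \<le> integral {u..v} (\<lambda>t. cmod (poly p (of_real t)))"
    if "\<And>t. t \<in> {a..b} \<Longrightarrow> c \<le> cmod (poly p (of_real t))" for c
  proof -
    have "h / 3 * c = integral {a..b} (\<lambda>t. c)" using sub ba by simp
    also have "\<dots> \<le> integral {a..b} (\<lambda>t. cmod (poly p (of_real t)))"
      using that by (intro integral_le integrable_continuous_real cont continuous_on_const) auto
    also have "\<dots> \<le> integral {u..v} (\<lambda>t. cmod (poly p (of_real t)))"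
      using sub by (intro integral_subset_le integrable_continuous_real cont) auto
    finally show ?thesis .
  qed
  have K: "3 * real n + 4 = 1 + 3 * N" by (simp add: N_def)
  have K1: "1 \<le> 1 + 3 * N" using N by simp
  have low: "1 / (1 + 3 * N) ^ n * cmod (poly q (of_real s)) \<le> cmod (poly q (of_real t))"
    if "q \<noteq> 0" "degree q \<le> n" "\<And>r. poly q r = 0 \<Longrightarrow> poly p r = 0" "t \<in> {a..b}" for q t
  proof -
    have "cmod (poly q (of_real s)) \<le> (1 + 3 * N) ^ degree q * cmod (poly q (of_real t))"
      by (rule poly_le_far_from_roots[OF that(1), of "h / 3"])
         (use far that(3,4) N h ts in auto)
    also have "\<dots> \<le> (1 + 3 * N) ^ n * cmod (poly q (of_real t))"
      using K1 that(2) by (intro mult_right_mono power_increasing) auto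
    finally show ?thesis using K1 by (simp add: field_simps)
  qed
  have c1: "poly_const n * (v - u) = (N / (1 + 3 * N)\<^sup>2) * (h / (1 + 3 * N) ^ n)"
    unfolding poly_const_def K vh power_add by simp
  have N2: "N / (1 + 3 * N)\<^sup>2 \<le> 1 / 3"
    using N by (simp add: power2_eq_square divide_simps) (simp add: algebra_simps)
  show "poly_const n * (v - u) * cmod (poly p (of_real s))
      \<le> integral {u..v} (\<lambda>t. cmod (poly p (of_real t)))"
  proof -
    have "poly_const n * (v - u) * cmod (poly p (of_real s))
        \<le> (1 / 3) * (h / (1 + 3 * N) ^ n) * cmod (poly p (of_real s))"
      unfolding c1 using N2 h N by (intro mult_right_mono) auto
    also have "\<dots> = h / 3 * (1 / (1 + 3 * N) ^ n * cmod (poly p (of_real s)))" by simp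
    also have "\<dots> \<le> integral {u..v} (\<lambda>t. cmod (poly p (of_real t)))"
      by (rule int_ge, rule low) (use p in auto)
    finally show ?thesis .
  qed
  \<comment> \<open>A root close to \<open>s\<close> improves the estimate. Its factor is at most
    \<rho> at \<open>s\<close> but at least \<open>h / 3\<close> on the middle third, so splitting
    it off gains the quotient, that is, a second power of the length.\<close>
  fix r \<rho> assume r: "poly p r = 0" and sr: "cmod (of_real s - r) \<le> \<rho>" and \<rho>: "0 < \<rho>"
  obtain q where q: "p = [:-r, 1:] * q" using r by (auto simp: poly_eq_0_iff_dvd elim: dvdE)
  then have q0: "q \<noteq> 0" using p(1) by auto
  have qd: "degree q \<le> n" using p(2) degree_linear_mult[OF q0, of r] unfolding q by simp
  have c2: "poly_const n * (v - u)\<^sup>2 / \<rho> = (N / (1 + 3 * N))\<^sup>2 * (h\<^sup>2 / \<rho> * (1 / (1 + 3 * N) ^ n))"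
    unfolding poly_const_def K vh power_add by (simp add: power_mult_distrib power_divide mult_ac)
  have N3: "(N / (1 + 3 * N))\<^sup>2 \<le> (1 / 3)\<^sup>2"
    using N by (intro power_mono) (auto simp: divide_simps)
  have "poly_const n * (v - u)\<^sup>2 / \<rho> * cmod (poly p (of_real s))
      \<le> (1 / 3)\<^sup>2 * (h\<^sup>2 / \<rho> * (1 / (1 + 3 * N) ^ n)) * cmod (poly p (of_real s))"
    unfolding c2 using N3 h N \<rho> by (intro mult_right_mono) auto
  also have "\<dots> = h / 3 * ((h / 3) * (cmod (of_real s - r) / \<rho>) * (1 / (1 + 3 * N) ^ n * cmod (poly q (of_real s))))"
    unfolding q poly_linear_mult by (simp add: norm_mult power2_eq_square mult_ac)
  also have "\<dots> \<le> integral {u..v} (\<lambda>t. cmod (poly p (of_real t)))"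
  proof (rule int_ge)
    fix t assume t: "t \<in> {a..b}"
    have "(h / 3) * (cmod (of_real s - r) / \<rho>) \<le> (h / 3) * 1"
      using h sr \<rho> by (intro mult_left_mono) auto
    also have "\<dots> \<le> cmod (of_real t - r)" using far[OF t r] by simp
    finally have 1: "(h / 3) * (cmod (of_real s - r) / \<rho>) \<le> cmod (of_real t - r)" .
    have 2: "1 / (1 + 3 * N) ^ n * cmod (poly q (of_real s)) \<le> cmod (poly q (of_real t))"
      by (rule low[OF q0 qd _ t]) (simp add: q)
    have "(h / 3) * (cmod (of_real s - r) / \<rho>) * (1 / (1 + 3 * N) ^ n * cmod (poly q (of_real s)))
        \<le> cmod (of_real t - r) * cmod (poly q (of_real t))"
      by (rule mult_mono[OF 1 2]) (use N in auto)
    then show "(h / 3) * (cmod (of_real s - r) / \<rho>) * (1 / (1 + 3 * N) ^ n * cmod (poly q (of_real s)))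
        \<le> cmod (poly p (of_real t))"
      unfolding q poly_linear_mult by (simp add: norm_mult)
  qed
  finally show "poly_const n * (v - u)\<^sup>2 / \<rho> * cmod (poly p (of_real s))
      \<le> integral {u..v} (\<lambda>t. cmod (poly p (of_real t)))" .
qed

text \<open>The integrand is the absolute derivative of the reciprocal of \<open>q\<close>. Between
  consecutive zeros of \<open>pderiv q\<close> the reciprocal is monotone, and since it keeps one
  sign and is bounded by \<open>1 / m\<close>, it varies there by at most \<open>1 / m\<close>. The
  number of zeros is bounded by the degree, so neither the length of the interval nor the
  coefficients matter.\<close>

lemma poly_variation_inverse:
  fixes q :: "real poly"
  assumes ab: "a \<le> b" and nz: "\<And>y. y \<in> {a..b} \<Longrightarrow> m \<le> \<bar>poly q y\<bar>" and m: "0 < m"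
  shows "integral {a..b} (\<lambda>y. \<bar>poly (pderiv q) y\<bar> / (poly q y)\<^sup>2) \<le> real (degree q + 1) / m"
proof (cases "pderiv q = 0")
  case True
  then show ?thesis using m by simp
next
  case False
  have fin: "finite {y. poly (pderiv q) y = 0}" using False by (rule poly_roots_finite)
  have sgnq: "poly q x * poly q y > 0" if "x \<in> {a..b}" "y \<in> {a..b}" for x y
  proof (rule ccontr)
    assume *: "\<not> ?thesis"
    have ne: "poly q z \<noteq> 0" if "z \<in> {a..b}" for z using nz[OF that] m by auto
    have "\<exists>z\<in>{min x y..max x y}. poly q z = 0"
    proof (rule ccontr)
      assume n: "\<not> ?thesis"
      have c: "connected (poly q ` {min x y..max x y})"
        by (intro connected_continuous_image continuous_intros) auto
      have "min (poly q x) (poly q y) \<in> poly q ` {min x y..max x y}"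
        "max (poly q x) (poly q y) \<in> poly q ` {min x y..max x y}"
        by (auto simp: min_def max_def)
      then have "0 \<in> poly q ` {min x y..max x y}"
        using connectedD_interval[OF c] * by (smt (verit) mult_pos_pos mult_neg_neg)
      then show False using n by auto
    qed
    then show False using ne that by (auto simp: min_def max_def split: if_splits)
  qed
  have cont: "continuous_on S (\<lambda>y. \<bar>poly (pderiv q) y\<bar> / (poly q y)\<^sup>2)" if "S \<subseteq> {a..b}" for S
  proof (intro continuous_intros ballI)
    fix y assume "y \<in> S"
    then show "(poly q y)\<^sup>2 \<noteq> 0" using nz[of y] m that by auto
  qed
  have main: "integral {c..d} (\<lambda>y. \<bar>poly (pderiv q) y\<bar> / (poly q y)\<^sup>2)
      \<le> real (card {y. c < y \<and> y < d \<and> poly (pderiv q) y = 0} + 1) / m"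
    if "c \<le> d" "{c..d} \<subseteq> {a..b}" for c d
    using that
  proof (induction "card {y. c < y \<and> y < d \<and> poly (pderiv q) y = 0}" arbitrary: c d rule: less_induct)
    case less
    have finc: "finite {y. c < y \<and> y < d \<and> poly (pderiv q) y = 0}" for c d
      by (rule finite_subset[OF _ fin]) auto
    have sub: "c \<in> {a..b}" "d \<in> {a..b}" using less.prems by auto
    show ?case
    proof (cases "{y. c < y \<and> y < d \<and> poly (pderiv q) y = 0} = {}")
      case True
      have sgn: "(\<forall>y\<in>{c..d}. 0 \<le> poly (pderiv q) y) \<or> (\<forall>y\<in>{c..d}. poly (pderiv q) y \<le> 0)"
      proof (rule ccontr)
        assume "\<not> ?thesis"
        then obtain x y where xy: "x \<in> {c..d}" "y \<in> {c..d}" "poly (pderiv q) x < 0" "0 < poly (pderiv q) y"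
          by (auto simp: not_le)
        then have "x \<noteq> y" by auto
        then consider "x < y" | "y < x" by linarith
        then show False
        proof cases
          case 1
          then obtain z where "x < z" "z < y" "poly (pderiv q) z = 0"
            using poly_IVT_pos[of x y "pderiv q"] xy by auto
          with xy True show False by auto
        next
          case 2
          then obtain z where "y < z" "z < x" "poly (pderiv q) z = 0"
            using poly_IVT_neg[of y x "pderiv q"] xy by auto
          with xy True show False by auto
        qed
      qed
      have ft: "((\<lambda>y. - poly (pderiv q) y / (poly q y)\<^sup>2) has_integral (1 / poly q d - 1 / poly q c)) {c..d}"
      proof (rule fundamental_theorem_of_calculus[OF less.prems(1)])
        fix y assume "y \<in> {c..d}"
        then have "poly q y \<noteq> 0" using nz[of y] m less.prems by auto
        then have "((\<lambda>y. 1 / poly q y) has_real_derivative (- poly (pderiv q) y / (poly q y)\<^sup>2)) (at y)"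
          by (auto intro!: derivative_eq_intros simp: power2_eq_square divide_simps)
        then show "((\<lambda>y. 1 / poly q y) has_vector_derivative (- poly (pderiv q) y / (poly q y)\<^sup>2)) (at y within {c..d})"
          by (metis has_field_derivative_at_within has_real_derivative_iff_has_vector_derivative)
      qed
      have "integral {c..d} (\<lambda>y. \<bar>poly (pderiv q) y\<bar> / (poly q y)\<^sup>2) = \<bar>1 / poly q d - 1 / poly q c\<bar>"
        using sgn
      proof
        assume *: "\<forall>y\<in>{c..d}. 0 \<le> poly (pderiv q) y"
        have e: "integral {c..d} (\<lambda>y. \<bar>poly (pderiv q) y\<bar> / (poly q y)\<^sup>2) = - (1 / poly q d - 1 / poly q c)"
          by (rule integral_unique, rule has_integral_eq[OF _ has_integral_neg[OF ft]]) (use * in auto)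
        moreover have "0 \<le> integral {c..d} (\<lambda>y. \<bar>poly (pderiv q) y\<bar> / (poly q y)\<^sup>2)"
          by (intro integral_nonneg integrable_continuous_real cont less.prems) auto
        ultimately show ?thesis by linarith
      next
        assume *: "\<forall>y\<in>{c..d}. poly (pderiv q) y \<le> 0"
        have e: "integral {c..d} (\<lambda>y. \<bar>poly (pderiv q) y\<bar> / (poly q y)\<^sup>2)
            = integral {c..d} (\<lambda>y. (- poly (pderiv q) y / (poly q y)\<^sup>2))"
          by (rule integral_cong) (use * in auto)
        also have "\<dots> = 1 / poly q d - 1 / poly q c" using ft by (rule integral_unique)
        finally have e: "integral {c..d} (\<lambda>y. \<bar>poly (pderiv q) y\<bar> / (poly q y)\<^sup>2) = (1 / poly q d - 1 / poly q c)" .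
        moreover have "0 \<le> integral {c..d} (\<lambda>y. \<bar>poly (pderiv q) y\<bar> / (poly q y)\<^sup>2)"
          by (intro integral_nonneg integrable_continuous_real cont less.prems) auto
        ultimately show ?thesis by linarith
      qed
      also have "\<dots> \<le> 1 / m"
      proof -
        have b: "\<bar>1 / poly q y\<bar> \<le> 1 / m" if "y \<in> {a..b}" for y
          using nz[OF that] m by (simp add: abs_divide frac_le)
        have "0 < poly q c * poly q d" by (rule sgnq[OF sub])
        then have "0 < 1 / poly q c * (1 / poly q d)" by (simp add: zero_less_mult_iff)
        then have "(0 < 1 / poly q c \<and> 0 < 1 / poly q d) \<or> (1 / poly q c < 0 \<and> 1 / poly q d < 0)"
          unfolding zero_less_mult_iff .
        then show ?thesis using b[OF sub(1)] b[OF sub(2)] by linarith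
      qed
      also have "\<dots> \<le> real (card {y. c < y \<and> y < d \<and> poly (pderiv q) y = 0} + 1) / m"
        using m by (intro divide_right_mono) auto
      finally show ?thesis .
    next
      case False
      then obtain e where e: "c < e" "e < d" "poly (pderiv q) e = 0" by auto
      let ?S = "\<lambda>c d. {y. c < y \<and> y < d \<and> poly (pderiv q) y = 0}"
      have un: "?S c d = insert e (?S c e \<union> ?S e d)" using e by auto
      have "card (?S c d) = Suc (card (?S c e \<union> ?S e d))"
        unfolding un by (rule card_insert_disjoint) (use finc in auto)
      also have "card (?S c e \<union> ?S e d) = card (?S c e) + card (?S e d)"
        by (rule card_Un_disjoint) (use finc in auto)
      finally have card: "card (?S c d) = Suc (card (?S c e) + card (?S e d))" .
      have "integral {c..d} (\<lambda>y. \<bar>poly (pderiv q) y\<bar> / (poly q y)\<^sup>2)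
          = integral {c..e} (\<lambda>y. \<bar>poly (pderiv q) y\<bar> / (poly q y)\<^sup>2)
            + integral {e..d} (\<lambda>y. \<bar>poly (pderiv q) y\<bar> / (poly q y)\<^sup>2)"
        by (rule Henstock_Kurzweil_Integration.integral_combine[symmetric]) (use e less.prems in \<open>auto intro!: integrable_continuous_real cont\<close>)
      also have "\<dots> \<le> real (card (?S c e) + 1) / m + real (card (?S e d) + 1) / m"
        by (intro add_mono less.hyps) (use e less.prems card in auto)
      also have "\<dots> = real (card (?S c d) + 1) / m"
        by (simp add: card add_divide_distrib)
      finally show ?thesis .
    qed
  qed
  have "card {y. a < y \<and> y < b \<and> poly (pderiv q) y = 0} \<le> card {y. poly (pderiv q) y = 0}"
    by (rule card_mono[OF fin]) auto
  also have "\<dots> \<le> degree (pderiv q)" by (rule card_poly_roots_bound[OF False])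
  also have "\<dots> \<le> degree q" by (simp add: degree_pderiv)
  finally have "real (card {y. a < y \<and> y < b \<and> poly (pderiv q) y = 0} + 1) / m \<le> real (degree q + 1) / m"
    using m by (intro divide_right_mono) auto
  with main[OF ab] show ?thesis by simp
qed

section \<open>Oscillatory integrals\<close>

lemma powr_half_norm:
  assumes "Re z = 1/2" shows "cmod (complex_of_real \<bar>p\<bar> powr z) = sqrt \<bar>p\<bar>"
proof (cases "p = 0")
  case False
  then have "cmod (complex_of_real \<bar>p\<bar> powr z) = \<bar>p\<bar> powr (1/2)"
    using norm_powr_real_powr[of "complex_of_real \<bar>p\<bar>" z] by (simp add: assms)
  then show ?thesis by (simp add: powr_half_sqrt)
qed simp

text \<open>Halving the logarithm of the square avoids differentiating the absolute value and treats
  both signs of \<open>p\<close> at once.\<close>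

lemma powr_abs_eq_exp:
  assumes "p \<noteq> 0"
  shows "complex_of_real \<bar>p\<bar> powr z = exp (z * complex_of_real (ln (p\<^sup>2) / 2))"
proof -
  have "ln (p\<^sup>2) / 2 = ln \<bar>p\<bar>" using assms ln_realpow[of "\<bar>p\<bar>" 2] by simp
  then show ?thesis using assms by (simp add: powr_def Ln_of_real)
qed

lemma powr_abs_deriv:
  fixes p :: "real \<Rightarrow> real"
  assumes y: "y \<in> S" and nz: "\<And>y. y \<in> S \<Longrightarrow> p y \<noteq> 0" and p: "(p has_real_derivative p') (at y within S)"
  shows "((\<lambda>y. complex_of_real \<bar>p y\<bar> powr z) has_vector_derivative
      (z * complex_of_real (p' / p y) * (complex_of_real \<bar>p y\<bar> powr z))) (at y within S)"
proof -
  have n: "p y \<noteq> 0" using nz[OF y] .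
  then have n2: "0 < p y * p y" by (metis not_real_square_gt_zero)
  have "((\<lambda>y. ln ((p y)\<^sup>2) / 2) has_real_derivative (p' / p y)) (at y within S)"
    using n n2 by (auto intro!: derivative_eq_intros p simp: power2_eq_square divide_simps)
  then have "((\<lambda>y. z * complex_of_real (ln ((p y)\<^sup>2) / 2)) has_vector_derivative (z * complex_of_real (p' / p y)))
      (at y within S)"
    by (intro has_vector_derivative_mult_right has_vector_derivative_of_real)
       (simp add: has_real_derivative_iff_has_vector_derivative)
  from field_vector_diff_chain_within[OF this, of exp "exp (z * complex_of_real (ln ((p y)\<^sup>2) / 2))"]
  have d: "((\<lambda>y. exp (z * complex_of_real (ln ((p y)\<^sup>2) / 2))) has_vector_derivative
      (z * complex_of_real (p' / p y) * exp (z * complex_of_real (ln ((p y)\<^sup>2) / 2)))) (at y within S)"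
    by (simp add: o_def DERIV_exp has_field_derivative_at_within)
  show ?thesis
    unfolding powr_abs_eq_exp[OF n]
    by (rule has_vector_derivative_transform[OF y _ d]) (rule powr_abs_eq_exp[OF nz])
qed

lemma oscillatory_deriv:
  assumes "(\<Phi> has_real_derivative \<psi>) (at y within S)"
  shows "((\<lambda>y. exp (\<i> * complex_of_real (lam * \<Phi> y))) has_vector_derivative
     (\<i> * complex_of_real (lam * \<psi>) * exp (\<i> * complex_of_real (lam * \<Phi> y)))) (at y within S)"
proof -
  have "((\<lambda>y. \<i> * complex_of_real (lam * \<Phi> y)) has_vector_derivative (\<i> * complex_of_real (lam * \<psi>)))
      (at y within S)"
    using assms by (intro has_vector_derivative_mult_right has_vector_derivative_of_real)
      (auto simp: has_real_derivative_iff_has_vector_derivative[symmetric] intro!: DERIV_cmult)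
  from field_vector_diff_chain_within[OF this, of exp "exp (\<i> * complex_of_real (lam * \<Phi> y))"]
  show ?thesis by (simp add: o_def DERIV_exp has_field_derivative_at_within)
qed

text \<open>The amplitude is written as \<psi> times \<open>H\<close>; the remaining integral has
  amplitude \<open>H'\<close>, so the identity can be applied again after dividing \<open>H'\<close>
  by \<psi>.\<close>

lemma oscillatory_by_parts:
  fixes H H' :: "real \<Rightarrow> complex" and \<Phi> \<psi> :: "real \<Rightarrow> real"
  assumes ab: "a \<le> b" and lam: "lam \<noteq> 0"
    and \<Phi>: "\<And>y. y \<in> {a..b} \<Longrightarrow> (\<Phi> has_real_derivative \<psi> y) (at y within {a..b})"
    and \<psi>: "continuous_on {a..b} \<psi>"
    and H: "\<And>y. y \<in> {a..b} \<Longrightarrow> (H has_vector_derivative H' y) (at y within {a..b})"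
    and H': "continuous_on {a..b} H'"
  defines "e \<equiv> \<lambda>y. exp (\<i> * complex_of_real (lam * \<Phi> y))"
  shows "integral {a..b} (\<lambda>y. e y * (of_real (\<psi> y) * H y))
    = (e b * H b - e a * H a - integral {a..b} (\<lambda>y. e y * H' y)) / (\<i> * of_real lam)"
proof -
  have ed: "(e has_vector_derivative (\<i> * complex_of_real (lam * \<psi> y) * e y)) (at y within {a..b})"
    if "y \<in> {a..b}" for y
    unfolding e_def by (rule oscillatory_deriv[OF \<Phi>[OF that]])
  have ec: "continuous_on {a..b} e" and Hc: "continuous_on {a..b} H"
    by (rule continuous_on_vector_derivative, erule ed, rule continuous_on_vector_derivative, erule H)
  have F: "((\<lambda>y. e y * H' y + (\<i> * complex_of_real (lam * \<psi> y) * e y) * H y) has_integral e b * H b - e a * H a) {a..b}"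
    by (rule fundamental_theorem_of_calculus[OF ab, where f = "\<lambda>y. e y * H y"])
       (intro has_vector_derivative_mult ed H)
  have i1: "(\<lambda>y. e y * H' y) integrable_on {a..b}" and i2: "(\<lambda>y. e y * (of_real (\<psi> y) * H y)) integrable_on {a..b}"
    using ec Hc H' \<psi> by (auto intro!: integrable_continuous_real continuous_intros)
  have "e b * H b - e a * H a
      = integral {a..b} (\<lambda>y. e y * H' y + (\<i> * of_real lam) * (e y * (of_real (\<psi> y) * H y)))"
    using integral_unique[OF F] by (simp add: mult_ac)
  also have "\<dots> = integral {a..b} (\<lambda>y. e y * H' y)
      + (\<i> * of_real lam) * integral {a..b} (\<lambda>y. e y * (of_real (\<psi> y) * H y))"
    using i1 i2 by (subst Henstock_Kurzweil_Integration.integral_add) (auto intro!: integrable_on_mult_right)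
  finally show ?thesis using lam by (simp add: divide_simps)
qed

lemma norm_oscillatory_integral_le:
  fixes h :: "real \<Rightarrow> complex"
  assumes "continuous_on {a..b} h" "continuous_on {a..b} \<Phi>"
  shows "cmod (integral {a..b} (\<lambda>y. exp (\<i> * complex_of_real (lam * \<Phi> y)) * h y))
    \<le> integral {a..b} (\<lambda>y. cmod (h y))"
  using assms by (intro integral_norm_bound_integral integrable_continuous_real continuous_intros)
     (auto simp: norm_mult)

text \<open>By \<open>E\<close> the amplitude divided by the phase derivative \<open>q\<close> is at
  most \<open>E * M\<^sup>2\<close>. In the final factor, 4 collects two boundary terms and the
  derivatives of the two cutoffs, \<open>2 * Z * \<kappa>\<close> comes from the two complex powers,
  and the last term is the variation of the reciprocal of \<open>q\<close>. Of the derivatives of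
  the cutoffs only the integrals enter, so the result does not see how narrow their supports
  are.\<close>

lemma oscillatory_one_step:
  fixes p1 p2 p1' p2' \<Phi> :: "real \<Rightarrow> real" and \<phi>1 \<phi>2 \<phi>1' \<phi>2' :: "real \<Rightarrow> complex" and q :: "real poly"
  assumes ab: "a < b" and lam: "lam \<noteq> 0"
    and \<Phi>: "\<And>y. y \<in> {a..b} \<Longrightarrow> (\<Phi> has_real_derivative poly q y) (at y within {a..b})"
    and q0: "\<And>y. y \<in> {a..b} \<Longrightarrow> poly q y \<noteq> 0"
    and p1: "\<And>y. y \<in> {a..b} \<Longrightarrow> (p1 has_real_derivative p1' y) (at y within {a..b})"
      "continuous_on {a..b} p1'" "\<And>y. y \<in> {a..b} \<Longrightarrow> p1 y \<noteq> 0"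
      "\<And>y. y \<in> {a..b} \<Longrightarrow> \<bar>p1' y\<bar> \<le> \<kappa> / (b - a) * \<bar>p1 y\<bar>"
      "\<And>y y'. y \<in> {a..b} \<Longrightarrow> y' \<in> {a..b} \<Longrightarrow> \<bar>p1 y\<bar> \<le> C * \<bar>p1 y'\<bar>"
    and p2: "\<And>y. y \<in> {a..b} \<Longrightarrow> (p2 has_real_derivative p2' y) (at y within {a..b})"
      "continuous_on {a..b} p2'" "\<And>y. y \<in> {a..b} \<Longrightarrow> p2 y \<noteq> 0"
      "\<And>y. y \<in> {a..b} \<Longrightarrow> \<bar>p2' y\<bar> \<le> \<kappa> / (b - a) * \<bar>p2 y\<bar>"
      "\<And>y y'. y \<in> {a..b} \<Longrightarrow> y' \<in> {a..b} \<Longrightarrow> \<bar>p2 y\<bar> \<le> C * \<bar>p2 y'\<bar>"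
    and \<phi>1: "\<And>y. y \<in> {a..b} \<Longrightarrow> (\<phi>1 has_vector_derivative \<phi>1' y) (at y within {a..b})"
      "continuous_on {a..b} \<phi>1'" "\<And>y. y \<in> {a..b} \<Longrightarrow> cmod (\<phi>1 y) \<le> M"
      "integral {a..b} (\<lambda>y. cmod (\<phi>1' y)) \<le> M"
    and \<phi>2: "\<And>y. y \<in> {a..b} \<Longrightarrow> (\<phi>2 has_vector_derivative \<phi>2' y) (at y within {a..b})"
      "continuous_on {a..b} \<phi>2'" "\<And>y. y \<in> {a..b} \<Longrightarrow> cmod (\<phi>2 y) \<le> M"
      "integral {a..b} (\<lambda>y. cmod (\<phi>2' y)) \<le> M"
    and E: "0 \<le> E" "\<And>y. y \<in> {a..b} \<Longrightarrow> sqrt (\<bar>p1 y\<bar> * \<bar>p2 y\<bar>) \<le> E * \<bar>poly q y\<bar>"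
    and z: "Re z1 = 1/2" "Re z2 = 1/2" "cmod z1 \<le> Z" "cmod z2 \<le> Z"
    and C: "0 \<le> C" and \<kappa>: "0 \<le> \<kappa>"
  shows "cmod (integral {a..b} (\<lambda>y. exp (\<i> * complex_of_real (lam * \<Phi> y)) *
      ((complex_of_real \<bar>p1 y\<bar> powr z1) * (complex_of_real \<bar>p2 y\<bar> powr z2) * (\<phi>1 y * \<phi>2 y))))
    \<le> E * M\<^sup>2 * (4 + 2 * Z * \<kappa> + C * real (degree q + 1)) / \<bar>lam\<bar>"
proof -
  define I where "I = {a..b}"
  define f1 where "f1 y = complex_of_real \<bar>p1 y\<bar> powr z1" for y
  define f2 where "f2 y = complex_of_real \<bar>p2 y\<bar> powr z2" for y
  define f1' where "f1' y = z1 * complex_of_real (p1' y / p1 y) * f1 y" for y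
  define f2' where "f2' y = z2 * complex_of_real (p2' y / p2 y) * f2 y" for y
  define v where "v y = complex_of_real (1 / poly q y)" for y
  define v' where "v' y = complex_of_real (- poly (pderiv q) y / (poly q y)\<^sup>2)" for y
  have f1: "(f1 has_vector_derivative f1' y) (at y within I)" if "y \<in> I" for y
    unfolding f1_def f1'_def by (rule powr_abs_deriv) (use p1 that I_def in auto)
  have f2: "(f2 has_vector_derivative f2' y) (at y within I)" if "y \<in> I" for y
    unfolding f2_def f2'_def by (rule powr_abs_deriv) (use p2 that I_def in auto)
  have v: "(v has_vector_derivative v' y) (at y within I)" if "y \<in> I" for y
  proof -
    have "((\<lambda>y. 1 / poly q y) has_real_derivative (- poly (pderiv q) y / (poly q y)\<^sup>2)) (at y)"
      using q0[of y] that by (auto intro!: derivative_eq_intros simp: I_def power2_eq_square divide_simps)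
    then show ?thesis unfolding v_def v'_def
      by (intro has_vector_derivative_of_real)
        (simp add: has_real_derivative_iff_has_vector_derivative has_vector_derivative_at_within)
  qed
  have cont: "continuous_on I f1" "continuous_on I f2" "continuous_on I v" "continuous_on I \<phi>1" "continuous_on I \<phi>2"
    "continuous_on I p1" "continuous_on I p2" "continuous_on I \<Phi>"
    by (rule continuous_on_vector_derivative, erule f1, rule continuous_on_vector_derivative, erule f2,
        rule continuous_on_vector_derivative, erule v,
        rule continuous_on_vector_derivative, erule \<phi>1(1)[folded I_def],
        rule continuous_on_vector_derivative, erule \<phi>2(1)[folded I_def],
        rule DERIV_continuous_on, erule p1(1)[folded I_def], rule DERIV_continuous_on, erule p2(1)[folded I_def],
        rule DERIV_continuous_on, erule \<Phi>[folded I_def])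
  have cont': "continuous_on I f1'" "continuous_on I f2'" "continuous_on I v'" "continuous_on I \<phi>1'" "continuous_on I \<phi>2'"
    unfolding f1'_def f2'_def v'_def
    using cont p1(2,3) p2(2,3) \<phi>1(2) \<phi>2(2) q0 unfolding I_def by (auto intro!: continuous_intros)
  define H where "H y = (f1 y * f2 y) * v y * (\<phi>1 y * \<phi>2 y)" for y
  define G' where "G' y = (f1 y * f2 y) * v' y + (f1 y * f2' y + f1' y * f2 y) * v y" for y
  define H' where "H' y = (f1 y * f2 y) * v y * (\<phi>1 y * \<phi>2' y + \<phi>1' y * \<phi>2 y) + G' y * (\<phi>1 y * \<phi>2 y)" for y
  have Hd: "(H has_vector_derivative H' y) (at y within I)" if "y \<in> I" for y
    unfolding H_def H'_def G'_def using that \<phi>1(1) \<phi>2(1)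
    by (intro has_vector_derivative_mult f1 f2 v) (auto simp: I_def)
  have H'c: "continuous_on I H'"
    unfolding H'_def G'_def using cont cont' by (intro continuous_intros)
  have eq: "f1 y * f2 y * (\<phi>1 y * \<phi>2 y) = of_real (poly q y) * H y" if "y \<in> I" for y
    using q0[of y] that by (simp add: H_def v_def I_def)
  have E': "cmod (f1 y * f2 y) \<le> E * \<bar>poly q y\<bar>" if "y \<in> I" for y
    using E(2)[of y] that z by (simp add: f1_def f2_def norm_mult powr_half_norm real_sqrt_mult I_def)
  have Ev: "cmod (f1 y * f2 y * v y) \<le> E" if "y \<in> I" for y
    using E'[OF that] q0[of y] that by (simp add: norm_mult norm_divide v_def I_def divide_simps mult_ac)
  have M: "0 \<le> M" using order_trans[OF norm_ge_zero \<phi>1(3)[of a]] ab by auto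
  have Hb: "cmod (H y) \<le> E * M\<^sup>2" if "y \<in> I" for y
  proof -
    have "cmod (H y) = cmod (f1 y * f2 y * v y) * (cmod (\<phi>1 y) * cmod (\<phi>2 y))"
      by (simp add: H_def norm_mult)
    also have "\<dots> \<le> E * (M * M)"
      using that E \<phi>1(3) \<phi>2(3) M by (intro mult_mono Ev) (auto simp: I_def)
    finally show ?thesis by (simp add: power2_eq_square)
  qed
  \<comment> \<open>At a minimum of the absolute value of \<open>q\<close> the hypothesis on
    \<open>E\<close> is strongest. Since \<open>p1\<close> and \<open>p2\<close> are essentially
    constant, the amplitude is everywhere at most \<open>C * E * m\<close>, and this
    \<open>m\<close> cancels the one in \<open>poly_variation_inverse\<close>.\<close>
  obtain ys where ys: "ys \<in> I" "\<And>y. y \<in> I \<Longrightarrow> \<bar>poly q ys\<bar> \<le> \<bar>poly q y\<bar>"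
  proof -
    have "continuous_on I (\<lambda>y. \<bar>poly q y\<bar>)" by (intro continuous_intros)
    moreover have "compact I" "I \<noteq> {}" using ab by (auto simp: I_def)
    ultimately show ?thesis using that continuous_attains_inf[of I "\<lambda>y. \<bar>poly q y\<bar>"] by auto
  qed
  define m where "m = \<bar>poly q ys\<bar>"
  have m: "0 < m" using q0[of ys] ys(1) by (auto simp: m_def I_def)
  have f12: "cmod (f1 y * f2 y) \<le> C * E * m" if "y \<in> I" for y
  proof -
    have "cmod (f1 y * f2 y) = sqrt (\<bar>p1 y\<bar> * \<bar>p2 y\<bar>)"
      using z by (simp add: f1_def f2_def norm_mult powr_half_norm real_sqrt_mult)
    also have "\<dots> \<le> sqrt ((C * \<bar>p1 ys\<bar>) * (C * \<bar>p2 ys\<bar>))"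
      using that ys(1) C by (intro real_sqrt_le_mono mult_mono p1(5) p2(5)) (auto simp: I_def)
    also have "\<dots> = C * sqrt (\<bar>p1 ys\<bar> * \<bar>p2 ys\<bar>)"
      using C by (simp add: real_sqrt_mult)
    also have "\<dots> \<le> C * (E * m)"
      using E(2)[of ys] ys(1) C by (intro mult_left_mono) (auto simp: I_def m_def)
    finally show ?thesis by simp
  qed
  have Z: "0 \<le> Z" using z(3) norm_ge_zero[of z1] by linarith
  have fd: "cmod (f1' y) \<le> Z * (\<kappa> / (b - a)) * cmod (f1 y)" "cmod (f2' y) \<le> Z * (\<kappa> / (b - a)) * cmod (f2 y)"
    if "y \<in> I" for y
  proof -
    have "\<bar>p1' y / p1 y\<bar> \<le> \<kappa> / (b - a)" "\<bar>p2' y / p2 y\<bar> \<le> \<kappa> / (b - a)"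
      using p1(3,4)[of y] p2(3,4)[of y] that by (auto simp: I_def abs_divide divide_le_eq)
    then show "cmod (f1' y) \<le> Z * (\<kappa> / (b - a)) * cmod (f1 y)" "cmod (f2' y) \<le> Z * (\<kappa> / (b - a)) * cmod (f2 y)"
      unfolding f1'_def f2'_def norm_mult norm_of_real using z Z
      by (intro mult_right_mono mult_mono; simp)+
  qed
  define W where "W y = \<bar>poly (pderiv q) y\<bar> / (poly q y)\<^sup>2" for y
  have Wc: "continuous_on I W" unfolding W_def using q0 by (intro continuous_intros) (auto simp: I_def)
  have G'b: "cmod (G' y) \<le> C * E * m * W y + 2 * (Z * (\<kappa> / (b - a))) * E" if "y \<in> I" for y
  proof -
    have 1: "cmod ((f1 y * f2 y) * v' y) \<le> C * E * m * W y"
      unfolding norm_mult[of "f1 y * f2 y"] v'_def norm_of_real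
      by (rule mult_mono[OF f12[OF that]]) (use C E m in \<open>auto simp: W_def abs_divide\<close>)
    have "cmod (f1 y * f2' y + f1' y * f2 y) \<le> cmod (f1 y) * cmod (f2' y) + cmod (f1' y) * cmod (f2 y)"
      using norm_triangle_ineq[of "f1 y * f2' y" "f1' y * f2 y"] by (simp add: norm_mult)
    also have "\<dots> \<le> cmod (f1 y) * (Z * (\<kappa> / (b - a)) * cmod (f2 y)) + (Z * (\<kappa> / (b - a)) * cmod (f1 y)) * cmod (f2 y)"
      by (intro add_mono mult_left_mono mult_right_mono fd that) auto
    also have "\<dots> = 2 * (Z * (\<kappa> / (b - a))) * cmod (f1 y * f2 y)" by (simp add: norm_mult)
    finally have "cmod ((f1 y * f2' y + f1' y * f2 y) * v y) \<le> 2 * (Z * (\<kappa> / (b - a))) * cmod (f1 y * f2 y) * cmod (v y)"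
      unfolding norm_mult[of _ "v y"] by (rule mult_right_mono) simp
    also have "\<dots> = 2 * (Z * (\<kappa> / (b - a))) * cmod (f1 y * f2 y * v y)" by (simp add: norm_mult)
    also have "\<dots> \<le> 2 * (Z * (\<kappa> / (b - a))) * E"
      using Z \<kappa> ab by (intro mult_left_mono Ev that) auto
    finally show ?thesis unfolding G'_def
      using 1 norm_triangle_ineq[of "(f1 y * f2 y) * v' y" "(f1 y * f2' y + f1' y * f2 y) * v y"] by linarith
  qed
  have H'b: "cmod (H' y) \<le> (E * M) * (cmod (\<phi>1' y) + cmod (\<phi>2' y))
      + M\<^sup>2 * (C * E * m * W y + 2 * (Z * (\<kappa> / (b - a))) * E)" if "y \<in> I" for y
  proof -
    have \<phi>: "cmod (\<phi>1 y) \<le> M" "cmod (\<phi>2 y) \<le> M" using \<phi>1(3) \<phi>2(3) that by (auto simp: I_def)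
    have "cmod (\<phi>1 y * \<phi>2' y + \<phi>1' y * \<phi>2 y) \<le> cmod (\<phi>1 y) * cmod (\<phi>2' y) + cmod (\<phi>1' y) * cmod (\<phi>2 y)"
      using norm_triangle_ineq[of "\<phi>1 y * \<phi>2' y" "\<phi>1' y * \<phi>2 y"] by (simp add: norm_mult)
    also have "\<dots> \<le> M * cmod (\<phi>2' y) + cmod (\<phi>1' y) * M"
      using \<phi> by (intro add_mono mult_right_mono mult_left_mono) auto
    finally have "cmod ((f1 y * f2 y * v y) * (\<phi>1 y * \<phi>2' y + \<phi>1' y * \<phi>2 y)) \<le> E * (M * cmod (\<phi>2' y) + cmod (\<phi>1' y) * M)"
      unfolding norm_mult[of "f1 y * f2 y * v y"] using Ev[OF that] E by (intro mult_mono) auto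
    moreover have "cmod (G' y * (\<phi>1 y * \<phi>2 y)) \<le> (C * E * m * W y + 2 * (Z * (\<kappa> / (b - a))) * E) * (M * M)"
    proof -
      have "0 \<le> C * E * m * W y + 2 * (Z * (\<kappa> / (b - a))) * E"
        by (rule order_trans[OF norm_ge_zero G'b[OF that]])
      then show ?thesis
        unfolding norm_mult by (intro mult_mono G'b that \<phi> M) auto
    qed
    ultimately show ?thesis unfolding H'_def
      using norm_triangle_ineq[of "(f1 y * f2 y * v y) * (\<phi>1 y * \<phi>2' y + \<phi>1' y * \<phi>2 y)" "G' y * (\<phi>1 y * \<phi>2 y)"]
      by (simp add: power2_eq_square algebra_simps)
  qed
  have ic: "(\<lambda>y. cmod (\<phi>1' y)) integrable_on I" "(\<lambda>y. cmod (\<phi>2' y)) integrable_on I" "W integrable_on I"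
    using cont' Wc unfolding I_def by (auto intro!: integrable_continuous_real continuous_intros)
  have WI: "integral I W \<le> real (degree q + 1) / m"
    unfolding W_def I_def by (rule poly_variation_inverse) (use ab ys m in \<open>auto simp: m_def I_def\<close>)
  have intH': "integral I (\<lambda>y. cmod (H' y)) \<le> E * M\<^sup>2 * (2 + 2 * Z * \<kappa> + C * real (degree q + 1))"
  proof -
    have "integral I (\<lambda>y. cmod (H' y)) \<le> integral I (\<lambda>y. ((E * M) * cmod (\<phi>1' y) + (E * M) * cmod (\<phi>2' y))
      + ((M\<^sup>2 * (C * E * m)) * W y + M\<^sup>2 * (2 * (Z * (\<kappa> / (b - a))) * E)))"
    proof (rule integral_le)
      show "(\<lambda>y. cmod (H' y)) integrable_on I"
        using H'c unfolding I_def by (intro integrable_continuous_real continuous_intros)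
      show "(\<lambda>y. ((E * M) * cmod (\<phi>1' y) + (E * M) * cmod (\<phi>2' y))
      + ((M\<^sup>2 * (C * E * m)) * W y + M\<^sup>2 * (2 * (Z * (\<kappa> / (b - a))) * E))) integrable_on I"
        using cont' Wc unfolding I_def by (intro integrable_continuous_real continuous_intros)
    qed (use H'b in \<open>simp add: algebra_simps\<close>)
    also have "\<dots> = (E * M) * integral I (\<lambda>y. cmod (\<phi>1' y)) + (E * M) * integral I (\<lambda>y. cmod (\<phi>2' y))
      + ((M\<^sup>2 * (C * E * m)) * integral I W + (b - a) * (M\<^sup>2 * (2 * (Z * (\<kappa> / (b - a))) * E)))"
    proof -
      have const: "((\<lambda>y. c) has_integral (b - a) * c) I" for c :: real
        using has_integral_const_real[of c a b] ab by (simp add: I_def)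
      show ?thesis
        by (intro integral_unique has_integral_add has_integral_mult_right integrable_integral ic const)
    qed
    also have "\<dots> \<le> (E * M) * M + (E * M) * M + ((M\<^sup>2 * (C * E * m)) * (real (degree q + 1) / m)
        + (b - a) * (M\<^sup>2 * (2 * (Z * (\<kappa> / (b - a))) * E)))"
      using \<phi>1(4) \<phi>2(4) WI E M C m Z \<kappa> ab unfolding I_def by (intro add_mono mult_left_mono) auto
    also have "\<dots> = E * M\<^sup>2 * (2 + 2 * Z * \<kappa> + C * real (degree q + 1))"
      using ab m by (simp add: field_simps power2_eq_square)
    finally show ?thesis .
  qed
  let ?e = "\<lambda>y. exp (\<i> * complex_of_real (lam * \<Phi> y))"
  have "integral I (\<lambda>y. ?e y * (f1 y * f2 y * (\<phi>1 y * \<phi>2 y))) = integral I (\<lambda>y. ?e y * (of_real (poly q y) * H y))"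
    by (rule integral_cong) (simp add: eq)
  also have "\<dots> = (?e b * H b - ?e a * H a - integral I (\<lambda>y. ?e y * H' y)) / (\<i> * of_real lam)"
    unfolding I_def by (rule oscillatory_by_parts)
      (use ab lam \<Phi> Hd H'c in \<open>auto simp: I_def intro!: continuous_intros\<close>)
  finally have "cmod (integral I (\<lambda>y. ?e y * (f1 y * f2 y * (\<phi>1 y * \<phi>2 y))))
      = cmod (?e b * H b - ?e a * H a - integral I (\<lambda>y. ?e y * H' y)) / \<bar>lam\<bar>"
    by (simp add: norm_divide norm_mult)
  also have "\<dots> \<le> (E * M\<^sup>2 + E * M\<^sup>2 + E * M\<^sup>2 * (2 + 2 * Z * \<kappa> + C * real (degree q + 1))) / \<bar>lam\<bar>"
  proof (rule divide_right_mono)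
    have "cmod (?e b * H b - ?e a * H a - integral I (\<lambda>y. ?e y * H' y))
        \<le> cmod (?e b * H b) + cmod (?e a * H a) + cmod (integral I (\<lambda>y. ?e y * H' y))"
      using norm_triangle_ineq4[of "?e b * H b - ?e a * H a" "integral I (\<lambda>y. ?e y * H' y)"]
        norm_triangle_ineq4[of "?e b * H b" "?e a * H a"] by linarith
    moreover have "cmod (?e b * H b) \<le> E * M\<^sup>2" "cmod (?e a * H a) \<le> E * M\<^sup>2"
      using Hb[of a] Hb[of b] ab by (auto simp: norm_mult I_def)
    moreover have "cmod (integral I (\<lambda>y. ?e y * H' y)) \<le> integral I (\<lambda>y. cmod (H' y))"
      unfolding I_def by (rule norm_oscillatory_integral_le) (use H'c cont in \<open>auto simp: I_def\<close>)
    ultimately show "cmod (?e b * H b - ?e a * H a - integral I (\<lambda>y. ?e y * H' y))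
        \<le> E * M\<^sup>2 + E * M\<^sup>2 + E * M\<^sup>2 * (2 + 2 * Z * \<kappa> + C * real (degree q + 1))"
      using intH' by linarith
  qed simp
  finally show ?thesis by (simp add: f1_def f2_def I_def algebra_simps)
qed

text \<open>\<open>U\<close> is the size and \<kappa> an inverse length scale. In this normalization
  a product has the product of the sizes and the sum of the scales \<kappa>, as the second
  derivative then produces the binomial square.\<close>

definition c2_bounds ::
  "real set \<Rightarrow> (real \<Rightarrow> complex) \<Rightarrow> (real \<Rightarrow> complex) \<Rightarrow> (real \<Rightarrow> complex) \<Rightarrow> real \<Rightarrow> real \<Rightarrow> bool" where
  "c2_bounds I u u' u'' U \<kappa> \<longleftrightarrow> 0 \<le> U \<and> 0 \<le> \<kappa> \<and> continuous_on I u'' \<and>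
     (\<forall>y\<in>I. (u has_vector_derivative u' y) (at y within I) \<and>
            (u' has_vector_derivative u'' y) (at y within I) \<and>
            cmod (u y) \<le> U \<and> cmod (u' y) \<le> U * \<kappa> \<and> cmod (u'' y) \<le> U * \<kappa>\<^sup>2)"

lemma c2_bounds_continuous:
  assumes "c2_bounds I u u' u'' U \<kappa>"
  shows "continuous_on I u" "continuous_on I u'" "continuous_on I u''"
proof -
  show "continuous_on I u" by (rule continuous_on_vector_derivative[of _ _ u']) (use assms in \<open>auto simp: c2_bounds_def\<close>)
  show "continuous_on I u'" by (rule continuous_on_vector_derivative[of _ _ u'']) (use assms in \<open>auto simp: c2_bounds_def\<close>)
  show "continuous_on I u''" using assms by (auto simp: c2_bounds_def)
qed

lemma c2_bounds_mult:
  assumes u: "c2_bounds I u u' u'' U \<kappa>" and v: "c2_bounds I v v' v'' V \<nu>"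
  shows "c2_bounds I (\<lambda>y. u y * v y) (\<lambda>y. u y * v' y + u' y * v y)
     (\<lambda>y. (u y * v'' y + u' y * v' y) + (u' y * v' y + u'' y * v y)) (U * V) (\<kappa> + \<nu>)"
proof -
  have nn: "0 \<le> U" "0 \<le> V" "0 \<le> \<kappa>" "0 \<le> \<nu>" using u v by (auto simp: c2_bounds_def)
  have "((\<lambda>y. u y * v y) has_vector_derivative u y * v' y + u' y * v y) (at y within I) \<and>
    ((\<lambda>y. u y * v' y + u' y * v y) has_vector_derivative
       (u y * v'' y + u' y * v' y) + (u' y * v' y + u'' y * v y)) (at y within I) \<and>
    cmod (u y * v y) \<le> U * V \<and> cmod (u y * v' y + u' y * v y) \<le> U * V * (\<kappa> + \<nu>) \<and>
    cmod ((u y * v'' y + u' y * v' y) + (u' y * v' y + u'' y * v y)) \<le> U * V * (\<kappa> + \<nu>)\<^sup>2"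
    if y: "y \<in> I" for y
  proof (intro conjI)
    have d: "(u has_vector_derivative u' y) (at y within I)" "(u' has_vector_derivative u'' y) (at y within I)"
      "(v has_vector_derivative v' y) (at y within I)" "(v' has_vector_derivative v'' y) (at y within I)"
      and b: "cmod (u y) \<le> U" "cmod (u' y) \<le> U * \<kappa>" "cmod (u'' y) \<le> U * \<kappa>\<^sup>2"
        "cmod (v y) \<le> V" "cmod (v' y) \<le> V * \<nu>" "cmod (v'' y) \<le> V * \<nu>\<^sup>2"
      using u v y by (auto simp: c2_bounds_def)
    show "((\<lambda>y. u y * v y) has_vector_derivative u y * v' y + u' y * v y) (at y within I)"
      by (intro has_vector_derivative_mult d)
    show "((\<lambda>y. u y * v' y + u' y * v y) has_vector_derivative
       (u y * v'' y + u' y * v' y) + (u' y * v' y + u'' y * v y)) (at y within I)"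
      by (intro has_vector_derivative_mult has_vector_derivative_add d)
    have p: "cmod (u y * v y) \<le> U * V" "cmod (u y * v' y) \<le> U * (V * \<nu>)" "cmod (u' y * v y) \<le> (U * \<kappa>) * V"
      "cmod (u y * v'' y) \<le> U * (V * \<nu>\<^sup>2)" "cmod (u' y * v' y) \<le> (U * \<kappa>) * (V * \<nu>)"
      "cmod (u'' y * v y) \<le> (U * \<kappa>\<^sup>2) * V"
      unfolding norm_mult by (intro mult_mono b; use nn in auto)+
    show "cmod (u y * v y) \<le> U * V" by (rule p)
    show "cmod (u y * v' y + u' y * v y) \<le> U * V * (\<kappa> + \<nu>)"
      using norm_triangle_ineq[of "u y * v' y" "u' y * v y"] p by (simp add: algebra_simps)
    have "cmod ((u y * v'' y + u' y * v' y) + (u' y * v' y + u'' y * v y))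
        \<le> cmod (u y * v'' y) + cmod (u' y * v' y) + (cmod (u' y * v' y) + cmod (u'' y * v y))"
      by (intro order_trans[OF norm_triangle_ineq] add_mono norm_triangle_ineq)
    also have "\<dots> \<le> U * (V * \<nu>\<^sup>2) + (U * \<kappa>) * (V * \<nu>) + ((U * \<kappa>) * (V * \<nu>) + (U * \<kappa>\<^sup>2) * V)"
      by (intro add_mono p)
    also have "\<dots> = U * V * (\<kappa> + \<nu>)\<^sup>2" by (simp add: power2_eq_square algebra_simps)
    finally show "cmod ((u y * v'' y + u' y * v' y) + (u' y * v' y + u'' y * v y)) \<le> U * V * (\<kappa> + \<nu>)\<^sup>2" .
  qed
  moreover have "continuous_on I (\<lambda>y. (u y * v'' y + u' y * v' y) + (u' y * v' y + u'' y * v y))"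
    by (intro continuous_intros c2_bounds_continuous[OF u] c2_bounds_continuous[OF v])
  ultimately show ?thesis using nn unfolding c2_bounds_def by auto
qed

text \<open>The second derivative of the reciprocal contributes \<open>\<kappa>\<^sup>2\<close> and
  \<open>2 * \<kappa>\<^sup>2\<close>; doubling \<kappa> leaves room for their sum.\<close>

lemma c2_bounds_inverse:
  fixes p p' p'' :: "real \<Rightarrow> real"
  assumes p: "\<And>y. y \<in> I \<Longrightarrow> (p has_real_derivative p' y) (at y within I)"
    "\<And>y. y \<in> I \<Longrightarrow> (p' has_real_derivative p'' y) (at y within I)" "continuous_on I p''"
    and m: "0 < m" "\<And>y. y \<in> I \<Longrightarrow> m \<le> \<bar>p y\<bar>" and \<kappa>: "0 \<le> \<kappa>"
    "\<And>y. y \<in> I \<Longrightarrow> \<bar>p' y\<bar> \<le> \<kappa> * \<bar>p y\<bar>" "\<And>y. y \<in> I \<Longrightarrow> \<bar>p'' y\<bar> \<le> \<kappa>\<^sup>2 * \<bar>p y\<bar>"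
  obtains v' v'' where "c2_bounds I (\<lambda>y. complex_of_real (1 / p y)) v' v'' (1 / m) (2 * \<kappa>)"
proof
  define v' where "v' y = - p' y / (p y)\<^sup>2" for y
  define v'' where "v'' y = - p'' y / (p y)\<^sup>2 + 2 * (p' y)\<^sup>2 / (p y) ^ 3" for y
  have nz: "p y \<noteq> 0" if "y \<in> I" for y using m(2)[OF that] m(1) by auto
  have "((\<lambda>y. 1 / p y) has_real_derivative v' y) (at y within I) \<and>
    (v' has_real_derivative v'' y) (at y within I) \<and>
    \<bar>1 / p y\<bar> \<le> 1 / m \<and> \<bar>v' y\<bar> \<le> 1 / m * (2 * \<kappa>) \<and> \<bar>v'' y\<bar> \<le> 1 / m * (2 * \<kappa>)\<^sup>2"
    if y: "y \<in> I" for y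
  proof (intro conjI)
    note n = nz[OF y]
    show "((\<lambda>y. 1 / p y) has_real_derivative v' y) (at y within I)"
      unfolding v'_def using n by (auto intro!: derivative_eq_intros p y simp: power2_eq_square divide_simps)
    show "(v' has_real_derivative v'' y) (at y within I)"
      unfolding v'_def v''_def using n
      by (auto intro!: derivative_eq_intros p y simp: power2_eq_square power3_eq_cube field_simps)
    have r1: "\<bar>p' y\<bar> / \<bar>p y\<bar> \<le> \<kappa>" and r2: "\<bar>p'' y\<bar> / \<bar>p y\<bar> \<le> \<kappa>\<^sup>2"
      using \<kappa>(2,3)[OF y] n by (auto simp: divide_le_eq)
    show i: "\<bar>1 / p y\<bar> \<le> 1 / m"
      using m(1) m(2)[OF y] by (simp add: abs_divide frac_le)
    have "\<bar>v' y\<bar> = \<bar>1 / p y\<bar> * (\<bar>p' y\<bar> / \<bar>p y\<bar>)"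
      by (simp add: v'_def abs_divide power2_eq_square abs_mult)
    also have "\<dots> \<le> 1 / m * \<kappa>" using i r1 m \<kappa>(1) by (intro mult_mono) auto
    also have "\<dots> \<le> 1 / m * (2 * \<kappa>)" using m \<kappa> by (intro mult_left_mono) auto
    finally show "\<bar>v' y\<bar> \<le> 1 / m * (2 * \<kappa>)" .
    have "\<bar>v'' y\<bar> \<le> \<bar>- p'' y / (p y)\<^sup>2\<bar> + \<bar>2 * (p' y)\<^sup>2 / (p y) ^ 3\<bar>"
      unfolding v''_def by (rule abs_triangle_ineq)
    also have "\<dots> = \<bar>1 / p y\<bar> * (\<bar>p'' y\<bar> / \<bar>p y\<bar> + 2 * (\<bar>p' y\<bar> / \<bar>p y\<bar>)\<^sup>2)"
      by (simp add: abs_divide power2_eq_square power3_eq_cube abs_mult algebra_simps)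
    also have "\<dots> \<le> 1 / m * (\<kappa>\<^sup>2 + 2 * \<kappa>\<^sup>2)"
      using i r1 r2 m \<kappa>(1) by (intro mult_mono add_mono mult_left_mono power_mono) auto
    also have "\<dots> \<le> 1 / m * (2 * \<kappa>)\<^sup>2"
      using m by (intro mult_left_mono) (auto simp: power_mult_distrib)
    finally show "\<bar>v'' y\<bar> \<le> 1 / m * (2 * \<kappa>)\<^sup>2" .
  qed
  moreover have "continuous_on I v''"
    unfolding v''_def using nz DERIV_continuous_on[OF p(1)] DERIV_continuous_on[OF p(2)] p(3)
    by (intro continuous_intros) auto
  ultimately show "c2_bounds I (\<lambda>y. complex_of_real (1 / p y)) (\<lambda>y. complex_of_real (v' y))
      (\<lambda>y. complex_of_real (v'' y)) (1 / m) (2 * \<kappa>)"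
    unfolding c2_bounds_def using m(1) \<kappa>(1)
    by (auto intro!: has_vector_derivative_of_real continuous_intros
         simp: has_real_derivative_iff_has_vector_derivative[symmetric] simp del: of_real_divide)
qed

text \<open>Every derivative of the power brings down the exponent: the second one is bounded by
  \<open>\<kappa>\<^sup>2\<close> times the square of the modulus of \<open>z\<close> plus twice the
  modulus, which is below the square of \<open>1 + cmod z\<close>. This is where the growth in
  \<open>z\<close> originates.\<close>

lemma c2_bounds_powr:
  fixes p p' p'' :: "real \<Rightarrow> real"
  assumes p: "\<And>y. y \<in> I \<Longrightarrow> (p has_real_derivative p' y) (at y within I)"
    "\<And>y. y \<in> I \<Longrightarrow> (p' has_real_derivative p'' y) (at y within I)" "continuous_on I p''"
    and m: "\<And>y. y \<in> I \<Longrightarrow> p y \<noteq> 0" "\<And>y. y \<in> I \<Longrightarrow> \<bar>p y\<bar> \<le> m" "0 \<le> m" and \<kappa>: "0 \<le> \<kappa>"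
    "\<And>y. y \<in> I \<Longrightarrow> \<bar>p' y\<bar> \<le> \<kappa> * \<bar>p y\<bar>" "\<And>y. y \<in> I \<Longrightarrow> \<bar>p'' y\<bar> \<le> \<kappa>\<^sup>2 * \<bar>p y\<bar>"
    and z: "Re z = 1/2"
  obtains v' v'' where "c2_bounds I (\<lambda>y. complex_of_real \<bar>p y\<bar> powr z) v' v'' (sqrt m) ((1 + cmod z) * \<kappa>)"
proof
  define f where "f y = complex_of_real \<bar>p y\<bar> powr z" for y
  define r where "r y = p' y / p y" for y
  define r' where "r' y = p'' y / p y - (p' y / p y)\<^sup>2" for y
  define f' where "f' y = z * complex_of_real (r y) * f y" for y
  define f'' where "f'' y = (z * complex_of_real (r y)) * f' y + (z * complex_of_real (r' y)) * f y" for y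
  have fd: "(f has_vector_derivative f' y) (at y within I)" if "y \<in> I" for y
    unfolding f_def f'_def r_def by (rule powr_abs_deriv) (use p m that in auto)
  have rd: "(r has_real_derivative r' y) (at y within I)" if "y \<in> I" for y
    unfolding r_def r'_def using m(1)[OF that]
    by (auto intro!: derivative_eq_intros p that simp: power2_eq_square field_simps)
  have "(f has_vector_derivative f' y) (at y within I) \<and> (f' has_vector_derivative f'' y) (at y within I) \<and>
    cmod (f y) \<le> sqrt m \<and> cmod (f' y) \<le> sqrt m * ((1 + cmod z) * \<kappa>) \<and>
    cmod (f'' y) \<le> sqrt m * ((1 + cmod z) * \<kappa>)\<^sup>2"
    if y: "y \<in> I" for y
  proof (intro conjI)
    show "(f has_vector_derivative f' y) (at y within I)" by (rule fd[OF y])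
    show "(f' has_vector_derivative f'' y) (at y within I)"
      unfolding f'_def f''_def using rd[OF y] fd[OF y]
      by (auto intro!: has_vector_derivative_mult has_vector_derivative_mult_right has_vector_derivative_of_real
          simp: has_real_derivative_iff_has_vector_derivative f'_def)
    have n: "p y \<noteq> 0" by (rule m(1)[OF y])
    have r1: "\<bar>r y\<bar> \<le> \<kappa>" and r2: "\<bar>p'' y / p y\<bar> \<le> \<kappa>\<^sup>2"
      using \<kappa>(2,3)[OF y] n by (auto simp: r_def abs_divide divide_le_eq)
    have "(r y)\<^sup>2 \<le> \<kappa>\<^sup>2" using r1 power_mono[OF r1, of 2] by simp
    moreover have "0 \<le> (r y)\<^sup>2" by simp
    ultimately have r3: "\<bar>r' y\<bar> \<le> 2 * \<kappa>\<^sup>2" using r2 unfolding r'_def r_def by linarith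
    show f0: "cmod (f y) \<le> sqrt m"
      using m(2)[OF y] by (simp add: f_def powr_half_norm[OF z])
    have f1: "cmod (f' y) \<le> (cmod z * \<kappa>) * sqrt m"
      unfolding f'_def norm_mult norm_of_real using r1 f0 \<kappa>(1) by (intro mult_mono) auto
    also have "\<dots> \<le> ((1 + cmod z) * \<kappa>) * sqrt m" using \<kappa>(1) m(3) by (intro mult_right_mono) auto
    finally show "cmod (f' y) \<le> sqrt m * ((1 + cmod z) * \<kappa>)" by (simp add: mult_ac)
    have "cmod (f'' y) \<le> (cmod z * \<bar>r y\<bar>) * cmod (f' y) + (cmod z * \<bar>r' y\<bar>) * cmod (f y)"
      unfolding f''_def by (rule order_trans[OF norm_triangle_ineq]) (simp add: norm_mult)
    also have "\<dots> \<le> (cmod z * \<kappa>) * ((cmod z * \<kappa>) * sqrt m) + (cmod z * (2 * \<kappa>\<^sup>2)) * sqrt m"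
      using r1 r3 f0 f1 \<kappa>(1) by (intro add_mono mult_mono) auto
    also have "\<dots> = (cmod z ^ 2 + 2 * cmod z) * (sqrt m * \<kappa>\<^sup>2)" by (simp add: power2_eq_square algebra_simps)
    also have "\<dots> \<le> (1 + cmod z)\<^sup>2 * (sqrt m * \<kappa>\<^sup>2)"
      using m(3) by (intro mult_right_mono) (auto simp: power2_sum)
    finally show "cmod (f'' y) \<le> sqrt m * ((1 + cmod z) * \<kappa>)\<^sup>2" by (simp add: power_mult_distrib mult_ac)
  qed
  moreover have "continuous_on I f''"
    unfolding f''_def f'_def r'_def r_def
    using continuous_on_vector_derivative[OF fd] DERIV_continuous_on[OF p(1)] DERIV_continuous_on[OF p(2)] p(3) m(1)
    by (intro continuous_intros) auto
  ultimately have "c2_bounds I f f' f'' (sqrt m) ((1 + cmod z) * \<kappa>)"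
    unfolding c2_bounds_def using m(3) \<kappa>(1) by auto
  then show "c2_bounds I (\<lambda>y. complex_of_real \<bar>p y\<bar> powr z) f' f'' (sqrt m) ((1 + cmod z) * \<kappa>)"
    unfolding f_def[abs_def] .
qed

lemma integral_norm_le_support:
  fixes h :: "real \<Rightarrow> complex"
  assumes h: "continuous_on {a..b} h" and B: "\<And>y. y \<in> {a..b} \<Longrightarrow> cmod (h y) \<le> B" "0 \<le> B"
    and cd: "c \<le> d" and z: "\<And>y. y \<in> {a..b} \<Longrightarrow> y \<notin> {c..d} \<Longrightarrow> h y = 0"
  shows "integral {a..b} (\<lambda>y. cmod (h y)) \<le> B * (d - c)"
proof -
  have "integral {a..b} (\<lambda>y. cmod (h y)) = integral {a..b} (\<lambda>y. if y \<in> {c..d} then cmod (h y) else 0)"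
    by (rule integral_cong) (use z in auto)
  also have "\<dots> = integral ({a..b} \<inter> {c..d}) (\<lambda>y. cmod (h y))"
    by (subst Int_commute) (rule integral_restrict_Int)
  also have "\<dots> = integral {max a c..min b d} (\<lambda>y. cmod (h y))"
    by (simp add: Int_atLeastAtMost)
  also have "\<dots> \<le> B * (d - c)"
  proof (cases "max a c \<le> min b d")
    case True
    have "integral {max a c..min b d} (\<lambda>y. cmod (h y)) \<le> integral {max a c..min b d} (\<lambda>y. B)"
      using B by (intro integral_le integrable_continuous_real continuous_intros continuous_on_subset[OF h]) auto
    also have "\<dots> = B * (min b d - max a c)" using True by simp
    also have "\<dots> \<le> B * (d - c)" using B(2) by (intro mult_left_mono) auto
    finally show ?thesis .
  next
    case False
    then have "integral {max a c..min b d} (\<lambda>y. cmod (h y)) = 0" by simp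
    then show ?thesis using B(2) cd by simp
  qed
  finally show ?thesis .
qed

text \<open>Dividing by \<psi> twice gives two factors \<open>1 / m\<close>. No boundary terms arise
  because \<alpha> and its derivative vanish at both ends, and what is left is integrated only over
  the support in \<open>{c..d}\<close>.\<close>

lemma oscillatory_two_steps:
  fixes \<Phi> \<psi> \<psi>' \<psi>'' :: "real \<Rightarrow> real"
  assumes ab: "a \<le> b" and lam: "lam \<noteq> 0"
    and \<Phi>: "\<And>y. y \<in> {a..b} \<Longrightarrow> (\<Phi> has_real_derivative \<psi> y) (at y within {a..b})"
    and \<psi>: "\<And>y. y \<in> {a..b} \<Longrightarrow> (\<psi> has_real_derivative \<psi>' y) (at y within {a..b})"
      "\<And>y. y \<in> {a..b} \<Longrightarrow> (\<psi>' has_real_derivative \<psi>'' y) (at y within {a..b})" "continuous_on {a..b} \<psi>''"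
    and m: "0 < m" "\<And>y. y \<in> {a..b} \<Longrightarrow> m \<le> \<bar>\<psi> y\<bar>" and \<nu>: "0 \<le> \<nu>"
      "\<And>y. y \<in> {a..b} \<Longrightarrow> \<bar>\<psi>' y\<bar> \<le> \<nu> * \<bar>\<psi> y\<bar>" "\<And>y. y \<in> {a..b} \<Longrightarrow> \<bar>\<psi>'' y\<bar> \<le> \<nu>\<^sup>2 * \<bar>\<psi> y\<bar>"
    and \<alpha>: "c2_bounds {a..b} \<alpha> \<alpha>' \<alpha>'' U \<kappa>"
    and bd: "\<alpha> a = 0" "\<alpha> b = 0" "\<alpha>' a = 0" "\<alpha>' b = 0"
    and cd: "c \<le> d" and sup: "\<And>y. y \<in> {a..b} \<Longrightarrow> y \<notin> {c..d} \<Longrightarrow> \<alpha> y = 0 \<and> \<alpha>' y = 0 \<and> \<alpha>'' y = 0"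
  shows "cmod (integral {a..b} (\<lambda>y. exp (\<i> * complex_of_real (lam * \<Phi> y)) * \<alpha> y))
    \<le> 2 * U * (\<kappa> + 2 * \<nu>)\<^sup>2 * (d - c) / (lam\<^sup>2 * m\<^sup>2)"
proof -
  define I where "I = {a..b}"
  define v where "v y = complex_of_real (1 / \<psi> y)" for y
  obtain v' v'' where "c2_bounds I (\<lambda>y. complex_of_real (1 / \<psi> y)) v' v'' (1 / m) (2 * \<nu>)"
    by (rule c2_bounds_inverse[OF \<psi>[folded I_def] m[folded I_def] \<nu>[folded I_def]])
  then have v: "c2_bounds I v v' v'' (1 / m) (2 * \<nu>)" unfolding v_def[abs_def] .
  define H where "H y = \<alpha> y * v y" for y
  define H' where "H' y = \<alpha> y * v' y + \<alpha>' y * v y" for y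
  define H'' where "H'' y = (\<alpha> y * v'' y + \<alpha>' y * v' y) + (\<alpha>' y * v' y + \<alpha>'' y * v y)" for y
  have H: "c2_bounds I H H' H'' (U * (1 / m)) (\<kappa> + 2 * \<nu>)"
    unfolding H_def H'_def H''_def by (rule c2_bounds_mult[OF \<alpha>[folded I_def] v])
  define L where "L y = H' y * v y" for y
  define L' where "L' y = H' y * v' y + H'' y * v y" for y
  have nz: "\<psi> y \<noteq> 0" if "y \<in> I" for y using m that by (force simp: I_def)
  have Ld: "(L has_vector_derivative L' y) (at y within I)" if "y \<in> I" for y
    unfolding L_def L'_def using H v that by (auto simp: c2_bounds_def intro!: has_vector_derivative_mult)
  have L'c: "continuous_on I L'"
    unfolding L'_def by (intro continuous_intros c2_bounds_continuous[OF H] c2_bounds_continuous[OF v])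
  have nn: "0 \<le> U" "0 \<le> \<kappa>" using \<alpha> by (auto simp: c2_bounds_def)
  have L'b: "cmod (L' y) \<le> 2 * U * (\<kappa> + 2 * \<nu>)\<^sup>2 / m\<^sup>2" if y: "y \<in> I" for y
  proof -
    have b: "cmod (H' y) \<le> U * (1 / m) * (\<kappa> + 2 * \<nu>)" "cmod (H'' y) \<le> U * (1 / m) * (\<kappa> + 2 * \<nu>)\<^sup>2"
      "cmod (v y) \<le> 1 / m" "cmod (v' y) \<le> 1 / m * (2 * \<nu>)"
      using H v y by (auto simp: c2_bounds_def)
    have "cmod (L' y) \<le> cmod (H' y) * cmod (v' y) + cmod (H'' y) * cmod (v y)"
      unfolding L'_def by (rule order_trans[OF norm_triangle_ineq]) (simp add: norm_mult)
    also have "\<dots> \<le> (U * (1 / m) * (\<kappa> + 2 * \<nu>)) * (1 / m * (2 * \<nu>)) + (U * (1 / m) * (\<kappa> + 2 * \<nu>)\<^sup>2) * (1 / m)"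
      by (intro add_mono mult_mono b) (use nn m \<nu>(1) in auto)
    also have "\<dots> = U / m\<^sup>2 * ((\<kappa> + 2 * \<nu>) * (2 * \<nu>) + (\<kappa> + 2 * \<nu>)\<^sup>2)"
      by (simp add: power2_eq_square algebra_simps add_divide_distrib)
    also have "\<dots> \<le> U / m\<^sup>2 * (2 * (\<kappa> + 2 * \<nu>)\<^sup>2)"
    proof -
      have "(\<kappa> + 2 * \<nu>) * (2 * \<nu>) \<le> (\<kappa> + 2 * \<nu>) * (\<kappa> + 2 * \<nu>)"
        using nn \<nu>(1) by (intro mult_left_mono) auto
      then show ?thesis using nn m by (intro mult_left_mono) (auto simp: power2_eq_square)
    qed
    finally show ?thesis by (simp add: mult_ac)
  qed
  let ?e = "\<lambda>y. exp (\<i> * complex_of_real (lam * \<Phi> y))"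
  have \<psi>c: "continuous_on {a..b} \<psi>" by (rule DERIV_continuous_on, erule \<psi>(1))
  have \<Phi>c: "continuous_on {a..b} \<Phi>" by (rule DERIV_continuous_on, erule \<Phi>)
  have Ha: "H a = 0" "H b = 0" "L a = 0" "L b = 0" using bd by (auto simp: H_def L_def H'_def)
  have "integral {a..b} (\<lambda>y. ?e y * \<alpha> y) = integral {a..b} (\<lambda>y. ?e y * (of_real (\<psi> y) * H y))"
    by (rule integral_cong) (use nz in \<open>simp add: H_def v_def I_def\<close>)
  also have "\<dots> = (?e b * H b - ?e a * H a - integral {a..b} (\<lambda>y. ?e y * H' y)) / (\<i> * of_real lam)"
    by (rule oscillatory_by_parts[OF ab lam \<Phi> \<psi>c])
       (use H c2_bounds_continuous[OF H] in \<open>auto simp: c2_bounds_def I_def\<close>)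
  also have "integral {a..b} (\<lambda>y. ?e y * H' y) = integral {a..b} (\<lambda>y. ?e y * (of_real (\<psi> y) * L y))"
    by (rule integral_cong) (use nz in \<open>simp add: L_def v_def I_def\<close>)
  also have "\<dots> = (?e b * L b - ?e a * L a - integral {a..b} (\<lambda>y. ?e y * L' y)) / (\<i> * of_real lam)"
    by (rule oscillatory_by_parts[OF ab lam \<Phi> \<psi>c]) (use Ld L'c in \<open>auto simp: I_def\<close>)
  finally have "cmod (integral {a..b} (\<lambda>y. ?e y * \<alpha> y)) = cmod (integral {a..b} (\<lambda>y. ?e y * L' y)) / lam\<^sup>2"
    unfolding Ha by (simp add: norm_divide norm_mult power2_eq_square)
  also have "\<dots> \<le> integral {a..b} (\<lambda>y. cmod (L' y)) / lam\<^sup>2"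
    by (intro divide_right_mono norm_oscillatory_integral_le) (use L'c \<Phi>c I_def in auto)
  also have "\<dots> \<le> (2 * U * (\<kappa> + 2 * \<nu>)\<^sup>2 / m\<^sup>2 * (d - c)) / lam\<^sup>2"
  proof (intro divide_right_mono integral_norm_le_support)
    show "L' y = 0" if "y \<in> {a..b}" "y \<notin> {c..d}" for y
      using sup[OF that] by (simp add: L'_def H'_def H''_def)
  qed (use L'c L'b cd nn m in \<open>auto simp: I_def\<close>)
  finally show ?thesis by (simp add: mult_ac)
qed

section \<open>Whitney boxes of a quasi-homogeneous polynomial\<close>

text \<open>The mixed derivative of the phase, over an arbitrary real normed field so that complex
  zeros can be used. The truncated exponents are harmless because the coefficient vanishes when
  \<open>k\<close> or \<open>l\<close> is 0.\<close>

definition mixed_poly :: "(nat \<times> nat) set \<Rightarrow> (nat \<Rightarrow> nat \<Rightarrow> real) \<Rightarrow> 'a::real_normed_field \<Rightarrow> 'a \<Rightarrow> 'a" where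
  "mixed_poly J a x y = (\<Sum>(k, l)\<in>J. of_real (a k l * real k * real l) * x ^ (k - 1) * y ^ (l - 1))"

definition dy_poly :: "(nat \<times> nat) set \<Rightarrow> (nat \<Rightarrow> nat \<Rightarrow> real) \<Rightarrow> real \<Rightarrow> real \<Rightarrow> real" where
  "dy_poly J a x y = (\<Sum>(k, l)\<in>J. a k l * real l * x ^ k * y ^ (l - 1))"

definition phase_poly :: "(nat \<times> nat) set \<Rightarrow> (nat \<Rightarrow> nat \<Rightarrow> real) \<Rightarrow> real \<Rightarrow> real \<Rightarrow> real" where
  "phase_poly J a x y = (\<Sum>(k, l)\<in>J. a k l * x ^ k * y ^ l)"

definition row_poly :: "(nat \<times> nat) set \<Rightarrow> (nat \<Rightarrow> nat \<Rightarrow> real) \<Rightarrow> real \<Rightarrow> real poly" where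
  "row_poly J a y = (\<Sum>(k, l)\<in>J. monom (a k l * real k * real l * y ^ (l - 1)) (k - 1))"

abbreviation cpoly :: "real poly \<Rightarrow> complex poly" where
  "cpoly \<equiv> map_poly complex_of_real"

lemma poly_cpoly_of_real: "poly (cpoly p) (of_real t) = of_real (poly p t)"
  by (induction p) (auto simp: map_poly_pCons)

lemma degree_cpoly: "degree (cpoly p) = degree p"
  by (rule degree_map_poly) simp

lemma cpoly_eq_0_iff: "cpoly p = 0 \<longleftrightarrow> p = 0"
  by (simp add: map_poly_eq_0_iff)

lemma pderiv_cpoly: "pderiv (cpoly p) = cpoly (pderiv p)"
  by (rule poly_eqI) (simp add: coeff_pderiv coeff_map_poly)

lemma cpoly_add: "cpoly (p + q) = cpoly p + cpoly q"
  by (rule poly_eqI) (simp add: coeff_map_poly)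

lemma cpoly_sum: "cpoly (\<Sum>i\<in>A. f i) = (\<Sum>i\<in>A. cpoly (f i))"
  by (induction A rule: infinite_finite_induct) (auto simp: cpoly_add)

lemma poly_cpoly_row: "poly (cpoly (row_poly J a y)) w = mixed_poly J a w (of_real y)"
  unfolding row_poly_def mixed_poly_def cpoly_sum poly_sum
  by (intro sum.cong refl) (auto simp: map_poly_monom poly_monom mult_ac)

lemma poly_row: "poly (row_poly J a y) x = mixed_poly J a x y"
  unfolding row_poly_def mixed_poly_def poly_sum
  by (intro sum.cong refl) (auto simp: poly_monom mult_ac)

lemma mixed_poly_of_real:
  "mixed_poly J a (complex_of_real x) (complex_of_real y) = of_real (mixed_poly J a x y)"
  using poly_cpoly_of_real[of "row_poly J a y" x] by (simp add: poly_row poly_cpoly_row)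

text \<open>Exchanging the roles of \<open>x\<close> and \<open>y\<close>. The adjoint of an
  operator of the class is the operator of the exchanged data, so each one-sided estimate yields its
  counterpart for the other variable.\<close>

definition flip_set :: "(nat \<times> nat) set \<Rightarrow> (nat \<times> nat) set" where
  "flip_set J = prod.swap ` J"

definition flip_coeff :: "(nat \<Rightarrow> nat \<Rightarrow> real) \<Rightarrow> nat \<Rightarrow> nat \<Rightarrow> real" where
  "flip_coeff a = (\<lambda>k l. a l k)"

lemma sum_flip: "(\<Sum>p\<in>flip_set J. f p) = (\<Sum>p\<in>J. f (prod.swap p))"
  unfolding flip_set_def by (subst sum.reindex) auto

lemma mixed_poly_flip: "mixed_poly (flip_set J) (flip_coeff a) y x = mixed_poly J a x y"
  unfolding mixed_poly_def sum_flip by (intro sum.cong refl) (auto simp: flip_coeff_def mult_ac)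

lemma phase_poly_flip: "phase_poly (flip_set J) (flip_coeff a) y x = phase_poly J a x y"
  unfolding phase_poly_def sum_flip by (intro sum.cong refl) (auto simp: flip_coeff_def mult_ac)

lemma continuous_mixed_poly [continuous_intros]:
  fixes f g :: "'b::topological_space \<Rightarrow> 'a::real_normed_field"
  assumes "continuous_on S f" "continuous_on S g"
  shows "continuous_on S (\<lambda>p. mixed_poly J a (f p) (g p))"
  unfolding mixed_poly_def case_prod_unfold by (intro continuous_intros assms)

lemma continuous_phase_poly [continuous_intros]:
  assumes "continuous_on S f" "continuous_on S g"
  shows "continuous_on S (\<lambda>p. phase_poly J a (f p) (g p))"
  unfolding phase_poly_def case_prod_unfold by (intro continuous_intros assms)

lemma phase_poly_dy: "((\<lambda>y. phase_poly J a x y) has_real_derivative dy_poly J a x y) (at y within S)"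
  unfolding phase_poly_def dy_poly_def case_prod_unfold
  by (auto intro!: derivative_eq_intros sum.cong simp: mult_ac)

lemma dy_poly_dx: "((\<lambda>x. dy_poly J a x y) has_real_derivative mixed_poly J a x y) (at x within S)"
  unfolding mixed_poly_def dy_poly_def case_prod_unfold
  by (auto intro!: derivative_eq_intros sum.cong simp: mult_ac)

text \<open>The derivative in \<open>y\<close> of the phase difference in the kernel of
  \<open>T T\<^sup>*\<close>, as a polynomial in \<open>y\<close>.\<close>

definition dy_diff_poly :: "(nat \<times> nat) set \<Rightarrow> (nat \<Rightarrow> nat \<Rightarrow> real) \<Rightarrow> real \<Rightarrow> real \<Rightarrow> real poly" where
  "dy_diff_poly J a x x' = (\<Sum>(k, l)\<in>J. monom (a k l * real l * (x ^ k - x' ^ k)) (l - 1))"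

lemma poly_dy_diff: "poly (dy_diff_poly J a x x') y = dy_poly J a x y - dy_poly J a x' y"
  unfolding dy_diff_poly_def dy_poly_def poly_sum sum_subtractf[symmetric]
  by (intro sum.cong refl) (auto simp: poly_monom algebra_simps)

text \<open>\<open>J\<close> holds the exponents that really occur, and \<open>nontriv\<close> says
  that the mixed derivative is not identically zero; otherwise the operator vanishes. Only the bound
  \<open>D\<close> on the degree is allowed to enter constants.\<close>

locale qh_data =
  fixes J :: "(nat \<times> nat) set" and a :: "nat \<Rightarrow> nat \<Rightarrow> real" and \<eta> d :: real and D :: nat
  assumes fin: "finite J" and \<eta>: "0 < \<eta>"
    and wt: "\<And>k l. (k, l) \<in> J \<Longrightarrow> real k * \<eta> + real l = d"
    and nz: "\<And>k l. (k, l) \<in> J \<Longrightarrow> a k l \<noteq> 0"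
    and deg: "\<And>k l. (k, l) \<in> J \<Longrightarrow> k + l \<le> D"
    and nontriv: "\<exists>k l. (k, l) \<in> J \<and> 0 < k \<and> 0 < l"
begin

lemma flip: "qh_data (flip_set J) (flip_coeff a) (1 / \<eta>) (d / \<eta>) D"
proof
  show "real k * (1 / \<eta>) + real l = d / \<eta>" if "(k, l) \<in> flip_set J" for k l
  proof -
    have "real l * \<eta> + real k = d" using that by (intro wt) (auto simp: flip_set_def)
    then show ?thesis using \<eta> by (simp add: field_simps)
  qed
  show "\<exists>k l. (k, l) \<in> flip_set J \<and> 0 < k \<and> 0 < l"
    using nontriv by (force simp: flip_set_def)
  show "k + l \<le> D" if "(k, l) \<in> flip_set J" for k l
    using deg[of l k] that by (auto simp: flip_set_def)
qed (use fin \<eta> nz in \<open>auto simp: flip_set_def flip_coeff_def\<close>)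

lemma degree_row: "degree (row_poly J a y) \<le> D"
  unfolding row_poly_def using deg
  by (intro degree_sum_le fin) (auto intro!: order_trans[OF degree_monom_le] dest!: deg)

lemma degree_dy_diff: "degree (dy_diff_poly J a x x') \<le> D"
  unfolding dy_diff_poly_def
  by (intro degree_sum_le fin) (auto intro!: order_trans[OF degree_monom_le] dest!: deg)

lemma inj_first: "(k, l) \<in> J \<Longrightarrow> (k, l') \<in> J \<Longrightarrow> l = l'"
  using wt[of k l] wt[of k l'] by simp

text \<open>The weight relation admits only one \<open>l\<close> for each \<open>k\<close>, so
  different monomials cannot cancel. The exponents \<open>k = 0\<close> and \<open>k = 1\<close>
  collide after truncated subtraction, but the former has coefficient 0.\<close>

lemma row_nonzero: assumes "y \<noteq> 0" shows "row_poly J a y \<noteq> 0"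
proof -
  obtain k l where kl: "(k, l) \<in> J" "0 < k" "0 < l" using nontriv by auto
  have "coeff (row_poly J a y) (k - 1)
      = (\<Sum>p\<in>J. if p = (k, l) then a k l * real k * real l * y ^ (l - 1) else 0)"
    unfolding row_poly_def coeff_sum
  proof (rule sum.cong[OF refl])
    fix p assume p: "p \<in> J"
    obtain k' l' where [simp]: "p = (k', l')" by (cases p)
    show "coeff (case p of (k, l) \<Rightarrow> monom (a k l * real k * real l * y ^ (l - 1)) (k - 1)) (k - 1)
        = (if p = (k, l) then a k l * real k * real l * y ^ (l - 1) else 0)"
    proof -
      consider "k' = 0" | "k' = k" | "k' \<noteq> 0" "k' \<noteq> k" by blast
      then show ?thesis
      proof cases
        case 1
        then show ?thesis using kl(2) by simp
      next
        case 2
        then have "l' = l" using inj_first[of k l' l] kl(1) p by simp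
        then show ?thesis using 2 by simp
      next
        case 3
        then have "k' - 1 \<noteq> k - 1" using kl(2) by linarith
        then show ?thesis using 3(2) by (simp add: coeff_monom)
      qed
    qed
  qed
  also have "\<dots> = a k l * real k * real l * y ^ (l - 1)"
    using kl(1) fin by simp
  also have "\<dots> \<noteq> 0" using nz[OF kl(1)] kl assms by simp
  finally show ?thesis by auto
qed

text \<open>The time \<theta> of the flow is complex and enters through \<open>exp\<close>, so no
  branch of a complex power with exponent \<eta> has to be chosen.\<close>

lemma quasi_homogeneous:
  "mixed_poly J a (exp (of_real \<eta> * \<theta>) * x) (exp \<theta> * y)
    = exp (of_real (d - \<eta> - 1) * \<theta>) * mixed_poly J a x (y :: complex)"
  unfolding mixed_poly_def sum_distrib_left
proof (rule sum.cong[OF refl])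
  fix p assume p: "p \<in> J"
  obtain k l where kl [simp]: "p = (k, l)" by (cases p)
  show "(case p of (k, l) \<Rightarrow> of_real (a k l * real k * real l) * (exp (of_real \<eta> * \<theta>) * x) ^ (k - 1) * (exp \<theta> * y) ^ (l - 1))
    = exp (of_real (d - \<eta> - 1) * \<theta>) * (case p of (k, l) \<Rightarrow> of_real (a k l * real k * real l) * x ^ (k - 1) * y ^ (l - 1))"
  proof (cases "k = 0 \<or> l = 0")
    case False
    have "real (k - 1) * \<eta> + real (l - 1) = d - \<eta> - 1"
      using wt[of k l] p False by (simp add: of_nat_diff algebra_simps)
    then have w: "complex_of_real (d - \<eta> - 1) = of_real (real (k - 1)) * of_real \<eta> + of_real (real (l - 1))"
      by (metis of_real_add of_real_mult)
    have "exp (of_real \<eta> * \<theta>) ^ (k - 1) * exp \<theta> ^ (l - 1) = exp (of_real (d - \<eta> - 1) * \<theta>)"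
      unfolding w exp_of_nat_mult[symmetric] exp_add[symmetric] by (simp add: algebra_simps)
    then have e: "exp (of_real (d - \<eta> - 1) * \<theta>) = exp (of_real \<eta> * \<theta>) ^ (k - 1) * exp \<theta> ^ (l - 1)" by simp
    show ?thesis unfolding e by (simp add: power_mult_distrib mult_ac)
  qed auto
qed

text \<open>A single monomial has no zeros off the axes, so two exponents with positive entries
  occur; their weights agree, which makes \<eta> a quotient of a difference of the \<open>l\<close>
  by a nonzero difference of the \<open>k\<close>. This keeps \<eta> out of all later
  constants.\<close>

lemma eta_le:
  assumes "mixed_poly J a x y = 0" "x \<noteq> (0::complex)" "y \<noteq> 0"
  shows "\<eta> \<le> real D"
proof -
  obtain k l where kl: "(k, l) \<in> J" "0 < k" "0 < l" using nontriv by auto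
  have "\<exists>k' l'. (k', l') \<in> J \<and> 0 < k' \<and> 0 < l' \<and> (k', l') \<noteq> (k, l)"
  proof (rule ccontr)
    assume *: "\<not> ?thesis"
    have "mixed_poly J a x y = (\<Sum>p\<in>J. if p = (k, l) then of_real (a k l * real k * real l) * x ^ (k - 1) * y ^ (l - 1) else 0)"
      unfolding mixed_poly_def
    proof (intro sum.cong refl)
      fix p assume p: "p \<in> J"
      obtain k' l' where kl': "p = (k', l')" by (cases p)
      show "(case p of (k, l) \<Rightarrow> of_real (a k l * real k * real l) * x ^ (k - 1) * y ^ (l - 1)) =
        (if p = (k, l) then of_real (a k l * real k * real l) * x ^ (k - 1) * y ^ (l - 1) else 0)"
      proof (cases "k' = 0 \<or> l' = 0")
        case True
        then have "p \<noteq> (k, l)" using kl kl' by auto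
        then show ?thesis using True kl' by auto
      next
        case False
        then have "p = (k, l)" using * p kl' by auto
        then show ?thesis by simp
      qed
    qed
    also have "\<dots> = of_real (a k l * real k * real l) * x ^ (k - 1) * y ^ (l - 1)"
      using kl(1) fin by simp
    finally show False using assms nz[OF kl(1)] kl by simp
  qed
  then obtain k' l' where kl': "(k', l') \<in> J" "0 < k'" "0 < l'" "(k', l') \<noteq> (k, l)" by auto
  have ne: "k \<noteq> k'" using inj_first[of k l l'] kl kl' by auto
  have eq: "(real k - real k') * \<eta> = real l' - real l" using wt[OF kl(1)] wt[OF kl'(1)] by (simp add: algebra_simps)
  have "1 * \<eta> \<le> \<bar>real k - real k'\<bar> * \<eta>"
    using \<eta> ne by (intro mult_right_mono) linarith+
  also have "\<dots> = \<bar>real l' - real l\<bar>" using eq \<eta> by (metis abs_mult abs_of_pos)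
  also have "\<dots> \<le> real D" using deg[OF kl(1)] deg[OF kl'(1)] by linarith
  finally show ?thesis by simp
qed

end

lemma norm_exp_diff_one_le: "cmod (exp w - 1) \<le> exp (cmod w) * cmod w"
proof -
  have "cmod (exp w - exp 0) \<le> exp (cmod w) * cmod (w - 0)"
  proof (rule field_differentiable_bound[of "cball 0 (cmod w)" exp exp])
    fix z :: complex assume z: "z \<in> cball 0 (cmod w)"
    show "(exp has_field_derivative exp z) (at z within cball 0 (cmod w))"
      by (intro DERIV_exp has_field_derivative_at_within)
    have "cmod (exp z) \<le> exp (cmod z)" by (rule norm_exp)
    also have "\<dots> \<le> exp (cmod w)" using z by simp
    finally show "cmod (exp z) \<le> exp (cmod w)" .
  qed auto
  then show ?thesis by simp
qed

text \<open>The dyadic block \<open>[2\<^sup>j, 2\<^sup>j\<^sup>+\<^sup>1)\<close> consists of the pieces \<open>ivl j m i\<close> with \<open>2 ^ m \<le> i < 2 ^ (m + 1)\<close>;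
  the parent of the piece with number \<open>i\<close> has number \<open>i div 2\<close>.\<close>

definition side :: "int \<Rightarrow> nat \<Rightarrow> real" where
  "side j m = 2 powr real_of_int j / 2 ^ m"

definition ivl :: "int \<Rightarrow> nat \<Rightarrow> nat \<Rightarrow> real set" where
  "ivl j m i = {real i * side j m..(real i + 1) * side j m}"

lemma side_pos [simp]: "0 < side j m"
  by (simp add: side_def)

lemma abs_side [simp]: "\<bar>side j m\<bar> = side j m"
  using side_pos[of j m] by linarith

lemma side_Suc: "side j m = 2 * side j (Suc m)"
  by (simp add: side_def)

lemma ivl_parent: "ivl j (Suc m) i \<subseteq> ivl j m (i div 2)"
proof -
  have "real (2 * (i div 2)) \<le> real i" "real (i + 1) \<le> real (2 * (i div 2) + 2)"
    by (intro of_nat_mono; presburger)+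
  then have 1: "2 * real (i div 2) \<le> real i" and 2: "real i + 1 \<le> 2 * (real (i div 2) + 1)"
    by auto
  have "real (i div 2) * side j m \<le> real i * side j (Suc m)"
    using mult_right_mono[OF 1, of "side j (Suc m)"] unfolding side_Suc[of j m] by (simp add: mult_ac)
  moreover have "(real i + 1) * side j (Suc m) \<le> (real (i div 2) + 1) * side j m"
    using mult_right_mono[OF 2, of "side j (Suc m)"] unfolding side_Suc[of j m] by (simp add: mult_ac)
  ultimately show ?thesis by (auto simp: ivl_def)
qed

lemma ivl_bounds:
  assumes "x \<in> ivl j m i" "2 ^ m \<le> i" "i < 2 ^ Suc m"
  shows "2 powr real_of_int j \<le> x" "x \<le> 2 * 2 powr real_of_int j" "0 < x"
proof -
  have e: "2 powr real_of_int j = 2 ^ m * side j m" by (simp add: side_def)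
  have 1: "(2::real) ^ m \<le> real i" using assms(2) by (metis of_nat_le_iff of_nat_numeral of_nat_power)
  have "real (i + 1) \<le> real (2 ^ Suc m)" using assms(3) by (intro of_nat_mono) simp
  then have 2: "real i + 1 \<le> 2 * 2 ^ m" by simp
  have "2 ^ m * side j m \<le> real i * side j m" "(real i + 1) * side j m \<le> (2 * 2 ^ m) * side j m"
    by (intro mult_right_mono[OF 1] mult_right_mono[OF 2] less_imp_le side_pos)+
  moreover have "real i * side j m \<le> x" "x \<le> (real i + 1) * side j m"
    using assms(1) by (auto simp: ivl_def)
  ultimately show "2 powr real_of_int j \<le> x" "x \<le> 2 * 2 powr real_of_int j"
    unfolding e by linarith+
  then show "0 < x" by (smt (verit) powr_gt_zero)
qed

definition near_ivl :: "int \<Rightarrow> nat \<Rightarrow> nat \<Rightarrow> complex \<Rightarrow> bool" where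
  "near_ivl j m i w \<longleftrightarrow> (\<exists>x\<in>ivl j m i. cmod (w - of_real x) \<le> 2 * side j m)"

text \<open>The neighbourhoods in \<open>near_ivl\<close> are complex because derivative bounds need
  all roots to be far. Their radius is two sides: one for enlarging the box by a full side in each
  direction, one as the distance from the enlarged box to the roots.\<close>

definition good :: "(nat \<times> nat) set \<Rightarrow> (nat \<Rightarrow> nat \<Rightarrow> real) \<Rightarrow> int \<Rightarrow> int \<Rightarrow> nat \<Rightarrow> nat \<Rightarrow> nat \<Rightarrow> bool" where
  "good J a j k m i l \<longleftrightarrow>
     (\<forall>z w. near_ivl j m i z \<longrightarrow> near_ivl k m l w \<longrightarrow> mixed_poly J a z w \<noteq> 0)"

text \<open>Stopping rule of the Whitney decomposition: the box is good, its parent is not.\<close>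

definition cell :: "(nat \<times> nat) set \<Rightarrow> (nat \<Rightarrow> nat \<Rightarrow> real) \<Rightarrow> int \<Rightarrow> int \<Rightarrow> nat \<Rightarrow> nat \<Rightarrow> nat \<Rightarrow> bool" where
  "cell J a j k m i l \<longleftrightarrow> 4 \<le> m \<and> 2 ^ m \<le> i \<and> i < 2 ^ Suc m \<and> 2 ^ m \<le> l \<and> l < 2 ^ Suc m \<and>
     good J a j k m i l \<and> (m = 4 \<or> \<not> good J a j k (m - 1) (i div 2) (l div 2))"

lemma good_flip: "good (flip_set J) (flip_coeff a) k j m l i = good J a j k m i l"
  unfolding good_def mixed_poly_flip by auto

lemma cell_flip: "cell (flip_set J) (flip_coeff a) k j m l i = cell J a j k m i l"
  unfolding cell_def good_flip by auto

text \<open>A zero near the parent box is at most 6 sides from the point: three parent sides. Moving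
  it along the flow adds \<open>48 * D * 3 ^ D\<close> sides, as the time multiplied by \<eta> is at
  most \<open>12 * D / 2 ^ m\<close>, the exponential at most \<open>3 ^ D\<close>, and the moved
  coordinate at most \<open>4 * 2 ^ m\<close> sides.\<close>

definition root_const :: "nat \<Rightarrow> nat" where
  "root_const D = 6 + 48 * D * 3 ^ D"

lemma exp_nat_le: "exp (real n) \<le> 3 ^ n"
  using power_mono[OF exp_le, of n] by (simp add: exp_of_nat_mult[symmetric])

context qh_data
begin

text \<open>The zero set is invariant under the complex flow \<open>(x, y) \<mapsto> (e\<^sup>\<eta>\<^sup>\<theta> x, e\<^sup>\<theta> y)\<close>: a complex
  zero near the parent box can be moved so that its second coordinate becomes the given real \<open>y\<close>.\<close>

lemma cell_near_root:
  assumes c: "cell J a j k m i l" and m: "m \<noteq> 4" and x: "x \<in> ivl j m i" and y: "y \<in> ivl k m l"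
  shows "\<exists>r. mixed_poly J a r (of_real y) = 0 \<and> cmod (of_real x - r) \<le> real (root_const D) * side j m"
proof -
  define A where "A = side j m"
  define B where "B = side k m"
  have AB: "0 < A" "0 < B" by (auto simp: A_def B_def)
  obtain n where n: "m = Suc n" using c m by (cases m) (auto simp: cell_def)
  have il: "2 ^ m \<le> i" "i < 2 ^ Suc m" "2 ^ m \<le> l" "l < 2 ^ Suc m" and m5: "5 \<le> m"
    and ng: "\<not> good J a j k n (i div 2) (l div 2)"
    using c m n by (auto simp: cell_def)
  obtain z w where zw: "near_ivl j n (i div 2) z" "near_ivl k n (l div 2) w" "mixed_poly J a z w = 0"
    using ng unfolding good_def by auto
  have par: "side j n = 2 * A" "side k n = 2 * B" unfolding A_def B_def n by (rule side_Suc)+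
  have near: "cmod (v - of_real u) \<le> 6 * side q m"
    if near: "near_ivl q n (r div 2) v" and u: "u \<in> ivl q m r" for v q r u
  proof -
    obtain x0 where x0: "x0 \<in> ivl q n (r div 2)" "cmod (v - of_real x0) \<le> 2 * side q n"
      using near by (auto simp: near_ivl_def)
    have "u \<in> ivl q n (r div 2)" using u ivl_parent[of q n r] n by auto
    then have "\<bar>x0 - u\<bar> \<le> side q n" using x0(1) by (auto simp: ivl_def algebra_simps)
    then have "cmod (of_real x0 - of_real u) \<le> side q n"
      by (metis norm_of_real of_real_diff)
    moreover have "cmod (v - of_real u) \<le> cmod (v - of_real x0) + cmod (of_real x0 - of_real u)"
      using norm_triangle_ineq[of "v - of_real x0" "of_real x0 - of_real u"] by simp
    ultimately show ?thesis using x0(2) side_Suc[of q n, folded n] by linarith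
  qed
  have z6: "cmod (z - of_real x) \<le> 6 * A" and w6: "cmod (w - of_real y) \<le> 6 * B"
    using near[OF zw(1) x] near[OF zw(2) y] by (auto simp: A_def B_def)
  have xb: "2 ^ m * A \<le> x" "x \<le> 2 * (2 ^ m * A)" and yb: "2 ^ m * B \<le> y"
    using ivl_bounds[OF x il(1,2)] ivl_bounds[OF y il(3,4)] by (simp_all add: A_def B_def side_def)
  \<comment> \<open>At level 5 or more both coordinates are at least 32 sides, so a displacement of
    6 sides leaves the zero off the axes and the relative error \<open>e\<close> below
    \<open>1/2\<close>.\<close>
  have m32: "(32::real) \<le> 2 ^ m"
    using power_increasing[OF m5, of "2::real"] by simp
  have x32: "32 * A \<le> x" and y32: "32 * B \<le> y"
    using xb yb mult_right_mono[OF m32, of A] mult_right_mono[OF m32, of B] AB by linarith+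
  have y0: "0 < y" "0 < x" using y32 x32 AB by linarith+
  have z0: "z \<noteq> 0"
  proof
    assume "z = 0"
    then have "x \<le> 6 * A" using z6 y0 by simp
    then show False using x32 AB by linarith
  qed
  have w0: "w \<noteq> 0"
  proof
    assume "w = 0"
    then have "y \<le> 6 * B" using w6 y0 by simp
    then show False using y32 AB by linarith
  qed
  have \<eta>D: "\<eta> \<le> real D" by (rule eta_le[OF zw(3) z0 w0])
  define e where "e = (w - of_real y) / of_real y"
  have e1: "cmod e \<le> 6 / 2 ^ m"
  proof -
    have "cmod e = cmod (w - of_real y) / y" using y0 by (simp add: e_def norm_divide)
    also have "\<dots> \<le> (6 * B) / (2 ^ m * B)" using w6 yb AB y0 by (intro frac_le) auto
    finally show ?thesis using AB by simp
  qed
  also have "6 / 2 ^ m \<le> (6 / 32 :: real)" using m32 by (intro divide_left_mono) auto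
  finally have e2: "cmod e < 1/2" by simp
  have we: "w = of_real y * (1 + e)" using y0 by (simp add: e_def field_simps)
  \<comment> \<open>The time for which the flow carries \<open>w\<close>, which is \<open>y\<close>
    times \<open>1 + e\<close>, to \<open>y\<close>; the principal logarithm of \<open>1 + e\<close>
    is at most twice \<open>e\<close> in modulus.\<close>
  define \<theta> where "\<theta> = - Ln (1 + e)"
  have ne: "1 + e \<noteq> 0"
  proof
    assume "1 + e = 0"
    then have "e = - 1" by (simp add: add_eq_0_iff)
    then show False using e2 by simp
  qed
  have th: "cmod \<theta> \<le> 12 / 2 ^ m" using norm_Ln_le[OF e2] e1 by (simp add: \<theta>_def)
  have ey: "exp \<theta> * w = of_real y"
    using ne by (simp add: \<theta>_def we exp_minus)
  define r where "r = exp (of_real \<eta> * \<theta>) * z"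
  have root: "mixed_poly J a r (of_real y) = 0"
    using quasi_homogeneous[of \<theta> z w] zw(3) unfolding ey r_def by simp
  have u: "cmod (of_real \<eta> * \<theta>) \<le> real D * (12 / 2 ^ m)"
    unfolding norm_mult using \<eta>D \<eta> th by (intro mult_mono) auto
  also have "\<dots> \<le> real D * 1" using m32 by (intro mult_left_mono) (auto simp: divide_le_eq)
  finally have "exp (cmod (of_real \<eta> * \<theta>)) \<le> exp (real D)" by simp
  then have u2: "exp (cmod (of_real \<eta> * \<theta>)) \<le> 3 ^ D" using exp_nat_le[of D] by linarith
  have "cmod z \<le> cmod (z - of_real x) + cmod (of_real x)"
    using norm_triangle_ineq[of "z - of_real x" "of_real x"] by simp
  also have "\<dots> \<le> 6 * A + 2 * (2 ^ m * A)" using z6 xb y0 by (intro add_mono) auto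
  also have "\<dots> \<le> 4 * (2 ^ m * A)" using mult_right_mono[OF m32, of A] AB by linarith
  finally have zb: "cmod z \<le> 4 * (2 ^ m * A)" .
  have "cmod (r - z) = cmod (exp (of_real \<eta> * \<theta>) - 1) * cmod z"
    unfolding r_def norm_mult[symmetric] by (simp add: algebra_simps)
  also have "\<dots> \<le> (3 ^ D * (real D * (12 / 2 ^ m))) * (4 * (2 ^ m * A))"
    by (intro mult_mono order_trans[OF norm_exp_diff_one_le] u u2 zb) auto
  also have "\<dots> = 48 * real D * 3 ^ D * A" by simp
  finally have rz: "cmod (r - z) \<le> 48 * real D * 3 ^ D * A" .
  have "cmod (of_real x - r) \<le> cmod (of_real x - z) + cmod (z - r)"
    using norm_triangle_ineq[of "of_real x - z" "z - r"] by simp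
  also have "\<dots> \<le> 6 * A + 48 * real D * 3 ^ D * A"
    using z6 rz by (simp add: norm_minus_commute)
  finally show ?thesis using root by (auto simp: root_const_def A_def algebra_simps)
qed

lemma good_far_root:
  assumes g: "good J a j k m i l" and x: "x \<in> ivl j m i"
    and y: "(real l - 1) * side k m \<le> y" "y \<le> (real l + 2) * side k m"
    and r: "mixed_poly J a r (of_real y) = 0"
  shows "side j m \<le> cmod (of_real x - r)"
proof (rule ccontr)
  assume *: "\<not> ?thesis"
  have "near_ivl j m i r"
    unfolding near_ivl_def using * side_pos[of j m] norm_minus_commute[of "of_real x" r]
    by (intro bexI[OF _ x]) linarith
  moreover have "near_ivl k m l (of_real y)"
  proof -
    define y0 where "y0 = max (real l * side k m) (min y ((real l + 1) * side k m))"
    have "y0 \<in> ivl k m l" by (auto simp: y0_def ivl_def max_def min_def mult_right_mono)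
    moreover have "\<bar>y - y0\<bar> \<le> 2 * side k m"
      using y side_pos[of k m] unfolding y0_def by (auto simp: max_def min_def algebra_simps)
    ultimately show ?thesis unfolding near_ivl_def
      by (intro bexI[of _ y0]) (auto simp flip: of_real_diff)
  qed
  ultimately show False using g r unfolding good_def by blast
qed

end

section \<open>Number, uniqueness and existence of the Whitney boxes, and their sectors\<close>

lemma side_nonzero [simp]: "side j m \<noteq> 0"
  using side_pos[of j m] by linarith

lemma card_nat_near: "card {l::nat. \<bar>real l - c\<bar> \<le> real C} \<le> 2 * C + 1" "finite {l::nat. \<bar>real l - c\<bar> \<le> real C}"
proof -
  have sub: "{l::nat. \<bar>real l - c\<bar> \<le> real C} \<subseteq> nat ` {\<lceil>c - real C\<rceil>..\<lfloor>c + real C\<rfloor>}"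
  proof
    fix l :: nat assume "l \<in> {l. \<bar>real l - c\<bar> \<le> real C}"
    then have "\<bar>real l - c\<bar> \<le> real C" by simp
    then have "c - real C \<le> real_of_int (int l)" "real_of_int (int l) \<le> c + real C"
      by (auto simp: abs_le_iff)
    then have "int l \<in> {\<lceil>c - real C\<rceil>..\<lfloor>c + real C\<rfloor>}"
      unfolding atLeastAtMost_iff ceiling_le_iff le_floor_iff by blast
    then show "l \<in> nat ` {\<lceil>c - real C\<rceil>..\<lfloor>c + real C\<rfloor>}" by (rule rev_image_eqI) simp
  qed
  show "finite {l::nat. \<bar>real l - c\<bar> \<le> real C}" by (rule finite_subset[OF sub]) simp
  have "card {l::nat. \<bar>real l - c\<bar> \<le> real C} \<le> card (nat ` {\<lceil>c - real C\<rceil>..\<lfloor>c + real C\<rfloor>})"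
    by (rule card_mono[OF _ sub]) simp
  also have "\<dots> \<le> card {\<lceil>c - real C\<rceil>..\<lfloor>c + real C\<rfloor>}" by (rule card_image_le) simp
  also have "\<dots> = nat (\<lfloor>c + real C\<rfloor> - \<lceil>c - real C\<rceil> + 1)" by simp
  also have "\<dots> \<le> 2 * C + 1"
  proof -
    have "real_of_int \<lfloor>c + real C\<rfloor> \<le> c + real C" "c - real C \<le> real_of_int \<lceil>c - real C\<rceil>" by simp_all
    then have "real_of_int (\<lfloor>c + real C\<rfloor> - \<lceil>c - real C\<rceil>) \<le> real_of_int (2 * int C)"
      unfolding of_int_diff of_int_mult of_int_numeral of_int_of_nat_eq by linarith
    then show ?thesis unfolding of_int_le_iff by linarith
  qed
  finally show "card {l::nat. \<bar>real l - c\<bar> \<le> real C} \<le> 2 * C + 1" .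
qed

text \<open>At the coarsest level 4 every index is below 32. At finer levels each of at most
  \<open>D\<close> roots accounts for the indices within \<open>root_const D\<close> of its real
  part.\<close>

definition count_const :: "nat \<Rightarrow> nat" where
  "count_const D = 32 + D * (2 * root_const D + 1)"

definition idx :: "int \<Rightarrow> nat \<Rightarrow> real \<Rightarrow> nat" where
  "idx j m x = nat \<lfloor>x / side j m\<rfloor>"

lemma idx_ivl: "0 \<le> x \<Longrightarrow> x \<in> ivl j m (idx j m x)"
proof -
  assume "0 \<le> x"
  then have "real (idx j m x) = of_int \<lfloor>x / side j m\<rfloor>" by (simp add: idx_def less_imp_le)
  then have "real (idx j m x) \<le> x / side j m" "x / side j m \<le> real (idx j m x) + 1"
    by linarith+
  then show ?thesis by (simp add: ivl_def field_simps)
qed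

lemma idx_parent: "0 \<le> x \<Longrightarrow> idx j (Suc m) x div 2 = idx j m x"
proof -
  assume "0 \<le> x"
  have "x / side j m = (x / side j (Suc m)) / real_of_int 2"
    by (simp add: side_Suc[of j m])
  then have "\<lfloor>x / side j m\<rfloor> = \<lfloor>x / side j (Suc m)\<rfloor> div 2"
    by (metis floor_divide_real_eq_div zero_le_numeral)
  then show ?thesis by (simp add: idx_def nat_div_distrib')
qed

lemma idx_eq_iff: "0 \<le> x \<Longrightarrow> idx j m x = i \<longleftrightarrow> real i * side j m \<le> x \<and> x < (real i + 1) * side j m"
proof -
  assume "0 \<le> x"
  then have "0 \<le> \<lfloor>x / side j m\<rfloor>" by (simp add: less_imp_le)
  then have "idx j m x = i \<longleftrightarrow> \<lfloor>x / side j m\<rfloor> = int i" unfolding idx_def by auto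
  also have "\<dots> \<longleftrightarrow> real i \<le> x / side j m \<and> x / side j m < real i + 1" by (simp add: floor_eq_iff)
  also have "\<dots> \<longleftrightarrow> real i * side j m \<le> x \<and> x < (real i + 1) * side j m"
    by (simp add: pos_le_divide_eq pos_divide_less_eq)
  finally show ?thesis .
qed

lemma idx_range_imp:
  assumes "0 \<le> x" "2 ^ m \<le> idx j m x" "idx j m x < 2 ^ Suc m"
  shows "2 powr real_of_int j \<le> x" "x < 2 powr (real_of_int j + 1)"
proof -
  define i where "i = idx j m x"
  have i: "real i * side j m \<le> x" "x < (real i + 1) * side j m"
    using idx_eq_iff[OF assms(1), of j m i] i_def by auto
  have "(2::real) ^ m \<le> real i" using assms(2) i_def by (metis of_nat_le_iff of_nat_numeral of_nat_power)
  then have "2 ^ m * side j m \<le> x"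
    using i(1) mult_right_mono[OF _ less_imp_le[OF side_pos], of "2 ^ m" "real i" j m] by linarith
  then show "2 powr real_of_int j \<le> x" by (simp add: side_def)
  have "real (i + 1) \<le> real (2 ^ Suc m)" using assms(3) i_def by (intro of_nat_mono) simp
  then have "(real i + 1) * side j m \<le> 2 * 2 ^ m * side j m"
    by (intro mult_right_mono less_imp_le[OF side_pos]) simp
  then show "x < 2 powr (real_of_int j + 1)" using i(2) by (simp add: side_def powr_add)
qed

lemma idx_range_if:
  assumes "2 powr real_of_int j \<le> x" "x < 2 powr (real_of_int j + 1)"
  shows "2 ^ m \<le> idx j m x" "idx j m x < 2 ^ Suc m"
proof -
  have "0 < x" using assms(1) by (smt (verit) powr_gt_zero)
  have e: "2 ^ m * side j m = 2 powr real_of_int j" by (simp add: side_def)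
  have "2 ^ m \<le> x / side j m" using assms(1) e by (simp add: pos_le_divide_eq)
  then have "(2::int) ^ m \<le> \<lfloor>x / side j m\<rfloor>" by (simp add: le_floor_iff)
  then show "2 ^ m \<le> idx j m x" unfolding idx_def
    by (metis nat_le_iff nat_mono nat_power_eq nat_numeral zero_le_numeral)
  have "x / side j m < 2 ^ Suc m" using assms(2) e by (simp add: pos_divide_less_eq powr_add)
  then have "\<lfloor>x / side j m\<rfloor> < (2::int) ^ Suc m" by (simp add: floor_less_iff)
  moreover have "0 \<le> \<lfloor>x / side j m\<rfloor>" using \<open>0 < x\<close> by (simp add: less_imp_le)
  ultimately show "idx j m x < 2 ^ Suc m" unfolding idx_def
    by (subst nat_less_iff) auto
qed

lemma dyadic_unique:
  assumes "2 powr real_of_int j \<le> x" "x < 2 powr (real_of_int j + 1)"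
    "2 powr real_of_int j' \<le> x" "x < 2 powr (real_of_int j' + 1)"
  shows "j = j'"
proof -
  have "(2::real) powr real_of_int j < 2 powr (real_of_int j' + 1)" "(2::real) powr real_of_int j' < 2 powr (real_of_int j + 1)"
    using assms by linarith+
  then show ?thesis by simp
qed

lemma dyadic_exists:
  assumes "0 < x" obtains j where "2 powr real_of_int j \<le> x" "x < 2 powr (real_of_int j + 1)"
proof (rule that[of "\<lfloor>log 2 x\<rfloor>"])
  show "2 powr real_of_int \<lfloor>log 2 x\<rfloor> \<le> x"
    using assms by (simp add: le_log_iff[symmetric])
  show "x < 2 powr (real_of_int \<lfloor>log 2 x\<rfloor> + 1)"
    using assms by (simp add: log_less_iff[symmetric])
qed

definition in_cell :: "(nat \<times> nat) set \<Rightarrow> (nat \<Rightarrow> nat \<Rightarrow> real) \<Rightarrow> int \<times> int \<times> nat \<Rightarrow> real \<Rightarrow> real \<Rightarrow> bool" where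
  "in_cell J a c x y \<longleftrightarrow> (case c of (j, k, m) \<Rightarrow> 0 < x \<and> 0 < y \<and> cell J a j k m (idx j m x) (idx k m y))"

lemma good_child:
  assumes "good J a j k m (i div 2) (l div 2)" shows "good J a j k (Suc m) i l"
proof -
  have n: "near_ivl q m (r div 2) z" if "near_ivl q (Suc m) r z" for q r z
  proof -
    obtain x where "x \<in> ivl q (Suc m) r" "cmod (z - of_real x) \<le> 2 * side q (Suc m)"
      using \<open>near_ivl q (Suc m) r z\<close> by (auto simp: near_ivl_def)
    moreover from this have "cmod (z - of_real x) \<le> 2 * side q m"
      using side_Suc[of q m] side_pos[of q "Suc m"] by linarith
    ultimately have "x \<in> ivl q m (r div 2)" "cmod (z - of_real x) \<le> 2 * side q m"
      using ivl_parent[of q m r] by auto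
    then show ?thesis by (auto simp: near_ivl_def)
  qed
  then show ?thesis using assms unfolding good_def by blast
qed

lemma good_idx_mono:
  assumes "0 \<le> x" "0 \<le> y" "m \<le> n" "good J a j k m (idx j m x) (idx k m y)"
  shows "good J a j k n (idx j n x) (idx k n y)"
  using assms(3)
proof (induction n rule: dec_induct)
  case (step n)
  show ?case by (rule good_child) (simp add: idx_parent assms step)
qed (rule assms)

text \<open>The dyadic block is determined by the point, and goodness passes from a box to its
  children, so there is at most one level at which the box is good and its parent is not.\<close>

lemma in_cell_unique:
  assumes "in_cell J a c x y" "in_cell J a c' x y" shows "c = c'"
proof -
  obtain j k m where c: "c = (j, k, m)" by (cases c)
  obtain j' k' m' where c': "c' = (j', k', m')" by (cases c')
  have xy: "0 < x" "0 < y" and C: "cell J a j k m (idx j m x) (idx k m y)"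
    "cell J a j' k' m' (idx j' m' x) (idx k' m' y)"
    using assms by (auto simp: in_cell_def c c')
  have rg: "2 ^ m \<le> idx j m x" "idx j m x < 2 ^ Suc m" "2 ^ m' \<le> idx j' m' x" "idx j' m' x < 2 ^ Suc m'"
    "2 ^ m \<le> idx k m y" "idx k m y < 2 ^ Suc m" "2 ^ m' \<le> idx k' m' y" "idx k' m' y < 2 ^ Suc m'"
    using C unfolding cell_def by blast+
  note xy' = less_imp_le[OF xy(1)] less_imp_le[OF xy(2)]
  have jj: "j = j'"
    by (rule dyadic_unique[OF idx_range_imp[OF xy'(1) rg(1,2)] idx_range_imp[OF xy'(1) rg(3,4)]])
  have kk: "k = k'"
    by (rule dyadic_unique[OF idx_range_imp[OF xy'(2) rg(5,6)] idx_range_imp[OF xy'(2) rg(7,8)]])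
  have no: False if lt: "m1 < m2" "cell J a j k m1 (idx j m1 x) (idx k m1 y)" "cell J a j k m2 (idx j m2 x) (idx k m2 y)" for m1 m2
  proof -
    obtain n where n: "m2 = Suc n" using lt by (cases m2) auto
    have "good J a j k n (idx j n x) (idx k n y)"
      by (rule good_idx_mono[of x y m1]) (use that n xy in \<open>auto simp: cell_def\<close>)
    moreover have "m2 \<noteq> 4" using that by (auto simp: cell_def)
    ultimately show False using that(3) xy idx_parent[of x j n] idx_parent[of y k n] by (auto simp: cell_def n)
  qed
  have "m = m'" using no[of m m'] no[of m' m] C jj kk by (cases m m' rule: linorder_cases) auto
  then show ?thesis using c c' jj kk by simp
qed

context qh_data
begin

lemma finite_roots: "y \<noteq> 0 \<Longrightarrow> finite {r. mixed_poly J a r (complex_of_real y) = 0}"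
  "y \<noteq> 0 \<Longrightarrow> card {r. mixed_poly J a r (complex_of_real y) = 0} \<le> D"
proof -
  assume y: "y \<noteq> 0"
  then have n: "cpoly (row_poly J a y) \<noteq> 0" using row_nonzero by (simp add: cpoly_eq_0_iff)
  have e: "{r. mixed_poly J a r (complex_of_real y) = 0} = {r. poly (cpoly (row_poly J a y)) r = 0}"
    by (simp add: poly_cpoly_row)
  show "finite {r. mixed_poly J a r (complex_of_real y) = 0}" unfolding e by (rule poly_roots_finite[OF n])
  show "card {r. mixed_poly J a r (complex_of_real y) = 0} \<le> D" unfolding e
    using card_poly_roots_bound[OF n] degree_row[of y] by (simp add: degree_cpoly)
qed

text \<open>All boxes with the same vertical index meet one horizontal line, and on this line each
  of them, unless at level 4, is within \<open>root_const D\<close> sides of one of at most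
  \<open>D\<close> complex zeros.\<close>

lemma card_cells:
  "finite {i. cell J a j k m i l}" "card {i. cell J a j k m i l} \<le> count_const D"
proof -
  have sub: "{i. cell J a j k m i l} \<subseteq> {..<2 ^ Suc m}" by (auto simp: cell_def)
  show f: "finite {i. cell J a j k m i l}" by (rule finite_subset[OF sub]) simp
  show "card {i. cell J a j k m i l} \<le> count_const D"
  proof (cases "m = 4")
    case True
    have "card {i. cell J a j k m i l} \<le> card {..<(2::nat) ^ Suc m}" by (rule card_mono[OF _ sub]) simp
    then show ?thesis using True by (simp add: count_const_def)
  next
    case False
    show ?thesis
    proof (cases "{i. cell J a j k m i l} = {}")
      case False
      then obtain i0 where "cell J a j k m i0 l" by auto
      then have l: "2 ^ m \<le> l" by (auto simp: cell_def)
      define y where "y = real l * side k m"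
      have y: "y \<in> ivl k m l" by (auto simp: y_def ivl_def)
      have "0 < l" using l by (metis gr0I not_le zero_less_numeral zero_less_power)
      then have y0: "y \<noteq> 0" by (simp add: y_def)
      let ?R = "{r. mixed_poly J a r (complex_of_real y) = 0}"
      let ?N = "\<lambda>r. {i::nat. \<bar>real i - Re r / side j m\<bar> \<le> real (root_const D)}"
      have "{i. cell J a j k m i l} \<subseteq> (\<Union>r\<in>?R. ?N r)"
      proof
        fix i assume "i \<in> {i. cell J a j k m i l}"
        then have c: "cell J a j k m i l" by simp
        have x: "real i * side j m \<in> ivl j m i" by (auto simp: ivl_def)
        obtain r where r: "r \<in> ?R" "cmod (of_real (real i * side j m) - r) \<le> real (root_const D) * side j m"
          using cell_near_root[OF c \<open>m \<noteq> 4\<close> x y] by auto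
        have "\<bar>real i * side j m - Re r\<bar> \<le> real (root_const D) * side j m"
          using r(2) abs_Re_le_cmod[of "of_real (real i * side j m) - r"] by simp
        moreover have "real i - Re r / side j m = (real i * side j m - Re r) / side j m"
          using side_pos[of j m] by (simp add: field_simps)
        ultimately have "\<bar>real i - Re r / side j m\<bar> \<le> real (root_const D)"
          using side_pos[of j m] by (simp add: abs_divide pos_divide_le_eq)
        then show "i \<in> (\<Union>r\<in>?R. ?N r)" using r(1) by auto
      qed
      then have "card {i. cell J a j k m i l} \<le> card (\<Union>r\<in>?R. ?N r)"
        by (rule card_mono[rotated]) (use finite_roots(1)[OF y0] card_nat_near(2) in auto)
      also have "\<dots> \<le> (\<Sum>r\<in>?R. card (?N r))" by (rule card_UN_le[OF finite_roots(1)[OF y0]])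
      also have "\<dots> \<le> (\<Sum>r\<in>?R. 2 * root_const D + 1)" by (intro sum_mono card_nat_near)
      also have "\<dots> = card ?R * (2 * root_const D + 1)" by simp
      also have "\<dots> \<le> D * (2 * root_const D + 1)" by (intro mult_right_mono finite_roots(2)[OF y0]) simp
      finally show ?thesis by (simp add: count_const_def)
    qed simp
  qed
qed

text \<open>A nonzero value persists on a complex ball, which contains the complex neighbourhood of
  the box around the point once the sides are small; the least good level from 4 on then gives the
  cell. A point of that neighbourhood is within three sides in each coordinate, whence the
  \<open>e / 6\<close>.\<close>

lemma in_cell_exists:
  assumes "0 < x" "0 < y" "mixed_poly J a x y \<noteq> 0"
  obtains c where "in_cell J a c x y"
proof -
  obtain j where j: "2 powr real_of_int j \<le> x" "x < 2 powr (real_of_int j + 1)" using dyadic_exists[OF assms(1)] .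
  obtain k where k: "2 powr real_of_int k \<le> y" "y < 2 powr (real_of_int k + 1)" using dyadic_exists[OF assms(2)] .
  have "continuous_on UNIV (\<lambda>p::complex \<times> complex. mixed_poly J a (fst p) (snd p))" by (intro continuous_intros)
  then have "open ((\<lambda>p::complex \<times> complex. mixed_poly J a (fst p) (snd p)) -` (- {0}))"
    by (intro open_vimage) auto
  moreover have "(of_real x, of_real y) \<in> (\<lambda>p::complex \<times> complex. mixed_poly J a (fst p) (snd p)) -` (- {0})"
    using assms(3) by (simp add: mixed_poly_of_real)
  ultimately obtain e where e: "0 < e" "ball (of_real x, of_real y) e \<subseteq> (\<lambda>p::complex \<times> complex. mixed_poly J a (fst p) (snd p)) -` (- {0})"
    by (rule openE)
  have small: "\<exists>n. \<forall>m\<ge>n. side q m < e / 6" for q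
  proof -
    obtain n where n: "(2 powr real_of_int q) / (e / 6) < 2 ^ n" using real_arch_pow[of 2 "(2 powr real_of_int q) / (e / 6)"] by auto
    have "side q m < e / 6" if "n \<le> m" for m
    proof -
      have "(2 powr real_of_int q) / (e / 6) < 2 ^ m"
        using n power_increasing[OF that, of "2::real"] by linarith
      then show ?thesis using e(1) by (simp add: side_def field_simps)
    qed
    then show ?thesis by auto
  qed
  obtain n1 n2 where n: "\<And>m. n1 \<le> m \<Longrightarrow> side j m < e / 6" "\<And>m. n2 \<le> m \<Longrightarrow> side k m < e / 6"
    using small[of j] small[of k] by auto
  define M where "M = max 4 (max n1 n2)"
  have nr: "cmod (of_real u - z) < e / 2" if nr: "near_ivl q M (idx q M u) z" and "side q M < e / 6" "0 < u" for q u z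
  proof -
    obtain u' where u': "u' \<in> ivl q M (idx q M u)" "cmod (z - of_real u') \<le> 2 * side q M"
      using nr by (auto simp: near_ivl_def)
    have "\<bar>u - u'\<bar> \<le> side q M"
      using u'(1) idx_ivl[of u q M] that(3) by (auto simp: ivl_def algebra_simps)
    then have "cmod (of_real u - of_real u') \<le> side q M" by (metis norm_of_real of_real_diff)
    moreover have "cmod (of_real u - z) \<le> cmod (of_real u - of_real u') + cmod (of_real u' - z)"
      using norm_triangle_ineq[of "of_real u - of_real u'" "of_real u' - z"] by simp
    ultimately show ?thesis using u'(2) that(2) by (simp add: norm_minus_commute)
  qed
  have gM: "good J a j k M (idx j M x) (idx k M y)"
    unfolding good_def
  proof (intro allI impI)
    fix z w assume "near_ivl j M (idx j M x) z" "near_ivl k M (idx k M y) w"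
    then have 1: "cmod (of_real x - z) < e / 2" "cmod (of_real y - w) < e / 2"
      using nr n assms by (auto simp: M_def)
    have "dist (complex_of_real x, complex_of_real y) (z, w) \<le> dist (complex_of_real x) z + dist (complex_of_real y) w"
      by (simp add: dist_Pair_Pair sqrt_sum_squares_le_sum)
    then have "(z, w) \<in> ball (of_real x, of_real y) e" using 1 by (simp add: dist_norm)
    then show "mixed_poly J a z w \<noteq> 0" using e(2) by auto
  qed
  define m where "m = (LEAST m. 4 \<le> m \<and> good J a j k m (idx j m x) (idx k m y))"
  have ex: "4 \<le> M \<and> good J a j k M (idx j M x) (idx k M y)" using gM by (simp add: M_def)
  have m: "4 \<le> m \<and> good J a j k m (idx j m x) (idx k m y)" unfolding m_def
    by (rule LeastI[where P = "\<lambda>m. 4 \<le> m \<and> good J a j k m (idx j m x) (idx k m y)", OF ex])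
  have "m = 4 \<or> \<not> good J a j k (m - 1) (idx j (m - 1) x) (idx k (m - 1) y)"
    using not_less_Least[of "m - 1" "\<lambda>m. 4 \<le> m \<and> good J a j k m (idx j m x) (idx k m y)"] m
    unfolding m_def[symmetric] by auto
  moreover have "idx j (m - 1) x = idx j m x div 2" "idx k (m - 1) y = idx k m y div 2"
    using idx_parent[of x j "m - 1"] idx_parent[of y k "m - 1"] assms m by auto
  ultimately have "cell J a j k m (idx j m x) (idx k m y)"
    using m idx_range_if[OF j] idx_range_if[OF k] by (simp add: cell_def)
  then show ?thesis using that[of "(j, k, m)"] assms by (simp add: in_cell_def)
qed

text \<open>By quasi-homogeneity the zeros in the open quadrant satisfy \<open>x = w * y powr \<eta>\<close> with \<open>w\<close> a zero of
  \<open>mixed_poly J a w 1\<close>; points are in the same sector if the same number of these curves lies to their left.\<close>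

definition sect :: "real \<Rightarrow> real \<Rightarrow> nat" where
  "sect x y = card {w. mixed_poly J a w 1 = 0 \<and> w < x * y powr (- \<eta>)}"

lemma finite_real_roots: "finite {w::real. mixed_poly J a w 1 = 0}" "card {w::real. mixed_poly J a w 1 = 0} \<le> D"
proof -
  have n: "row_poly J a 1 \<noteq> 0" by (rule row_nonzero) simp
  have e: "{w::real. mixed_poly J a w 1 = 0} = {w. poly (row_poly J a 1) w = 0}" by (simp add: poly_row)
  show "finite {w::real. mixed_poly J a w 1 = 0}" unfolding e by (rule poly_roots_finite[OF n])
  show "card {w::real. mixed_poly J a w 1 = 0} \<le> D" unfolding e
    using card_poly_roots_bound[OF n] degree_row[of 1] by simp
qed

lemma sect_le: "sect x y \<le> D"
proof -
  have "sect x y \<le> card {w::real. mixed_poly J a w 1 = 0}"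
    unfolding sect_def by (rule card_mono[OF finite_real_roots(1)]) auto
  then show ?thesis using finite_real_roots(2) by simp
qed

lemma mixed_poly_zero_iff:
  fixes x y :: real
  assumes y: "0 < y" shows "mixed_poly J a x y = 0 \<longleftrightarrow> mixed_poly J a (x * y powr (- \<eta>)) 1 = 0"
proof -
  define \<theta> where "\<theta> = complex_of_real (ln y)"
  have e: "exp \<theta> = of_real y" using y by (simp add: \<theta>_def exp_of_real)
  define u where "u = x * y powr (- \<eta>)"
  have eq: "exp (of_real \<eta> * \<theta>) * complex_of_real u = of_real x"
  proof -
    have "exp (of_real \<eta> * \<theta>) = complex_of_real (y powr \<eta>)"
      using y by (simp add: \<theta>_def powr_def exp_of_real[symmetric])
    moreover have "y powr \<eta> * u = x"
      using y by (simp add: u_def powr_minus field_simps)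
    ultimately show ?thesis by (metis of_real_mult)
  qed
  have "complex_of_real (mixed_poly J a x y)
      = exp (of_real (d - \<eta> - 1) * \<theta>) * complex_of_real (mixed_poly J a u 1)"
    using quasi_homogeneous[of \<theta> "complex_of_real u" 1]
    unfolding e eq mult_1_right mixed_poly_of_real[of J a x y, symmetric] mixed_poly_of_real[of J a u 1, symmetric]
    by simp
  then show ?thesis unfolding u_def[symmetric] by (metis exp_not_eq_zero mult_eq_0_iff of_real_eq_0_iff)
qed

text \<open>A root between the two parameters would be counted for the second point but not for the
  first.\<close>

lemma sect_separates:
  assumes "0 < y" "0 < y'" and nz: "mixed_poly J a x y \<noteq> 0" "mixed_poly J a x' y' \<noteq> 0"
    and eq: "sect x y = sect x' y'"
    and w: "mixed_poly J a w 1 = 0" "x * y powr (- \<eta>) \<le> w" "w \<le> x' * y' powr (- \<eta>)"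
  shows False
proof -
  have w': "w < x' * y' powr (- \<eta>)"
    using w nz(2) mixed_poly_zero_iff[OF assms(2)] by (cases "w = x' * y' powr (- \<eta>)") auto
  define u u' where uu: "u = x * y powr (- \<eta>)" "u' = x' * y' powr (- \<eta>)"
  define A where "A u = {w::real. mixed_poly J a w 1 = 0 \<and> w < u}" for u
  have "finite (A u')" unfolding A_def by (rule finite_subset[OF _ finite_real_roots(1)]) blast
  moreover have "A u \<subset> A u'"
  proof
    show "A u \<subseteq> A u'" using w(2) w' unfolding A_def uu[symmetric] by force
    have "w \<in> A u'" "w \<notin> A u" using w(1,2) w' unfolding A_def uu[symmetric] by auto
    then show "A u \<noteq> A u'" by blast
  qed
  ultimately have "card (A u) < card (A u')" by (rule psubset_card_mono)
  then have "sect x y < sect x' y'" unfolding sect_def A_def uu .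
  with eq show False by simp
qed

lemma sect_segment_x:
  assumes "0 < y" "mixed_poly J a x y \<noteq> 0" "mixed_poly J a x' y \<noteq> 0" "sect x y = sect x' y"
    and t: "t \<in> {x..x'}"
  shows "mixed_poly J a t y \<noteq> 0"
proof
  assume "mixed_poly J a t y = 0"
  then have "mixed_poly J a (t * y powr (- \<eta>)) 1 = 0" using mixed_poly_zero_iff[OF assms(1)] by simp
  then show False
    by (rule sect_separates[OF assms(1,1,2,3,4)]) (use t in \<open>auto intro: mult_right_mono\<close>)
qed

text \<open>Along an upward vertical segment the parameter \<open>x * t powr (- \<eta>)\<close>
  decreases, so the end points are passed to \<open>sect_separates\<close> in the opposite
  order.\<close>

lemma sect_segment_y:
  assumes "0 < x" "0 < y" "mixed_poly J a x y \<noteq> 0" "mixed_poly J a x y' \<noteq> 0" "sect x y = sect x y'"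
    and t: "t \<in> {y..y'}"
  shows "mixed_poly J a x t \<noteq> 0"
proof
  have p: "0 < t" "0 < y'" using assms t by auto
  assume "mixed_poly J a x t = 0"
  then have "mixed_poly J a (x * t powr (- \<eta>)) 1 = 0" using mixed_poly_zero_iff[OF p(1)] by simp
  then show False
    by (rule sect_separates[OF p(2) assms(2) assms(4) assms(3) assms(5)[symmetric]])
       (use t p assms \<eta> in \<open>auto intro!: mult_left_mono powr_mono2'\<close>)
qed

text \<open>The parameter maps the box onto an interval. A root inside this interval would be
  attained at a point of the box, where the mixed derivative would vanish, against goodness.\<close>

lemma sect_const_on_cell:
  assumes c: "cell J a j k m i l" and xy: "x \<in> ivl j m i" "y \<in> ivl k m l" and xy': "x' \<in> ivl j m i" "y' \<in> ivl k m l"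
  shows "sect x y = sect x' y'"
proof -
  have il: "2 ^ m \<le> i" "i < 2 ^ Suc m" "2 ^ m \<le> l" "l < 2 ^ Suc m" "good J a j k m i l"
    using c by (auto simp: cell_def)
  define B where "B = ivl j m i \<times> ivl k m l"
  define g where "g p = fst p * snd p powr (- \<eta>)" for p :: "real \<times> real"
  have pos: "0 < fst p" "0 < snd p" if "p \<in> B" for p
    using ivl_bounds(3)[OF _ il(1,2)] ivl_bounds(3)[OF _ il(3,4)] that by (auto simp: B_def)
  have nz: "mixed_poly J a (fst p) (snd p) \<noteq> 0" if "p \<in> B" for p
  proof -
    have "near_ivl j m i (of_real (fst p))" "near_ivl k m l (of_real (snd p))"
      using that less_imp_le[OF side_pos] unfolding B_def near_ivl_def by (force intro!: bexI)+
    then have "mixed_poly J a (complex_of_real (fst p)) (of_real (snd p)) \<noteq> 0" using il(5) by (auto simp: good_def)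
    then show ?thesis by (simp add: mixed_poly_of_real)
  qed
  have "convex B" unfolding B_def ivl_def by (intro convex_Times convex_real_interval)
  moreover have "continuous_on B g"
    unfolding g_def using pos by (intro continuous_intros) (force simp: less_le)+
  ultimately have conn: "connected (g ` B)" by (intro connected_continuous_image convex_connected)
  have "{w. mixed_poly J a w 1 = 0 \<and> w < g p} \<subseteq> {w. mixed_poly J a w 1 = 0 \<and> w < g p'}"
    if p: "p \<in> B" "p' \<in> B" for p p'
  proof
    fix w assume w: "w \<in> {w. mixed_poly J a w 1 = 0 \<and> w < g p}"
    show "w \<in> {w. mixed_poly J a w 1 = 0 \<and> w < g p'}"
    proof (rule ccontr)
      assume "\<not> ?thesis"
      then have "g p' \<le> w" "w \<le> g p" using w by auto
      then have "w \<in> g ` B" using connectedD_interval[OF conn, of "g p'" "g p" w] p by auto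
      then obtain q where q: "q \<in> B" "w = g q" by auto
      then have "mixed_poly J a (fst q) (snd q) = 0"
        using mixed_poly_zero_iff[OF pos(2)[OF q(1)], of "fst q"] w by (simp add: g_def)
      then show False using nz[OF q(1)] by simp
    qed
  qed
  then have "{w. mixed_poly J a w 1 = 0 \<and> w < g (x, y)} = {w. mixed_poly J a w 1 = 0 \<and> w < g (x', y')}"
    using xy xy' by (intro subset_antisym) (auto simp: B_def)
  then show ?thesis by (simp add: sect_def g_def)
qed

end

section \<open>Sums of blocks with few blocks in each row and column\<close>

lemma nrm_restrict: "nrm (\<lambda>x. indicator A x * f x) ^ 2 = (LINT x|lborel. indicator A x * (cmod (f x))\<^sup>2)"
  unfolding nrm_sq by (intro Bochner_Integration.integral_cong) (auto simp: indicator_def)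

lemma sum_nrm_restrict_le:
  assumes f: "sqint f" and I: "finite I" and A: "\<And>i. i \<in> I \<Longrightarrow> A i \<in> sets borel"
    and disj: "\<And>i j x. i \<in> I \<Longrightarrow> j \<in> I \<Longrightarrow> x \<in> A i \<Longrightarrow> x \<in> A j \<Longrightarrow> i = j"
  shows "(\<Sum>i\<in>I. (nrm (\<lambda>x. indicator (A i) x * f x))\<^sup>2) \<le> (nrm f)\<^sup>2"
proof -
  have int: "integrable lborel (\<lambda>x. indicator (A i) x * (cmod (f x))\<^sup>2)" if "i \<in> I" for i
    using sqint_integrable[OF sqint_indicator_mult[OF f A[OF that]]]
    by (rule Bochner_Integration.integrable_cong[THEN iffD1, rotated 2]) (auto simp: indicator_def)
  have "(\<Sum>i\<in>I. (nrm (\<lambda>x. indicator (A i) x * f x))\<^sup>2)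
      = (LINT x|lborel. (\<Sum>i\<in>I. indicator (A i) x * (cmod (f x))\<^sup>2))"
    unfolding nrm_restrict by (rule Bochner_Integration.integral_sum[symmetric]) (rule int)
  also have "\<dots> \<le> (LINT x|lborel. (cmod (f x))\<^sup>2)"
  proof (rule integral_mono)
    fix x
    have "(\<Sum>i\<in>I. indicator (A i) x * (cmod (f x))\<^sup>2) = (\<Sum>i\<in>I. indicator (A i) x) * (cmod (f x))\<^sup>2"
      by (simp add: sum_distrib_right)
    moreover have "(\<Sum>i\<in>I. indicator (A i) x :: real) \<le> 1"
    proof (cases "\<exists>i\<in>I. x \<in> A i")
      case True
      then obtain i where i: "i \<in> I" "x \<in> A i" by auto
      have "(\<Sum>j\<in>I. indicator (A j) x :: real) = (\<Sum>j\<in>I. if j = i then 1 else 0)"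
        by (intro sum.cong refl) (use disj i in \<open>auto simp: indicator_def\<close>)
      then show ?thesis using i I by simp
    qed (auto simp: indicator_def)
    ultimately show "(\<Sum>i\<in>I. indicator (A i) x * (cmod (f x))\<^sup>2) \<le> (cmod (f x))\<^sup>2"
      by (simp add: mult_left_le_one_le sum_nonneg)
  qed (use int sqint_integrable[OF f] in auto)
  finally show ?thesis by (simp add: nrm_sq)
qed

definition kcut :: "real set \<Rightarrow> real set \<Rightarrow> (real \<Rightarrow> real \<Rightarrow> complex) \<Rightarrow> real \<Rightarrow> real \<Rightarrow> complex" where
  "kcut A B k x y = indicator A x * indicator B y * k x y"

lemma bker_kcut:
  assumes k: "bker k" and [measurable]: "A \<in> sets borel" "B \<in> sets borel" shows "bker (kcut A B k)"
  unfolding kcut_def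
  by (rule bker_mult_bounded[OF k, of _ 1]) (measurable, auto simp: indicator_def)

lemma ip_kcut:
  "ip (kop (kcut A B k) f) g = ip (kop (kcut A B k) (\<lambda>y. indicator B y * f y)) (\<lambda>x. indicator A x * g x)"
proof -
  have "kop (kcut A B k) f = kop (kcut A B k) (\<lambda>y. indicator B y * f y)"
    unfolding kop_def kcut_def by (intro ext Bochner_Integration.integral_cong) (auto simp: indicator_def)
  moreover have "kop (kcut A B k) f x = indicator A x * kop (kcut A B k) f x" for x f
    unfolding kop_def kcut_def by (auto simp: indicator_def)
  ultimately show ?thesis unfolding ip_def
    by (intro Bochner_Integration.integral_cong) (auto simp: indicator_def)
qed

text \<open>A block sees only the restrictions of \<open>f\<close> and \<open>g\<close> to its
  sides. By disjointness the squared norms of these restrictions add up to at most the full squared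
  norms, and in the sum over all blocks each restriction is repeated at most \<open>N\<close>
  times.\<close>

lemma opb_blocks:
  fixes S :: "('i \<times> 'l) set"
  assumes S: "finite S" and k: "bker k" and \<beta>: "0 \<le> \<beta>"
    and A: "\<And>i. A i \<in> sets borel" and B: "\<And>l. B l \<in> sets borel"
    and dA: "\<And>i j x. x \<in> A i \<Longrightarrow> x \<in> A j \<Longrightarrow> i = j" and dB: "\<And>i j x. x \<in> B i \<Longrightarrow> x \<in> B j \<Longrightarrow> i = j"
    and o: "\<And>i l. (i, l) \<in> S \<Longrightarrow> opb (kcut (A i) (B l) k) \<beta>"
    and N: "\<And>i. card {l. (i, l) \<in> S} \<le> N" "\<And>l. card {i. (i, l) \<in> S} \<le> N"
  shows "opb (\<lambda>x y. \<Sum>p\<in>S. kcut (A (fst p)) (B (snd p)) k x y) (real N * \<beta>)"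
proof (rule opb_formI)
  show bk: "bker (\<lambda>x y. \<Sum>p\<in>S. kcut (A (fst p)) (B (snd p)) k x y)"
    by (intro bker_sum bker_kcut k A B)
  show "0 \<le> real N * \<beta>" using \<beta> by simp
  fix f g assume f: "sqint f" and g: "sqint g"
  define F where "F l = nrm (\<lambda>y. indicator (B l) y * f y)" for l
  define G where "G i = nrm (\<lambda>x. indicator (A i) x * g x)" for i
  let ?K = "\<lambda>p. kcut (A (fst p)) (B (snd p)) k"
  let ?X = "cmod (ip (kop (\<lambda>x y. \<Sum>p\<in>S. ?K p x y) f) g)"
  have "kop (\<lambda>x y. \<Sum>p\<in>S. ?K p x y) f = (\<lambda>x. \<Sum>p\<in>S. kop (?K p) f x)"
    by (rule kop_sum_ker) (use bker_kcut k A B f in auto)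
  then have "ip (kop (\<lambda>x y. \<Sum>p\<in>S. ?K p x y) f) g = (\<Sum>p\<in>S. ip (kop (?K p) f) g)"
    by (simp only:) (rule ip_sum_left, use bker_kcut k A B f g kop_sqint in auto)
  then have X: "?X \<le> (\<Sum>p\<in>S. cmod (ip (kop (?K p) f) g))" by (simp add: norm_sum)
  also have "\<dots> \<le> (\<Sum>p\<in>S. \<beta> * (F (snd p) * G (fst p)))"
  proof (rule sum_mono)
    fix p assume p: "p \<in> S"
    then have "opb (?K p) \<beta>" using o[of "fst p" "snd p"] by simp
    then show "cmod (ip (kop (?K p) f) g) \<le> \<beta> * (F (snd p) * G (fst p))"
      unfolding F_def G_def
      using opb_form[OF bker_kcut[OF k A B] _ sqint_indicator_mult[OF f B] sqint_indicator_mult[OF g A]]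
      by (subst ip_kcut) (simp add: mult.assoc)
  qed
  finally have X: "?X \<le> \<beta> * (\<Sum>p\<in>S. F (snd p) * G (fst p))" by (simp add: sum_distrib_left)
  have FS: "(\<Sum>p\<in>S. (F (snd p))\<^sup>2) \<le> real N * (nrm f)\<^sup>2"
  proof -
    have "(\<Sum>p\<in>S. (F (snd p))\<^sup>2) = (\<Sum>l\<in>snd ` S. \<Sum>p\<in>{p\<in>S. snd p = l}. (F (snd p))\<^sup>2)"
      by (rule sum.group[symmetric]) (use S in auto)
    also have "\<dots> = (\<Sum>l\<in>snd ` S. real (card {p\<in>S. snd p = l}) * (F l)\<^sup>2)"
      by (intro sum.cong refl) simp
    also have "\<dots> \<le> (\<Sum>l\<in>snd ` S. real N * (F l)\<^sup>2)"
    proof (intro sum_mono mult_right_mono)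
      fix l
      have "{p\<in>S. snd p = l} = (\<lambda>i. (i, l)) ` {i. (i, l) \<in> S}" by force
      then have "card {p\<in>S. snd p = l} = card {i. (i, l) \<in> S}"
        by (simp add: card_image inj_on_def)
      then show "real (card {p\<in>S. snd p = l}) \<le> real N" using N(2)[of l] by simp
    qed simp
    also have "\<dots> = real N * (\<Sum>l\<in>snd ` S. (F l)\<^sup>2)" by (simp add: sum_distrib_left)
    also have "\<dots> \<le> real N * (nrm f)\<^sup>2"
      unfolding F_def by (intro mult_left_mono sum_nrm_restrict_le f) (use S B dB in auto)
    finally show ?thesis .
  qed
  have GS: "(\<Sum>p\<in>S. (G (fst p))\<^sup>2) \<le> real N * (nrm g)\<^sup>2"
  proof -
    have "(\<Sum>p\<in>S. (G (fst p))\<^sup>2) = (\<Sum>l\<in>fst ` S. \<Sum>p\<in>{p\<in>S. fst p = l}. (G (fst p))\<^sup>2)"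
      by (rule sum.group[symmetric]) (use S in auto)
    also have "\<dots> = (\<Sum>l\<in>fst ` S. real (card {p\<in>S. fst p = l}) * (G l)\<^sup>2)"
      by (intro sum.cong refl) simp
    also have "\<dots> \<le> (\<Sum>l\<in>fst ` S. real N * (G l)\<^sup>2)"
    proof (intro sum_mono mult_right_mono)
      fix l
      have "{p\<in>S. fst p = l} = (\<lambda>i. (l, i)) ` {i. (l, i) \<in> S}" by force
      then have "card {p\<in>S. fst p = l} = card {i. (l, i) \<in> S}"
        by (simp add: card_image inj_on_def)
      then show "real (card {p\<in>S. fst p = l}) \<le> real N" using N(1)[of l] by simp
    qed simp
    also have "\<dots> = real N * (\<Sum>l\<in>fst ` S. (G l)\<^sup>2)" by (simp add: sum_distrib_left)
    also have "\<dots> \<le> real N * (nrm g)\<^sup>2"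
      unfolding G_def by (intro mult_left_mono sum_nrm_restrict_le g) (use S A dA in auto)
    finally show ?thesis .
  qed
  have "(\<Sum>p\<in>S. F (snd p) * G (fst p)) \<le> (sqrt N * nrm f) * (sqrt N * nrm g)"
  proof (rule le_mult_if_le_weighted)
    fix t :: real assume t: "0 < t"
    have "2 * (\<Sum>p\<in>S. F (snd p) * G (fst p)) \<le> (\<Sum>p\<in>S. t * (F (snd p))\<^sup>2 + (G (fst p))\<^sup>2 / t)"
      unfolding sum_distrib_left
    proof (rule sum_mono)
      fix p
      have "2 * (F (snd p) * G (fst p)) * t \<le> (t * F (snd p))\<^sup>2 + (G (fst p))\<^sup>2"
        using sum_squares_bound[of "t * F (snd p)" "G (fst p)"] by (simp add: algebra_simps)
      then show "2 * (F (snd p) * G (fst p)) \<le> t * (F (snd p))\<^sup>2 + (G (fst p))\<^sup>2 / t"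
        using t by (simp add: field_simps power2_eq_square)
    qed
    also have "\<dots> = t * (\<Sum>p\<in>S. (F (snd p))\<^sup>2) + (\<Sum>p\<in>S. (G (fst p))\<^sup>2) / t"
      by (simp add: sum.distrib sum_distrib_left sum_divide_distrib)
    also have "\<dots> \<le> t * (real N * (nrm f)\<^sup>2) + (real N * (nrm g)\<^sup>2) / t"
      using t FS GS by (intro add_mono mult_left_mono divide_right_mono) auto
    finally show "2 * (\<Sum>p\<in>S. F (snd p) * G (fst p)) \<le> t * (sqrt N * nrm f)\<^sup>2 + (sqrt N * nrm g)\<^sup>2 / t"
      by (simp add: power_mult_distrib)
  qed auto
  also have "\<dots> = (sqrt N * sqrt N) * (nrm f * nrm g)" by (simp only: mult_ac)
  also have "\<dots> = real N * (nrm f * nrm g)" by simp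
  finally have "\<beta> * (\<Sum>p\<in>S. F (snd p) * G (fst p)) \<le> \<beta> * (real N * (nrm f * nrm g))"
    by (rule mult_left_mono[OF _ \<beta>])
  with X show "?X \<le> real N * \<beta> * nrm f * nrm g" by (simp add: mult_ac)
qed

section \<open>Cutoffs and oscillatory kernels\<close>

lemma bker_cnj: assumes "bker k" shows "bker (\<lambda>x y. cnj (k x y))"
proof -
  obtain B R where BR: "\<And>x y. cmod (k x y) \<le> B" "\<And>x y. k x y \<noteq> 0 \<Longrightarrow> \<bar>x\<bar> \<le> R \<and> \<bar>y\<bar> \<le> R"
    and m: "(\<lambda>p. k (fst p) (snd p)) \<in> borel_measurable borel"
    using assms unfolding bker_def by blast
  show ?thesis
    by (rule bkerI[OF measurable_cnj[OF m], of B R]) (use BR in simp_all)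
qed

text \<open>The width \<open>s x\<close> of the support of a row takes the place of \<open>\<delta>\<^sub>\<Omega>\<^sub>,\<^sub>h(x)\<close>, which need not be measurable in \<open>x\<close>.\<close>

locale cutoff =
  fixes \<phi> \<phi>' \<phi>'' :: "real \<Rightarrow> real \<Rightarrow> complex" and s u :: "real \<Rightarrow> real" and M :: real
  assumes ker: "bker \<phi>" and s_meas: "s \<in> borel_measurable borel" and s_nonneg: "\<And>x. 0 \<le> s x"
    and d1: "\<And>x y. (\<phi> x has_vector_derivative \<phi>' x y) (at y)"
    and d2: "\<And>x y. (\<phi>' x has_vector_derivative \<phi>'' x y) (at y)"
    and cont: "\<And>x. continuous_on UNIV (\<phi>'' x)"
    and b0: "\<And>x y. cmod (\<phi> x y) \<le> M" and b1: "\<And>x y. s x * cmod (\<phi>' x y) \<le> M"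
    and b2: "\<And>x y. (s x)\<^sup>2 * cmod (\<phi>'' x y) \<le> M"
    and supp_row: "\<And>x y. y \<notin> {u x..u x + s x} \<Longrightarrow> \<phi> x y = 0 \<and> \<phi>' x y = 0 \<and> \<phi>'' x y = 0"
    and s_zero: "\<And>x y. s x = 0 \<Longrightarrow> \<phi> x y = 0"
begin

lemma M_nonneg: "0 \<le> M"
  using order_trans[OF norm_ge_zero b0[of 0 0]] .

lemma c2_bounds_row:
  assumes "0 < s x" shows "c2_bounds I (\<phi> x) (\<phi>' x) (\<phi>'' x) M (1 / s x)"
  unfolding c2_bounds_def
proof (intro conjI ballI)
  fix y
  show "cmod (\<phi>' x y) \<le> M * (1 / s x)" "cmod (\<phi>'' x y) \<le> M * (1 / s x)\<^sup>2"
    using b1[of x y] b2[of x y] assms by (simp_all add: field_simps)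
qed (use M_nonneg assms b0 d1 d2 continuous_on_subset[OF cont] in \<open>auto intro: has_vector_derivative_at_within\<close>)

lemma cont_row: "continuous_on I (\<phi>' x)"
  by (rule continuous_on_vector_derivative[of _ _ "\<phi>'' x"]) (rule has_vector_derivative_at_within[OF d2])

text \<open>The derivative is at most \<open>M\<close> over the width on an interval of that width,
  so the width cancels. This is why a single integration by parts is insensitive to the
  cutoff.\<close>

lemma integral_row_deriv: "integral {a..b} (\<lambda>y. cmod (\<phi>' x y)) \<le> M"
proof (cases "s x = 0")
  case True
  have "\<phi>' x y = 0" for y
  proof -
    have "\<phi> x = (\<lambda>y. 0)" using s_zero[OF True] by auto
    then have "(\<phi> x has_vector_derivative 0) (at y)" by simp
    then show ?thesis using vector_derivative_unique_at[OF d1[of x y]] by simp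
  qed
  then show ?thesis using M_nonneg by simp
next
  case False
  then have s: "0 < s x" using s_nonneg[of x] by simp
  have "integral {a..b} (\<lambda>y. cmod (\<phi>' x y)) \<le> (M / s x) * (u x + s x - u x)"
  proof (rule integral_norm_le_support)
    show "cmod (\<phi>' x y) \<le> M / s x" for y using b1[of x y] s by (simp add: field_simps)
  qed (use s M_nonneg supp_row cont_row in auto)
  then show ?thesis using s by simp
qed

lemma cutoff_cnj: "cutoff (\<lambda>x y. cnj (\<phi> x y)) (\<lambda>x y. cnj (\<phi>' x y)) (\<lambda>x y. cnj (\<phi>'' x y)) s u M"
proof
  show "bker (\<lambda>x y. cnj (\<phi> x y))" by (rule bker_cnj[OF ker])
  show "((\<lambda>y. cnj (\<phi> x y)) has_vector_derivative cnj (\<phi>' x y)) (at y)" for x y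
    by (rule has_vector_derivative_cnj[OF d1])
  show "((\<lambda>y. cnj (\<phi>' x y)) has_vector_derivative cnj (\<phi>'' x y)) (at y)" for x y
    by (rule has_vector_derivative_cnj[OF d2])
  show "continuous_on UNIV (\<lambda>y. cnj (\<phi>'' x y))" for x by (intro continuous_intros cont)
qed (use s_meas s_nonneg b0 b1 b2 supp_row s_zero in auto)

end

definition osc_ker ::
  "real \<Rightarrow> complex \<Rightarrow> (nat \<times> nat) set \<Rightarrow> (nat \<Rightarrow> nat \<Rightarrow> real) \<Rightarrow> (real \<Rightarrow> real \<Rightarrow> complex) \<Rightarrow> real \<Rightarrow> real \<Rightarrow> complex" where
  "osc_ker lam z J a \<phi> x y =
     exp (\<i> * complex_of_real (lam * phase_poly J a x y)) *
     (complex_of_real \<bar>mixed_poly J a x y\<bar> powr z) * \<phi> x y"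

lemma measurable_mixed_poly [measurable]:
  "(\<lambda>p. mixed_poly J a (fst p) (snd p :: real)) \<in> borel_measurable (borel \<Otimes>\<^sub>M borel)"
  unfolding borel_prod by (intro borel_measurable_continuous_onI continuous_intros)

lemma measurable_phase_poly [measurable]:
  "(\<lambda>p. phase_poly J a (fst p) (snd p)) \<in> borel_measurable (borel \<Otimes>\<^sub>M borel)"
  unfolding borel_prod by (intro borel_measurable_continuous_onI continuous_intros)

lemma measurable_powr_abs:
  assumes [measurable]: "f \<in> borel_measurable N"
  shows "(\<lambda>p. complex_of_real \<bar>f p\<bar> powr z) \<in> borel_measurable N"
proof -
  have e: "(\<lambda>p. complex_of_real \<bar>f p\<bar> powr z)
      = (\<lambda>p. if f p = 0 then 0 else exp (z * complex_of_real (ln ((f p)\<^sup>2) / 2)))"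
    by (auto simp: powr_abs_eq_exp)
  show ?thesis unfolding e by measurable
qed

lemma bker_osc_ker:
  assumes z: "Re z = 1/2" and \<phi>: "bker \<phi>"
  shows "bker (osc_ker lam z J a \<phi>)"
proof -
  obtain B R where BR0: "0 \<le> B" "0 \<le> R"
    "\<And>x y. cmod (\<phi> x y) \<le> B * indicator {-R..R} x * indicator {-R..R} y"
    "\<And>x y. \<phi> x y \<noteq> 0 \<Longrightarrow> \<bar>x\<bar> \<le> R \<and> \<bar>y\<bar> \<le> R"
    by (rule bkerE[OF \<phi>]) (rule that; assumption)
  have "cmod (\<phi> x y) \<le> B" for x y
    by (rule order_trans[OF BR0(3)]) (use BR0(1) in \<open>auto simp: indicator_def\<close>)
  note BR = BR0(1,2) this BR0(4)
  have "compact ({-R..R} \<times> {-R..R})" by (intro compact_Times compact_Icc)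
  moreover have "continuous_on ({-R..R} \<times> {-R..R}) (\<lambda>p. mixed_poly J a (fst p) (snd p :: real))"
    by (intro continuous_intros)
  ultimately have "bounded ((\<lambda>p. mixed_poly J a (fst p) (snd p :: real)) ` ({-R..R} \<times> {-R..R}))"
    using compact_continuous_image compact_imp_bounded by blast
  then obtain C where "\<forall>v\<in>(\<lambda>p. mixed_poly J a (fst p) (snd p :: real)) ` ({-R..R} \<times> {-R..R}). norm v \<le> C"
    unfolding bounded_iff by blast
  then have C: "\<bar>mixed_poly J a (fst p) (snd p)\<bar> \<le> C" if "p \<in> {-R..R} \<times> {-R..R}" for p
    using that by fastforce
  have C0: "0 \<le> C" using C[of "(0, 0)"] BR(2) by fastforce
  show ?thesis
  proof (rule bkerI[of _ "sqrt C * B" R])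
    have "(\<lambda>p. osc_ker lam z J a \<phi> (fst p) (snd p)) \<in> borel_measurable (borel \<Otimes>\<^sub>M borel)"
      unfolding osc_ker_def
      by (intro borel_measurable_times measurable_powr_abs measurable_mixed_poly bker_measurable2[OF \<phi>]) measurable
    then show "(\<lambda>p. osc_ker lam z J a \<phi> (fst p) (snd p)) \<in> borel_measurable borel" by (simp add: borel_prod)
    show "cmod (osc_ker lam z J a \<phi> x y) \<le> sqrt C * B" for x y
    proof (cases "\<phi> x y = 0")
      case False
      then have "(x, y) \<in> {-R..R} \<times> {-R..R}" using BR(4)[of x y] by (auto simp: abs_le_iff)
      then have "\<bar>mixed_poly J a x y\<bar> \<le> C" using C[of "(x, y)"] by simp
      then show ?thesis using BR(3)[of x y] BR(1) C0
        by (auto simp: osc_ker_def norm_mult powr_half_norm[OF z] intro!: mult_mono)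
    qed (use C0 BR in \<open>simp add: osc_ker_def\<close>)
    show "osc_ker lam z J a \<phi> x y \<noteq> 0 \<Longrightarrow> \<bar>x\<bar> \<le> R \<and> \<bar>y\<bar> \<le> R" for x y
      using BR(4)[of x y] by (auto simp: osc_ker_def)
  qed
qed

lemma cnj_powr_abs: "cnj (complex_of_real \<bar>p\<bar> powr z) = complex_of_real \<bar>p\<bar> powr cnj z"
  by (cases "p = 0") (simp_all add: powr_abs_eq_exp exp_cnj)

lemma kadj_osc_ker:
  "kadj (osc_ker lam z J a \<phi>) = osc_ker (- lam) (cnj z) (flip_set J) (flip_coeff a) (\<lambda>y x. cnj (\<phi> x y))"
  by (intro ext) (simp add: kadj_def osc_ker_def mixed_poly_flip phase_poly_flip cnj_powr_abs exp_cnj)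

section \<open>The mixed derivative and the phase on a good box\<close>

lemma sign_constant:
  fixes f :: "real \<Rightarrow> real"
  assumes "continuous_on {u..v} f" "\<And>t. t \<in> {u..v} \<Longrightarrow> f t \<noteq> 0"
  shows "(\<forall>t\<in>{u..v}. 0 < f t) \<or> (\<forall>t\<in>{u..v}. f t < 0)"
proof (rule ccontr)
  assume "\<not> ?thesis"
  then obtain s t where st: "s \<in> {u..v}" "t \<in> {u..v}" "f s \<le> 0" "0 \<le> f t" by (auto simp: not_less)
  have "connected (f ` {u..v})" by (intro connected_continuous_image assms) auto
  then have "0 \<in> f ` {u..v}" using connectedD_interval[of "f ` {u..v}" "f s" "f t" 0] st by auto
  then show False using assms(2) by auto
qed

lemma abs_integral_nonvanishing:
  fixes f :: "real \<Rightarrow> real"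
  assumes f: "continuous_on {u..v} f" "\<And>t. t \<in> {u..v} \<Longrightarrow> f t \<noteq> 0"
  shows "\<bar>integral {u..v} f\<bar> = integral {u..v} (\<lambda>t. \<bar>f t\<bar>)"
  using sign_constant[OF f]
proof
  assume *: "\<forall>t\<in>{u..v}. 0 < f t"
  then have "integral {u..v} f = integral {u..v} (\<lambda>t. \<bar>f t\<bar>)" by (intro integral_cong) force
  moreover have "0 \<le> integral {u..v} (\<lambda>t. \<bar>f t\<bar>)"
    by (intro integral_nonneg integrable_continuous_real continuous_intros f) auto
  ultimately show ?thesis by simp
next
  assume *: "\<forall>t\<in>{u..v}. f t < 0"
  then have "integral {u..v} (\<lambda>t. \<bar>f t\<bar>) = integral {u..v} (\<lambda>t. - f t)" by (intro integral_cong) force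
  then have "integral {u..v} (\<lambda>t. \<bar>f t\<bar>) = - integral {u..v} f" by simp
  moreover have "0 \<le> integral {u..v} (\<lambda>t. \<bar>f t\<bar>)"
    by (intro integral_nonneg integrable_continuous_real continuous_intros f) auto
  ultimately show ?thesis by simp
qed

lemma lborel_integral_indicator_Icc:
  fixes f :: "real \<Rightarrow> complex"
  assumes "continuous_on {a..b} f"
  shows "(LINT y|lborel. indicator {a..b} y * f y) = integral {a..b} f"
proof -
  have "set_integrable lborel {a..b} f" by (rule borel_integrable_atLeastAtMost'[OF assms])
  from set_borel_integral_eq_integral(2)[OF this]
  have "(LINT y|lborel. indicator {a..b} y *\<^sub>R f y) = integral {a..b} f"
    by (simp add: set_lebesgue_integral_def)
  moreover have "indicator {a..b} y *\<^sub>R f y = indicator {a..b} y * f y" for y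
    by (simp add: indicator_def)
  ultimately show ?thesis by simp
qed

abbreviation col_poly :: "(nat \<times> nat) set \<Rightarrow> (nat \<Rightarrow> nat \<Rightarrow> real) \<Rightarrow> real \<Rightarrow> real poly" where
  "col_poly J a x \<equiv> row_poly (flip_set J) (flip_coeff a) x"

lemma poly_col: "poly (col_poly J a x) y = mixed_poly J a x y"
  by (simp add: poly_row mixed_poly_flip)

lemma poly_cpoly_col: "poly (cpoly (col_poly J a x)) w = mixed_poly J a (of_real x) w"
  by (simp add: poly_cpoly_row mixed_poly_flip)

lemma pderiv_sum: "pderiv (\<Sum>i\<in>I. f i) = (\<Sum>i\<in>I. pderiv (f i :: real poly))"
  by (induction I rule: infinite_finite_induct) (auto simp: pderiv_add)

lemma higher_pderiv_sum: "(pderiv ^^ n) (\<Sum>i\<in>I. f i) = (\<Sum>i\<in>I. (pderiv ^^ n) (f i :: real poly))"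
  by (induction n) (simp_all add: pderiv_sum)

lemma higher_pderiv_monom: "(pderiv ^^ n) (monom c q) = smult c ((pderiv ^^ n) (monom (1::real) q))"
  by (induction n) (simp_all add: pderiv_smult smult_monom)

lemma poly_higher_dy_diff:
  "poly ((pderiv ^^ n) (dy_diff_poly J a t u)) y = (\<Sum>p\<in>J. a (fst p) (snd p) * real (snd p) *
      (t ^ fst p - u ^ fst p) * poly ((pderiv ^^ n) (monom 1 (snd p - 1))) y)"
  unfolding dy_diff_poly_def higher_pderiv_sum poly_sum case_prod_unfold
  by (intro sum.cong refl, subst higher_pderiv_monom) simp

lemma poly_higher_col:
  "poly ((pderiv ^^ n) (col_poly J a t)) y = (\<Sum>p\<in>J. a (fst p) (snd p) * real (snd p) *
      (real (fst p) * t ^ (fst p - 1)) * poly ((pderiv ^^ n) (monom 1 (snd p - 1))) y)"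
  unfolding row_poly_def sum_flip higher_pderiv_sum poly_sum case_prod_unfold
  by (intro sum.cong refl, subst higher_pderiv_monom) (simp add: flip_coeff_def mult_ac)

text \<open>The fundamental theorem in the first variable after \<open>n\<close> derivatives in the
  second: bounds for derivatives of the mixed derivative, valid at every \<open>t\<close> of a
  segment, integrate to bounds for the phase difference.\<close>

lemma dy_diff_pderiv:
  assumes "u \<le> v"
  shows "((\<lambda>t. poly ((pderiv ^^ n) (col_poly J a t)) y) has_integral poly ((pderiv ^^ n) (dy_diff_poly J a v u)) y) {u..v}"
proof -
  have D: "((\<lambda>t. poly ((pderiv ^^ n) (dy_diff_poly J a t u)) y) has_real_derivative
      poly ((pderiv ^^ n) (col_poly J a t)) y) (at t within S)" for t S
    unfolding poly_higher_dy_diff poly_higher_col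
  proof (rule DERIV_sum)
    fix p
    show "((\<lambda>t. a (fst p) (snd p) * real (snd p) * (t ^ fst p - u ^ fst p) *
          poly ((pderiv ^^ n) (monom 1 (snd p - 1))) y) has_real_derivative
        a (fst p) (snd p) * real (snd p) * (real (fst p) * t ^ (fst p - 1)) *
          poly ((pderiv ^^ n) (monom 1 (snd p - 1))) y) (at t within S)"
      by (auto intro!: derivative_eq_intros)
  qed
  have z: "dy_diff_poly J a u u = 0" by (simp add: dy_diff_poly_def case_prod_unfold)
  have "((\<lambda>t. poly ((pderiv ^^ n) (col_poly J a t)) y) has_integral
      poly ((pderiv ^^ n) (dy_diff_poly J a v u)) y - poly ((pderiv ^^ n) (dy_diff_poly J a u u)) y) {u..v}"
    by (rule fundamental_theorem_of_calculus[OF assms])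
       (simp add: D has_real_derivative_iff_has_vector_derivative[symmetric])
  moreover have "(pderiv ^^ n) (0::real poly) = 0" by (induction n) auto
  ultimately show ?thesis by (simp add: z)
qed

lemma continuous_higher_pderiv_col: "continuous_on S (\<lambda>t. poly ((pderiv ^^ n) (col_poly J a t)) y)"
  unfolding poly_higher_col by (intro continuous_intros)

lemma dy_diff_poly_swap: "dy_diff_poly J a x x' = - dy_diff_poly J a x' x"
  by (rule poly_ext) (simp add: poly_dy_diff)

text \<open>Half-open pieces partition the half-line at each level, while the closed pieces
  \<open>ivl\<close> serve for estimates and integrals.\<close>

definition hivl :: "int \<Rightarrow> nat \<Rightarrow> nat \<Rightarrow> real set" where
  "hivl j m i = {real i * side j m..<(real i + 1) * side j m}"

lemma hivl_subset: "hivl j m i \<subseteq> ivl j m i"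
  by (auto simp: hivl_def ivl_def)

lemma hivl_borel [measurable]: "hivl j m i \<in> sets borel"
  by (simp add: hivl_def)

lemma hivl_iff: "0 \<le> x \<Longrightarrow> x \<in> hivl j m i \<longleftrightarrow> idx j m x = i"
  by (auto simp: idx_eq_iff hivl_def)

lemma hivl_nonneg: assumes "x \<in> hivl j m i" shows "0 \<le> x"
proof -
  have "0 \<le> real i * side j m" by (intro mult_nonneg_nonneg less_imp_le[OF side_pos]) simp
  then show ?thesis using assms by (simp add: hivl_def)
qed

lemma hivl_disjoint: "x \<in> hivl j m i \<Longrightarrow> x \<in> hivl j m i' \<Longrightarrow> i = i'"
  using hivl_iff[OF hivl_nonneg] by metis

context qh_data
begin

lemma good_far_root_col:
  assumes g: "good J a j k m i l" and x: "x \<in> ivl j m i"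
    and y: "(real l - 1) * side k m \<le> y" "y \<le> (real l + 2) * side k m"
    and r: "mixed_poly J a (of_real x) r = 0"
  shows "side k m \<le> cmod (of_real y - r)"
proof (rule ccontr)
  assume *: "\<not> ?thesis"
  have "near_ivl j m i (of_real x)"
    unfolding near_ivl_def by (intro bexI[OF _ x]) (simp add: less_imp_le)
  moreover have "near_ivl k m l r"
  proof -
    define y0 where "y0 = max (real l * side k m) (min y ((real l + 1) * side k m))"
    have "y0 \<in> ivl k m l" by (auto simp: y0_def ivl_def max_def min_def mult_right_mono)
    moreover have "\<bar>y - y0\<bar> \<le> side k m"
      using y side_pos[of k m] unfolding y0_def by (auto simp: max_def min_def algebra_simps)
    then have "cmod (of_real y - of_real y0) \<le> side k m" by (metis norm_of_real of_real_diff)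
    then have "cmod (r - of_real y0) \<le> 2 * side k m"
      using * norm_triangle_ineq[of "r - of_real y" "of_real y - of_real y0"] norm_minus_commute[of "of_real y" r] by simp
    ultimately show ?thesis unfolding near_ivl_def by auto
  qed
  ultimately show False using g r unfolding good_def by blast
qed

lemma col_nonzero: "x \<noteq> 0 \<Longrightarrow> col_poly J a x \<noteq> 0"
  using qh_data.row_nonzero[OF flip] .

lemma degree_col: "degree (col_poly J a x) \<le> D"
  using qh_data.degree_row[OF flip] .

lemma power_degree_le: "1 \<le> K \<Longrightarrow> degree (p :: complex poly) \<le> D \<Longrightarrow> 0 \<le> X \<Longrightarrow> K ^ degree p * X \<le> K ^ D * (X::real)"
  by (intro mult_right_mono power_increasing) auto

text \<open>Moving by at most one side in \<open>x\<close> costs a factor 2 per root, and moving by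
  at most three sides in \<open>y\<close> a factor 4, together \<open>8 ^ D\<close>. The vertical
  coordinate ranges over the interval tripled about its centre, where the roots are still one side
  away.\<close>

lemma good_comparable:
  assumes g: "good J a j k m i l" and i: "0 < i" and l: "1 < l"
    and x: "x \<in> ivl j m i" "x' \<in> ivl j m i"
    and y: "(real l - 1) * side k m \<le> y" "y \<le> (real l + 2) * side k m"
    and y': "(real l - 1) * side k m \<le> y'" "y' \<le> (real l + 2) * side k m"
  shows "\<bar>mixed_poly J a x y\<bar> \<le> 8 ^ D * \<bar>mixed_poly J a x' y'\<bar>"
    and "mixed_poly J a x y \<noteq> 0"
    and "\<bar>poly (pderiv (col_poly J a x)) y\<bar> \<le> real D / side k m * \<bar>mixed_poly J a x y\<bar>"
    and "\<bar>poly (pderiv (pderiv (col_poly J a x))) y\<bar> \<le> (real D / side k m)\<^sup>2 * \<bar>mixed_poly J a x y\<bar>"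
proof -
  have x0: "x \<noteq> 0" "x' \<noteq> 0" and yp: "0 < y" "0 < y'"
  proof -
    have "0 < real i * side j m" using i by simp
    then show "x \<noteq> 0" "x' \<noteq> 0" using x by (auto simp: ivl_def)
    have "0 < (real l - 1) * side k m" using l by simp
    then show "0 < y" "0 < y'" using y y' by auto
  qed
  let ?c = "cpoly (col_poly J a x)" and ?c' = "cpoly (col_poly J a x')" and ?r = "cpoly (row_poly J a y)"
  have c0: "?c \<noteq> 0" "?c' \<noteq> 0" using col_nonzero x0 by (auto simp: cpoly_eq_0_iff)
  have r0: "?r \<noteq> 0" using row_nonzero yp by (auto simp: cpoly_eq_0_iff)
  have far: "side k m \<le> cmod (of_real v - r)" if "poly (cpoly (col_poly J a u)) r = 0" "u \<in> ivl j m i"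
      "(real l - 1) * side k m \<le> v" "v \<le> (real l + 2) * side k m" for u v r
    using good_far_root_col[OF g that(2,3,4)] that(1) by (simp add: poly_cpoly_col)
  have farx: "side j m \<le> cmod (of_real u - r)" if "poly ?r r = 0" "u \<in> ivl j m i" for u r
    using good_far_root[OF g that(2) y] that(1) by (simp add: poly_cpoly_row)
  have vals: "cmod (poly (cpoly (col_poly J a u)) (of_real v)) = \<bar>mixed_poly J a u v\<bar>" for u v
    by (simp add: poly_cpoly_of_real poly_col)
  have dist: "\<bar>v - v'\<bar> \<le> 3 * side k m" if "(real l - 1) * side k m \<le> v" "v \<le> (real l + 2) * side k m"
    "(real l - 1) * side k m \<le> v'" "v' \<le> (real l + 2) * side k m" for v v'
    using that by (auto simp: algebra_simps abs_le_iff)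
  have "\<bar>mixed_poly J a x y\<bar> \<le> (1 + 1) ^ degree ?r * \<bar>mixed_poly J a x' y\<bar>"
    using poly_le_shift[OF r0, of "side j m" "of_real x'" 1 "of_real x"] farx x
    by (simp add: poly_cpoly_row mixed_poly_of_real ivl_def abs_le_iff algebra_simps flip: of_real_diff)
  also have "\<dots> \<le> 2 ^ D * \<bar>mixed_poly J a x' y\<bar>"
    using power_degree_le[of "1+1" ?r "\<bar>mixed_poly J a x' y\<bar>"] degree_row[of y] by (simp add: degree_cpoly)
  also have "\<bar>mixed_poly J a x' y\<bar> \<le> (1 + 3) ^ degree ?c' * \<bar>mixed_poly J a x' y'\<bar>"
    using poly_le_shift[OF c0(2), of "side k m" "of_real y'" 3 "of_real y"] far x y' dist[OF y y']
    by (simp add: vals flip: of_real_diff)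
  also have "\<dots> \<le> 4 ^ D * \<bar>mixed_poly J a x' y'\<bar>"
    using power_degree_le[of "1+3" ?c' "\<bar>mixed_poly J a x' y'\<bar>"] degree_col[of x'] by (simp add: degree_cpoly)
  finally have "\<bar>mixed_poly J a x y\<bar> \<le> (2 ^ D * 4 ^ D) * \<bar>mixed_poly J a x' y'\<bar>" by simp
  then show "\<bar>mixed_poly J a x y\<bar> \<le> 8 ^ D * \<bar>mixed_poly J a x' y'\<bar>"
    by (simp flip: power_mult_distrib)
  show "mixed_poly J a x y \<noteq> 0"
  proof
    assume "mixed_poly J a x y = 0"
    then have "poly ?c (of_real y) = 0" by (simp add: poly_cpoly_of_real poly_col)
    from far[OF this x(1) y] show False using side_pos[of k m] by simp
  qed
  have d: "real (degree ?c) \<le> real D" using degree_col[of x] by (simp add: degree_cpoly)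
  note pd = poly_deriv_le[OF c0(1), of "side k m" "of_real y"]
  have "\<bar>poly (pderiv (col_poly J a x)) y\<bar> \<le> real (degree ?c) / side k m * \<bar>mixed_poly J a x y\<bar>"
    using pd(1) far x(1) y by (simp add: pderiv_cpoly poly_cpoly_of_real poly_col)
  also have "\<dots> \<le> real D / side k m * \<bar>mixed_poly J a x y\<bar>"
    using d by (intro mult_right_mono divide_right_mono) (auto simp: less_imp_le)
  finally show "\<bar>poly (pderiv (col_poly J a x)) y\<bar> \<le> real D / side k m * \<bar>mixed_poly J a x y\<bar>" .
  have "\<bar>poly (pderiv (pderiv (col_poly J a x))) y\<bar> \<le> (real (degree ?c) / side k m)\<^sup>2 * \<bar>mixed_poly J a x y\<bar>"
    using pd(2) far x(1) y by (simp add: pderiv_cpoly poly_cpoly_of_real poly_col)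
  also have "\<dots> \<le> (real D / side k m)\<^sup>2 * \<bar>mixed_poly J a x y\<bar>"
    using d by (intro mult_right_mono divide_right_mono power_mono) (auto simp: less_imp_le)
  finally show "\<bar>poly (pderiv (pderiv (col_poly J a x))) y\<bar> \<le> (real D / side k m)\<^sup>2 * \<bar>mixed_poly J a x y\<bar>" .
qed

text \<open>On the box the mixed derivative has no zero, so the absolute phase difference is the
  integral of its absolute value. The lower bound and both relative derivative bounds of
  \<open>good_comparable\<close> can therefore be integrated over the segment.\<close>

lemma good_phase_bounds:
  assumes g: "good J a j k m i l" and i: "0 < i" and l: "1 < l"
    and x: "x \<in> ivl j m i" "x' \<in> ivl j m i" and x0: "x0 \<in> ivl j m i"
    and y: "(real l - 1) * side k m \<le> y" "y \<le> (real l + 2) * side k m"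
    and y0: "(real l - 1) * side k m \<le> y0" "y0 \<le> (real l + 2) * side k m"
  shows "\<bar>x - x'\<bar> * \<bar>mixed_poly J a x0 y0\<bar> / 8 ^ D \<le> \<bar>poly (dy_diff_poly J a x x') y\<bar>"
    and "\<bar>poly (pderiv (dy_diff_poly J a x x')) y\<bar> \<le> real D / side k m * \<bar>poly (dy_diff_poly J a x x') y\<bar>"
    and "\<bar>poly (pderiv (pderiv (dy_diff_poly J a x x'))) y\<bar> \<le> (real D / side k m)\<^sup>2 * \<bar>poly (dy_diff_poly J a x x') y\<bar>"
proof -
  have main: "(v - u) * \<bar>mixed_poly J a x0 y0\<bar> / 8 ^ D \<le> \<bar>poly (dy_diff_poly J a v u) y\<bar> \<and>
    \<bar>poly (pderiv (dy_diff_poly J a v u)) y\<bar> \<le> real D / side k m * \<bar>poly (dy_diff_poly J a v u) y\<bar> \<and>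
    \<bar>poly (pderiv (pderiv (dy_diff_poly J a v u))) y\<bar> \<le> (real D / side k m)\<^sup>2 * \<bar>poly (dy_diff_poly J a v u) y\<bar>"
    if uv: "u \<le> v" "u \<in> ivl j m i" "v \<in> ivl j m i" for u v
  proof (intro conjI)
    have t: "t \<in> ivl j m i" if "t \<in> {u..v}" for t using that uv by (auto simp: ivl_def)
    note cmp = good_comparable[OF g i l]
    have pc: "continuous_on {u..v} (\<lambda>t. mixed_poly J a t y)" by (intro continuous_intros)
    have I0: "integral {u..v} (\<lambda>t. mixed_poly J a t y) = poly (dy_diff_poly J a v u) y"
      using integral_unique[OF dy_diff_pderiv[OF uv(1), of 0 J a y]] by (simp add: poly_col)
    have eq: "\<bar>poly (dy_diff_poly J a v u) y\<bar> = integral {u..v} (\<lambda>t. \<bar>mixed_poly J a t y\<bar>)"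
      unfolding I0[symmetric]
      by (rule abs_integral_nonvanishing[OF pc]) (rule cmp(2)[OF t x0 y y0])
    have "(v - u) * (\<bar>mixed_poly J a x0 y0\<bar> / 8 ^ D) = integral {u..v} (\<lambda>t. \<bar>mixed_poly J a x0 y0\<bar> / 8 ^ D)"
      using uv by simp
    also have "\<dots> \<le> integral {u..v} (\<lambda>t. \<bar>mixed_poly J a t y\<bar>)"
    proof (intro integral_le integrable_continuous_real continuous_intros pc)
      fix t' assume "t' \<in> {u..v}"
      then show "\<bar>mixed_poly J a x0 y0\<bar> / 8 ^ D \<le> \<bar>mixed_poly J a t' y\<bar>"
        using cmp(1)[OF x0 t y0 y] by (simp add: pos_divide_le_eq mult.commute)
    qed
    finally show "(v - u) * \<bar>mixed_poly J a x0 y0\<bar> / 8 ^ D \<le> \<bar>poly (dy_diff_poly J a v u) y\<bar>"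
      by (simp add: eq)
    have gen: "\<bar>poly ((pderiv ^^ n) (dy_diff_poly J a v u)) y\<bar> \<le> c * \<bar>poly (dy_diff_poly J a v u) y\<bar>"
      if c: "\<And>t. t \<in> {u..v} \<Longrightarrow> \<bar>poly ((pderiv ^^ n) (col_poly J a t)) y\<bar> \<le> c * \<bar>mixed_poly J a t y\<bar>" for n c
    proof -
      have "\<bar>poly ((pderiv ^^ n) (dy_diff_poly J a v u)) y\<bar> = norm (integral {u..v} (\<lambda>t. poly ((pderiv ^^ n) (col_poly J a t)) y))"
        using integral_unique[OF dy_diff_pderiv[OF uv(1), of n J a y]] by simp
      also have "\<dots> \<le> integral {u..v} (\<lambda>t. c * \<bar>mixed_poly J a t y\<bar>)"
        by (rule integral_norm_bound_integral)
           (use c in \<open>auto intro!: integrable_continuous_real continuous_higher_pderiv_col continuous_intros pc\<close>)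
      also have "\<dots> = c * \<bar>poly (dy_diff_poly J a v u) y\<bar>" by (simp add: eq)
      finally show ?thesis .
    qed
    show "\<bar>poly (pderiv (dy_diff_poly J a v u)) y\<bar> \<le> real D / side k m * \<bar>poly (dy_diff_poly J a v u) y\<bar>"
      using gen[of 1 "real D / side k m"] cmp(3)[OF t x0 y y0] by simp
    show "\<bar>poly (pderiv (pderiv (dy_diff_poly J a v u))) y\<bar> \<le> (real D / side k m)\<^sup>2 * \<bar>poly (dy_diff_poly J a v u) y\<bar>"
      using gen[of 2 "(real D / side k m)\<^sup>2"] cmp(4)[OF t x0 y y0] by (simp add: numeral_2_eq_2)
  qed
  have "\<bar>x - x'\<bar> * \<bar>mixed_poly J a x0 y0\<bar> / 8 ^ D \<le> \<bar>poly (dy_diff_poly J a x x') y\<bar> \<and>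
    \<bar>poly (pderiv (dy_diff_poly J a x x')) y\<bar> \<le> real D / side k m * \<bar>poly (dy_diff_poly J a x x') y\<bar> \<and>
    \<bar>poly (pderiv (pderiv (dy_diff_poly J a x x'))) y\<bar> \<le> (real D / side k m)\<^sup>2 * \<bar>poly (dy_diff_poly J a x x') y\<bar>"
  proof (cases "x' \<le> x")
    case True
    then show ?thesis using main[OF True x(2) x(1)] by simp
  next
    case False
    then have "x \<le> x'" by simp
    from main[OF this x] False show ?thesis
      by (simp add: dy_diff_poly_swap[of J a x x'] pderiv_minus)
  qed
  then show "\<bar>x - x'\<bar> * \<bar>mixed_poly J a x0 y0\<bar> / 8 ^ D \<le> \<bar>poly (dy_diff_poly J a x x') y\<bar>"
    and "\<bar>poly (pderiv (dy_diff_poly J a x x')) y\<bar> \<le> real D / side k m * \<bar>poly (dy_diff_poly J a x x') y\<bar>"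
    and "\<bar>poly (pderiv (pderiv (dy_diff_poly J a x x'))) y\<bar> \<le> (real D / side k m)\<^sup>2 * \<bar>poly (dy_diff_poly J a x x') y\<bar>"
    by auto
qed

end

text \<open>The two hypotheses are the two regimes of \<open>pois\<close>: the first is used near
  the diagonal, the second away from it.\<close>

lemma le_two_pois:
  assumes d: "0 < d" and c: "0 \<le> c" and 1: "X \<le> c * d" and 2: "t \<noteq> 0 \<Longrightarrow> X \<le> c / (d * t\<^sup>2)"
  shows "X \<le> 2 * c * pois d t"
proof (cases "d * \<bar>t\<bar> \<le> 1")
  case True
  then have "d / 2 \<le> pois d t" using pois_ge_half d by simp
  from mult_left_mono[OF this c] 1 show ?thesis by simp
next
  case False
  then have t: "t \<noteq> 0" by auto
  have "1 / (2 * d * t\<^sup>2) \<le> pois d t" using pois_ge_inverse[of d t] False d by simp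
  from mult_left_mono[OF this c] have "c * (1 / (2 * d * t\<^sup>2)) \<le> c * pois d t" .
  moreover have "c / (d * t\<^sup>2) = 2 * (c * (1 / (2 * d * t\<^sup>2)))" by simp
  ultimately show ?thesis using 2[OF t] by linarith
qed

text \<open>A polynomial in place of a smooth bump. It vanishes at the ends of the tripled interval
  and is at least 1 on the middle third; since it occurs twice in the kernel of
  \<open>T T\<^sup>*\<close>, the amplitude vanishes there together with its first derivative, as
  \<open>oscillatory_two_steps\<close> requires.\<close>

lemma c2_bounds_of_real_quadratic:
  assumes B: "0 < B"
  shows "c2_bounds {b..b + 3 * B} (\<lambda>y. complex_of_real ((y - b) * (b + 3 * B - y) / B\<^sup>2))
    (\<lambda>y. complex_of_real ((2 * b + 3 * B - 2 * y) / B\<^sup>2)) (\<lambda>y. complex_of_real (- 2 / B\<^sup>2)) 3 (1 / B)"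
  unfolding c2_bounds_def
proof (intro conjI ballI)
  fix y assume y: "y \<in> {b..b + 3 * B}"
  have r1: "((\<lambda>y. (y - b) * (b + 3 * B - y) / B\<^sup>2) has_real_derivative (2 * b + 3 * B - 2 * y) / B\<^sup>2) (at y within {b..b + 3 * B})"
    by (rule DERIV_cdivide) (auto intro!: derivative_eq_intros simp: algebra_simps)
  have r2: "((\<lambda>y. (2 * b + 3 * B - 2 * y) / B\<^sup>2) has_real_derivative (- 2 / B\<^sup>2)) (at y within {b..b + 3 * B})"
    by (rule DERIV_cdivide) (auto intro!: derivative_eq_intros)
  show "((\<lambda>y. complex_of_real ((y - b) * (b + 3 * B - y) / B\<^sup>2)) has_vector_derivative
      complex_of_real ((2 * b + 3 * B - 2 * y) / B\<^sup>2)) (at y within {b..b + 3 * B})"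
    by (rule has_vector_derivative_of_real[OF r1])
  show "((\<lambda>y. complex_of_real ((2 * b + 3 * B - 2 * y) / B\<^sup>2)) has_vector_derivative
      complex_of_real (- 2 / B\<^sup>2)) (at y within {b..b + 3 * B})"
    by (rule has_vector_derivative_of_real[OF r2])
  have "(y - b) * (b + 3 * B - y) \<le> 3 * B\<^sup>2"
  proof -
    have "0 \<le> (2 * (y - b) - 3 * B)\<^sup>2" by simp
    then have "4 * ((y - b) * (b + 3 * B - y)) \<le> 9 * B\<^sup>2" by (simp add: power2_eq_square algebra_simps)
    moreover have "0 \<le> B\<^sup>2" by simp
    ultimately show ?thesis by linarith
  qed
  moreover have "0 \<le> (y - b) * (b + 3 * B - y)" using y by auto
  ultimately show "cmod (complex_of_real ((y - b) * (b + 3 * B - y) / B\<^sup>2)) \<le> 3"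
    using B unfolding norm_of_real by (simp add: abs_divide pos_divide_le_eq)
  have "\<bar>2 * b + 3 * B - 2 * y\<bar> \<le> 3 * B" using y by auto
  then show "cmod (complex_of_real ((2 * b + 3 * B - 2 * y) / B\<^sup>2)) \<le> 3 * (1 / B)"
    using B unfolding norm_of_real by (simp add: abs_divide divide_simps power2_eq_square)
  show "cmod (complex_of_real (- 2 / B\<^sup>2)) \<le> 3 * (1 / B)\<^sup>2"
    using B unfolding norm_of_real by (simp add: abs_divide divide_simps)
qed (use B in auto)

text \<open>54 is the product of the 2 of \<open>oscillatory_two_steps\<close>, the squared bound 3
  of the quadratic weight, and a support of length three times \<delta>. Of the powers of 8, one
  comes from the size of the amplitude and two from the squared phase derivative; the last square
  bounds the derivative scale.\<close>

definition kernel_const :: "nat \<Rightarrow> real" where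
  "kernel_const D = 54 * 8 ^ (3 * D) * (4 * real D + 4)\<^sup>2"

text \<open>The \<open>64 * pi\<close> of \<open>opb_pois\<close>, doubled by
  \<open>le_two_pois\<close>; the root passes from \<open>T T\<^sup>*\<close> to
  \<open>T\<close>.\<close>

definition box_const :: "nat \<Rightarrow> real" where
  "box_const D = sqrt (128 * pi * kernel_const D)"

section \<open>The operator on a single box\<close>

lemma osc_ker_mult_cnj:
  "osc_ker lam z J a \<phi> x y * cnj (osc_ker lam z J a \<phi> x' y)
    = exp (\<i> * complex_of_real (lam * (phase_poly J a x y - phase_poly J a x' y))) *
      (((complex_of_real \<bar>mixed_poly J a x y\<bar> powr z) * (complex_of_real \<bar>mixed_poly J a x' y\<bar> powr cnj z)) *
       (\<phi> x y * cnj (\<phi> x' y)))"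
proof -
  have "exp (\<i> * complex_of_real (lam * (phase_poly J a x y - phase_poly J a x' y)))
    = exp (\<i> * complex_of_real (lam * phase_poly J a x y)) * cnj (exp (\<i> * complex_of_real (lam * phase_poly J a x' y)))"
    by (simp add: exp_cnj exp_add[symmetric] algebra_simps)
  then show ?thesis by (simp add: osc_ker_def cnj_powr_abs mult_ac)
qed

lemma phase_diff_deriv:
  "((\<lambda>y. phase_poly J a x y - phase_poly J a x' y) has_real_derivative poly (dy_diff_poly J a x x') y) (at y within S)"
  unfolding poly_dy_diff by (intro DERIV_diff phase_poly_dy)

context qh_data
begin

text \<open>\<mu> is the size of the mixed derivative on the box and \<delta> the smallest of the
  three lengths on which the amplitude varies: the two row widths and the side. The trivial bound is
  of order \<mu> times \<delta>. Each integration by parts divides by \<open>lam\<close>, \<mu> and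
  the distance of \<open>x\<close> and \<open>x'\<close>, and costs a factor of order
  \<open>(1 + cmod z) / \<delta>\<close>. Both bounds together have the shape of \<open>pois\<close>
  with height proportional to the minimum of the two scales, as \<open>opb_pois\<close>
  demands.\<close>

lemma box_kernel_bound:
  fixes i l :: nat
  assumes c: "cell J a j k m i l" and cut: "cutoff \<phi> \<phi>' \<phi>'' s u M" and lam: "lam \<noteq> 0" and z: "Re z = 1/2"
  defines "B \<equiv> side k m"
  defines "b \<equiv> (real l - 1) * side k m"
  defines "w0 \<equiv> \<lambda>y. (y - b) * (b + 3 * B - y) / B\<^sup>2"
  defines "\<mu> \<equiv> \<bar>mixed_poly J a (real i * side j m) (real l * side k m)\<bar>"
  assumes x: "x \<in> ivl j m i" "x' \<in> ivl j m i" and s: "0 < s x" "0 < s x'"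
  defines "\<delta> \<equiv> min (min (s x) (s x')) B"
  defines "V \<equiv> cmod (integral {b..b + 3 * B} (\<lambda>y. of_real (w0 y) * of_real (w0 y) *
      (osc_ker lam z J a \<phi> x y * cnj (osc_ker lam z J a \<phi> x' y))))"
  defines "Q \<equiv> kernel_const D * (1 + cmod z)\<^sup>2 * M\<^sup>2"
  shows "V \<le> 2 * (Q / \<bar>lam\<bar>) * pois (\<bar>lam\<bar> * \<mu> * \<delta>) (x - x')"
proof -
  interpret cutoff \<phi> \<phi>' \<phi>'' s u M by (rule cut)
  have g: "good J a j k m i l" and il: "0 < i" "1 < l"
  proof -
    have "(16::nat) \<le> 2 ^ m" using c power_increasing[of 4 m "2::nat"] by (simp add: cell_def)
    then show "good J a j k m i l" "0 < i" "1 < l" using c by (auto simp: cell_def)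
  qed
  have B: "0 < B" by (simp add: B_def)
  define I where "I = {b..b + 3 * B}"
  have yI: "(real l - 1) * side k m \<le> y \<and> y \<le> (real l + 2) * side k m" if "y \<in> I" for y
    using that by (auto simp: I_def b_def B_def algebra_simps)
  have y0I: "(real l - 1) * side k m \<le> real l * side k m" "real l * side k m \<le> (real l + 2) * side k m"
    by (intro mult_right_mono less_imp_le[OF side_pos]; simp)+
  have x0I: "real i * side j m \<in> ivl j m i" by (simp add: ivl_def mult_right_mono)
  note cmp = good_comparable[OF g il]
  note ph = good_phase_bounds[OF g il x x0I _ _ y0I]
  define m0 where "m0 = 8 ^ D * \<mu>"
  have \<mu>: "0 < \<mu>" using cmp(2)[OF x0I x0I y0I y0I] by (simp add: \<mu>_def)
  have m0: "0 \<le> m0" using \<mu> by (simp add: m0_def)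
  define \<nu> where "\<nu> = real D / B"
  have \<nu>: "0 \<le> \<nu>" using B by (simp add: \<nu>_def)
  define Z where "Z = cmod z"
  have Z: "0 \<le> Z" by (simp add: Z_def)
  have pw: "\<exists>v' v''. c2_bounds I (\<lambda>y. complex_of_real \<bar>mixed_poly J a v y\<bar> powr w) v' v'' (sqrt m0) ((1 + cmod w) * \<nu>)"
    if v: "v \<in> ivl j m i" and w: "Re w = 1/2" for v w
  proof -
    have d: "((\<lambda>y. mixed_poly J a v y) has_real_derivative poly (pderiv (col_poly J a v)) y) (at y within I)" for y
      unfolding poly_col[symmetric] by (rule has_field_derivative_at_within[OF poly_DERIV])
    have d2: "((\<lambda>y. poly (pderiv (col_poly J a v)) y) has_real_derivative poly (pderiv (pderiv (col_poly J a v))) y) (at y within I)" for y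
      by (rule has_field_derivative_at_within[OF poly_DERIV])
    obtain v' v'' where "c2_bounds I (\<lambda>y. complex_of_real \<bar>mixed_poly J a v y\<bar> powr w) v' v'' (sqrt m0) ((1 + cmod w) * \<nu>)"
    proof (rule c2_bounds_powr[OF d d2 _ _ _ m0 \<nu> _ _ w])
      show "continuous_on I (poly (pderiv (pderiv (col_poly J a v))))" by (intro continuous_intros)
      fix y assume "y \<in> I"
      note y = yI[OF this]
      show "mixed_poly J a v y \<noteq> 0" using cmp(2)[OF v x0I _ _ y0I] y by simp
      show "\<bar>mixed_poly J a v y\<bar> \<le> m0" using cmp(1)[OF v x0I _ _ y0I] y by (simp add: m0_def \<mu>_def)
      show "\<bar>poly (pderiv (col_poly J a v)) y\<bar> \<le> \<nu> * \<bar>mixed_poly J a v y\<bar>"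
        using cmp(3)[OF v x0I _ _ y0I] y by (simp add: \<nu>_def B_def)
      show "\<bar>poly (pderiv (pderiv (col_poly J a v))) y\<bar> \<le> \<nu>\<^sup>2 * \<bar>mixed_poly J a v y\<bar>"
        using cmp(4)[OF v x0I _ _ y0I] y by (simp add: \<nu>_def B_def)
    qed blast
    then show ?thesis by blast
  qed
  obtain f1' f1'' where f1: "c2_bounds I (\<lambda>y. complex_of_real \<bar>mixed_poly J a x y\<bar> powr z) f1' f1'' (sqrt m0) ((1 + Z) * \<nu>)"
    using pw[OF x(1) z] by (auto simp: Z_def)
  obtain f2' f2'' where f2: "c2_bounds I (\<lambda>y. complex_of_real \<bar>mixed_poly J a x' y\<bar> powr cnj z) f2' f2'' (sqrt m0) ((1 + Z) * \<nu>)"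
    using pw[OF x(2), of "cnj z"] z by (auto simp: Z_def)
  note f12 = c2_bounds_mult[OF f1 f2]
  have p1: "c2_bounds I (\<phi> x) (\<phi>' x) (\<phi>'' x) M (1 / s x)" by (rule c2_bounds_row[OF s(1)])
  have p2: "c2_bounds I (\<lambda>y. cnj (\<phi> x' y)) (\<lambda>y. cnj (\<phi>' x' y)) (\<lambda>y. cnj (\<phi>'' x' y)) M (1 / s x')"
    by (rule cutoff.c2_bounds_row[OF cutoff_cnj s(2)])
  note p12 = c2_bounds_mult[OF p1 p2]
  have w: "c2_bounds I (\<lambda>y. complex_of_real (w0 y)) (\<lambda>y. complex_of_real ((2 * b + 3 * B - 2 * y) / B\<^sup>2))
      (\<lambda>y. complex_of_real (- 2 / B\<^sup>2)) 3 (1 / B)"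
    unfolding I_def w0_def by (rule c2_bounds_of_real_quadratic[OF B])
  note ww = c2_bounds_mult[OF w w]
  note tot = c2_bounds_mult[OF c2_bounds_mult[OF f12 p12] ww]
  define U where "U = 9 * m0 * M\<^sup>2"
  have U: "(sqrt m0 * sqrt m0) * (M * M) * (3 * 3) = U"
    using m0 by (simp add: U_def power2_eq_square)
  have \<delta>: "0 < \<delta>" "\<delta> \<le> s x" "\<delta> \<le> s x'" "\<delta> \<le> B" using s B by (auto simp: \<delta>_def)
  define \<kappa> where "\<kappa> = ((1 + Z) * \<nu> + (1 + Z) * \<nu> + (1 / s x + 1 / s x')) + (1 / B + 1 / B)"
  have inv: "1 / s x \<le> 1 / \<delta>" "1 / s x' \<le> 1 / \<delta>" "1 / B \<le> 1 / \<delta>"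
    using \<delta> by (auto intro!: divide_left_mono)
  have \<kappa>0: "0 \<le> \<kappa>" unfolding \<kappa>_def using Z \<nu> s B by (intro add_nonneg_nonneg mult_nonneg_nonneg) auto
  have \<nu>\<delta>: "\<nu> \<le> real D * (1 / \<delta>)"
    using mult_left_mono[OF inv(3), of "real D"] by (simp add: \<nu>_def)
  have \<kappa>: "\<kappa> + 2 * \<nu> \<le> (4 * real D + 4) * (1 + Z) / \<delta>"
  proof -
    have "(1 + Z) * \<nu> \<le> (1 + Z) * (real D * (1 / \<delta>))" using \<nu>\<delta> Z by (intro mult_left_mono) auto
    then have "\<kappa> + 2 * \<nu> \<le> 2 * ((1 + Z) * (real D * (1 / \<delta>))) + 4 * (1 / \<delta>) + 2 * (real D * (1 / \<delta>))"
      unfolding \<kappa>_def using inv \<nu>\<delta> by linarith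
    also have "\<dots> = (2 * real D * (1 + Z) + 4 + 2 * real D) * (1 / \<delta>)" by (simp add: algebra_simps add_divide_distrib)
    also have "\<dots> \<le> ((4 * real D + 4) * (1 + Z)) * (1 / \<delta>)"
      using \<delta> Z by (intro mult_right_mono) (auto simp: algebra_simps)
    finally show ?thesis by simp
  qed
  \<comment> \<open>When \<delta> is one of the row widths, the support of that row is taken; when
    it is the side, the whole tripled interval.\<close>
  obtain c1 c2 where cc: "c1 \<le> c2" "c2 - c1 \<le> 3 * \<delta>"
    "\<And>y. y \<in> I \<Longrightarrow> y \<notin> {c1..c2} \<Longrightarrow> (\<phi> x y = 0 \<and> \<phi>' x y = 0 \<and> \<phi>'' x y = 0) \<or> (\<phi> x' y = 0 \<and> \<phi>' x' y = 0 \<and> \<phi>'' x' y = 0)"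
  proof -
    have "\<delta> = s x \<or> \<delta> = s x' \<or> \<delta> = B" by (auto simp: \<delta>_def min_def)
    then consider "\<delta> = s x" | "\<delta> = s x'" | "\<delta> = B" by blast
    then show ?thesis
    proof cases
      case 1
      show ?thesis by (rule that[of "u x" "u x + s x"]) (use 1 s supp_row in auto)
    next
      case 2
      show ?thesis by (rule that[of "u x'" "u x' + s x'"]) (use 2 s supp_row in auto)
    next
      case 3
      show ?thesis by (rule that[of b "b + 3 * B"]) (use 3 B in \<open>auto simp: I_def\<close>)
    qed
  qed
  define \<Phi> where "\<Phi> y = phase_poly J a x y - phase_poly J a x' y" for y
  define \<alpha> where "\<alpha> y = (complex_of_real \<bar>mixed_poly J a x y\<bar> powr z) * (complex_of_real \<bar>mixed_poly J a x' y\<bar> powr cnj z) *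
      (\<phi> x y * cnj (\<phi> x' y)) * (complex_of_real (w0 y) * complex_of_real (w0 y))" for y
  have Veq: "V = cmod (integral I (\<lambda>y. exp (\<i> * complex_of_real (lam * \<Phi> y)) * \<alpha> y))"
    unfolding V_def I_def osc_ker_mult_cnj \<alpha>_def \<Phi>_def by (simp add: mult_ac)
  obtain \<alpha>' \<alpha>'' where \<alpha>: "c2_bounds I \<alpha> \<alpha>' \<alpha>'' U \<kappa>"
    and bd: "\<alpha> b = 0" "\<alpha> (b + 3 * B) = 0" "\<alpha>' b = 0" "\<alpha>' (b + 3 * B) = 0"
    and sp: "\<And>y. y \<in> I \<Longrightarrow> y \<notin> {c1..c2} \<Longrightarrow> \<alpha> y = 0 \<and> \<alpha>' y = 0 \<and> \<alpha>'' y = 0"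
    by (rule that[OF tot[unfolded U, folded \<kappa>_def \<alpha>_def[abs_def]]])
       (use cc(3) in \<open>force simp: \<alpha>_def w0_def\<close>)+
  have Qpos: "0 \<le> Q / \<bar>lam\<bar>" unfolding Q_def kernel_const_def by (intro divide_nonneg_nonneg mult_nonneg_nonneg) auto
  have ic: "continuous_on I (\<lambda>y. exp (\<i> * complex_of_real (lam * \<Phi> y)) * \<alpha> y)"
    unfolding \<Phi>_def by (intro continuous_intros c2_bounds_continuous[OF \<alpha>])
  have U0: "0 \<le> U" using m0 by (simp add: U_def)
  have V1: "V \<le> U * (3 * \<delta>)"
  proof -
    have "V \<le> integral I (\<lambda>y. cmod (\<alpha> y))"
      unfolding Veq I_def by (rule norm_oscillatory_integral_le)
        (use c2_bounds_continuous[OF \<alpha>] in \<open>auto simp: I_def \<Phi>_def intro!: continuous_intros\<close>)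
    also have "\<dots> \<le> U * (c2 - c1)"
      unfolding I_def by (rule integral_norm_le_support)
        (use c2_bounds_continuous[OF \<alpha>] \<alpha> sp cc U0 in \<open>auto simp: I_def c2_bounds_def\<close>)
    also have "\<dots> \<le> U * (3 * \<delta>)" using cc U0 by (intro mult_left_mono) auto
    finally show ?thesis .
  qed
  show ?thesis
  proof (rule le_two_pois[OF _ Qpos])
    show "0 < \<bar>lam\<bar> * \<mu> * \<delta>" using lam \<mu> \<delta> by simp
    have k1: "27 * 8 ^ D \<le> kernel_const D * (1 + Z)\<^sup>2"
    proof -
      have "(27::real) * 8 ^ D * 1 * 1 \<le> 54 * 8 ^ (3 * D) * (4 * real D + 4)\<^sup>2 * (1 + Z)\<^sup>2"
      proof (intro mult_mono)
        show "(8::real) ^ D \<le> 8 ^ (3 * D)" by (rule power_increasing) auto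
        show "1 \<le> (4 * real D + 4)\<^sup>2" by (rule one_le_power) simp
        show "1 \<le> (1 + Z)\<^sup>2" using Z by (intro one_le_power) simp
      qed auto
      then show ?thesis by (simp add: kernel_const_def)
    qed
    have "U * (3 * \<delta>) = 27 * 8 ^ D * (M\<^sup>2 * \<mu> * \<delta>)" by (simp add: U_def m0_def)
    also have "\<dots> \<le> kernel_const D * (1 + Z)\<^sup>2 * (M\<^sup>2 * \<mu> * \<delta>)"
      using k1 \<mu> \<delta> by (intro mult_right_mono) auto
    also have "\<dots> = Q / \<bar>lam\<bar> * (\<bar>lam\<bar> * \<mu> * \<delta>)" using lam by (simp add: Q_def Z_def)
    finally show "V \<le> Q / \<bar>lam\<bar> * (\<bar>lam\<bar> * \<mu> * \<delta>)" using V1 by linarith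
    assume L: "x - x' \<noteq> 0"
    define m1 where "m1 = \<bar>x - x'\<bar> * \<mu> / 8 ^ D"
    have m1: "0 < m1" using L \<mu> by (simp add: m1_def)
    have "V \<le> 2 * U * (\<kappa> + 2 * \<nu>)\<^sup>2 * (c2 - c1) / (lam\<^sup>2 * m1\<^sup>2)"
      unfolding Veq I_def
    proof (rule oscillatory_two_steps[OF _ lam, where \<psi> = "poly (dy_diff_poly J a x x')" and
          \<psi>' = "poly (pderiv (dy_diff_poly J a x x'))" and \<psi>'' = "poly (pderiv (pderiv (dy_diff_poly J a x x')))" and
          \<alpha>' = \<alpha>' and \<alpha>'' = \<alpha>''])
      show "b \<le> b + 3 * B" using B by simp
      fix y assume "y \<in> {b..b + 3 * B}"
      then have y: "(real l - 1) * side k m \<le> y" "y \<le> (real l + 2) * side k m" using yI by (auto simp: I_def)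
      show "(\<Phi> has_real_derivative poly (dy_diff_poly J a x x') y) (at y within {b..b + 3 * B})"
        unfolding \<Phi>_def[abs_def] by (rule phase_diff_deriv)
      show "m1 \<le> \<bar>poly (dy_diff_poly J a x x') y\<bar>" using ph(1)[OF y] by (simp add: m1_def \<mu>_def)
      show "\<bar>poly (pderiv (dy_diff_poly J a x x')) y\<bar> \<le> \<nu> * \<bar>poly (dy_diff_poly J a x x') y\<bar>"
        using ph(2)[OF y] by (simp add: \<nu>_def B_def)
      show "\<bar>poly (pderiv (pderiv (dy_diff_poly J a x x'))) y\<bar> \<le> \<nu>\<^sup>2 * \<bar>poly (dy_diff_poly J a x x') y\<bar>"
        using ph(3)[OF y] by (simp add: \<nu>_def B_def)
    qed (use m1 \<nu> \<alpha> bd cc(1) sp in \<open>auto simp: I_def intro!: continuous_intros has_field_derivative_at_within poly_DERIV\<close>)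
    also have "\<dots> \<le> 2 * U * ((4 * real D + 4) * (1 + Z) / \<delta>)\<^sup>2 * (3 * \<delta>) / (lam\<^sup>2 * m1\<^sup>2)"
      using U0 \<kappa> \<kappa>0 \<nu> cc by (intro divide_right_mono mult_mono power_mono) auto
    also have "\<dots> = Q / \<bar>lam\<bar> / (\<bar>lam\<bar> * \<mu> * \<delta> * (x - x')\<^sup>2)"
    proof -
      have e8: "(8::real) ^ (3 * D) = 8 ^ D * 8 ^ D * 8 ^ D" by (simp add: power_add[symmetric] mult.commute)
      show ?thesis
        using lam \<mu> \<delta> L unfolding Q_def kernel_const_def U_def m0_def m1_def Z_def e8
        by (simp add: power_mult_distrib power_divide divide_simps) (simp add: power2_eq_square mult_ac)
    qed
    finally show "V \<le> Q / \<bar>lam\<bar> / (\<bar>lam\<bar> * \<mu> * \<delta> * (x - x')\<^sup>2)" .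
  qed
qed

text \<open>A sharp cut in \<open>y\<close> would leave boundary terms. The kernel is therefore
  first multiplied by the quadratic weight on the tripled interval, and the weight is divided out of
  \<open>f\<close> afterwards, where it is at least 1. The cut in \<open>x\<close> may stay sharp
  because the kernel of \<open>T T\<^sup>*\<close> is an integral in \<open>y\<close> only.\<close>

lemma box_bound:
  fixes i l :: nat
  assumes c: "cell J a j k m i l" and cut: "cutoff \<phi> \<phi>' \<phi>'' s u M" and lam: "lam \<noteq> 0" and z: "Re z = 1/2"
  shows "opb (kcut (hivl j m i) (hivl k m l) (osc_ker lam z J a \<phi>)) (box_const D * (1 + cmod z) * M / sqrt \<bar>lam\<bar>)"
proof -
  interpret cutoff \<phi> \<phi>' \<phi>'' s u M by (rule cut)
  define B where "B = side k m"
  define b where "b = (real l - 1) * side k m"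
  define w0 where "w0 y = (y - b) * (b + 3 * B - y) / B\<^sup>2" for y
  define \<mu> where "\<mu> = \<bar>mixed_poly J a (real i * side j m) (real l * side k m)\<bar>"
  define Q where "Q = kernel_const D * (1 + cmod z)\<^sup>2 * M\<^sup>2"
  define A where "A = hivl j m i"
  define K where "K = osc_ker lam z J a \<phi>"
  define wk where "wk x y = (indicator A x * (indicator {b..b + 3 * B} y * complex_of_real (w0 y))) * K x y" for x y
  have B: "0 < B" by (simp add: B_def)
  have Q0: "0 \<le> Q" by (simp add: Q_def kernel_const_def)
  have K: "bker K" unfolding K_def by (rule bker_osc_ker[OF z ker])
  have w3: "\<bar>w0 y\<bar> \<le> 3" if "y \<in> {b..b + 3 * B}" for y
  proof -
    have "cmod (complex_of_real (w0 y)) \<le> 3"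
      using c2_bounds_of_real_quadratic[OF B, of b] that unfolding c2_bounds_def w0_def by blast
    then show ?thesis by simp
  qed
  have wk: "bker wk"
    unfolding wk_def
  proof (rule bker_mult_bounded[OF K, of _ 3])
    show "(\<lambda>p. indicator A (fst p) * (indicator {b..b + 3 * B} (snd p) * complex_of_real (w0 (snd p)))) \<in> borel_measurable (borel \<Otimes>\<^sub>M borel)"
      unfolding A_def w0_def by measurable
    show "cmod (indicator A x * (indicator {b..b + 3 * B} y * complex_of_real (w0 y))) \<le> 3" for x y
      using w3[of y] by (auto simp: indicator_def)
  qed
  \<comment> \<open>The scale varies with \<open>x\<close> through the row width, about which only
    measurability is known.\<close>
  define Df where "Df x = \<bar>lam\<bar> * \<mu> * min (s x) B" for x
  have \<mu>: "0 \<le> \<mu>" by (simp add: \<mu>_def)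
  have bound: "cmod (kcomp wk (kadj wk) x x') \<le> 2 * (Q / \<bar>lam\<bar>) * pois (min (Df x) (Df x')) (x - x')" for x x'
  proof -
    have D0: "0 \<le> min (Df x) (Df x')" using \<mu> B s_nonneg by (simp add: Df_def)
    have rhs: "0 \<le> 2 * (Q / \<bar>lam\<bar>) * pois (min (Df x) (Df x')) (x - x')"
      using Q0 pois_nonneg[OF D0] by simp
    have zero: ?thesis if "\<And>y. wk x y * kadj wk y x' = 0"
    proof -
      have "(\<lambda>y. wk x y * kadj wk y x') = (\<lambda>y. 0)" using that by auto
      then have "kcomp wk (kadj wk) x x' = 0" unfolding kcomp_def by simp
      then show ?thesis using rhs by simp
    qed
    show ?thesis
    proof (cases "x \<in> A \<and> x' \<in> A \<and> s x \<noteq> 0 \<and> s x' \<noteq> 0")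
      case False
      then consider "x \<notin> A" | "x' \<notin> A" | "s x = 0" | "s x' = 0" by blast
      then show ?thesis
        by (cases; intro zero; simp add: wk_def kadj_def K_def osc_ker_def s_zero)
    next
      case True
      then have s: "0 < s x" "0 < s x'" using s_nonneg[of x] s_nonneg[of x'] by auto
      have xi: "x \<in> ivl j m i" "x' \<in> ivl j m i" using True hivl_subset by (auto simp: A_def)
      let ?f = "\<lambda>y. of_real (w0 y) * of_real (w0 y) * (osc_ker lam z J a \<phi> x y * cnj (osc_ker lam z J a \<phi> x' y))"
      have "(\<lambda>y. wk x y * kadj wk y x') = (\<lambda>y. indicator {b..b + 3 * B} y * ?f y)"
        using True by (auto simp: wk_def kadj_def K_def indicator_def fun_eq_iff)
      then have "kcomp wk (kadj wk) x x' = (LINT y|lborel. indicator {b..b + 3 * B} y * ?f y)"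
        unfolding kcomp_def by simp
      also have "\<dots> = integral {b..b + 3 * B} ?f"
      proof (rule lborel_integral_indicator_Icc)
        have \<phi>c: "continuous_on {b..b + 3 * B} (\<phi> v)" for v
          by (rule continuous_on_vector_derivative[of _ _ "\<phi>' v"]) (rule has_vector_derivative_at_within[OF d1])
        have kc: "continuous_on {b..b + 3 * B} (osc_ker lam z J a \<phi> v)" for v
          unfolding osc_ker_def by (intro continuous_intros \<phi>c) (use z in auto)
        show "continuous_on {b..b + 3 * B} ?f"
          unfolding w0_def using B by (intro continuous_intros kc) auto
      qed
      finally have "cmod (kcomp wk (kadj wk) x x') = cmod (integral {b..b + 3 * B} ?f)" by simp
      also have "\<dots> \<le> 2 * (Q / \<bar>lam\<bar>) * pois (\<bar>lam\<bar> * \<mu> * min (min (s x) (s x')) B) (x - x')"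
        using box_kernel_bound[OF c cut lam z xi s] unfolding B_def b_def w0_def \<mu>_def Q_def .
      also have "\<bar>lam\<bar> * \<mu> * min (min (s x) (s x')) B = min (Df x) (Df x')"
      proof -
        have p: "0 \<le> \<bar>lam\<bar> * \<mu>" using \<mu> by simp
        have "min (Df x) (Df x') = \<bar>lam\<bar> * \<mu> * min (min (s x) B) (min (s x') B)"
          unfolding Df_def using p by (simp add: min_mult_distrib_left)
        also have "min (min (s x) B) (min (s x') B) = min (min (s x) (s x')) B" by (auto simp: min_def)
        finally show ?thesis by simp
      qed
      finally show ?thesis .
    qed
  qed
  have "opb (kcomp wk (kadj wk)) (64 * pi * (2 * (Q / \<bar>lam\<bar>)))"
  proof (rule opb_pois[OF bker_comp[OF wk bker_adj[OF wk]], where D = Df and Dm = "\<bar>lam\<bar> * \<mu> * B"])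
    show "Df \<in> borel_measurable borel" unfolding Df_def[abs_def] using s_meas by measurable
    show "0 \<le> Df x" for x using \<mu> B s_nonneg by (simp add: Df_def)
    show "Df x \<le> \<bar>lam\<bar> * \<mu> * B" for x unfolding Df_def using \<mu> by (intro mult_left_mono) auto
  qed (use Q0 bound in auto)
  moreover have "64 * pi * (2 * (Q / \<bar>lam\<bar>)) = (box_const D * (1 + cmod z) * M / sqrt \<bar>lam\<bar>)\<^sup>2"
  proof -
    have "0 \<le> 128 * pi * kernel_const D" by (simp add: kernel_const_def)
    then show ?thesis by (simp add: box_const_def power_mult_distrib power_divide Q_def)
  qed
  moreover have nn: "0 \<le> box_const D * (1 + cmod z) * M / sqrt \<bar>lam\<bar>"
    using M_nonneg by (simp add: box_const_def kernel_const_def)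
  ultimately have ow: "opb wk (box_const D * (1 + cmod z) * M / sqrt \<bar>lam\<bar>)" (is "opb wk ?C")
    by (intro opb_of_kcomp_adj[OF wk]) auto
  have w1: "1 \<le> w0 y" if "y \<in> hivl k m l" for y
  proof -
    have "B \<le> y - b" "B \<le> b + 3 * B - y" using that by (auto simp: hivl_def b_def B_def algebra_simps)
    then have "B * B \<le> (y - b) * (b + 3 * B - y)" using B by (intro mult_mono) auto
    then show ?thesis using B by (simp add: w0_def power2_eq_square)
  qed
  have sub: "y \<in> {b..b + 3 * B}" if "y \<in> hivl k m l" for y
    using that B by (auto simp: hivl_def b_def B_def algebra_simps)
  show ?thesis unfolding opb_def
  proof (intro allI impI)
    fix f assume f: "sqint f"
    have [measurable]: "f \<in> borel_measurable borel" using f by (rule sqint_measurable)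
    \<comment> \<open>On the box the reciprocal of the weight is at most 1, so \<open>h\<close> is
      no larger than \<open>f\<close> and the weighted operator at \<open>h\<close> is the cut
      operator at \<open>f\<close>.\<close>
    define h where "h y = indicator (hivl k m l) y * complex_of_real (1 / w0 y) * f y" for y
    have hm: "h \<in> borel_measurable borel" unfolding h_def[abs_def] w0_def by measurable
    have hle: "cmod (h y) \<le> 1 * cmod (f y)" for y
    proof (cases "y \<in> hivl k m l")
      case True
      then have "cmod (complex_of_real (1 / w0 y)) \<le> 1" using w1[OF True] unfolding norm_of_real by simp
      then show ?thesis using True unfolding h_def norm_mult by (simp add: mult_left_le_one_le)
    qed (simp add: h_def)
    have h: "sqint h" "nrm h \<le> 1 * nrm f" using sqint_bound[OF hm f hle] by auto
    have "kop (kcut A (hivl k m l) K) f = kop wk h"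
    proof
      fix x
      have "kcut A (hivl k m l) K x y * f y = wk x y * h y" for y
        using w1[of y] sub[of y] by (cases "y \<in> hivl k m l") (auto simp: kcut_def wk_def h_def)
      then show "kop (kcut A (hivl k m l) K) f x = kop wk h x" by (simp add: kop_def)
    qed
    then have "nrm (kop (kcut A (hivl k m l) K) f) \<le> ?C * nrm h" using opbD[OF ow h(1)] by simp
    also have "\<dots> \<le> ?C * nrm f" using h(2) nn by (intro mult_left_mono) auto
    finally show "nrm (kop (kcut (hivl j m i) (hivl k m l) (osc_ker lam z J a \<phi>)) f) \<le> ?C * nrm f"
      by (simp add: A_def K_def)
  qed
qed

end

section \<open>Almost orthogonality\<close>

definition ck ::
  "(int \<Rightarrow> int \<Rightarrow> nat \<Rightarrow> nat \<Rightarrow> nat \<Rightarrow> bool) \<Rightarrow> (real \<Rightarrow> real \<Rightarrow> complex) \<Rightarrow> int \<times> int \<times> nat \<Rightarrow> real \<Rightarrow> real \<Rightarrow> complex" where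
  "ck G K c x y = (case c of (j, k, m) \<Rightarrow>
     if 0 < x \<and> 0 < y \<and> G j k m (idx j m x) (idx k m y) then K x y else 0)"

lemma kcomp_adj_swap: "kcomp A (kadj B) = kadj (kcomp B (kadj A))"
  unfolding kcomp_def kadj_def Bochner_Integration.integral_cnj[symmetric] by (simp add: mult.commute)

lemma ivl_ancestor: "ivl k (m + n) l \<subseteq> ivl k m (l div 2 ^ n)"
proof (induction n arbitrary: l)
  case (Suc n)
  have "ivl k (m + Suc n) l \<subseteq> ivl k (m + n) (l div 2)" using ivl_parent[of k "m + n" l] by simp
  also have "\<dots> \<subseteq> ivl k m (l div 2 div 2 ^ n)" by (rule Suc)
  finally show ?case by (simp add: div_mult2_eq)
qed simp

lemma idx_ancestor: "0 \<le> y \<Longrightarrow> idx k m y = idx k (m + n) y div 2 ^ n"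
proof (induction n)
  case (Suc n)
  then have "idx k m y = (idx k (m + Suc n) y div 2) div 2 ^ n" using idx_parent[of y k "m + n"] by simp
  then show ?case by (simp add: div_mult2_eq)
qed simp

lemma side_antimono: "m \<le> m' \<Longrightarrow> side k m' \<le> side k m"
  unfolding side_def by (intro divide_left_mono power_increasing) auto

text \<open>The second condition holds for the cells in one sector; it turns \<open>\<bar>\<integral> mixed_poly J a t y dt\<bar>\<close>, taken
  over the segment between two cells, into \<open>\<integral> \<bar>mixed_poly J a t y\<bar> dt\<close>.\<close>

locale cell_family = qh_data +
  fixes G :: "int \<Rightarrow> int \<Rightarrow> nat \<Rightarrow> nat \<Rightarrow> nat \<Rightarrow> bool"
  assumes G_cell: "\<And>j k m i l. G j k m i l \<Longrightarrow> cell J a j k m i l"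
    and G_seg: "\<And>j k m i l j' m' i' l' x x' y t. G j k m i l \<Longrightarrow> G j' k m' i' l' \<Longrightarrow>
      x \<in> ivl j m i \<Longrightarrow> x' \<in> ivl j' m' i' \<Longrightarrow> y \<in> ivl k m l \<Longrightarrow> y \<in> ivl k m' l' \<Longrightarrow>
      t \<in> {min x x'..max x x'} \<Longrightarrow> mixed_poly J a t y \<noteq> 0"
begin

lemma cell_simps:
  assumes "G j k m i l"
  shows "4 \<le> m" "2 ^ m \<le> i" "i < 2 ^ Suc m" "2 ^ m \<le> l" "l < 2 ^ Suc m" "good J a j k m i l" "0 < i" "1 < l" "0 < l"
proof -
  note c = G_cell[OF assms]
  show "4 \<le> m" "2 ^ m \<le> i" "i < 2 ^ Suc m" "2 ^ m \<le> l" "l < 2 ^ Suc m" "good J a j k m i l"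
    using c by (simp_all add: cell_def)
  moreover from this have "(16::nat) \<le> 2 ^ m" using power_increasing[of 4 m "2::nat"] by simp
  ultimately show "0 < i" "1 < l" "0 < l" by linarith+
qed

lemma finite_G: "finite {(i, l). G j k m i l}"
proof (rule finite_subset)
  show "{(i, l). G j k m i l} \<subseteq> {..<2 ^ Suc m} \<times> {..<2 ^ Suc m}" using cell_simps by auto
qed simp

lemma card_G:
  "card {i. G j k m i l} \<le> count_const D" "card {l. G j k m i l} \<le> count_const D" "finite {l. G j k m i l}"
proof -
  have "card {i. G j k m i l} \<le> card {i. cell J a j k m i l}"
    by (rule card_mono[OF card_cells(1)]) (use G_cell in auto)
  also have "\<dots> \<le> count_const D" by (rule card_cells)
  finally show "card {i. G j k m i l} \<le> count_const D" .
  have f: "finite {l. cell J a j k m i l}" and cd: "card {l. cell J a j k m i l} \<le> count_const D"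
    using qh_data.card_cells[OF flip, of k j m i] unfolding cell_flip by auto
  show "finite {l. G j k m i l}" by (rule finite_subset[OF _ f]) (use G_cell in auto)
  have "card {l. G j k m i l} \<le> card {l. cell J a j k m i l}"
    by (rule card_mono[OF f]) (use G_cell in auto)
  also note cd
  finally show "card {l. G j k m i l} \<le> count_const D" .
qed

lemma ck_eq_sum:
  "ck G K (j, k, m) = (\<lambda>x y. \<Sum>p\<in>{(i, l). G j k m i l}. kcut (hivl j m (fst p)) (hivl k m (snd p)) K x y)"
proof (intro ext)
  fix x y
  let ?S = "{(i, l). G j k m i l}"
  have pos: "0 < x" if "x \<in> hivl q m i" "0 < i" for x q i
  proof -
    have "0 < real i * side q m" using that(2) by simp
    then show ?thesis using that(1) by (simp add: hivl_def)
  qed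
  show "ck G K (j, k, m) x y = (\<Sum>p\<in>?S. kcut (hivl j m (fst p)) (hivl k m (snd p)) K x y)"
  proof (cases "0 < x \<and> 0 < y")
    case True
    have "kcut (hivl j m (fst p)) (hivl k m (snd p)) K x y = (if p = (idx j m x, idx k m y) then K x y else 0)" for p
      using hivl_iff[of x j m "fst p"] hivl_iff[of y k m "snd p"] True
      by (auto simp: kcut_def indicator_def prod_eq_iff)
    then show ?thesis using True finite_G by (simp add: ck_def)
  next
    case False
    have "kcut (hivl j m (fst p)) (hivl k m (snd p)) K x y = 0" if p: "p \<in> ?S" for p
    proof -
      have "G j k m (fst p) (snd p)" using p by auto
      from cell_simps(7,9)[OF this] show ?thesis
        using pos False by (auto simp: kcut_def indicator_def)
    qed
    then have "(\<Sum>p\<in>?S. kcut (hivl j m (fst p)) (hivl k m (snd p)) K x y) = 0" by (rule sum.neutral[rule_format])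
    then show ?thesis using False by (auto simp: ck_def)
  qed
qed

lemma bker_ck: assumes "bker K" shows "bker (ck G K c)"
proof -
  obtain j k m where c: "c = (j, k, m)" by (cases c)
  show ?thesis unfolding c ck_eq_sum by (intro bker_sum bker_kcut assms hivl_borel)
qed

lemma cell_bound:
  assumes cut: "cutoff \<phi> \<phi>' \<phi>'' s u M" and lam: "lam \<noteq> 0" and z: "Re z = 1/2"
  shows "opb (ck G (osc_ker lam z J a \<phi>) c) (real (count_const D) * (box_const D * (1 + cmod z) * M / sqrt \<bar>lam\<bar>))"
proof -
  obtain j k m where c: "c = (j, k, m)" by (cases c)
  interpret cutoff \<phi> \<phi>' \<phi>'' s u M by (rule cut)
  show ?thesis unfolding c ck_eq_sum
  proof (rule opb_blocks[OF finite_G bker_osc_ker[OF z ker]])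
    show "0 \<le> box_const D * (1 + cmod z) * M / sqrt \<bar>lam\<bar>"
      using M_nonneg by (simp add: box_const_def kernel_const_def)
    show "opb (kcut (hivl j m i) (hivl k m l) (osc_ker lam z J a \<phi>)) (box_const D * (1 + cmod z) * M / sqrt \<bar>lam\<bar>)"
      if "(i, l) \<in> {(i, l). G j k m i l}" for i l
      by (rule box_bound[OF _ cut lam z]) (use that G_cell in auto)
  qed (use hivl_disjoint card_G in auto)
qed

text \<open>Both bounds come from \<open>poly_integral_ge\<close> for the row polynomial. The second
  gains a further factor, distance over side, because a stopped box has a zero within
  \<open>root_const D\<close> sides. At level 4 no such zero is known, but if the distance is at
  most 64 sides the second bound follows from the first.\<close>

lemma phase_lower:
  assumes g: "G j k m i l" and x: "x \<in> ivl j m i" and y: "y \<in> ivl k m l" and ne: "x \<noteq> x'"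
    and seg: "\<And>t. t \<in> {min x x'..max x x'} \<Longrightarrow> mixed_poly J a t y \<noteq> 0"
  shows "poly_const D * \<bar>x - x'\<bar> * \<bar>mixed_poly J a x y\<bar> \<le> \<bar>poly (dy_diff_poly J a x x') y\<bar>"
    and "m \<noteq> 4 \<or> \<bar>x - x'\<bar> \<le> 64 * side j m \<Longrightarrow>
      poly_const D * (x - x')\<^sup>2 * \<bar>mixed_poly J a x y\<bar> \<le> real (64 + root_const D) * side j m * \<bar>poly (dy_diff_poly J a x x') y\<bar>"
proof -
  define u v where uv: "u = min x x'" "v = max x x'"
  have lt: "u < v" using ne by (auto simp: uv)
  have L: "v - u = \<bar>x - x'\<bar>" by (auto simp: uv)
  have L2: "(v - u)\<^sup>2 = (x - x')\<^sup>2" unfolding L by simp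
  have y0: "0 < y" using ivl_bounds(3)[OF y cell_simps(4,5)[OF g]] .
  let ?p = "cpoly (row_poly J a y)"
  have p: "?p \<noteq> 0" "degree ?p \<le> D"
    using row_nonzero[of y] y0 degree_row[of y] by (auto simp: cpoly_eq_0_iff degree_cpoly)
  have v: "cmod (poly ?p (of_real t)) = \<bar>mixed_poly J a t y\<bar>" for t by (simp add: poly_cpoly_of_real poly_row)
  have "integral {u..v} (\<lambda>t. mixed_poly J a t y) = poly (dy_diff_poly J a v u) y"
    using integral_unique[OF dy_diff_pderiv[of u v 0 J a y]] lt by (simp add: poly_col)
  moreover have "\<bar>integral {u..v} (\<lambda>t. mixed_poly J a t y)\<bar> = integral {u..v} (\<lambda>t. \<bar>mixed_poly J a t y\<bar>)"
    by (rule abs_integral_nonvanishing) (use seg in \<open>auto simp: uv intro!: continuous_intros\<close>)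
  moreover have "\<bar>poly (dy_diff_poly J a v u) y\<bar> = \<bar>poly (dy_diff_poly J a x x') y\<bar>"
    using dy_diff_poly_swap[of J a x x'] by (auto simp: uv max_def min_def)
  ultimately have I: "\<bar>poly (dy_diff_poly J a x x') y\<bar> = integral {u..v} (\<lambda>t. cmod (poly ?p (of_real t)))"
    unfolding v by simp
  have xin: "x \<in> {u..v}" by (auto simp: uv)
  show 1: "poly_const D * \<bar>x - x'\<bar> * \<bar>mixed_poly J a x y\<bar> \<le> \<bar>poly (dy_diff_poly J a x x') y\<bar>"
    unfolding I using poly_integral_ge(1)[OF p lt xin] unfolding v L .
  assume *: "m \<noteq> 4 \<or> \<bar>x - x'\<bar> \<le> 64 * side j m"
  show "poly_const D * (x - x')\<^sup>2 * \<bar>mixed_poly J a x y\<bar> \<le> real (64 + root_const D) * side j m * \<bar>poly (dy_diff_poly J a x x') y\<bar>"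
  proof (cases "m = 4")
    case False
    obtain r where r: "mixed_poly J a r (of_real y) = 0" "cmod (of_real x - r) \<le> real (root_const D) * side j m"
      using cell_near_root[OF G_cell[OF g] False x y] by auto
    have "0 < root_const D" by (simp add: root_const_def)
    then have rho: "0 < real (root_const D) * side j m" by (intro mult_pos_pos side_pos) simp
    have "poly_const D * (x - x')\<^sup>2 / (real (root_const D) * side j m) * \<bar>mixed_poly J a x y\<bar> \<le> \<bar>poly (dy_diff_poly J a x x') y\<bar>"
      unfolding I using poly_integral_ge(2)[OF p lt xin _ r(2) rho] r(1) unfolding v L2 by (simp add: poly_cpoly_row)
    then have "poly_const D * (x - x')\<^sup>2 * \<bar>mixed_poly J a x y\<bar> \<le> \<bar>poly (dy_diff_poly J a x x') y\<bar> * (real (root_const D) * side j m)"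
      using rho by (simp add: pos_divide_le_eq)
    also have "\<dots> \<le> \<bar>poly (dy_diff_poly J a x x') y\<bar> * (real (64 + root_const D) * side j m)"
      by (intro mult_left_mono mult_right_mono) (auto simp: less_imp_le)
    finally show ?thesis by (simp add: mult_ac)
  next
    case True
    then have "\<bar>x - x'\<bar> \<le> 64 * side j m" using * by simp
    also have "\<dots> \<le> real (64 + root_const D) * side j m" by (intro mult_right_mono) (auto simp: less_imp_le)
    finally have "\<bar>x - x'\<bar> * (poly_const D * \<bar>x - x'\<bar> * \<bar>mixed_poly J a x y\<bar>) \<le> real (64 + root_const D) * side j m * \<bar>poly (dy_diff_poly J a x x') y\<bar>"
      by (intro mult_mono 1) (use poly_const_pos[of D] side_pos[of j m] in \<open>auto intro!: mult_nonneg_nonneg simp: less_imp_le\<close>)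
    moreover have "(x - x')\<^sup>2 = \<bar>x - x'\<bar> * \<bar>x - x'\<bar>" by (simp add: power2_eq_square abs_mult[symmetric])
    ultimately show ?thesis by (simp add: mult_ac)
  qed
qed

text \<open>The factor of \<open>oscillatory_one_step\<close> with the constants of
  \<open>good_comparable\<close>, once for each vertical interval on which the integrand
  lives.\<close>

definition offdiag_const :: "real \<Rightarrow> real" where
  "offdiag_const Z = real (count_const D) * (4 + 2 * Z * real D + 8 ^ D * real (D + 1))"

text \<open>For fixed \<open>x\<close> and \<open>x'\<close> the integrand in \<open>y\<close> lives
  on at most \<open>count_const D\<close> intervals of the finer level, and each of them lies inside
  an interval of the coarser level. So both amplitudes vary slowly on it, and one integration by
  parts per interval suffices. The sharp ends of the intervals only cause boundary terms.\<close>

lemma offdiag_kernel_bound: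
  assumes cut: "cutoff \<phi> \<phi>' \<phi>'' s u M" and lam: "lam \<noteq> 0" and z: "Re z = 1/2"
    and mm: "m \<le> m'" and ne: "x \<noteq> x'" and E0: "0 \<le> E"
    and E: "\<And>l l' y. G j k m (idx j m x) l \<Longrightarrow> G j' k m' (idx j' m' x') l' \<Longrightarrow> y \<in> ivl k m l \<Longrightarrow> y \<in> ivl k m' l' \<Longrightarrow>
      sqrt (\<bar>mixed_poly J a x y\<bar> * \<bar>mixed_poly J a x' y\<bar>) \<le> E * \<bar>poly (dy_diff_poly J a x x') y\<bar>"
  shows "cmod (kcomp (ck G (osc_ker lam z J a \<phi>) (j, k, m)) (kadj (ck G (osc_ker lam z J a \<phi>) (j', k, m'))) x x')
    \<le> offdiag_const (cmod z) * M\<^sup>2 * E / \<bar>lam\<bar>"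
proof -
  interpret cutoff \<phi> \<phi>' \<phi>'' s u M by (rule cut)
  define K where "K = osc_ker lam z J a \<phi>"
  define n where "n = m' - m"
  have m': "m' = m + n" using mm by (simp add: n_def)
  define i i' where ii: "i = idx j m x" "i' = idx j' m' x'"
  have rhs0: "0 \<le> offdiag_const (cmod z) * M\<^sup>2 * E / \<bar>lam\<bar>"
    unfolding offdiag_const_def using E0 by (intro divide_nonneg_nonneg mult_nonneg_nonneg add_nonneg_nonneg) auto
  \<comment> \<open>\<open>l' div 2 ^ n\<close> is the ancestor of \<open>l'\<close> at the coarser
    level \<open>m\<close>.\<close>
  define S where "S = {l'. G j' k m' i' l' \<and> G j k m i (l' div 2 ^ n)}"
  have finS: "finite S" unfolding S_def by (rule finite_subset[OF _ card_G(3)[of j' k m' i']]) auto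
  have cardS: "card S \<le> count_const D"
    by (rule order_trans[OF card_mono[OF card_G(3)[of j' k m' i']] card_G(2)[of j' k m' i']]) (auto simp: S_def)
  show ?thesis
  proof (cases "0 < x \<and> 0 < x'")
    case False
    then have "(\<lambda>y. ck G K (j, k, m) x y * kadj (ck G K (j', k, m')) y x') = (\<lambda>y. 0)"
      by (auto simp: ck_def kadj_def)
    then have "kcomp (ck G K (j, k, m)) (kadj (ck G K (j', k, m'))) x x' = 0" unfolding kcomp_def by simp
    then show ?thesis using rhs0 by (simp add: K_def)
  next
    case True
    then have xi: "x \<in> ivl j m i" "x' \<in> ivl j' m' i'" using idx_ivl by (auto simp: ii)
    let ?f = "\<lambda>y. K x y * cnj (K x' y)"
    have \<phi>c: "continuous_on T (\<phi> v)" for v T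
      by (rule continuous_on_vector_derivative[of _ _ "\<phi>' v"]) (rule has_vector_derivative_at_within[OF d1])
    have fc: "continuous_on T ?f" for T
      unfolding K_def osc_ker_def by (intro continuous_intros \<phi>c) (use z in auto)
    have pt: "ck G K (j, k, m) x y * kadj (ck G K (j', k, m')) y x' = (\<Sum>l'\<in>S. indicator (hivl k m' l') y * ?f y)" for y
    proof (cases "0 < y")
      case True
      have "(\<Sum>l'\<in>S. indicator (hivl k m' l') y * ?f y) = (\<Sum>l'\<in>S. if l' = idx k m' y then ?f y else 0)"
        by (intro sum.cong refl) (use True hivl_iff[of y k m'] in \<open>auto simp: indicator_def\<close>)
      also have "\<dots> = (if idx k m' y \<in> S then ?f y else 0)" using finS by simp
      also have "\<dots> = ck G K (j, k, m) x y * kadj (ck G K (j', k, m')) y x'"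
        using True \<open>0 < x \<and> 0 < x'\<close> idx_ancestor[of y k m n] by (simp add: S_def ck_def kadj_def ii m')
      finally show ?thesis by simp
    next
      case False
      have "indicator (hivl k m' l') y = (0::complex)" if l': "l' \<in> S" for l'
      proof -
        have "0 < l'" using cell_simps(9) l' by (auto simp: S_def)
        then have "0 < real l' * side k m'" by simp
        then show ?thesis using False by (auto simp: hivl_def indicator_def)
      qed
      then show ?thesis using False by (simp add: ck_def)
    qed
    have si: "integrable lborel (\<lambda>y. indicator {p..q} y * ?f y)" for p q
    proof -
      have e: "(\<lambda>y. indicator {p..q} y *\<^sub>R ?f y) = (\<lambda>y. indicator {p..q} y * ?f y)"
        by (auto simp: indicator_def fun_eq_iff)
      show ?thesis using borel_integrable_atLeastAtMost'[OF fc, of p q] unfolding set_integrable_def e .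
    qed
    have hv: "(LINT y|lborel. indicator (hivl k m' l') y * ?f y) = integral (ivl k m' l') ?f"
      and hi: "integrable lborel (\<lambda>y. indicator (hivl k m' l') y * ?f y)" for l'
    proof -
      define p q where pq: "p = real l' * side k m'" "q = (real l' + 1) * side k m'"
      have pq': "hivl k m' l' = {p..<q}" "ivl k m' l' = {p..q}" by (auto simp: hivl_def ivl_def pq)
      \<comment> \<open>The half-open interval of the partition and the closed one used for
        integration differ by a null set.\<close>
      have ae: "AE y in lborel. indicator {p..<q} y * ?f y = indicator {p..q} y * ?f y"
        using AE_lborel_singleton[of q] by eventually_elim (auto simp: indicator_def)
      have fm: "?f \<in> borel_measurable borel" by (rule borel_measurable_continuous_onI[OF fc])
      have "(LINT y|lborel. indicator {p..<q} y * ?f y) = (LINT y|lborel. indicator {p..q} y * ?f y)"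
        by (rule integral_cong_AE) (use ae fm in measurable)
      then show "(LINT y|lborel. indicator (hivl k m' l') y * ?f y) = integral (ivl k m' l') ?f"
        unfolding pq' using lborel_integral_indicator_Icc[OF fc, of p q] by simp
      show "integrable lborel (\<lambda>y. indicator (hivl k m' l') y * ?f y)"
        unfolding pq' by (rule integrable_cong_AE_imp[OF si[of p q]]) (use ae fm in measurable, use ae in \<open>auto elim!: eventually_mono\<close>)
    qed
    have "kcomp (ck G K (j, k, m)) (kadj (ck G K (j', k, m'))) x x' = (\<Sum>l'\<in>S. integral (ivl k m' l') ?f)"
      unfolding kcomp_def pt by (subst Bochner_Integration.integral_sum) (simp_all add: hv hi)
    then have "cmod (kcomp (ck G K (j, k, m)) (kadj (ck G K (j', k, m'))) x x') \<le> (\<Sum>l'\<in>S. cmod (integral (ivl k m' l') ?f))"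
      by (simp add: norm_sum)
    also have "\<dots> \<le> (\<Sum>l'\<in>S. E * M\<^sup>2 * (4 + 2 * cmod z * real D + 8 ^ D * real (D + 1)) / \<bar>lam\<bar>)"
    proof (rule sum_mono)
      fix l' assume l': "l' \<in> S"
      define l where "l = l' div 2 ^ n"
      have g: "G j k m i l" "G j' k m' i' l'" using l' by (auto simp: S_def l_def)
      define p q where pq: "p = real l' * side k m'" "q = (real l' + 1) * side k m'"
      have iv: "ivl k m' l' = {p..q}" by (auto simp: ivl_def pq)
      have qp: "q - p = side k m'" by (simp add: pq algebra_simps)
      have lt: "p < q" using qp side_pos[of k m'] by linarith
      have sub: "ivl k m' l' \<subseteq> ivl k m l" using ivl_ancestor[of k m n l'] by (simp add: l_def m')
      have yl: "(real l - 1) * side k m \<le> y \<and> y \<le> (real l + 2) * side k m" if "y \<in> {p..q}" for y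
      proof -
        have "y \<in> ivl k m l" using that sub iv by auto
        then show ?thesis using side_pos[of k m] by (auto simp: ivl_def algebra_simps)
      qed
      have yl': "(real l' - 1) * side k m' \<le> y \<and> y \<le> (real l' + 2) * side k m'" if "y \<in> {p..q}" for y
        using that side_pos[of k m'] by (auto simp: pq algebra_simps)
      note c1 = good_comparable[OF cell_simps(6,7,8)[OF g(1)] xi(1) xi(1)]
      note c2 = good_comparable[OF cell_simps(6,7,8)[OF g(2)] xi(2) xi(2)]
      have sd: "real D / side k m \<le> real D / (q - p)"
        unfolding qp using side_antimono[OF mm, of k] by (intro divide_left_mono) auto
      have "cmod (integral {p..q} (\<lambda>y. exp (\<i> * complex_of_real (lam * (phase_poly J a x y - phase_poly J a x' y))) *
          ((complex_of_real \<bar>mixed_poly J a x y\<bar> powr z) * (complex_of_real \<bar>mixed_poly J a x' y\<bar> powr cnj z) * (\<phi> x y * cnj (\<phi> x' y)))))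
        \<le> E * M\<^sup>2 * (4 + 2 * cmod z * real D + 8 ^ D * real (degree (dy_diff_poly J a x x') + 1)) / \<bar>lam\<bar>"
      proof (rule oscillatory_one_step[OF lt lam phase_diff_deriv])
        fix y assume y: "y \<in> {p..q}"
        show "poly (dy_diff_poly J a x x') y \<noteq> 0"
        proof -
          have yy: "y \<in> ivl k m l" "y \<in> ivl k m' l'" using y sub iv by auto
          have "poly_const D * \<bar>x - x'\<bar> * \<bar>mixed_poly J a x y\<bar> \<le> \<bar>poly (dy_diff_poly J a x x') y\<bar>"
            by (rule phase_lower(1)[OF g(1) xi(1) yy(1) ne]) (rule G_seg[OF g xi yy])
          moreover have "0 < poly_const D * \<bar>x - x'\<bar> * \<bar>mixed_poly J a x y\<bar>"
            using poly_const_pos[of D] ne c1(2)[of y y] yl[OF y] by simp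
          ultimately show ?thesis by auto
        qed
        show "((\<lambda>y. mixed_poly J a x y) has_real_derivative poly (pderiv (col_poly J a x)) y) (at y within {p..q})"
          "((\<lambda>y. mixed_poly J a x' y) has_real_derivative poly (pderiv (col_poly J a x')) y) (at y within {p..q})"
          unfolding poly_col[symmetric] by (rule has_field_derivative_at_within[OF poly_DERIV])+
        show "mixed_poly J a x y \<noteq> 0" "mixed_poly J a x' y \<noteq> 0" using c1(2)[of y y] c2(2)[of y y] yl[OF y] yl'[OF y] by auto
        show "\<bar>poly (pderiv (col_poly J a x)) y\<bar> \<le> real D / (q - p) * \<bar>mixed_poly J a x y\<bar>"
          using c1(3)[of y y] yl[OF y] mult_right_mono[OF sd, of "\<bar>mixed_poly J a x y\<bar>"] by simp
        show "\<bar>poly (pderiv (col_poly J a x')) y\<bar> \<le> real D / (q - p) * \<bar>mixed_poly J a x' y\<bar>"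
          using c2(3)[of y y] yl'[OF y] by (simp add: qp)
        show "sqrt (\<bar>mixed_poly J a x y\<bar> * \<bar>mixed_poly J a x' y\<bar>) \<le> E * \<bar>poly (dy_diff_poly J a x x') y\<bar>"
          by (rule E[of l l']) (use g y sub iv in \<open>auto simp: ii\<close>)
        show "(\<phi> x has_vector_derivative \<phi>' x y) (at y within {p..q})" by (rule has_vector_derivative_at_within[OF d1])
        show "((\<lambda>y. cnj (\<phi> x' y)) has_vector_derivative cnj (\<phi>' x' y)) (at y within {p..q})"
          by (rule has_vector_derivative_at_within[OF cutoff.d1[OF cutoff_cnj]])
        fix y' assume y': "y' \<in> {p..q}"
        show "\<bar>mixed_poly J a x y\<bar> \<le> 8 ^ D * \<bar>mixed_poly J a x y'\<bar>" using c1(1) yl[OF y] yl[OF y'] by blast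
        show "\<bar>mixed_poly J a x' y\<bar> \<le> 8 ^ D * \<bar>mixed_poly J a x' y'\<bar>" using c2(1) yl'[OF y] yl'[OF y'] by blast
      next
        show "integral {p..q} (\<lambda>y. cmod (\<phi>' x y)) \<le> M" by (rule integral_row_deriv)
        show "integral {p..q} (\<lambda>y. cmod (cnj (\<phi>' x' y))) \<le> M" using integral_row_deriv by simp
      qed (use E0 z b0 cont_row cutoff.cont_row[OF cutoff_cnj] in \<open>auto intro!: continuous_intros\<close>)
      also have "\<dots> \<le> E * M\<^sup>2 * (4 + 2 * cmod z * real D + 8 ^ D * real (D + 1)) / \<bar>lam\<bar>"
        using E0 degree_dy_diff[of x x'] by (intro divide_right_mono mult_left_mono add_mono) auto
      finally show "cmod (integral (ivl k m' l') ?f) \<le> E * M\<^sup>2 * (4 + 2 * cmod z * real D + 8 ^ D * real (D + 1)) / \<bar>lam\<bar>"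
        unfolding iv K_def osc_ker_mult_cnj .
    qed
    also have "\<dots> = real (card S) * (E * M\<^sup>2 * (4 + 2 * cmod z * real D + 8 ^ D * real (D + 1)) / \<bar>lam\<bar>)" by simp
    also have "\<dots> \<le> real (count_const D) * (E * M\<^sup>2 * (4 + 2 * cmod z * real D + 8 ^ D * real (D + 1)) / \<bar>lam\<bar>)"
      using cardS E0 by (intro mult_right_mono) auto
    also have "\<dots> = offdiag_const (cmod z) * M\<^sup>2 * E / \<bar>lam\<bar>" by (simp add: offdiag_const_def)
    finally show ?thesis by (simp add: K_def)
  qed
qed

end

text \<open>The bound for a product of two pieces. The Cotlar--Stein theorem takes its square root,
  so sums of powers of \<open>2 powr (- 1 / 4)\<close> appear later.\<close>

definition decay :: "int \<Rightarrow> nat \<Rightarrow> int \<Rightarrow> nat \<Rightarrow> real" where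
  "decay j m j' m' = 2 powr (- (\<bar>real_of_int j - real_of_int j'\<bar> + \<bar>real m - real m'\<bar>) / 2)"

lemma decay_sym: "decay j m j' m' = decay j' m' j m"
  by (simp add: decay_def abs_minus_commute)

text \<open>64 sides at level 4 are four times the lower end of the dyadic block, which exceeds
  every distance between points of this block and of a neighbouring one.\<close>

definition gain_const :: "nat \<Rightarrow> real" where
  "gain_const D = real (64 + root_const D)"

text \<open>The interaction of two pieces has three regimes: blocks at least two dyadic steps apart,
  neighbouring or equal blocks with very different levels, and the remaining pairs, for which the
  product of the norms is enough.\<close>

definition far_const :: "nat \<Rightarrow> real" where
  "far_const D = 2 * sqrt (2 * gain_const D) / poly_const D"

definition near_const :: "nat \<Rightarrow> real" where
  "near_const D = 8 * pi * gain_const D / poly_const D"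

text \<open>The power of 2 is the inverse of the smallest decay factor that can occur when the
  blocks differ by at most 1 and the levels by at most \<open>root_const D + 2\<close>.\<close>

definition close_const :: "nat \<Rightarrow> real" where
  "close_const D = (real (count_const D) * box_const D)\<^sup>2 * 2 powr ((1 + real (root_const D + 2)) / 2)"

definition tt_const :: "nat \<Rightarrow> real" where
  "tt_const D = real (count_const D) * (4 + 2 * real D + 8 ^ D * real (D + 1)) * (far_const D + near_const D) + close_const D"

lemma gain_const_ge: "64 \<le> gain_const D"
  by (simp add: gain_const_def)

lemma const_nonneg: "0 \<le> far_const D" "0 \<le> near_const D" "0 \<le> close_const D"
  using poly_const_pos[of D] gain_const_ge[of D] by (simp_all add: far_const_def near_const_def close_const_def)

lemma tt_const_nonneg: "0 \<le> tt_const D"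
  unfolding tt_const_def using const_nonneg[of D]
  by (intro add_nonneg_nonneg mult_nonneg_nonneg) auto

section \<open>Interaction of pieces of different sizes\<close>

lemma bker_integral_le:
  assumes k: "bker k" and p: "p \<le> q" and c: "0 \<le> c" and z: "\<And>y. k x y \<noteq> 0 \<Longrightarrow> y \<in> {p..q}" and b: "\<And>y. cmod (k x y) \<le> c"
  shows "(LINT y|lborel. cmod (k x y)) \<le> c * (q - p)"
proof -
  have i: "integrable lborel (indicator {p..q} :: real \<Rightarrow> real)"
    by (intro integrable_real_indicator) (auto simp: emeasure_lborel_Icc_eq)
  have "(LINT y|lborel. cmod (k x y)) \<le> (LINT y|lborel. c * indicator {p..q} y)"
  proof (rule integral_mono)
    show "cmod (k x y) \<le> c * indicator {p..q} y" for y
      using z[of y] b[of y] c by (cases "k x y = 0") auto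
  qed (use bker_integrable_row[OF k] i in auto)
  also have "\<dots> = c * (q - p)" using p by simp
  finally show ?thesis .
qed

lemma bker_integral_le_pois:
  assumes k: "bker k" and d: "0 < d" and c: "0 \<le> c" and b: "\<And>y. cmod (k x y) \<le> c * pois d (x - y)"
  shows "(LINT y|lborel. cmod (k x y)) \<le> c * pi"
proof -
  obtain R where R: "0 \<le> R" "\<And>x y. k x y \<noteq> 0 \<Longrightarrow> \<bar>x\<bar> \<le> R \<and> \<bar>y\<bar> \<le> R"
    using bkerE[OF k] by metis
  have "(LINT y|lborel. cmod (k x y)) \<le> (LINT y|lborel. c * (pois d (x - y) * indicator {-R..R} y))"
  proof (rule integral_mono)
    show "cmod (k x y) \<le> c * (pois d (x - y) * indicator {-R..R} y)" for y
      using R(2)[of x y] b[of y] c pois_nonneg[of d "x - y"] d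
      by (cases "k x y = 0") (auto simp: indicator_def abs_le_iff)
  qed (use bker_integrable_row[OF k] pois_integral[OF d R(1)] in auto)
  also have "\<dots> \<le> c * pi" using pois_integral(2)[OF d R(1), of x] c by (simp add: mult_left_mono)
  finally show ?thesis .
qed

lemma kcomp_nonzero:
  assumes "kcomp k l x z \<noteq> 0" obtains y where "k x y \<noteq> 0" "l y z \<noteq> 0"
proof -
  have "\<exists>y. k x y * l y z \<noteq> 0"
  proof (rule ccontr)
    assume "\<not> ?thesis"
    then have "(\<lambda>y. k x y * l y z) = (\<lambda>y. 0)" by (simp add: fun_eq_iff)
    with assms show False unfolding kcomp_def by simp
  qed
  with that show ?thesis by auto
qed

context cell_family
begin

lemma kcomp_ck_nonzero:
  assumes "kcomp (ck G K (j, k, m)) (kadj (ck G K (j', k', m'))) x x' \<noteq> 0"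
  obtains y where "0 < x" "0 < x'" "0 < y" "G j k m (idx j m x) (idx k m y)" "G j' k' m' (idx j' m' x') (idx k' m' y)"
proof -
  obtain y where y: "ck G K (j, k, m) x y \<noteq> 0" "kadj (ck G K (j', k', m')) y x' \<noteq> 0"
    using kcomp_nonzero[OF assms] .
  have 1: "0 < x \<and> 0 < y \<and> G j k m (idx j m x) (idx k m y)"
    using y(1) by (auto simp: ck_def split: if_splits)
  have 2: "0 < x' \<and> 0 < y \<and> G j' k' m' (idx j' m' x') (idx k' m' y)"
    using y(2) by (auto simp: ck_def kadj_def split: if_splits)
  show ?thesis by (rule that[of y]) (use 1 2 in auto)
qed

lemma G_range:
  assumes "G j k m (idx j m x) l" "0 < x"
  shows "2 powr real_of_int j \<le> x" "x \<le> 2 * 2 powr real_of_int j"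
  using ivl_bounds[OF idx_ivl cell_simps(2,3)[OF assms(1)]] assms(2) by auto

lemma G_range_y:
  assumes "G j k m i (idx k m y)" "0 < y"
  shows "2 powr real_of_int k \<le> y" "y < 2 powr (real_of_int k + 1)"
  using idx_range_imp[OF less_imp_le[OF assms(2)] cell_simps(4,5)[OF assms(1)]] by auto

lemma opb_kcomp_disjoint:
  assumes "k \<noteq> k'" shows "opb (kcomp (ck G K (j, k, m)) (kadj (ck G K (j', k', m')))) 0"
proof -
  have "kcomp (ck G K (j, k, m)) (kadj (ck G K (j', k', m'))) x x' = 0" for x x'
  proof (rule ccontr)
    assume "kcomp (ck G K (j, k, m)) (kadj (ck G K (j', k', m'))) x x' \<noteq> 0"
    then obtain y where y: "0 < y" "G j k m (idx j m x) (idx k m y)" "G j' k' m' (idx j' m' x') (idx k' m' y)"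
      by (rule kcomp_ck_nonzero) blast
    have "k = k'" by (rule dyadic_unique[OF G_range_y[OF y(2,1)] G_range_y[OF y(3,1)]])
    with assms show False by simp
  qed
  then have "kcomp (ck G K (j, k, m)) (kadj (ck G K (j', k', m'))) = (\<lambda>x y. 0)" by (intro ext)
  then show ?thesis using opb_zero[of 0] by simp
qed

text \<open>Points of the two blocks are at distance at least \<open>W / 2\<close>, where
  \<open>W\<close> is the larger dyadic scale. The linear bound of \<open>phase_lower\<close> for
  the coarser piece and the quadratic one for the finer piece have a geometric mean that gains the
  root of \<open>2 ^ m'\<close>. The Schur test over dyadic blocks contributes the geometric mean of
  the two scales over \<open>W\<close>, which is the decay in the difference of \<open>j\<close> and
  \<open>j'\<close>.\<close>

lemma opb_kcomp_far:
  assumes cut: "cutoff \<phi> \<phi>' \<phi>'' s u M" and lam: "lam \<noteq> 0" and z: "Re z = 1/2"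
    and mm: "m \<le> m'" and jj: "2 \<le> \<bar>j - j'\<bar>"
  defines "K \<equiv> osc_ker lam z J a \<phi>"
  shows "opb (kcomp (ck G K (j, k, m)) (kadj (ck G K (j', k, m'))))
    (offdiag_const (cmod z) * M\<^sup>2 / \<bar>lam\<bar> * (far_const D * decay j m j' m'))"
proof -
  interpret cutoff \<phi> \<phi>' \<phi>'' s u M by (rule cut)
  define X where "X = offdiag_const (cmod z) * M\<^sup>2 / \<bar>lam\<bar>"
  have X0: "0 \<le> X" unfolding X_def offdiag_const_def by simp
  let ?C = "kcomp (ck G K (j, k, m)) (kadj (ck G K (j', k, m')))"
  have bK: "bker K" unfolding K_def by (rule bker_osc_ker[OF z ker])
  have bC: "bker ?C" by (intro bker_comp bker_adj bker_ck bK)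
  define W where "W = max (2 powr real_of_int j) (2 powr real_of_int j')"
  have W: "0 < W" by (simp add: W_def less_max_iff_disj)
  define g where "g = 2 * gain_const D / 2 ^ m'"
  have g0: "0 < g" using gain_const_ge[of D] by (simp add: g_def)
  define E where "E = 2 / (poly_const D * W) * sqrt g"
  have E0: "0 \<le> E" using poly_const_pos[of D] W g0 by (simp add: E_def)
  have sep: "W / 2 \<le> \<bar>x - x'\<bar>"
    if "2 powr real_of_int j \<le> x" "x \<le> 2 * 2 powr real_of_int j" "2 powr real_of_int j' \<le> x'" "x' \<le> 2 * 2 powr real_of_int j'" for x x'
  proof -
    have q: "2 * (2 * 2 powr real_of_int p) \<le> 2 powr real_of_int p'" if "p + 2 \<le> p'" for p p' :: int
    proof -
      have "(2::real) powr (real_of_int p + 2) \<le> 2 powr real_of_int p'" using that by (intro powr_mono) linarith+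
      then show ?thesis by (simp add: powr_add)
    qed
    consider "j + 2 \<le> j'" | "j' + 2 \<le> j" using jj by linarith
    then show ?thesis
    proof cases
      case 1
      then show ?thesis using q[OF 1] that by (auto simp: W_def max_def)
    next
      case 2
      then show ?thesis using q[OF 2] that by (auto simp: W_def max_def)
    qed
  qed
  have sW: "side j' m' \<le> W / 2 ^ m'" unfolding side_def W_def by (intro divide_right_mono) auto
  have kb: "cmod (?C x x') \<le> X * E" for x x'
  proof (cases "?C x x' = 0")
    case False
    then obtain y0 where y0: "0 < x" "0 < x'" "G j k m (idx j m x) (idx k m y0)" "G j' k m' (idx j' m' x') (idx k m' y0)"
      by (rule kcomp_ck_nonzero) blast
    have L: "W / 2 \<le> \<bar>x - x'\<bar>" by (rule sep; rule G_range[OF y0(3,1)] G_range[OF y0(4,2)])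
    then have ne: "x \<noteq> x'" using W by auto
    have "cmod (?C x x') \<le> offdiag_const (cmod z) * M\<^sup>2 * E / \<bar>lam\<bar>"
      unfolding K_def
    proof (rule offdiag_kernel_bound[OF cut lam z mm ne E0])
      fix l l' y assume g1: "G j k m (idx j m x) l" and g2: "G j' k m' (idx j' m' x') l'"
        and y: "y \<in> ivl k m l" "y \<in> ivl k m' l'"
      define P where "P = \<bar>mixed_poly J a x y\<bar>"
      define P' where "P' = \<bar>mixed_poly J a x' y\<bar>"
      define \<Psi> where "\<Psi> = \<bar>poly (dy_diff_poly J a x x') y\<bar>"
      define L where "L = \<bar>x - x'\<bar>"
      define pc where "pc = poly_const D"
      have pc: "0 < pc" by (simp add: pc_def poly_const_pos)
      have L0: "0 < L" using ne by (simp add: L_def)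
      have xi: "x \<in> ivl j m (idx j m x)" "x' \<in> ivl j' m' (idx j' m' x')" using y0 idx_ivl by auto
      have seg: "mixed_poly J a t y \<noteq> 0" if "t \<in> {min x x'..max x x'}" for t by (rule G_seg[OF g1 g2 xi y that])
      have seg': "mixed_poly J a t y \<noteq> 0" if "t \<in> {min x' x..max x' x}" for t using seg that by (simp add: min.commute max.commute)
      have \<Psi>': "\<bar>poly (dy_diff_poly J a x' x) y\<bar> = \<Psi>" using dy_diff_poly_swap[of J a x' x] by (simp add: \<Psi>_def)
      have L': "\<bar>x' - x\<bar> = L" "(x' - x)\<^sup>2 = L * L" by (simp_all add: L_def abs_minus_commute power2_eq_square abs_mult_self_eq algebra_simps)
      have 1: "pc * L * P \<le> \<Psi>" using phase_lower(1)[OF g1 xi(1) y(1) ne seg] by (simp add: pc_def L_def P_def \<Psi>_def)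
      \<comment> \<open>At level 4 the number \<open>g\<close> is at least 1 and the linear bound
        does it; otherwise the quadratic bound is divided by the distance, which is at least
        \<open>W / 2\<close>.\<close>
      have 2: "pc * L * P' \<le> g * \<Psi>"
      proof (cases "m' = 4")
        case True
        have "pc * L * P' \<le> 1 * \<Psi>" using phase_lower(1)[OF g2 xi(2) y(2) ne[symmetric] seg'] by (simp add: pc_def L' P'_def \<Psi>')
        also have "\<dots> \<le> g * \<Psi>" using gain_const_ge[of D] by (intro mult_right_mono) (auto simp: g_def True \<Psi>_def)
        finally show ?thesis .
      next
        case False
        then have "pc * (L * L) * P' \<le> gain_const D * side j' m' * \<Psi>"
          using phase_lower(2)[OF g2 xi(2) y(2) ne[symmetric] seg'] by (simp add: pc_def L' P'_def \<Psi>' gain_const_def)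
        also have "\<dots> \<le> gain_const D * (W / 2 ^ m') * \<Psi>"
          using sW gain_const_ge[of D] by (intro mult_right_mono mult_left_mono) (auto simp: \<Psi>_def)
        also have "\<dots> = (g * \<Psi>) * (W / 2)" by (simp add: g_def)
        also have "\<dots> \<le> (g * \<Psi>) * L" using L[folded L_def] g0 by (intro mult_left_mono) (auto simp: \<Psi>_def)
        finally have "(pc * L * P') * L \<le> (g * \<Psi>) * L" by (simp add: mult_ac)
        then show ?thesis using L0 by (simp add: mult_ac)
      qed
      have "(pc * L * P) * (pc * L * P') \<le> \<Psi> * (g * \<Psi>)"
        using pc L0 by (intro mult_mono 1 2) (auto simp: P'_def \<Psi>_def)
      then have "sqrt ((pc * L)\<^sup>2 * (P * P')) \<le> sqrt (g * \<Psi>\<^sup>2)"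
        by (intro real_sqrt_le_mono) (simp add: power2_eq_square mult_ac)
      then have 3: "pc * L * sqrt (P * P') \<le> sqrt g * \<Psi>"
        using pc L0 by (simp add: real_sqrt_mult \<Psi>_def)
      have "pc * (W / 2) * sqrt (P * P') \<le> pc * L * sqrt (P * P')"
        using L[folded L_def] pc by (intro mult_right_mono mult_left_mono) (auto simp: P_def P'_def)
      with 3 have "pc * (W / 2) * sqrt (P * P') \<le> sqrt g * \<Psi>" by linarith
      then have "sqrt (P * P') \<le> E * \<Psi>"
        using pc W unfolding E_def pc_def[symmetric] by (simp add: field_simps)
      then show "sqrt (\<bar>mixed_poly J a x y\<bar> * \<bar>mixed_poly J a x' y\<bar>) \<le> E * \<bar>poly (dy_diff_poly J a x x') y\<bar>"
        by (simp add: P_def P'_def \<Psi>_def)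
    qed
    then show ?thesis by (simp add: X_def)
  qed (use X0 E0 in simp)
  have supp: "x \<in> {2 powr real_of_int j..2 * 2 powr real_of_int j} \<and> x' \<in> {2 powr real_of_int j'..2 * 2 powr real_of_int j'}"
    if nzC: "?C x x' \<noteq> 0" for x x'
  proof -
    obtain y0 where y0: "0 < x" "0 < x'" "G j k m (idx j m x) (idx k m y0)" "G j' k m' (idx j' m' x') (idx k m' y0)"
      using nzC by (rule kcomp_ck_nonzero) blast
    then show ?thesis using G_range[OF y0(3,1)] G_range[OF y0(4,2)] by simp
  qed
  have "opb ?C (sqrt ((X * E * (2 * 2 powr real_of_int j' - 2 powr real_of_int j')) * (X * E * (2 * 2 powr real_of_int j - 2 powr real_of_int j))))"
  proof (rule schur[OF bC])
    show "(LINT y|lborel. cmod (?C x y)) \<le> X * E * (2 * 2 powr real_of_int j' - 2 powr real_of_int j')" for x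
      by (rule bker_integral_le[OF bC]) (use supp kb X0 E0 in auto)
    show "(LINT x|lborel. cmod (?C x y)) \<le> X * E * (2 * 2 powr real_of_int j - 2 powr real_of_int j)" for y
    proof -
      have "(LINT x|lborel. cmod (kadj ?C y x)) \<le> X * E * (2 * 2 powr real_of_int j - 2 powr real_of_int j)"
        by (rule bker_integral_le[OF bker_adj[OF bC]]) (use supp kb X0 E0 in \<open>auto simp: kadj_def\<close>)
      then show ?thesis by (simp add: kadj_def)
    qed
  qed (use X0 E0 in auto)
  then show ?thesis
    unfolding X_def[symmetric]
  proof (rule opb_mono)
    have "sqrt ((X * E * (2 * 2 powr real_of_int j' - 2 powr real_of_int j')) * (X * E * (2 * 2 powr real_of_int j - 2 powr real_of_int j)))
        = X * E * sqrt (2 powr (real_of_int j + real_of_int j'))"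
    proof -
      have "(X * E * (2 * 2 powr real_of_int j' - 2 powr real_of_int j')) * (X * E * (2 * 2 powr real_of_int j - 2 powr real_of_int j))
        = (X * E)\<^sup>2 * 2 powr (real_of_int j + real_of_int j')"
        by (simp add: power2_eq_square powr_add mult_ac)
      then show ?thesis using X0 E0 by (simp add: real_sqrt_mult)
    qed
    also have "\<dots> = X * (far_const D * (2 powr ((real_of_int j + real_of_int j') / 2) / W * 2 powr (- real m' / 2)))"
    proof -
      have "sqrt (2 powr (real_of_int j + real_of_int j')) = 2 powr ((real_of_int j + real_of_int j') / 2)"
        by (simp add: powr_half_sqrt[symmetric] powr_powr)
      moreover have "sqrt g = sqrt (2 * gain_const D) * 2 powr (- real m' / 2)"
      proof -
        have "g = 2 * gain_const D * 2 powr (- real m')"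
          by (simp add: g_def powr_minus powr_realpow divide_inverse)
        then show ?thesis using gain_const_ge[of D]
          by (simp add: real_sqrt_mult powr_half_sqrt[symmetric] powr_powr)
      qed
      ultimately show ?thesis by (simp add: E_def far_const_def)
    qed
    also have "\<dots> \<le> X * (far_const D * decay j m j' m')"
    proof (intro mult_left_mono X0 const_nonneg)
      have "W = 2 powr (max (real_of_int j) (real_of_int j'))" by (auto simp: W_def max_def)
      then have "2 powr ((real_of_int j + real_of_int j') / 2) / W * 2 powr (- real m' / 2)
          = 2 powr ((real_of_int j + real_of_int j') / 2 - max (real_of_int j) (real_of_int j') + (- real m' / 2))"
        by (simp only: powr_diff powr_add)
      also have "\<dots> \<le> decay j m j' m'"
        unfolding decay_def using mm by (intro powr_mono) (auto simp: max_def abs_if field_simps)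
      finally show "2 powr ((real_of_int j + real_of_int j') / 2) / W * 2 powr (- real m' / 2) \<le> decay j m j' m'" .
    qed
    finally show "sqrt ((X * E * (2 * 2 powr real_of_int j' - 2 powr real_of_int j')) * (X * E * (2 * 2 powr real_of_int j - 2 powr real_of_int j)))
        \<le> X * (far_const D * decay j m j' m')" .
  qed
qed

text \<open>On a common horizontal line the finer cell is within \<open>root_const D\<close> of its
  own sides of a complex zero, while the coarser cell is a full side \<sigma> away from all zeros;
  so the two are at least \<open>\<sigma> / 2\<close> apart. Quadratic bounds for both cells give a
  kernel of order \<open>sqrt (\<sigma> * \<sigma>')\<close> over the squared distance, and
  integrating beyond \<open>\<sigma> / 2\<close> leaves the root of the quotient of the
  sides.\<close>

lemma opb_kcomp_near:
  assumes cut: "cutoff \<phi> \<phi>' \<phi>'' s u M" and lam: "lam \<noteq> 0" and z: "Re z = 1/2"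
    and mm: "m + (root_const D + 2) \<le> m'" and jj: "\<bar>j - j'\<bar> \<le> 1"
  defines "K \<equiv> osc_ker lam z J a \<phi>"
  shows "opb (kcomp (ck G K (j, k, m)) (kadj (ck G K (j', k, m'))))
    (offdiag_const (cmod z) * M\<^sup>2 / \<bar>lam\<bar> * (near_const D * decay j m j' m'))"
proof -
  interpret cutoff \<phi> \<phi>' \<phi>'' s u M by (rule cut)
  define X where "X = offdiag_const (cmod z) * M\<^sup>2 / \<bar>lam\<bar>"
  have X0: "0 \<le> X" unfolding X_def offdiag_const_def by simp
  let ?C = "kcomp (ck G K (j, k, m)) (kadj (ck G K (j', k, m')))"
  have bK: "bker K" unfolding K_def by (rule bker_osc_ker[OF z ker])
  have bC: "bker ?C" by (intro bker_comp bker_adj bker_ck bK)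
  have mm': "m \<le> m'" and m4: "m' \<noteq> 4" if "4 \<le> m" using mm that by (auto simp: root_const_def)
  define \<sigma> where "\<sigma> = side j m"
  define \<sigma>' where "\<sigma>' = side j' m'"
  have s: "0 < \<sigma>" "0 < \<sigma>'" by (auto simp: \<sigma>_def \<sigma>'_def)
  define pc where "pc = poly_const D"
  have pc: "0 < pc" by (simp add: pc_def poly_const_pos)
  define gc where "gc = gain_const D"
  have gc: "64 \<le> gc" using gain_const_ge by (simp add: gc_def)
  have jle: "(2::real) powr real_of_int j' \<le> 2 * 2 powr real_of_int j"
  proof -
    have "(2::real) powr real_of_int j' \<le> 2 powr (real_of_int j + 1)" using jj by (intro powr_mono) linarith+
    then show ?thesis by (simp add: powr_add)
  qed
  have ratio: "\<sigma>' \<le> 2 * \<sigma> / 2 ^ (m' - m)"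
  proof -
    have "(2::real) ^ m' = 2 ^ m * 2 ^ (m' - m)" using mm by (simp add: power_add[symmetric])
    then have "\<sigma>' = 2 powr real_of_int j' / 2 ^ m / 2 ^ (m' - m)" by (simp add: \<sigma>'_def side_def)
    also have "\<dots> \<le> 2 * 2 powr real_of_int j / 2 ^ m / 2 ^ (m' - m)"
      by (intro divide_right_mono jle) auto
    finally show ?thesis by (simp add: \<sigma>_def side_def)
  qed
  \<comment> \<open>Points in the support are at distance at least \<open>1 / d\<close>, so there
    the inverse squared distance is at most \<open>2 * d\<close> times \<open>pois d\<close>, whose
    integral does not depend on \<open>d\<close>.\<close>
  define d where "d = 2 / \<sigma>"
  have d: "0 < d" using s by (simp add: d_def)
  define c where "c = X * (gc / pc * sqrt (\<sigma> * \<sigma>') * (2 * d))"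
  have c0: "0 \<le> c" using X0 gc pc d s by (simp add: c_def)
  have kb: "cmod (?C x x') \<le> c * pois d (x - x')" for x x'
  proof (cases "?C x x' = 0")
    case False
    then obtain y0 where y0: "0 < x" "0 < x'" "0 < y0" "G j k m (idx j m x) (idx k m y0)" "G j' k m' (idx j' m' x') (idx k m' y0)"
      by (rule kcomp_ck_nonzero) blast
    have m: "4 \<le> m" by (rule cell_simps(1)[OF y0(4)])
    note r1 = G_range[OF y0(4,1)] and r2 = G_range[OF y0(5,2)]
    have L: "\<sigma> / 2 \<le> \<bar>x - x'\<bar>"
    proof -
      have yi: "y0 \<in> ivl k m (idx k m y0)" "y0 \<in> ivl k m' (idx k m' y0)" using idx_ivl y0(3) by auto
      have xi: "x \<in> ivl j m (idx j m x)" "x' \<in> ivl j' m' (idx j' m' x')" using y0 idx_ivl by auto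
      obtain r where r: "mixed_poly J a r (of_real y0) = 0" "cmod (of_real x' - r) \<le> real (root_const D) * \<sigma>'"
        using cell_near_root[OF G_cell[OF y0(5)] m4[OF m] xi(2) yi(2)] by (auto simp: \<sigma>'_def)
      have "\<sigma> \<le> cmod (of_real x - r)"
        unfolding \<sigma>_def by (rule good_far_root[OF cell_simps(6)[OF y0(4)] xi(1) _ _ r(1)])
          (use yi(1) side_pos[of k m] in \<open>auto simp: ivl_def algebra_simps\<close>)
      also have "\<dots> \<le> cmod (of_real x - of_real x') + cmod (of_real x' - r)"
        using norm_triangle_ineq[of "of_real x - of_real x'" "of_real x' - r"] by simp
      also have "cmod (complex_of_real x - of_real x') = \<bar>x - x'\<bar>" by (metis norm_of_real of_real_diff)
      finally have 1: "\<sigma> \<le> \<bar>x - x'\<bar> + real (root_const D) * \<sigma>'" using r(2) by linarith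
      \<comment> \<open>The gap \<open>root_const D + 2\<close> between the levels is chosen for
        this: neighbouring blocks may cost a factor 2 in the ratio of the sides, and another 2
        leaves half of \<sigma>.\<close>
      have "real (4 * root_const D) \<le> 2 ^ (root_const D + 2)"
      proof -
        have "root_const D \<le> 2 ^ root_const D" by (rule less_imp_le[OF less_exp])
        then have "real (4 * root_const D) \<le> real (4 * 2 ^ root_const D)" by (intro of_nat_mono) simp
        then show ?thesis by (simp add: power_add)
      qed
      also have "\<dots> \<le> 2 ^ (m' - m)" using mm by (intro power_increasing) auto
      finally have "4 * real (root_const D) \<le> 2 ^ (m' - m)" by simp
      then have "real (root_const D) * (2 * \<sigma> / 2 ^ (m' - m)) \<le> \<sigma> / 2" using s by (simp add: field_simps)
      moreover have "real (root_const D) * \<sigma>' \<le> real (root_const D) * (2 * \<sigma> / 2 ^ (m' - m))"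
        using ratio by (intro mult_left_mono) auto
      ultimately show ?thesis using 1 by linarith
    qed
    then have ne: "x \<noteq> x'" using s by auto
    define E where "E = gc / pc * sqrt (\<sigma> * \<sigma>') / (x - x')\<^sup>2"
    have E0: "0 \<le> E" using gc pc s by (simp add: E_def)
    have "cmod (?C x x') \<le> offdiag_const (cmod z) * M\<^sup>2 * E / \<bar>lam\<bar>"
      unfolding K_def
    proof (rule offdiag_kernel_bound[OF cut lam z mm'[OF m] ne E0])
      fix l l' y assume g1: "G j k m (idx j m x) l" and g2: "G j' k m' (idx j' m' x') l'"
        and y: "y \<in> ivl k m l" "y \<in> ivl k m' l'"
      define P where "P = \<bar>mixed_poly J a x y\<bar>"
      define P' where "P' = \<bar>mixed_poly J a x' y\<bar>"
      define \<Psi> where "\<Psi> = \<bar>poly (dy_diff_poly J a x x') y\<bar>"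
      define L2 where "L2 = (x - x')\<^sup>2"
      have L20: "0 < L2" using ne by (simp add: L2_def)
      have xi: "x \<in> ivl j m (idx j m x)" "x' \<in> ivl j' m' (idx j' m' x')" using y0 idx_ivl by auto
      have seg: "mixed_poly J a t y \<noteq> 0" if "t \<in> {min x x'..max x x'}" for t by (rule G_seg[OF g1 g2 xi y that])
      have seg': "mixed_poly J a t y \<noteq> 0" if "t \<in> {min x' x..max x' x}" for t using seg that by (simp add: min.commute max.commute)
      have \<Psi>': "\<bar>poly (dy_diff_poly J a x' x) y\<bar> = \<Psi>" using dy_diff_poly_swap[of J a x' x] by (simp add: \<Psi>_def)
      have L': "(x' - x)\<^sup>2 = L2" by (simp add: L2_def power2_commute)
      have cond: "m \<noteq> 4 \<or> \<bar>x - x'\<bar> \<le> 64 * side j m"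
      proof (cases "m = 4")
        case True
        then have "64 * side j m = 4 * 2 powr real_of_int j" by (simp add: side_def)
        moreover have "x' \<le> 4 * 2 powr real_of_int j" using r2(2) jle by linarith
        ultimately have "\<bar>x - x'\<bar> \<le> 64 * side j m" using r1 y0(1,2) by (simp add: abs_le_iff)
        then show ?thesis ..
      qed simp
      have 1: "pc * L2 * P \<le> gc * \<sigma> * \<Psi>"
        using phase_lower(2)[OF g1 xi(1) y(1) ne seg cond] by (simp add: pc_def L2_def P_def \<Psi>_def gc_def gain_const_def \<sigma>_def)
      have 2: "pc * L2 * P' \<le> gc * \<sigma>' * \<Psi>"
        using phase_lower(2)[OF g2 xi(2) y(2) ne[symmetric] seg'] m4[OF m]
        by (simp add: pc_def L' P'_def \<Psi>' gc_def gain_const_def \<sigma>'_def)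
      have "(pc * L2 * P) * (pc * L2 * P') \<le> (gc * \<sigma> * \<Psi>) * (gc * \<sigma>' * \<Psi>)"
        using pc L20 gc s by (intro mult_mono 1 2) (auto simp: P'_def \<Psi>_def)
      then have "sqrt ((pc * L2)\<^sup>2 * (P * P')) \<le> sqrt ((gc * \<Psi>)\<^sup>2 * (\<sigma> * \<sigma>'))"
        by (intro real_sqrt_le_mono) (simp add: power2_eq_square mult_ac)
      then have "pc * L2 * sqrt (P * P') \<le> gc * \<Psi> * sqrt (\<sigma> * \<sigma>')"
        using pc L20 gc by (simp add: real_sqrt_mult[of "_ ^ 2"] \<Psi>_def)
      then have "sqrt (P * P') \<le> E * \<Psi>"
        using pc L20 unfolding E_def L2_def[symmetric] by (simp add: field_simps)
      then show "sqrt (\<bar>mixed_poly J a x y\<bar> * \<bar>mixed_poly J a x' y\<bar>) \<le> E * \<bar>poly (dy_diff_poly J a x x') y\<bar>"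
        by (simp add: P_def P'_def \<Psi>_def)
    qed
    also have "\<dots> = X * (gc / pc * sqrt (\<sigma> * \<sigma>') * (1 / (x - x')\<^sup>2))" by (simp add: X_def E_def)
    also have "\<dots> \<le> X * (gc / pc * sqrt (\<sigma> * \<sigma>') * (2 * d * pois d (x - x')))"
    proof (intro mult_left_mono)
      have "1 \<le> d * \<bar>x - x'\<bar>" using L s by (simp add: d_def field_simps)
      then have "1 \<le> (d * \<bar>x - x'\<bar>)\<^sup>2" by (rule one_le_power)
      then have "1 + d\<^sup>2 * (x - x')\<^sup>2 \<le> 2 * (d\<^sup>2 * (x - x')\<^sup>2)" by (simp add: power_mult_distrib)
      moreover have "0 < (x - x')\<^sup>2" using ne by simp
      ultimately show "1 / (x - x')\<^sup>2 \<le> 2 * d * pois d (x - x')"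
        using pois_den_pos[of d "x - x'"] unfolding pois_def by (simp add: field_simps power2_eq_square)
    qed (use X0 gc pc s in auto)
    also have "\<dots> = c * pois d (x - x')" by (simp add: c_def)
    finally show ?thesis .
  qed (use c0 pois_nonneg[of d] d in simp)
  have "opb ?C (sqrt ((c * pi) * (c * pi)))"
  proof (rule schur[OF bC])
    show "(LINT y|lborel. cmod (?C x y)) \<le> c * pi" for x by (rule bker_integral_le_pois[OF bC d c0 kb])
    show "(LINT x|lborel. cmod (?C x y)) \<le> c * pi" for y
    proof -
      have "(LINT x|lborel. cmod (kadj ?C y x)) \<le> c * pi"
      proof (rule bker_integral_le_pois[OF bker_adj[OF bC] d c0])
        show "cmod (kadj ?C y x) \<le> c * pois d (y - x)" for x
          using kb[of x y] by (simp add: kadj_def pois_def power2_commute)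
      qed
      then show ?thesis by (simp add: kadj_def)
    qed
  qed (use c0 in auto)
  then show ?thesis
    unfolding X_def[symmetric]
  proof (rule opb_mono)
    have ceq: "c = X * (gc / pc * 4 * sqrt (\<sigma>' / \<sigma>))"
    proof -
      have "sqrt (\<sigma> * \<sigma>') * (2 * d) = 4 * (sqrt \<sigma> / \<sigma> * sqrt \<sigma>')" by (simp add: d_def real_sqrt_mult)
      also have "sqrt \<sigma> / \<sigma> = 1 / sqrt \<sigma>" using s by (simp add: field_simps)
      finally have e: "sqrt (\<sigma> * \<sigma>') * (2 * d) = 4 * sqrt (\<sigma>' / \<sigma>)" by (simp add: real_sqrt_divide)
      have "c = X * (gc / pc * (sqrt (\<sigma> * \<sigma>') * (2 * d)))" by (simp only: c_def mult.assoc)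
      then show ?thesis unfolding e by simp
    qed
    have "sqrt ((c * pi) * (c * pi)) = c * pi" using c0 by simp
    also have "c * pi = X * (gc / pc * 4 * sqrt (\<sigma>' / \<sigma>)) * pi" by (simp only: ceq)
    also have "X * (gc / pc * 4 * sqrt (\<sigma>' / \<sigma>)) * pi \<le> X * (gc / pc * 4 * (2 * decay j m j' m')) * pi"
    proof (intro mult_right_mono mult_left_mono X0)
      have "\<sigma>' / \<sigma> \<le> 2 / 2 ^ (m' - m)" using ratio s by (simp add: field_simps)
      also have "\<dots> = 2 powr (1 - (real m' - real m))"
        using mm by (simp add: powr_diff powr_realpow[symmetric] of_nat_diff)
      finally have "sqrt (\<sigma>' / \<sigma>) \<le> sqrt (2 powr (1 - (real m' - real m)))" by (rule real_sqrt_le_mono)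
      also have "\<dots> = 2 powr ((1 - (real m' - real m)) / 2)" by (simp add: powr_half_sqrt[symmetric] powr_powr)
      also have "\<dots> \<le> 2 powr (1 + (- (\<bar>real_of_int j - real_of_int j'\<bar> + \<bar>real m - real m'\<bar>) / 2))"
      proof (rule powr_mono)
        have h: "(1 - r) / 2 \<le> 1 + (- (p + r) / 2)" if "p \<le> 1" for p r :: real
          using that by (simp add: field_simps)
        have "\<bar>real_of_int j - real_of_int j'\<bar> \<le> 1" using jj by linarith
        moreover have "\<bar>real m - real m'\<bar> = real m' - real m" using mm by simp
        ultimately show "(1 - (real m' - real m)) / 2 \<le> 1 + (- (\<bar>real_of_int j - real_of_int j'\<bar> + \<bar>real m - real m'\<bar>) / 2)"
          by (simp only: h)
      qed simp
      also have "\<dots> = 2 * decay j m j' m'" by (simp add: decay_def powr_add)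
      finally show "sqrt (\<sigma>' / \<sigma>) \<le> 2 * decay j m j' m'" .
    qed (use gc pc in auto)
    also have "\<dots> = X * (near_const D * decay j m j' m')" by (simp add: near_const_def gc_def pc_def)
    finally show "sqrt ((c * pi) * (c * pi)) \<le> X * (near_const D * decay j m j' m')" .
  qed
qed

text \<open>Taking adjoints interchanges the two pieces, so the second may be assumed to have the
  finer level. For close parameters the decay factor is bounded below and the norms of the single
  pieces suffice.\<close>

lemma opb_kcomp_decay:
  assumes cut: "cutoff \<phi> \<phi>' \<phi>'' s u M" and lam: "lam \<noteq> 0" and z: "Re z = 1/2"
  defines "K \<equiv> osc_ker lam z J a \<phi>"
  shows "opb (kcomp (ck G K (j, k, m)) (kadj (ck G K (j', k, m'))))
    (tt_const D * (1 + cmod z)\<^sup>2 * M\<^sup>2 / \<bar>lam\<bar> * decay j m j' m')"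
proof -
  interpret cutoff \<phi> \<phi>' \<phi>'' s u M by (rule cut)
  have bK: "bker K" unfolding K_def by (rule bker_osc_ker[OF z ker])
  define X where "X = offdiag_const (cmod z) * M\<^sup>2 / \<bar>lam\<bar>"
  have X: "X \<le> real (count_const D) * (4 + 2 * real D + 8 ^ D * real (D + 1)) * ((1 + cmod z)\<^sup>2 * M\<^sup>2 / \<bar>lam\<bar>)"
  proof -
    define e where "e = (8::real) ^ D * real (D + 1)"
    have e: "0 \<le> e" by (simp add: e_def)
    have "1 \<le> (1 + cmod z)\<^sup>2" "cmod z \<le> (1 + cmod z)\<^sup>2" by (simp_all add: power2_sum)
    then have "4 + 2 * cmod z * real D + e \<le> 4 * (1 + cmod z)\<^sup>2 + 2 * (1 + cmod z)\<^sup>2 * real D + e * (1 + cmod z)\<^sup>2"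
      using mult_left_mono[of 1 "(1 + cmod z)\<^sup>2" e] e by (intro add_mono mult_right_mono mult_left_mono) auto
    then have "real (count_const D) * (4 + 2 * cmod z * real D + e) \<le> real (count_const D) * ((4 + 2 * real D + e) * (1 + cmod z)\<^sup>2)"
      by (intro mult_left_mono) (auto simp: algebra_simps)
    then have "offdiag_const (cmod z) \<le> real (count_const D) * (4 + 2 * real D + e) * (1 + cmod z)\<^sup>2"
      by (simp add: offdiag_const_def e_def mult.assoc)
    then have "offdiag_const (cmod z) * (M\<^sup>2 / \<bar>lam\<bar>) \<le> real (count_const D) * (4 + 2 * real D + e) * (1 + cmod z)\<^sup>2 * (M\<^sup>2 / \<bar>lam\<bar>)"
      by (rule mult_right_mono) simp
    then show ?thesis by (simp add: X_def e_def mult_ac)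
  qed
  define Y where "Y = (1 + cmod z)\<^sup>2 * M\<^sup>2 / \<bar>lam\<bar>"
  have Y0: "0 \<le> Y" by (simp add: Y_def)
  have dp: "0 \<le> decay j m j' m'" for j m j' m' by (simp add: decay_def)
  have wlog: "opb (kcomp (ck G K (j, k, m)) (kadj (ck G K (j', k, m')))) (tt_const D * Y * decay j m j' m')"
    if mm: "m \<le> m'" for j m j' m'
  proof -
    define N where "N = real (count_const D) * (4 + 2 * real D + 8 ^ D * real (D + 1))"
    have N0: "0 \<le> N" by (simp add: N_def)
    have XN: "X \<le> N * Y" using X by (simp add: N_def Y_def)
    have far: "X * (far_const D * decay j m j' m') \<le> tt_const D * Y * decay j m j' m'"
      and near: "X * (near_const D * decay j m j' m') \<le> tt_const D * Y * decay j m j' m'"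
      and close: "close_const D * Y * decay j m j' m' \<le> tt_const D * Y * decay j m j' m'"
    proof -
      have t: "tt_const D = N * (far_const D + near_const D) + close_const D" by (simp add: tt_const_def N_def)
      have "X * far_const D \<le> N * Y * far_const D" "X * near_const D \<le> N * Y * near_const D"
        using XN const_nonneg by (auto intro: mult_right_mono)
      moreover have "0 \<le> N * Y * far_const D" "0 \<le> N * Y * near_const D" "0 \<le> close_const D * Y"
        using N0 Y0 const_nonneg[of D] by auto
      ultimately have "X * far_const D \<le> tt_const D * Y" "X * near_const D \<le> tt_const D * Y" "close_const D * Y \<le> tt_const D * Y"
        unfolding t by (simp_all add: algebra_simps)
      from this[THEN mult_right_mono, OF dp]
      show "X * (far_const D * decay j m j' m') \<le> tt_const D * Y * decay j m j' m'"
        "X * (near_const D * decay j m j' m') \<le> tt_const D * Y * decay j m j' m'"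
        "close_const D * Y * decay j m j' m' \<le> tt_const D * Y * decay j m j' m'"
        by (simp_all add: mult.assoc)
    qed
    consider "2 \<le> \<bar>j - j'\<bar>" | "\<bar>j - j'\<bar> \<le> 1" "m + (root_const D + 2) \<le> m'" | "\<bar>j - j'\<bar> \<le> 1" "m' \<le> m + (root_const D + 2)"
      by linarith
    then show ?thesis
    proof cases
      case 1
      show ?thesis by (rule opb_mono[OF opb_kcomp_far[OF cut lam z mm 1, folded K_def X_def] far])
    next
      case 2
      show ?thesis by (rule opb_mono[OF opb_kcomp_near[OF cut lam z 2(2,1), folded K_def X_def] near])
    next
      case 3
      define \<beta> where "\<beta> = real (count_const D) * (box_const D * (1 + cmod z) * M / sqrt \<bar>lam\<bar>)"
      have \<beta>0: "0 \<le> \<beta>" using M_nonneg by (simp add: \<beta>_def box_const_def kernel_const_def)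
      have o: "opb (ck G K c) \<beta>" for c unfolding \<beta>_def K_def by (rule cell_bound[OF cut lam z])
      have "opb (kcomp (ck G K (j, k, m)) (kadj (ck G K (j', k, m')))) (\<beta> * \<beta>)"
        by (intro opb_comp bker_adj bker_ck bK opb_adj o \<beta>0)
      moreover have "\<beta> * \<beta> \<le> close_const D * Y * decay j m j' m'"
      proof -
        have b: "\<beta> * \<beta> = (real (count_const D) * box_const D)\<^sup>2 * Y"
          by (simp add: \<beta>_def Y_def power2_eq_square field_simps)
        have "1 \<le> 2 powr ((1 + real (root_const D + 2)) / 2) * decay j m j' m'"
        proof -
          have h: "0 \<le> (1 + r) / 2 + (- (p + q) / 2)" if "p \<le> 1" "q \<le> r" for p q r :: real
            using that by (simp add: field_simps)
          have "\<bar>real_of_int j - real_of_int j'\<bar> \<le> 1" "\<bar>real m - real m'\<bar> \<le> real (root_const D + 2)"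
            using 3 mm by (linarith, auto)
          then have "0 \<le> (1 + real (root_const D + 2)) / 2 + (- (\<bar>real_of_int j - real_of_int j'\<bar> + \<bar>real m - real m'\<bar>) / 2)" by (rule h)
          then have "(1::real) \<le> 2 powr ((1 + real (root_const D + 2)) / 2 + (- (\<bar>real_of_int j - real_of_int j'\<bar> + \<bar>real m - real m'\<bar>) / 2))"
            by (rule ge_one_powr_ge_zero[rotated]) simp
          then show ?thesis by (simp add: decay_def powr_add)
        qed
        from mult_left_mono[OF this, of "(real (count_const D) * box_const D)\<^sup>2 * Y"] Y0
        show ?thesis unfolding b by (simp add: close_const_def mult_ac)
      qed
      ultimately show ?thesis using close opb_mono by (meson order_trans)
    qed
  qed
  have "opb (kcomp (ck G K (j, k, m)) (kadj (ck G K (j', k, m')))) (tt_const D * Y * decay j m j' m')"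
  proof (cases "m \<le> m'")
    case True
    then show ?thesis by (rule wlog)
  next
    case False
    then have "opb (kcomp (ck G K (j', k, m')) (kadj (ck G K (j, k, m)))) (tt_const D * Y * decay j' m' j m)"
      by (intro wlog) simp
    then have "opb (kadj (kcomp (ck G K (j', k, m')) (kadj (ck G K (j, k, m))))) (tt_const D * Y * decay j' m' j m)"
      by (rule opb_adj[rotated 2]) (use tt_const_nonneg Y0 dp in \<open>auto intro!: bker_comp bker_adj bker_ck bK\<close>)
    then show ?thesis by (subst kcomp_adj_swap) (simp add: decay_sym)
  qed
  then show ?thesis by (simp add: Y_def mult.assoc)
qed

end

text \<open>Dominated convergence in the sesquilinear form. It replaces the infinite sum over all
  cells, since the Cotlar--Stein theorem above is for finite families.\<close>

lemma opb_limit: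
  assumes k: "bker k" and kn: "\<And>n. bker (kn n)" and C: "0 \<le> C" and o: "\<And>n. opb (kn n) C"
    and le: "\<And>n x y. cmod (kn n x y) \<le> cmod (k x y)" and lim: "\<And>x y. (\<lambda>n. kn n x y) \<longlonglongrightarrow> k x y"
  shows "opb k C"
proof (rule opb_formI[OF k C])
  fix f g assume f: "sqint f" and g: "sqint g"
  let ?F = "\<lambda>k p. k (fst p) (snd p) * f (snd p) * cnj (g (fst p))"
  have i: "integrable (lborel \<Otimes>\<^sub>M lborel) (\<lambda>p. cmod (k (fst p) (snd p)) * cmod (f (snd p)) * cmod (g (fst p)))"
    using bker_integrable2(2)[OF k f g] by (simp add: case_prod_unfold)
  have ik: "integrable (lborel \<Otimes>\<^sub>M lborel) (?F l)" if "bker l" for l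
    using bker_integrable2(1)[OF that f g] by (simp add: case_prod_unfold)
  have "(\<lambda>n. LINT p|(lborel \<Otimes>\<^sub>M lborel). ?F (kn n) p) \<longlonglongrightarrow> (LINT p|(lborel \<Otimes>\<^sub>M lborel). ?F k p)"
  proof (rule integral_dominated_convergence)
    show "?F k \<in> borel_measurable (lborel \<Otimes>\<^sub>M lborel)" by (rule borel_measurable_integrable[OF ik[OF k]])
    show "?F (kn n) \<in> borel_measurable (lborel \<Otimes>\<^sub>M lborel)" for n by (rule borel_measurable_integrable[OF ik[OF kn]])
    show "integrable (lborel \<Otimes>\<^sub>M lborel) (\<lambda>p. cmod (k (fst p) (snd p)) * cmod (f (snd p)) * cmod (g (fst p)))" by (rule i)
    show "AE p in lborel \<Otimes>\<^sub>M lborel. (\<lambda>n. ?F (kn n) p) \<longlonglongrightarrow> ?F k p"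
      by (intro AE_I2 tendsto_intros lim)
    show "AE p in lborel \<Otimes>\<^sub>M lborel. norm (?F (kn n) p) \<le> cmod (k (fst p) (snd p)) * cmod (f (snd p)) * cmod (g (fst p))" for n
      by (rule AE_I2) (use le in \<open>auto simp: norm_mult intro!: mult_right_mono\<close>)
  qed
  then have "(\<lambda>n. ip (kop (kn n) f) g) \<longlonglongrightarrow> ip (kop k f) g"
    by (simp add: ip_kop_integral k kn f g)
  then have "(\<lambda>n. cmod (ip (kop (kn n) f) g)) \<longlonglongrightarrow> cmod (ip (kop k f) g)" by (rule tendsto_norm)
  then show "cmod (ip (kop k f) g) \<le> C * nrm f * nrm g"
    by (rule LIMSEQ_le_const2) (use opb_form[OF kn o f g] in auto)
qed

section \<open>Summation over sizes and sectors in the first quadrant\<close>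

lemma sum_geometric_nat:
  fixes r :: real
  assumes "0 \<le> r" "r < 1" "finite S"
  shows "(\<Sum>n\<in>S. r ^ n) \<le> 1 / (1 - r)"
  using sum_le_suminf[of "\<lambda>n. r ^ n" S] assms suminf_geometric[of r] summable_geometric[of r] by auto

lemma sum_geometric_int:
  fixes r :: real and S :: "int set"
  assumes r: "0 \<le> r" "r < 1" and S: "finite S"
  shows "(\<Sum>j'\<in>S. r ^ nat \<bar>j - j'\<bar>) \<le> 2 / (1 - r)"
proof -
  have h: "(\<Sum>j'\<in>T. r ^ nat \<bar>j - j'\<bar>) \<le> 1 / (1 - r)" if "T \<subseteq> S" "inj_on (\<lambda>j'. nat \<bar>j - j'\<bar>) T" for T
  proof -
    have "(\<Sum>j'\<in>T. r ^ nat \<bar>j - j'\<bar>) = (\<Sum>n\<in>(\<lambda>j'. nat \<bar>j - j'\<bar>) ` T. r ^ n)"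
      using that(2) by (simp add: sum.reindex)
    also have "\<dots> \<le> 1 / (1 - r)"
      using sum_geometric_nat r finite_subset[OF that(1) S] by blast
    finally show ?thesis .
  qed
  have "(\<Sum>j'\<in>S. r ^ nat \<bar>j - j'\<bar>) = (\<Sum>j'\<in>{j'\<in>S. j \<le> j'}. r ^ nat \<bar>j - j'\<bar>) + (\<Sum>j'\<in>{j'\<in>S. j' < j}. r ^ nat \<bar>j - j'\<bar>)"
    by (subst sum.union_disjoint[symmetric]) (use S in \<open>auto intro!: sum.cong\<close>)
  also have "\<dots> \<le> 1 / (1 - r) + 1 / (1 - r)"
    by (intro add_mono h) (auto simp: inj_on_def)
  finally show ?thesis by simp
qed

definition root4 :: real where
  "root4 = 2 powr (- 1 / 4)"

lemma root4: "0 \<le> root4" "root4 < 1"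
  by (simp_all add: root4_def powr_less_one)

lemma sqrt_decay: "sqrt (decay j m j' m') = root4 ^ nat \<bar>j - j'\<bar> * root4 ^ nat \<bar>int m - int m'\<bar>"
proof -
  have p: "root4 ^ n = 2 powr (- real n / 4)" for n
    unfolding root4_def by (simp add: powr_realpow[symmetric] powr_powr)
  have "sqrt (decay j m j' m') = 2 powr (- (\<bar>real_of_int j - real_of_int j'\<bar> + \<bar>real m - real m'\<bar>) / 4)"
    by (simp add: decay_def powr_half_sqrt[symmetric] powr_powr)
  moreover have "real (nat \<bar>j - j'\<bar>) = \<bar>real_of_int j - real_of_int j'\<bar>" "real (nat \<bar>int m - int m'\<bar>) = \<bar>real m - real m'\<bar>"
    by (simp_all add: nat_abs_int_diff)
  ultimately show ?thesis unfolding p by (simp add: powr_add[symmetric] add_divide_distrib diff_divide_distrib)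
qed

definition geo_const :: real where
  "geo_const = (2 / (1 - root4))\<^sup>2"

lemma geo_const_pos: "0 < geo_const"
  using root4 by (simp add: geo_const_def)

lemma sum_sqrt_decay:
  assumes S: "finite S"
  shows "(\<Sum>(j', m')\<in>S. sqrt (decay j m j' m')) \<le> geo_const"
proof -
  define S1 where "S1 = fst ` S"
  define S2 where "S2 = int ` snd ` S"
  have fin: "finite S1" "finite S2" using S by (auto simp: S1_def S2_def)
  have "(\<Sum>(j', m')\<in>S. sqrt (decay j m j' m')) = (\<Sum>q\<in>(\<lambda>(j', m'). (j', int m')) ` S. root4 ^ nat \<bar>j - fst q\<bar> * root4 ^ nat \<bar>int m - snd q\<bar>)"
    by (subst sum.reindex) (auto simp: inj_on_def sqrt_decay case_prod_unfold)
  also have "\<dots> \<le> (\<Sum>q\<in>S1 \<times> S2. root4 ^ nat \<bar>j - fst q\<bar> * root4 ^ nat \<bar>int m - snd q\<bar>)"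
    by (rule sum_mono2) (use fin root4 in \<open>auto simp: S1_def S2_def image_iff intro!: mult_nonneg_nonneg zero_le_power, force+\<close>)
  also have "\<dots> = (\<Sum>j'\<in>S1. root4 ^ nat \<bar>j - j'\<bar>) * (\<Sum>m'\<in>S2. root4 ^ nat \<bar>int m - m'\<bar>)"
    by (simp add: sum_product sum.cartesian_product case_prod_unfold)
  also have "\<dots> \<le> (2 / (1 - root4)) * (2 / (1 - root4))"
    by (intro mult_mono sum_geometric_int fin root4 sum_nonneg zero_le_power) (use root4 in auto)
  finally show ?thesis by (simp add: geo_const_def power2_eq_square)
qed

lemma tt_const_pos: "0 < tt_const D"
proof -
  have "0 < count_const D" by (simp add: count_const_def)
  then have "0 < real (count_const D)" by simp
  moreover have "0 < box_const D" by (simp add: box_const_def kernel_const_def add_nonneg_pos)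
  ultimately have "0 < real (count_const D) * box_const D" by (rule mult_pos_pos)
  then have "0 < (real (count_const D) * box_const D)\<^sup>2" by (rule zero_less_power)
  then have "0 < close_const D" unfolding close_const_def by (rule mult_pos_pos) simp
  moreover have "0 \<le> real (count_const D) * (4 + 2 * real D + 8 ^ D * real (D + 1)) * (far_const D + near_const D)"
    using const_nonneg[of D] by (intro mult_nonneg_nonneg add_nonneg_nonneg) auto
  ultimately show ?thesis by (simp add: tt_const_def)
qed

context qh_data
begin

text \<open>The corner stands for the whole box, because a good box lies in one sector by
  \<open>sect_const_on_cell\<close>.\<close>

definition sector_cell :: "nat \<Rightarrow> int \<Rightarrow> int \<Rightarrow> nat \<Rightarrow> nat \<Rightarrow> nat \<Rightarrow> bool" where
  "sector_cell \<sigma> j k m i l \<longleftrightarrow> cell J a j k m i l \<and> sect (real i * side j m) (real l * side k m) = \<sigma>"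

lemma cell_point:
  assumes c: "cell J a j k m i l" and x: "x \<in> ivl j m i" and y: "y \<in> ivl k m l"
  shows "0 < x" "0 < y" "mixed_poly J a x y \<noteq> 0" "sect x y = sect (real i * side j m) (real l * side k m)"
proof -
  have il: "2 ^ m \<le> i" "i < 2 ^ Suc m" "2 ^ m \<le> l" "l < 2 ^ Suc m" "good J a j k m i l" "4 \<le> m"
    using c by (auto simp: cell_def)
  then have "(16::nat) \<le> 2 ^ m" using power_increasing[of 4 m "2::nat"] by simp
  then have il': "0 < i" "1 < l" using il by linarith+
  show "0 < x" "0 < y" using ivl_bounds(3)[OF x il(1,2)] ivl_bounds(3)[OF y il(3,4)] .
  have yl: "(real l - 1) * side k m \<le> y" "y \<le> (real l + 2) * side k m"
    using y side_pos[of k m] by (auto simp: ivl_def algebra_simps)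
  show "mixed_poly J a x y \<noteq> 0" by (rule good_comparable(2)[OF il(5) il' x x yl yl])
  show "sect x y = sect (real i * side j m) (real l * side k m)"
    by (rule sect_const_on_cell[OF c x y]) (auto simp: ivl_def mult_right_mono less_imp_le)
qed

lemma sector_family: "cell_family J a \<eta> d D (sector_cell \<sigma>)"
proof
  show "cell J a j k m i l" if "sector_cell \<sigma> j k m i l" for j k m i l
    using that by (simp add: sector_cell_def)
  show "mixed_poly J a t y \<noteq> 0"
    if g: "sector_cell \<sigma> j k m i l" "sector_cell \<sigma> j' k m' i' l'" and x: "x \<in> ivl j m i" "x' \<in> ivl j' m' i'"
      and y: "y \<in> ivl k m l" "y \<in> ivl k m' l'" and t: "t \<in> {min x x'..max x x'}" for j k m i l j' m' i' l' x x' y t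
  proof -
    have c: "cell J a j k m i l" "cell J a j' k m' i' l'" using g by (auto simp: sector_cell_def)
    have s: "sect x y = sect x' y"
      using cell_point(4)[OF c(1) x(1) y(1)] cell_point(4)[OF c(2) x(2) y(2)] g by (simp add: sector_cell_def)
    note p = cell_point[OF c(1) x(1) y(1)] and p' = cell_point[OF c(2) x(2) y(2)]
    show ?thesis
    proof (cases "x \<le> x'")
      case True
      then show ?thesis using sect_segment_x[OF p(2) p(3) p'(3) s] t by simp
    next
      case False
      then show ?thesis using sect_segment_x[OF p(2) p'(3) p(3) s[symmetric]] t by simp
    qed
  qed
qed

text \<open>The zero curves are monotone in the quadrant, so vertical segments between points of one
  sector avoid them just as horizontal ones do. Hence the same family of cells serves the
  adjoint.\<close>

lemma sector_family_flip:
  "cell_family (flip_set J) (flip_coeff a) (1 / \<eta>) (d / \<eta>) D (\<lambda>k j m l i. sector_cell \<sigma> j k m i l)"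
proof -
  interpret F: qh_data "flip_set J" "flip_coeff a" "1 / \<eta>" "d / \<eta>" D by (rule flip)
  show ?thesis
  proof
    show "cell (flip_set J) (flip_coeff a) k j m l i" if "sector_cell \<sigma> j k m i l" for j k m i l
      using that by (simp add: sector_cell_def cell_flip)
    show "mixed_poly (flip_set J) (flip_coeff a) t x \<noteq> 0"
      if g: "sector_cell \<sigma> j k m i l" "sector_cell \<sigma> j k' m' i' l'" and y: "y \<in> ivl k m l" "y' \<in> ivl k' m' l'"
        and x: "x \<in> ivl j m i" "x \<in> ivl j m' i'" and t: "t \<in> {min y y'..max y y'}" for k j m l i k' m' l' i' y y' x t
    proof -
      have c: "cell J a j k m i l" "cell J a j k' m' i' l'" using g by (auto simp: sector_cell_def)
      have s: "sect x y = sect x y'"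
        using cell_point(4)[OF c(1) x(1) y(1)] cell_point(4)[OF c(2) x(2) y(2)] g by (simp add: sector_cell_def)
      note p = cell_point[OF c(1) x(1) y(1)] and p' = cell_point[OF c(2) x(2) y(2)]
      have "mixed_poly J a x t \<noteq> 0"
      proof (cases "y \<le> y'")
        case True
        then show ?thesis using sect_segment_y[OF p(1,2) p(3) p'(3) s] t by simp
      next
        case False
        then show ?thesis using sect_segment_y[OF p'(1,2) p'(3) p(3) s[symmetric]] t by simp
      qed
      then show ?thesis by (simp add: mixed_poly_flip)
    qed
  qed
qed

text \<open>\<open>cut\<close> supplies the estimates for \<open>T T\<^sup>*\<close>, and
  \<open>cut2\<close>, the cutoff with its variables exchanged, those for
  \<open>T\<^sup>* T\<close>. The constant in the products is quadratic in
  \<open>(1 + cmod z) * M\<close>, and its square root is linear.\<close>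

lemma sector_bound:
  assumes cut: "cutoff \<phi> \<phi>' \<phi>'' s u M" and cut2: "cutoff (\<lambda>y x. \<phi> x y) \<psi>' \<psi>'' s2 u2 M"
    and M: "0 < M" and lam: "lam \<noteq> 0" and z: "Re z = 1/2" and F: "finite F"
  shows "opb (\<lambda>x y. \<Sum>c\<in>F. ck (sector_cell \<sigma>) (osc_ker lam z J a \<phi>) c x y)
    (sqrt (tt_const D) * geo_const * ((1 + cmod z) * M / sqrt \<bar>lam\<bar>))"
proof -
  interpret C: cutoff \<phi> \<phi>' \<phi>'' s u M by (rule cut)
  interpret S: cell_family J a \<eta> d D "sector_cell \<sigma>" by (rule sector_family)
  interpret S': cell_family "flip_set J" "flip_coeff a" "1 / \<eta>" "d / \<eta>" D "\<lambda>k j m l i. sector_cell \<sigma> j k m i l"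
    by (rule sector_family_flip)
  define K where "K = osc_ker lam z J a \<phi>"
  define K' where "K' = osc_ker (- lam) (cnj z) (flip_set J) (flip_coeff a) (\<lambda>y x. cnj (\<phi> x y))"
  define A2 where "A2 = tt_const D * (1 + cmod z)\<^sup>2 * M\<^sup>2 / \<bar>lam\<bar>"
  have A2: "0 < A2" unfolding A2_def using tt_const_pos[of D] M lam
    by (intro divide_pos_pos mult_pos_pos zero_less_power) (auto simp: add_pos_nonneg)
  have sA: "sqrt A2 = sqrt (tt_const D) * ((1 + cmod z) * M / sqrt \<bar>lam\<bar>)"
    using M tt_const_nonneg[of D] by (simp add: A2_def real_sqrt_mult real_sqrt_divide)
  let ?T = "ck (sector_cell \<sigma>) K"
  have bK: "bker K" unfolding K_def by (rule bker_osc_ker[OF z C.ker])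
  have adjT: "kadj (?T (j, k, m)) = ck (\<lambda>k j m l i. sector_cell \<sigma> j k m i l) K' (k, j, m)" for j k m
  proof -
    have "K' = kadj K" unfolding K'_def K_def kadj_osc_ker ..
    then show ?thesis by (auto simp: kadj_def ck_def fun_eq_iff)
  qed
  \<comment> \<open>Pieces over different dyadic blocks in the variable of integration have disjoint
    supports there, so their product is 0; this leaves two parameters to sum over.\<close>
  define a' where "a' c c' = (case (c, c') of ((j, k, m), (j', k', m')) \<Rightarrow> if j = j' then sqrt (A2 * decay k m k' m') else 0)"
    for c c' :: "int \<times> int \<times> nat"
  define b' where "b' c c' = (case (c, c') of ((j, k, m), (j', k', m')) \<Rightarrow> if k = k' then sqrt (A2 * decay j m j' m') else 0)"
    for c c' :: "int \<times> int \<times> nat"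
  have dp: "0 \<le> decay j m j' m'" for j m j' m' by (simp add: decay_def)
  have nn: "0 \<le> a' c c'" "0 \<le> b' c c'" for c c'
    using A2 dp by (auto simp: a'_def b'_def split: prod.splits)
  have TTs: "opb (kcomp (?T c) (kadj (?T c'))) ((b' c c')\<^sup>2)" for c c'
  proof -
    obtain j k m j' k' m' where c: "c = (j, k, m)" "c' = (j', k', m')" by (cases c; cases c')
    show ?thesis
    proof (cases "k = k'")
      case True
      have "(b' c c')\<^sup>2 = A2 * decay j m j' m'" using A2 dp[of j m j' m'] True by (simp add: c b'_def)
      then show ?thesis
        using S.opb_kcomp_decay[OF cut lam z, of j k' m j' m', folded A2_def K_def] True by (simp add: c)
    next
      case False
      then show ?thesis using S.opb_kcomp_disjoint[OF False, of K j m j' m'] by (simp add: c b'_def)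
    qed
  qed
  have TsT: "opb (kcomp (kadj (?T c)) (?T c')) ((a' c c')\<^sup>2)" for c c'
  proof -
    obtain j k m j' k' m' where c: "c = (j, k, m)" "c' = (j', k', m')" by (cases c; cases c')
    have e: "kcomp (kadj (?T c)) (?T c') = kcomp (kadj (?T c)) (kadj (kadj (?T c')))" by simp
    show ?thesis
    proof (cases "j = j'")
      case True
      have z': "Re (cnj z) = 1/2" "- lam \<noteq> 0" using z lam by auto
      have sq: "(a' c c')\<^sup>2 = A2 * decay k m k' m'" using A2 dp[of k m k' m'] True by (simp add: c a'_def)
      have "tt_const D * (1 + cmod (cnj z))\<^sup>2 * M\<^sup>2 / \<bar>- lam\<bar> = A2" by (simp add: A2_def)
      then show ?thesis
        unfolding e sq unfolding c adjT
        using S'.opb_kcomp_decay[OF cutoff.cutoff_cnj[OF cut2] z'(2,1), of k j' m k' m', folded K'_def] True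
        by simp
    next
      case False
      then show ?thesis unfolding e unfolding c adjT using S'.opb_kcomp_disjoint[OF False, of K' k m k' m'] by (simp add: a'_def)
    qed
  qed
  have sb: "(\<Sum>c'\<in>F. b' c c') \<le> sqrt A2 * geo_const" for c
  proof -
    obtain j k m where c: "c = (j, k, m)" by (cases c)
    define H where "H = {c'\<in>F. fst (snd c') = k}"
    have "(\<Sum>c'\<in>F. b' c c') = (\<Sum>c'\<in>H. sqrt A2 * sqrt (decay j m (fst c') (snd (snd c'))))"
      unfolding H_def by (rule sum.mono_neutral_cong_right) (use F in \<open>auto simp: c b'_def real_sqrt_mult split: prod.splits\<close>)
    also have "\<dots> = sqrt A2 * (\<Sum>c'\<in>H. sqrt (decay j m (fst c') (snd (snd c'))))" by (simp add: sum_distrib_left)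
    also have "(\<Sum>c'\<in>H. sqrt (decay j m (fst c') (snd (snd c')))) = (\<Sum>(j', m')\<in>(\<lambda>c'. (fst c', snd (snd c'))) ` H. sqrt (decay j m j' m'))"
      by (subst sum.reindex) (auto simp: inj_on_def H_def)
    also have "sqrt A2 * \<dots> \<le> sqrt A2 * geo_const"
      by (intro mult_left_mono sum_sqrt_decay) (use F A2 in \<open>auto simp: H_def\<close>)
    finally show ?thesis .
  qed
  have sa: "(\<Sum>c'\<in>F. a' c c') \<le> sqrt A2 * geo_const" for c
  proof -
    obtain j k m where c: "c = (j, k, m)" by (cases c)
    define H where "H = {c'\<in>F. fst c' = j}"
    have "(\<Sum>c'\<in>F. a' c c') = (\<Sum>c'\<in>H. sqrt A2 * sqrt (decay k m (fst (snd c')) (snd (snd c'))))"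
      unfolding H_def by (rule sum.mono_neutral_cong_right) (use F in \<open>auto simp: c a'_def real_sqrt_mult split: prod.splits\<close>)
    also have "\<dots> = sqrt A2 * (\<Sum>c'\<in>H. sqrt (decay k m (fst (snd c')) (snd (snd c'))))" by (simp add: sum_distrib_left)
    also have "(\<Sum>c'\<in>H. sqrt (decay k m (fst (snd c')) (snd (snd c')))) = (\<Sum>(j', m')\<in>(\<lambda>c'. (fst (snd c'), snd (snd c'))) ` H. sqrt (decay k m j' m'))"
      by (subst sum.reindex) (auto simp: inj_on_def H_def case_prod_unfold)
    also have "sqrt A2 * \<dots> \<le> sqrt A2 * geo_const"
      by (intro mult_left_mono sum_sqrt_decay) (use F A2 in \<open>auto simp: H_def\<close>)
    finally show ?thesis .
  qed
  have "opb (\<lambda>x y. \<Sum>c\<in>F. ?T c x y) (sqrt A2 * geo_const)"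
  proof (rule cotlar_stein[OF F, where a = a' and b = b'])
    show "bker (?T c)" for c by (rule S.bker_ck[OF bK])
    show "opb (?T c) (real (count_const D) * (box_const D * (1 + cmod z) * M / sqrt \<bar>lam\<bar>))" for c
      unfolding K_def by (rule S.cell_bound[OF cut lam z])
    show "0 < sqrt A2 * geo_const" using A2 geo_const_pos by simp
  qed (use TTs TsT nn sa sb in auto)
  then show ?thesis unfolding K_def sA by (simp add: mult_ac)
qed

text \<open>Off the zero set a point lies in exactly one cell and one sector, so the finite sums are
  restrictions of the kernel and increase to it; on the zero set the kernel itself is 0. The sectors
  are merely added, being at most \<open>D + 1\<close> in number.\<close>

lemma quadrant_bound:
  assumes cut: "cutoff \<phi> \<phi>' \<phi>'' s u M" and cut2: "cutoff (\<lambda>y x. \<phi> x y) \<psi>' \<psi>'' s2 u2 M"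
    and M: "0 < M" and lam: "lam \<noteq> 0" and z: "Re z = 1/2"
  shows "opb (kcut {0<..} {0<..} (osc_ker lam z J a \<phi>))
    (real (Suc D) * (sqrt (tt_const D) * geo_const) * ((1 + cmod z) * M / sqrt \<bar>lam\<bar>))"
proof -
  interpret C: cutoff \<phi> \<phi>' \<phi>'' s u M by (rule cut)
  define K where "K = osc_ker lam z J a \<phi>"
  have bK: "bker K" unfolding K_def by (rule bker_osc_ker[OF z C.ker])
  define F where "F n = {- int n..int n} \<times> {- int n..int n} \<times> {..n}" for n
  have F: "finite (F n)" for n by (simp add: F_def)
  define kn where "kn n x y = (\<Sum>\<sigma>\<le>D. \<Sum>c\<in>F n. ck (sector_cell \<sigma>) K c x y)" for n x y
  let ?B = "sqrt (tt_const D) * geo_const * ((1 + cmod z) * M / sqrt \<bar>lam\<bar>)"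
  have bsec: "bker (\<lambda>x y. \<Sum>c\<in>F n. ck (sector_cell \<sigma>) K c x y)" for n \<sigma>
    by (intro bker_sum cell_family.bker_ck[OF sector_family] bK)
  have bkn: "bker (kn n)" for n unfolding kn_def by (intro bker_sum bsec)
  have okn: "opb (kn n) (\<Sum>\<sigma>\<le>D. ?B)" for n
    unfolding kn_def by (rule opb_sum[OF bsec]) (unfold K_def, rule sector_bound[OF cut cut2 M lam z F])
  have val: "kn n x y = (if 0 < x \<and> 0 < y \<and> (\<exists>c\<in>F n. in_cell J a c x y) then K x y else 0)" for n x y
  proof -
    have 1: "(\<Sum>\<sigma>\<le>D. ck (sector_cell \<sigma>) K c x y) = (if in_cell J a c x y then K x y else 0)" for c
    proof -
      obtain j k m where c: "c = (j, k, m)" by (cases c)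
      define \<tau> where "\<tau> = sect (real (idx j m x) * side j m) (real (idx k m y) * side k m)"
      have "(\<Sum>\<sigma>\<le>D. ck (sector_cell \<sigma>) K c x y) = (\<Sum>\<sigma>\<le>D. if \<sigma> = \<tau> then (if in_cell J a c x y then K x y else 0) else 0)"
        by (intro sum.cong refl) (auto simp: ck_def c in_cell_def sector_cell_def \<tau>_def)
      also have "\<dots> = (if in_cell J a c x y then K x y else 0)"
        using sect_le by (simp add: \<tau>_def)
      finally show ?thesis .
    qed
    have "kn n x y = (\<Sum>c\<in>F n. if in_cell J a c x y then K x y else 0)"
      unfolding kn_def by (subst sum.swap) (simp only: 1)
    also have "\<dots> = (if 0 < x \<and> 0 < y \<and> (\<exists>c\<in>F n. in_cell J a c x y) then K x y else 0)"
    proof (cases "\<exists>c\<in>F n. in_cell J a c x y")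
      case True
      then obtain c where c: "c \<in> F n" "in_cell J a c x y" by auto
      have "(\<Sum>c'\<in>F n. if in_cell J a c' x y then K x y else 0) = (\<Sum>c'\<in>F n. if c' = c then K x y else 0)"
        by (intro sum.cong refl) (use c in_cell_unique in auto)
      moreover have "0 < x \<and> 0 < y" using c(2) by (auto simp: in_cell_def split: prod.splits)
      ultimately show ?thesis using c F by auto
    qed (auto intro: sum.neutral)
    finally show ?thesis .
  qed
  have "opb (kcut {0<..} {0<..} K) (\<Sum>\<sigma>\<le>D. ?B)"
  proof (rule opb_limit[OF bker_kcut[OF bK] bkn _ okn])
    show "0 \<le> (\<Sum>\<sigma>\<le>D. ?B)"
      using M geo_const_pos tt_const_nonneg[of D] by (intro sum_nonneg mult_nonneg_nonneg divide_nonneg_nonneg) auto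
    show "cmod (kn n x y) \<le> cmod (kcut {0<..} {0<..} K x y)" for n x y
      unfolding val by (auto simp: kcut_def)
    show "(\<lambda>n. kn n x y) \<longlonglongrightarrow> kcut {0<..} {0<..} K x y" for x y
    proof (cases "0 < x \<and> 0 < y \<and> mixed_poly J a x y \<noteq> 0")
      case True
      then obtain c where c: "in_cell J a c x y" using in_cell_exists[of x y] by blast
      obtain j k m where jkm: "c = (j, k, m)" by (cases c)
      define N where "N = max (nat \<bar>j\<bar>) (max (nat \<bar>k\<bar>) m)"
      have "eventually (\<lambda>n. kn n x y = kcut {0<..} {0<..} K x y) sequentially"
        unfolding eventually_sequentially
      proof (intro exI allI impI)
        fix n assume "N \<le> n"
        then have "c \<in> F n" by (auto simp: F_def jkm N_def)
        then show "kn n x y = kcut {0<..} {0<..} K x y" using True c by (auto simp: val kcut_def)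
      qed
      then show ?thesis by (rule tendsto_eventually)
    next
      case False
      then have "kcut {0<..} {0<..} K x y = 0" by (auto simp: kcut_def K_def osc_ker_def)
      moreover have "kn n x y = 0" for n using False by (auto simp: val K_def osc_ker_def)
      ultimately show ?thesis by simp
    qed
  qed auto
  then show ?thesis by (simp add: K_def mult.assoc)
qed

end

section \<open>The whole plane\<close>

text \<open>Four quadrants, \<open>D + 1\<close> sectors, and in each the Cotlar--Stein sum. Only
  the degree enters.\<close>

definition osc_const :: "nat \<Rightarrow> real" where
  "osc_const D = 4 * (real (Suc D) * (sqrt (tt_const D) * geo_const))"

lemma osc_const_nonneg: "0 \<le> osc_const D"
  using geo_const_pos tt_const_nonneg[of D] by (simp add: osc_const_def)

definition sign :: "real \<Rightarrow> bool" where
  "sign e \<longleftrightarrow> e = 1 \<or> e = -1"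

lemma sign_simps:
  assumes "sign e"
  shows "e * (e * x) = x" "\<bar>e\<bar> = 1" "e \<noteq> 0" "e ^ k * e ^ k = 1"
  using assms by (auto simp: sign_def power_add[symmetric])

lemma lborel_integral_sign:
  fixes f :: "real \<Rightarrow> 'a :: {banach, second_countable_topology}"
  assumes "sign e" shows "(LINT x|lborel. f (e * x)) = (LINT x|lborel. f x)"
  using lborel_integral_real_affine[of e f 0] assms by (auto simp: sign_simps)

lemma sqint_sign:
  assumes e: "sign e" and f: "sqint f"
  shows "sqint (\<lambda>x. f (e * x))" "nrm (\<lambda>x. f (e * x)) = nrm f"
proof -
  have [measurable]: "f \<in> borel_measurable borel" using f by (rule sqint_measurable)
  have "integrable lborel (\<lambda>x. (cmod (f (0 + e * x)))\<^sup>2)"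
    using lborel_integrable_real_affine_iff[of e "\<lambda>x. (cmod (f x))\<^sup>2" 0] sqint_integrable[OF f] sign_simps(3)[OF e] by simp
  then show "sqint (\<lambda>x. f (e * x))" by (simp add: sqint_def)
  show "nrm (\<lambda>x. f (e * x)) = nrm f"
    unfolding nrm_def using lborel_integral_sign[OF e, of "\<lambda>x. (cmod (f x))\<^sup>2"] by simp
qed

lemma bker_sign:
  assumes e: "sign e1" "sign e2" and k: "bker k" shows "bker (\<lambda>x y. k (e1 * x) (e2 * y))"
proof -
  obtain B R where BR: "\<And>x y. cmod (k x y) \<le> B"
    "\<And>x y. k x y \<noteq> 0 \<Longrightarrow> \<bar>x\<bar> \<le> R \<and> \<bar>y\<bar> \<le> R"
    using k unfolding bker_def by blast
  show ?thesis
  proof (rule bkerI[OF _ BR(1)])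
    show "(\<lambda>p. k (e1 * fst p) (e2 * snd p)) \<in> borel_measurable borel"
      unfolding borel_prod[symmetric] using k by measurable
    show "\<bar>x\<bar> \<le> R \<and> \<bar>y\<bar> \<le> R" if "k (e1 * x) (e2 * y) \<noteq> 0" for x y
      using BR(2)[OF that] e by (simp add: abs_mult sign_simps)
  qed
qed

lemma opb_sign:
  assumes e: "sign e1" "sign e2" and k: "bker k" and o: "opb k C"
  shows "opb (\<lambda>x y. k (e1 * x) (e2 * y)) C"
  unfolding opb_def
proof (intro allI impI)
  fix f assume f: "sqint f"
  let ?g = "\<lambda>y. f (e2 * y)"
  note g = sqint_sign[OF e(2) f]
  have "kop (\<lambda>x y. k (e1 * x) (e2 * y)) f = (\<lambda>x. kop k ?g (e1 * x))"
  proof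
    fix x
    show "kop (\<lambda>x y. k (e1 * x) (e2 * y)) f x = kop k ?g (e1 * x)"
      unfolding kop_def
      using lborel_integral_sign[OF e(2), of "\<lambda>y. k (e1 * x) (e2 * y) * f y"] e by (simp add: sign_simps)
  qed
  then show "nrm (kop (\<lambda>x y. k (e1 * x) (e2 * y)) f) \<le> C * nrm f"
    using sqint_sign(2)[OF e(1) kop_sqint[OF k g(1)]] opbD[OF o g(1)] g(2) by simp
qed

text \<open>A reflection of the coordinates changes only signs of coefficients, so exponents,
  weights and degree are unaffected.\<close>

definition sign_coeff :: "real \<Rightarrow> real \<Rightarrow> (nat \<Rightarrow> nat \<Rightarrow> real) \<Rightarrow> nat \<Rightarrow> nat \<Rightarrow> real" where
  "sign_coeff e1 e2 a k l = e1 ^ k * e2 ^ l * a k l"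

lemma phase_poly_sign:
  assumes "sign e1" "sign e2"
  shows "phase_poly J (sign_coeff e1 e2 a) (e1 * x) (e2 * y) = phase_poly J a x y"
  unfolding phase_poly_def
proof (intro sum.cong refl, clarify)
  fix k l
  have "sign_coeff e1 e2 a k l * (e1 * x) ^ k * (e2 * y) ^ l
      = (e1 ^ k * e1 ^ k) * (e2 ^ l * e2 ^ l) * (a k l * x ^ k * y ^ l)"
    by (simp add: sign_coeff_def power_mult_distrib)
  then show "sign_coeff e1 e2 a k l * (e1 * x) ^ k * (e2 * y) ^ l = a k l * x ^ k * y ^ l"
    using assms by (simp add: sign_simps)
qed

lemma mixed_poly_sign:
  assumes "sign e1" "sign e2"
  shows "\<bar>mixed_poly J (sign_coeff e1 e2 a) (e1 * x) (e2 * y)\<bar> = \<bar>mixed_poly J a x y\<bar>"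
proof -
  have "mixed_poly J (sign_coeff e1 e2 a) (e1 * x) (e2 * y) = (\<Sum>p\<in>J. e1 * e2 * (case p of (k, l) \<Rightarrow> a k l * real k * real l * x ^ (k - 1) * y ^ (l - 1)))"
    unfolding mixed_poly_def
  proof (intro sum.cong refl, clarify)
    fix k l
    show "of_real (sign_coeff e1 e2 a k l * real k * real l) * (e1 * x) ^ (k - 1) * (e2 * y) ^ (l - 1)
      = e1 * e2 * (a k l * real k * real l * x ^ (k - 1) * y ^ (l - 1))"
    proof (cases "k = 0 \<or> l = 0")
      case False
      then obtain k' l' where kl: "k = Suc k'" "l = Suc l'" by (meson not0_implies_Suc)
      have "sign_coeff e1 e2 a k l * (e1 * x) ^ k' * (e2 * y) ^ l'
        = (e1 ^ k' * e1 ^ k') * (e2 ^ l' * e2 ^ l') * (e1 * e2 * (a k l * x ^ k' * y ^ l'))"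
        by (simp add: sign_coeff_def power_mult_distrib kl)
      also have "\<dots> = e1 * e2 * (a k l * x ^ k' * y ^ l')" using assms by (simp only: sign_simps mult_1)
      finally have "sign_coeff e1 e2 a k l * (e1 * x) ^ k' * (e2 * y) ^ l' * (real k * real l)
        = e1 * e2 * (a k l * x ^ k' * y ^ l') * (real k * real l)" by (rule arg_cong)
      then show ?thesis by (simp add: kl mult_ac del: of_nat_Suc)
    qed auto
  qed
  also have "\<dots> = e1 * e2 * mixed_poly J a x y"
    unfolding mixed_poly_def sum_distrib_left[symmetric] by (simp add: case_prod_unfold)
  finally show ?thesis using assms by (simp add: abs_mult sign_simps)
qed

lemma osc_ker_sign:
  assumes "sign e1" "sign e2"
  shows "osc_ker lam z J (sign_coeff e1 e2 a) (\<lambda>x y. \<phi> (e1 * x) (e2 * y)) (e1 * x) (e2 * y) = osc_ker lam z J a \<phi> x y"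
  unfolding osc_ker_def phase_poly_sign[OF assms] mixed_poly_sign[OF assms] using assms by (simp add: sign_simps)

lemma (in qh_data) qh_data_sign:
  assumes "sign e1" "sign e2" shows "qh_data J (sign_coeff e1 e2 a) \<eta> d D"
  by unfold_locales (use fin \<eta> wt nz deg nontriv assms in \<open>auto simp: sign_coeff_def sign_simps\<close>)

text \<open>Reflecting the second variable turns the support interval into the one from
  \<open>- (u + s)\<close> to \<open>- u\<close>, and the first derivative changes sign while the
  second does not.\<close>

lemma (in cutoff) cutoff_sign:
  assumes e: "sign e1" "sign e2"
  shows "cutoff (\<lambda>x y. \<phi> (e1 * x) (e2 * y)) (\<lambda>x y. of_real e2 * \<phi>' (e1 * x) (e2 * y)) (\<lambda>x y. \<phi>'' (e1 * x) (e2 * y))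
    (\<lambda>x. s (e1 * x)) (\<lambda>x. if e2 = 1 then u (e1 * x) else - (u (e1 * x) + s (e1 * x))) M"
proof
  have e': "\<bar>e2\<bar> = 1" using e by (auto simp: sign_def)
  have lin: "((\<lambda>y. e2 * y) has_vector_derivative e2) (at y)" for y
    by (auto intro!: derivative_eq_intros simp flip: has_real_derivative_iff_has_vector_derivative)
  show "bker (\<lambda>x y. \<phi> (e1 * x) (e2 * y))" by (rule bker_sign[OF e ker])
  show "(\<lambda>x. s (e1 * x)) \<in> borel_measurable borel" using s_meas by measurable
  show "0 \<le> s (e1 * x)" for x by (rule s_nonneg)
  show "((\<lambda>y. \<phi> (e1 * x) (e2 * y)) has_vector_derivative of_real e2 * \<phi>' (e1 * x) (e2 * y)) (at y)" for x y
    using vector_diff_chain_at[OF lin[of y] d1[of "e1 * x" "e2 * y"]] by (simp add: o_def scaleR_conv_of_real)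
  have "((\<lambda>y. of_real e2 * \<phi>' (e1 * x) (e2 * y)) has_vector_derivative of_real e2 * (e2 *\<^sub>R \<phi>'' (e1 * x) (e2 * y))) (at y)" for x y
    using has_vector_derivative_mult_right[OF vector_diff_chain_at[OF lin[of y] d2[of "e1 * x" "e2 * y"]], of "of_real e2"] by (simp add: o_def)
  moreover have "of_real e2 * (e2 *\<^sub>R c) = c" for c :: complex using e by (auto simp: sign_def)
  ultimately show "((\<lambda>y. of_real e2 * \<phi>' (e1 * x) (e2 * y)) has_vector_derivative \<phi>'' (e1 * x) (e2 * y)) (at y)" for x y by simp
  show "continuous_on UNIV (\<lambda>y. \<phi>'' (e1 * x) (e2 * y))" for x
    by (rule continuous_on_compose2[OF cont]) (auto intro!: continuous_intros)
  show "cmod (\<phi> (e1 * x) (e2 * y)) \<le> M" "s (e1 * x) * cmod (of_real e2 * \<phi>' (e1 * x) (e2 * y)) \<le> M"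
    "(s (e1 * x))\<^sup>2 * cmod (\<phi>'' (e1 * x) (e2 * y)) \<le> M" for x y
    using b0 b1[of "e1 * x" "e2 * y"] b2 by (auto simp: norm_mult e')
  show "\<phi> (e1 * x) (e2 * y) = 0 \<and> of_real e2 * \<phi>' (e1 * x) (e2 * y) = 0 \<and> \<phi>'' (e1 * x) (e2 * y) = 0"
    if "y \<notin> {if e2 = 1 then u (e1 * x) else - (u (e1 * x) + s (e1 * x))..(if e2 = 1 then u (e1 * x) else - (u (e1 * x) + s (e1 * x))) + s (e1 * x)}" for x y
    using supp_row[of "e2 * y" "e1 * x"] that e(2) by (auto simp: sign_def split: if_splits)
  show "\<phi> (e1 * x) (e2 * y) = 0" if "s (e1 * x) = 0" for x y using s_zero[OF that] .
qed

lemma nrm_cong_AE: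
  assumes "sqint f" "sqint g" "AE x in lborel. f x = g x" shows "nrm f = nrm g"
proof -
  have [measurable]: "f \<in> borel_measurable borel" "g \<in> borel_measurable borel" using assms by (auto simp: sqint_def)
  have "(LINT x|lborel. (cmod (f x))\<^sup>2) = (LINT x|lborel. (cmod (g x))\<^sup>2)"
    by (rule integral_cong_AE) (use assms(3) in auto)
  then show ?thesis by (simp add: nrm_def)
qed

text \<open>The open quadrants miss the axes: for \<open>x \<noteq> 0\<close> the point
  \<open>y = 0\<close> is null in the inner integral, and \<open>x = 0\<close> is null in the
  norm.\<close>

lemma opb_cong_off_axes:
  assumes k: "bker k" and l: "bker l" and o: "opb l C" and eq: "\<And>x y. x \<noteq> 0 \<Longrightarrow> y \<noteq> 0 \<Longrightarrow> k x y = l x y"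
  shows "opb k C"
  unfolding opb_def
proof (intro allI impI)
  fix f assume f: "sqint f"
  have [measurable]: "f \<in> borel_measurable borel" using f by (rule sqint_measurable)
  have n0: "AE x in lborel. x \<noteq> (0::real)" by (rule AE_lborel_singleton)
  have "kop k f x = kop l f x" if "x \<noteq> 0" for x
    unfolding kop_def
  proof (rule integral_cong_AE)
    show "AE y in lborel. k x y * f y = l x y * f y" using n0 by eventually_elim (use eq that in auto)
  qed (use k l in measurable)
  then have "nrm (kop k f) = nrm (kop l f)"
    by (intro nrm_cong_AE kop_sqint k l f eventually_mono[OF n0])
  then show "nrm (kop k f) \<le> C * nrm f" using opbD[OF o f] by simp
qed

lemma (in qh_data) osc_bound:
  assumes cut: "cutoff \<phi> \<phi>' \<phi>'' s u M" and cut2: "cutoff (\<lambda>y x. \<phi> x y) \<psi>' \<psi>'' s2 u2 M"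
    and M: "0 < M" and lam: "lam \<noteq> 0" and z: "Re z = 1/2"
  shows "opb (osc_ker lam z J a \<phi>) (osc_const D * ((1 + cmod z) * M / sqrt \<bar>lam\<bar>))"
proof -
  interpret C: cutoff \<phi> \<phi>' \<phi>'' s u M by (rule cut)
  define K where "K = osc_ker lam z J a \<phi>"
  have bK: "bker K" unfolding K_def by (rule bker_osc_ker[OF z C.ker])
  define E where "E = {1, -1::real} \<times> {1, -1::real}"
  define Q where "Q p x y = kcut {0<..} {0<..} (osc_ker lam z J (sign_coeff (fst p) (snd p) a) (\<lambda>x y. \<phi> (fst p * x) (snd p * y))) (fst p * x) (snd p * y)" for p x y
  let ?B = "real (Suc D) * (sqrt (tt_const D) * geo_const) * ((1 + cmod z) * M / sqrt \<bar>lam\<bar>)"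
  have Q: "bker (Q p) \<and> opb (Q p) ?B" if "p \<in> E" for p
  proof -
    have e: "sign (fst p)" "sign (snd p)" using that by (auto simp: E_def sign_def)
    interpret R: qh_data J "sign_coeff (fst p) (snd p) a" \<eta> d D by (rule qh_data_sign[OF e])
    note c = cutoff.cutoff_sign[OF cut e] cutoff.cutoff_sign[OF cut2 e(2,1)]
    have b: "bker (kcut {0<..} {0<..} (osc_ker lam z J (sign_coeff (fst p) (snd p) a) (\<lambda>x y. \<phi> (fst p * x) (snd p * y))))"
      by (intro bker_kcut bker_osc_ker z bker_sign e C.ker) auto
    have "Q p = (\<lambda>x y. kcut {0<..} {0<..} (osc_ker lam z J (sign_coeff (fst p) (snd p) a) (\<lambda>x y. \<phi> (fst p * x) (snd p * y))) (fst p * x) (snd p * y))"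
      by (simp add: Q_def fun_eq_iff)
    then show ?thesis using bker_sign[OF e b] opb_sign[OF e b R.quadrant_bound[OF c M lam z]] by simp
  qed
  have sum: "bker (\<lambda>x y. \<Sum>p\<in>E. Q p x y)" "opb (\<lambda>x y. \<Sum>p\<in>E. Q p x y) (\<Sum>p\<in>E. ?B)"
    by (intro bker_sum opb_sum; use Q in blast)+
  have "(\<Sum>p\<in>E. ?B) = osc_const D * ((1 + cmod z) * M / sqrt \<bar>lam\<bar>)"
    by (simp add: E_def osc_const_def card_cartesian_product)
  moreover have "K x y = (\<Sum>p\<in>E. Q p x y)" if "x \<noteq> 0" "y \<noteq> 0" for x y
  proof -
    have q: "Q p x y = (if p = (sgn x, sgn y) then K x y else 0)" if "p \<in> E" for p
    proof -
      have e: "sign (fst p)" "sign (snd p)" using that by (auto simp: E_def sign_def)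
      have "Q p x y = indicator {0<..} (fst p * x) * indicator {0<..} (snd p * y) * K x y"
        unfolding Q_def kcut_def osc_ker_sign[OF e] K_def ..
      moreover have "(indicator {0<..} (fst p * x) * indicator {0<..} (snd p * y) :: complex) = (if p = (sgn x, sgn y) then 1 else 0)"
        using e \<open>x \<noteq> 0\<close> \<open>y \<noteq> 0\<close> by (cases p) (auto simp: sign_def indicator_def sgn_if)
      ultimately show ?thesis by simp
    qed
    have "(\<Sum>p\<in>E. Q p x y) = (\<Sum>p\<in>E. if p = (sgn x, sgn y) then K x y else 0)" by (rule sum.cong[OF refl q])
    also have "\<dots> = K x y" using that by (auto simp: E_def sgn_if)
    finally show ?thesis by simp
  qed
  ultimately show ?thesis
    unfolding K_def using opb_cong_off_axes[OF bK[unfolded K_def] sum(1) sum(2)] by metis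
qed

section \<open>From test functions on a domain to cutoffs\<close>

lemma has_vector_derivative_zero_on_open:
  assumes d: "(f has_vector_derivative f') (at x)" and S: "open S" "x \<in> S" and z: "\<And>y. y \<in> S \<Longrightarrow> f y = 0"
  shows "f' = 0"
proof -
  have "((\<lambda>_. 0) has_vector_derivative f') (at x)"
    by (rule has_vector_derivative_transform_within_open[OF d S]) (use z in auto)
  then show ?thesis using vector_derivative_unique_at[OF _ has_vector_derivative_const] by metis
qed

text \<open>The width is taken to be the diameter of the section where \<phi> does not vanish. It is
  at most \<delta>, so the derivative bounds persist, and it is lower semicontinuous, hence
  measurable, whatever \<delta> is.\<close>

lemma cutoff_exists:
  fixes \<phi> \<phi>' \<phi>'' :: "real \<Rightarrow> real \<Rightarrow> complex"
  assumes c: "continuous_on UNIV (\<lambda>p. \<phi> (fst p) (snd p))"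
    and R: "\<And>x y. \<phi> x y \<noteq> 0 \<Longrightarrow> \<bar>x\<bar> \<le> R \<and> \<bar>y\<bar> \<le> R"
    and d1: "\<And>x y. (\<phi> x has_vector_derivative \<phi>' x y) (at y)"
    and d2: "\<And>x y. (\<phi>' x has_vector_derivative \<phi>'' x y) (at y)"
    and cont: "\<And>x. continuous_on UNIV (\<phi>'' x)"
    and \<delta>: "\<And>x. 0 \<le> \<delta> x" "\<And>x y y'. \<phi> x y \<noteq> 0 \<Longrightarrow> \<phi> x y' \<noteq> 0 \<Longrightarrow> y' - y \<le> \<delta> x"
    and b: "\<And>x y. cmod (\<phi> x y) \<le> M" "\<And>x y. \<delta> x * cmod (\<phi>' x y) \<le> M" "\<And>x y. (\<delta> x)\<^sup>2 * cmod (\<phi>'' x y) \<le> M"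
  shows "\<exists>s u. cutoff \<phi> \<phi>' \<phi>'' s u M"
proof -
  \<comment> \<open>Inserting 0 gives rows on which \<phi> vanishes the width 0 instead of the
    supremum of an empty set.\<close>
  define T where "T x = insert 0 {y' - y |y y'. \<phi> x y \<noteq> 0 \<and> \<phi> x y' \<noteq> 0}" for x
  define s where "s x = Sup (T x)" for x
  define u where "u x = Inf {y. \<phi> x y \<noteq> 0}" for x
  have le: "t \<le> \<delta> x" if "t \<in> T x" for t x using that \<delta> by (auto simp: T_def)
  have bdd: "bdd_above (T x)" for x by (rule bdd_aboveI[OF le])
  have sT: "t \<le> s x" if "t \<in> T x" for t x unfolding s_def by (rule cSup_upper[OF that bdd])
  have s0: "0 \<le> s x" for x by (rule sT) (simp add: T_def)
  have s\<delta>: "s x \<le> \<delta> x" for x unfolding s_def by (rule cSup_least) (use le in \<open>auto simp: T_def\<close>)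
  have sec: "y \<in> {u x..u x + s x}" if y: "\<phi> x y \<noteq> 0" for x y
  proof -
    have bb: "bdd_below {y. \<phi> x y \<noteq> 0}" using R[of x] by (intro bdd_belowI[of _ "- R"]) force
    have 1: "u x \<le> y" unfolding u_def by (rule cInf_lower[OF _ bb]) (use y in simp)
    have "y - s x \<le> u x" unfolding u_def
    proof (rule cInf_greatest)
      fix y' assume "y' \<in> {y. \<phi> x y \<noteq> 0}"
      then have "y - y' \<in> T x" using y by (auto simp: T_def)
      then show "y - s x \<le> y'" using sT by fastforce
    qed (use y in auto)
    then show ?thesis using 1 by simp
  qed
  have crow: "continuous_on UNIV (\<phi> x)" for x
  proof -
    have "continuous_on UNIV (\<lambda>y. (x, y))" by (intro continuous_intros)
    then show ?thesis using continuous_on_compose2[OF c, of UNIV "\<lambda>y. (x, y)"] by simp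
  qed
  have ccol: "continuous_on UNIV (\<lambda>x. \<phi> x y)" for y
  proof -
    have "continuous_on UNIV (\<lambda>x. (x, y))" by (intro continuous_intros)
    then show ?thesis using continuous_on_compose2[OF c, of UNIV "\<lambda>x. (x, y)"] by simp
  qed
  have op: "open {x. \<phi> x y \<noteq> 0}" "open {y. \<phi> x y \<noteq> 0}" for x y
    by (intro open_Collect_neq ccol crow continuous_on_const)+
  have "cutoff \<phi> \<phi>' \<phi>'' s u M"
  proof
    show "bker \<phi>"
      by (rule bkerI[OF borel_measurable_continuous_onI[OF c] b(1) R])
    show "s \<in> borel_measurable borel"
      unfolding borel_measurable_iff_greater
    proof
      fix t
      \<comment> \<open>The width exceeds \<open>t\<close> exactly if two points of the section are
        more than \<open>t\<close> apart, and each of the two nonvanishing conditions is open in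
        \<open>x\<close>.\<close>
      have "{x. t < s x} = (if t < 0 then UNIV else (\<Union>(y, y')\<in>{(y, y'). t < y' - y}. {x. \<phi> x y \<noteq> 0} \<inter> {x. \<phi> x y' \<noteq> 0}))"
      proof -
        have "t < s x \<longleftrightarrow> (\<exists>w\<in>T x. t < w)" for x
          unfolding s_def by (rule less_cSup_iff[OF _ bdd]) (simp add: T_def)
        then show ?thesis by (auto simp: T_def)
      qed
      also have "open \<dots>" using op by (auto intro!: open_UN open_Int)
      finally show "{x \<in> space borel. t < s x} \<in> sets borel" by simp
    qed
    show "0 \<le> s x" for x by (rule s0)
    show "(\<phi> x has_vector_derivative \<phi>' x y) (at y)" "(\<phi>' x has_vector_derivative \<phi>'' x y) (at y)"
      "continuous_on UNIV (\<phi>'' x)" "cmod (\<phi> x y) \<le> M" for x y by (rule d1 d2 cont b)+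
    show "s x * cmod (\<phi>' x y) \<le> M" for x y
      by (rule order_trans[OF mult_right_mono[OF s\<delta>] b(2)]) simp
    show "(s x)\<^sup>2 * cmod (\<phi>'' x y) \<le> M" for x y
      by (rule order_trans[OF mult_right_mono[OF power_mono[OF s\<delta> s0]] b(3)]) simp
    show "\<phi> x y = 0 \<and> \<phi>' x y = 0 \<and> \<phi>'' x y = 0" if y: "y \<notin> {u x..u x + s x}" for x y
    proof -
      have S: "open (- {u x..u x + s x})" by (simp add: open_Compl)
      have 0: "\<phi> x w = 0" if "w \<in> - {u x..u x + s x}" for w using sec that by auto
      have 1: "\<phi>' x w = 0" if "w \<in> - {u x..u x + s x}" for w
        by (rule has_vector_derivative_zero_on_open[OF d1 S that 0])
      have 2: "\<phi>'' x w = 0" if "w \<in> - {u x..u x + s x}" for w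
        by (rule has_vector_derivative_zero_on_open[OF d2 S that 1])
      show ?thesis using 0 1 2 y by simp
    qed
    \<comment> \<open>A nonempty section is open, so it contains two points and has positive
      diameter.\<close>
    show "\<phi> x y = 0" if "s x = 0" for x y
    proof (rule ccontr)
      assume "\<phi> x y \<noteq> 0"
      then have "y \<in> {y. \<phi> x y \<noteq> 0}" by simp
      from openE[OF op(2) this] obtain e where e: "0 < e" "ball y e \<subseteq> {y. \<phi> x y \<noteq> 0}" .
      have "y + e / 2 \<in> ball y e" using e by (simp add: dist_real_def)
      with e(2) have "\<phi> x (y + e / 2) \<noteq> 0" by auto
      then have "y + e / 2 - y \<in> T x" unfolding T_def using \<open>\<phi> x y \<noteq> 0\<close> by blast
      then show False using sT[of "y + e / 2 - y" x] that e(1) by simp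
    qed
  qed
  then show ?thesis by blast
qed

lemma partial_y_vector_derivative:
  assumes "F differentiable_on UNIV"
  shows "((\<lambda>t. F (x, t)) has_vector_derivative partial_y F (x, y)) (at y)"
proof -
  have "F differentiable at (x, y)" using assms by (auto simp: differentiable_on_def)
  then have "(F \<circ> (\<lambda>t. (x, t))) differentiable at y"
    by (intro differentiable_chain_at) (auto intro!: derivative_intros simp: differentiable_def intro!: exI has_derivative_Pair)
  then show ?thesis
    unfolding partial_y_def by (simp add: vector_derivative_works o_def)
qed

lemma partial_x_vector_derivative:
  assumes "F differentiable_on UNIV"
  shows "((\<lambda>t. F (t, y)) has_vector_derivative partial_x F (x, y)) (at x)"
proof -
  have "F differentiable at (x, y)" using assms by (auto simp: differentiable_on_def)
  then have "(F \<circ> (\<lambda>t. (t, y))) differentiable at x"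
    by (intro differentiable_chain_at) (auto intro!: derivative_intros simp: differentiable_def intro!: exI has_derivative_Pair)
  then show ?thesis
    unfolding partial_x_def by (simp add: vector_derivative_works o_def)
qed

lemma partial_outside_supp:
  assumes F: "F differentiable_on UNIV" and p: "p \<notin> supp F"
  shows "F p = 0" "partial_x F p = 0" "partial_y F p = 0"
proof -
  obtain x y where xy: "p = (x, y)" by (cases p)
  have z: "F q = 0" if "q \<notin> supp F" for q
    using that closure_subset[of "{p. F p \<noteq> 0}"] by (auto simp: supp_def)
  then show "F p = 0" using p by blast
  have op: "open (- supp F)" by (simp add: supp_def open_Compl)
  have o: "open ((\<lambda>t. (x, t)) -` (- supp F))" "open ((\<lambda>t. (t, y)) -` (- supp F))"
    by (intro open_vimage op continuous_intros)+
  show "partial_x F p = 0" unfolding xy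
    by (rule has_vector_derivative_zero_on_open[OF partial_x_vector_derivative[OF F] o(2)]) (use p z xy in auto)
  show "partial_y F p = 0" unfolding xy
    by (rule has_vector_derivative_zero_on_open[OF partial_y_vector_derivative[OF F] o(1)]) (use p z xy in auto)
qed

lemma supp_partial:
  assumes F: "F differentiable_on UNIV"
  shows "supp (partial_x F) \<subseteq> supp F" "supp (partial_y F) \<subseteq> supp F"
proof -
  have cl: "closed (supp F)" by (simp add: supp_def)
  show "supp (partial_x F) \<subseteq> supp F"
    unfolding supp_def[of "partial_x F"] by (rule closure_minimal[OF _ cl]) (use partial_outside_supp[OF F] in blast)
  show "supp (partial_y F) \<subseteq> supp F"
    unfolding supp_def[of "partial_y F"] by (rule closure_minimal[OF _ cl]) (use partial_outside_supp[OF F] in blast)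
qed

lemma section_length:
  assumes "hv_convex_domain \<Omega>"
  shows "(x, y) \<in> \<Omega> \<Longrightarrow> (x, y') \<in> \<Omega> \<Longrightarrow> y' - y \<le> delta_h \<Omega> x"
    "(x, y) \<in> \<Omega> \<Longrightarrow> (x', y) \<in> \<Omega> \<Longrightarrow> x' - x \<le> delta_v \<Omega> y"
proof -
  obtain a b g h c d u v where 1: "\<Omega> = {(x, y). a \<le> x \<and> x \<le> b \<and> g x \<le> y \<and> y \<le> h x}"
    and 2: "\<Omega> = {(x, y). c \<le> y \<and> y \<le> d \<and> u y \<le> x \<and> x \<le> v y}"
    using assms unfolding hv_convex_domain_def by blast
  show "y' - y \<le> delta_h \<Omega> x" if "(x, y) \<in> \<Omega>" "(x, y') \<in> \<Omega>"
  proof -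
    have "{y. (x, y) \<in> \<Omega>} = {g x..h x}" using that unfolding 1 by auto
    then show ?thesis using that unfolding delta_h_def 1 by auto
  qed
  show "x' - x \<le> delta_v \<Omega> y" if "(x, y) \<in> \<Omega>" "(x', y) \<in> \<Omega>"
  proof -
    have "{x. (x, y) \<in> \<Omega>} = {u y..v y}" using that unfolding 2 by auto
    then show ?thesis using that unfolding delta_v_def 2 by auto
  qed
qed

lemma cutoff_size_bounds:
  assumes M: "cutoff_size \<Omega> \<phi> \<le> ereal M" and p: "(x, y) \<in> \<Omega>" and k: "k \<le> 2"
  shows "delta_h \<Omega> x ^ k * cmod ((partial_y ^^ k) \<phi> (x, y)) \<le> M"
    "delta_v \<Omega> y ^ k * cmod ((partial_x ^^ k) \<phi> (x, y)) \<le> M"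
proof -
  let ?a = "\<lambda>k. delta_h \<Omega> x ^ k * cmod ((partial_y ^^ k) \<phi> (x, y))"
  let ?b = "\<lambda>k. delta_v \<Omega> y ^ k * cmod ((partial_x ^^ k) \<phi> (x, y))"
  have nn: "0 \<le> ?a k" "0 \<le> ?b k" for k by (auto simp: delta_h_def delta_v_def)
  have "ereal (\<Sum>k=0..2. ?a k + ?b k) \<le> cutoff_size \<Omega> \<phi>"
    unfolding cutoff_size_def by (rule SUP_upper2[OF p]) simp
  then have S: "(\<Sum>k=0..2. ?a k + ?b k) \<le> M" using M by (meson ereal_less_eq(3) order_trans)
  have "?a k + ?b k \<le> (\<Sum>k=0..2. ?a k + ?b k)"
    by (rule member_le_sum) (use k nn add_nonneg_nonneg in auto)
  then show "?a k \<le> M" "?b k \<le> M" using S nn[of k] by linarith+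
qed

text \<open>Sections of the nonvanishing set of \<phi> lie in sections of \<Omega>, which are
  intervals, so their diameters are at most \<open>delta_h\<close> and \<open>delta_v\<close>; the
  supremum over \<Omega> then provides the derivative bounds.\<close>

lemma test_function_cutoffs:
  assumes \<phi>: "test_function \<phi>" and \<Omega>: "hv_convex_domain \<Omega>" "supp \<phi> \<subseteq> \<Omega>"
    and M: "cutoff_size \<Omega> \<phi> \<le> ereal M" "0 < M"
  shows "\<exists>\<phi>' \<phi>'' s u. cutoff (\<lambda>x y. \<phi> (x, y)) \<phi>' \<phi>'' s u M"
    "\<exists>\<phi>' \<phi>'' s u. cutoff (\<lambda>y x. \<phi> (x, y)) \<phi>' \<phi>'' s u M"
proof -
  \<comment> \<open>The third order makes the second partial derivatives differentiable and thereby
    continuous.\<close>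
  have "C_k_plane 3 \<phi>" using \<phi> by (auto simp: test_function_def smooth_plane_def)
  then have df: "\<phi> differentiable_on UNIV" "partial_x \<phi> differentiable_on UNIV" "partial_y \<phi> differentiable_on UNIV"
    "partial_x (partial_x \<phi>) differentiable_on UNIV" "partial_y (partial_y \<phi>) differentiable_on UNIV"
    by (simp_all add: numeral_3_eq_3)
  have cont: "continuous_on UNIV F" if "F differentiable_on UNIV" for F :: "real \<times> real \<Rightarrow> complex"
    using that by (rule differentiable_imp_continuous_on)
  have "bounded (supp \<phi>)" using \<phi> by (auto simp: test_function_def compact_imp_bounded)
  then obtain R where R: "\<And>p. p \<in> supp \<phi> \<Longrightarrow> norm p \<le> R" unfolding bounded_iff by blast
  have in_supp: "(x, y) \<in> supp \<phi>" if "\<phi> (x, y) \<noteq> 0" for x y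
    using partial_outside_supp(1)[OF df(1)] that by blast
  have R': "\<bar>x\<bar> \<le> R \<and> \<bar>y\<bar> \<le> R" if "\<phi> (x, y) \<noteq> 0" for x y
    using R[OF in_supp[OF that]] norm_fst_le[of x y] norm_snd_le[of y x] by (auto simp: real_norm_def)
  \<comment> \<open>The supremum says nothing outside \<Omega>, but there \<phi> and its derivatives
    vanish, so the bounds hold on the whole plane.\<close>
  have out: "\<phi> p = 0" "partial_x \<phi> p = 0" "partial_y \<phi> p = 0" "partial_x (partial_x \<phi>) p = 0" "partial_y (partial_y \<phi>) p = 0"
    if "p \<notin> \<Omega>" for p
    using that \<Omega>(2) supp_partial[OF df(1)] partial_outside_supp[OF df(1), of p]
      partial_outside_supp[OF df(2), of p] partial_outside_supp[OF df(3), of p] by auto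
  note bd = cutoff_size_bounds[OF M(1)]
  have y: "cmod (\<phi> (x, y)) \<le> M" "delta_h \<Omega> x * cmod (partial_y \<phi> (x, y)) \<le> M"
    "(delta_h \<Omega> x)\<^sup>2 * cmod (partial_y (partial_y \<phi>) (x, y)) \<le> M" for x y
    using bd(1)[of x y 0] bd(1)[of x y 1] bd(1)[of x y 2] out[of "(x, y)"] M(2)
    by (cases "(x, y) \<in> \<Omega>"; simp add: numeral_2_eq_2)+
  have x: "delta_v \<Omega> y * cmod (partial_x \<phi> (x, y)) \<le> M"
    "(delta_v \<Omega> y)\<^sup>2 * cmod (partial_x (partial_x \<phi>) (x, y)) \<le> M" for x y
    using bd(2)[of x y 1] bd(2)[of x y 2] out[of "(x, y)"] M(2)
    by (cases "(x, y) \<in> \<Omega>"; simp add: numeral_2_eq_2)+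
  have "\<exists>s u. cutoff (\<lambda>x y. \<phi> (x, y)) (\<lambda>x y. partial_y \<phi> (x, y)) (\<lambda>x y. partial_y (partial_y \<phi>) (x, y)) s u M"
  proof (rule cutoff_exists[where \<delta> = "delta_h \<Omega>" and R = R])
    show "continuous_on UNIV (\<lambda>p. \<phi> (fst p, snd p))" using cont[OF df(1)] by simp
    show "continuous_on UNIV (\<lambda>y. partial_y (partial_y \<phi>) (x, y))" for x
      by (rule continuous_on_compose2[OF cont[OF df(5)]]) (auto intro!: continuous_intros)
    show "y' - y \<le> delta_h \<Omega> x" if "\<phi> (x, y) \<noteq> 0" "\<phi> (x, y') \<noteq> 0" for x y y'
      using section_length(1)[OF \<Omega>(1)] in_supp that \<Omega>(2) by blast
  qed (use R' y partial_y_vector_derivative df in \<open>auto simp: delta_h_def\<close>)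
  then show "\<exists>\<phi>' \<phi>'' s u. cutoff (\<lambda>x y. \<phi> (x, y)) \<phi>' \<phi>'' s u M" by blast
  have "\<exists>s u. cutoff (\<lambda>y x. \<phi> (x, y)) (\<lambda>y x. partial_x \<phi> (x, y)) (\<lambda>y x. partial_x (partial_x \<phi>) (x, y)) s u M"
  proof (rule cutoff_exists[where \<delta> = "delta_v \<Omega>" and R = R])
    show "continuous_on UNIV (\<lambda>p. \<phi> (snd p, fst p))"
      by (rule continuous_on_compose2[OF cont[OF df(1)]]) (auto intro!: continuous_intros)
    show "continuous_on UNIV (\<lambda>x. partial_x (partial_x \<phi>) (x, y))" for y
      by (rule continuous_on_compose2[OF cont[OF df(4)]]) (auto intro!: continuous_intros)
    show "x' - x \<le> delta_v \<Omega> y" if "\<phi> (x, y) \<noteq> 0" "\<phi> (x', y) \<noteq> 0" for x x' y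
      using section_length(2)[OF \<Omega>(1)] in_supp that \<Omega>(2) by blast
  qed (use R' x y partial_x_vector_derivative df in \<open>auto simp: delta_v_def\<close>)
  then show "\<exists>\<phi>' \<phi>'' s u. cutoff (\<lambda>y x. \<phi> (x, y)) \<phi>' \<phi>'' s u M" by blast
qed

text \<open>The operators above act on Borel functions, whereas the theorem speaks of Lebesgue
  measurable ones. Changing \<open>f\<close> on a null set alters neither its norm nor the integral
  operator.\<close>

lemma in_L2_representative:
  assumes "in_L2 f"
  obtains g where "sqint g" "AE x in lborel. f x = g x" "L2_norm f = nrm g"
proof -
  have [measurable]: "f \<in> borel_measurable lebesgue" and i: "integrable lebesgue (\<lambda>x. (cmod (f x))\<^sup>2)"
    using assms by (auto simp: in_L2_def)
  have "(\<lambda>x. Re (f x)) \<in> borel_measurable lebesgue" "(\<lambda>x. Im (f x)) \<in> borel_measurable lebesgue" by measurable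
  from this[THEN completion_ex_borel_measurable_real] obtain r i' where ri [measurable]: "r \<in> borel_measurable lborel" "i' \<in> borel_measurable lborel"
    and ae: "AE x in lborel. Re (f x) = r x" "AE x in lborel. Im (f x) = i' x"
    by auto
  define g where "g x = Complex (r x) (i' x)" for x
  have g: "g \<in> borel_measurable borel"
    using ri by (simp add: borel_measurable_complex_iff g_def)
  have e: "AE x in lborel. f x = g x"
    using ae by eventually_elim (simp add: g_def complex_eq_iff)
  have m: "(\<lambda>x. (cmod (g x))\<^sup>2) \<in> lborel \<rightarrow>\<^sub>M borel" using g by simp
  have fm: "(\<lambda>x. (cmod (f x))\<^sup>2) \<in> borel_measurable lebesgue" using i by (rule borel_measurable_integrable)
  have e2: "AE x in lebesgue. (cmod (f x))\<^sup>2 = (cmod (g x))\<^sup>2"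
    by (rule AE_completion, rule eventually_mono[OF e]) simp
  have "integrable lebesgue (\<lambda>x. (cmod (g x))\<^sup>2)"
    by (rule Bochner_Integration.integrable_cong_AE_imp[OF i measurable_completion[OF m] e2])
  then have sq: "sqint g" using g integrable_completion[OF m] by (simp add: sqint_def)
  have "(LINT x|lebesgue. (cmod (f x))\<^sup>2) = (LINT x|lebesgue. (cmod (g x))\<^sup>2)"
    by (rule integral_cong_AE[OF fm measurable_completion[OF m] e2])
  then have "L2_norm f = nrm g" using integral_completion[OF m] by (simp add: L2_norm_def nrm_def)
  then show ?thesis using that sq e by blast
qed

lemma sqint_in_L2:
  assumes "sqint g" shows "in_L2 g" "L2_norm g = nrm g"
proof -
  have g: "g \<in> borel_measurable borel" using assms by (rule sqint_measurable)
  have m: "(\<lambda>x. (cmod (g x))\<^sup>2) \<in> lborel \<rightarrow>\<^sub>M borel" using g by simp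
  show "L2_norm g = nrm g" using integral_completion[OF m] by (simp add: L2_norm_def nrm_def)
  show "in_L2 g" using assms integrable_completion[OF m] measurable_completion[of g lborel borel] g
    by (simp add: in_L2_def sqint_def)
qed

lemma kop_lebesgue:
  assumes k: "bker k" and g: "sqint g" and f: "f \<in> borel_measurable lebesgue" and e: "AE x in lborel. f x = g x"
  shows "(LINT y|lebesgue. k x y * f y) = kop k g x"
proof -
  have kx: "(\<lambda>y. k x y) \<in> borel_measurable borel" using bker_row[OF k, of x] by (rule sqint_measurable)
  have m: "(\<lambda>y. k x y * g y) \<in> lborel \<rightarrow>\<^sub>M borel" using kx sqint_measurable[OF g] by simp
  have kl: "(\<lambda>y. k x y) \<in> borel_measurable lebesgue" by (rule measurable_completion) (use kx in simp)
  have "(LINT y|lebesgue. k x y * f y) = (LINT y|lebesgue. k x y * g y)"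
  proof (rule integral_cong_AE)
    show "(\<lambda>y. k x y * f y) \<in> borel_measurable lebesgue" using kl f by (rule borel_measurable_times)
    show "(\<lambda>y. k x y * g y) \<in> borel_measurable lebesgue" by (rule measurable_completion[OF m])
    show "AE y in lebesgue. k x y * f y = k x y * g y"
      by (rule AE_completion) (rule eventually_mono[OF e], simp)
  qed
  then show ?thesis using integral_completion[OF m] by (simp add: kop_def)
qed

lemma qh_poly_phase:
  assumes "0 < \<eta>"
  shows "qh_poly \<eta> d a (x, y) = phase_poly {(k, l) \<in> qh_index \<eta> d. a k l \<noteq> 0} a x y"
  unfolding qh_poly_def phase_poly_def prod.case
  by (rule sum.mono_neutral_right[OF finite_qh_index[OF assms]]) auto

lemma mixed_partial_qh_poly:
  assumes "0 < \<eta>"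
  shows "partial_x (partial_y (qh_poly \<eta> d a)) (x, y) = mixed_poly {(k, l) \<in> qh_index \<eta> d. a k l \<noteq> 0} a x y"
proof -
  let ?J = "{(k, l) \<in> qh_index \<eta> d. a k l \<noteq> 0}"
  have "partial_y (qh_poly \<eta> d a) (x, y) = dy_poly ?J a x y" for x y
    unfolding partial_y_def prod.case qh_poly_phase[OF assms]
    by (rule vector_derivative_at) (simp add: phase_poly_dy flip: has_real_derivative_iff_has_vector_derivative)
  then show ?thesis
    unfolding partial_x_def prod.case
    by (intro vector_derivative_at) (simp add: dy_poly_dx flip: has_real_derivative_iff_has_vector_derivative)
qed

theorem theorem1p2:
  shows "\<exists>C :: nat \<Rightarrow> real.
    \<forall>(\<eta>::real) (d::real) (a :: nat \<Rightarrow> nat \<Rightarrow> real) (lam::real) (z::complex)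
      (\<phi> :: real \<times> real \<Rightarrow> complex) (\<Omega> :: (real \<times> real) set) (M::real) (f :: real \<Rightarrow> complex).
      \<eta> > 0 \<longrightarrow> d > 0 \<longrightarrow> lam \<noteq> 0 \<longrightarrow> Re z = 1/2 \<longrightarrow>
      test_function \<phi> \<longrightarrow> hv_convex_domain \<Omega> \<longrightarrow> supp \<phi> \<subseteq> \<Omega> \<longrightarrow>
      M > 0 \<longrightarrow> cutoff_size \<Omega> \<phi> \<le> ereal M \<longrightarrow> in_L2 f \<longrightarrow>
      in_L2 (W_op lam (qh_poly \<eta> d a) z \<phi> f) \<and>
      L2_norm (W_op lam (qh_poly \<eta> d a) z \<phi> f)
        \<le> C (qh_degree \<eta> d a) * (1 + cmod z)\<^sup>2 * M * \<bar>lam\<bar> powr (- 1/2) * L2_norm f"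
proof (intro exI[where x = osc_const] allI impI)
  fix \<eta> d :: real and a :: "nat \<Rightarrow> nat \<Rightarrow> real" and lam :: real and z :: complex
    and \<phi> :: "real \<times> real \<Rightarrow> complex" and \<Omega> :: "(real \<times> real) set" and M :: real and f :: "real \<Rightarrow> complex"
  assume \<eta>: "0 < \<eta>" and "0 < d" and lam: "lam \<noteq> 0" and z: "Re z = 1/2"
    and \<phi>: "test_function \<phi>" and \<Omega>: "hv_convex_domain \<Omega>" "supp \<phi> \<subseteq> \<Omega>"
    and M: "0 < M" and size: "cutoff_size \<Omega> \<phi> \<le> ereal M" and f: "in_L2 f"
  define J where "J = {(k, l) \<in> qh_index \<eta> d. a k l \<noteq> 0}"
  define D where "D = qh_degree \<eta> d a"
  define K where "K = osc_ker lam z J a (\<lambda>x y. \<phi> (x, y))"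
  obtain \<phi>' \<phi>'' s u where cut: "cutoff (\<lambda>x y. \<phi> (x, y)) \<phi>' \<phi>'' s u M"
    using test_function_cutoffs(1)[OF \<phi> \<Omega> size M] by blast
  obtain \<psi>' \<psi>'' s2 u2 where cut2: "cutoff (\<lambda>y x. \<phi> (x, y)) \<psi>' \<psi>'' s2 u2 M"
    using test_function_cutoffs(2)[OF \<phi> \<Omega> size M] by blast
  obtain g where g: "sqint g" "AE x in lborel. f x = g x" "L2_norm f = nrm g"
    using in_L2_representative[OF f] .
  have bK: "bker K" unfolding K_def by (rule bker_osc_ker[OF z cutoff.ker[OF cut]])
  have fm: "f \<in> borel_measurable lebesgue" using f by (simp add: in_L2_def)
  have W: "W_op lam (qh_poly \<eta> d a) z \<phi> f = kop K g"
    unfolding W_op_def fun_eq_iff kop_lebesgue[OF bK g(1) fm g(2), symmetric]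
    by (simp add: qh_poly_phase[OF \<eta>] mixed_partial_qh_poly[OF \<eta>] J_def K_def osc_ker_def)
  have bound: "opb K (osc_const D * ((1 + cmod z) * M / sqrt \<bar>lam\<bar>))"
  proof (cases "\<exists>k l. (k, l) \<in> J \<and> 0 < k \<and> 0 < l")
    case True
    have "qh_data J a \<eta> d D"
    proof
      show "finite J" unfolding J_def by (rule finite_subset[OF _ finite_qh_index[OF \<eta>]]) auto
      show "k + l \<le> D" if "(k, l) \<in> J" for k l
        unfolding D_def qh_degree_def
        by (rule Max_ge) (use that finite_qh_degree_set[OF \<eta>, of d a] in \<open>auto simp: J_def\<close>)
    qed (use \<eta> True in \<open>auto simp: J_def qh_index_def\<close>)
    then show ?thesis unfolding K_def by (rule qh_data.osc_bound[OF _ cut cut2 M lam z])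
  next
    case False
    \<comment> \<open>Without a genuinely mixed monomial the damping factor is
      \<open>0 powr z\<close>, which is 0, and so is the operator.\<close>
    then have "mixed_poly J a x y = 0" for x y :: real
      unfolding mixed_poly_def by (intro sum.neutral) auto
    then have "K = (\<lambda>x y. 0)" by (simp add: K_def osc_ker_def fun_eq_iff)
    then show ?thesis using M osc_const_nonneg by (auto intro!: opb_zero)
  qed
  have "L2_norm (kop K g) \<le> osc_const D * ((1 + cmod z) * M / sqrt \<bar>lam\<bar>) * L2_norm f"
    using opbD[OF bound g(1)] sqint_in_L2(2)[OF kop_sqint[OF bK g(1)]] g(3) by simp
  \<comment> \<open>The argument yields the first power of \<open>1 + cmod z\<close>; only here it
    is weakened to the square.\<close>
  also have "\<dots> \<le> osc_const D * ((1 + cmod z)\<^sup>2 * M / sqrt \<bar>lam\<bar>) * L2_norm f"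
    using M osc_const_nonneg[of D] g(3) self_le_power[of "1 + cmod z" 2]
    by (intro mult_right_mono mult_left_mono divide_right_mono) auto
  also have "\<dots> = osc_const D * (1 + cmod z)\<^sup>2 * M * \<bar>lam\<bar> powr (- 1/2) * L2_norm f"
    using powr_minus_divide[of "\<bar>lam\<bar>" "1/2"] powr_half_sqrt[of "\<bar>lam\<bar>"] by simp
  finally show "in_L2 (W_op lam (qh_poly \<eta> d a) z \<phi> f) \<and>
      L2_norm (W_op lam (qh_poly \<eta> d a) z \<phi> f)
        \<le> osc_const (qh_degree \<eta> d a) * (1 + cmod z)\<^sup>2 * M * \<bar>lam\<bar> powr (- 1/2) * L2_norm f"
    using sqint_in_L2(1)[OF kop_sqint[OF bK g(1)]] W by (simp add: D_def)
qed

end
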